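(* Let $A$ be a commutative monoid object in $(\mathbf C,\otimes,1)$ and let $\{t_i\}_{i\in I}$ be a partition of unity on $A$. Then the schemes $\{Spec(A_{t_i})\}_{i\in I}$ form a Zariski open cover of $Spec(A)$.
   Context: Standing assumptions: $(\mathbf C,\otimes,1)$ is an abelian symmetric monoidal category with small limits and small colimits such that for every object $X$ the functor $-\otimes X$ preserves colimits. $Comm(\mathbf C)$ is the category of unital commutative monoid objects in $\mathbf C$ (all monoids are unital and commutative), and $A\text{-}Mod$ is the category of modules over $A\in Comm(\mathbf C)$. For every monoid $A$, filtered colimits commute with finite limits in $A\text{-}Mod$. Moreover: (C1) $Hom_{\mathbf C}(1,-)$ preserves filtered colimits, and for every monoid $A$ and every finite (not necessarily filtered) system of $A$-modules of the form $\{A^{r_i}\}_{i\in I}$, $r_i\ge 0$, the canonical map $colim_{i}\,Hom_{A-Mod}(A,A^{r_i})\to Hom_{A-Mod}(A,colim_i A^{r_i})$ is an isomorphism. (C2) For every monoid $A$, every object of $A\text{-}Mod$ is a directed colimit of finitely presented objects, where $M$ is finitely presented if $Hom_{A-Mod}(M,-)$ preserves directed colimits. $\mathcal E(A):=Hom_{A-Mod}(A,A)$, a commutative ring under composition; a morphism $g:A\to B$ in $Comm(\mathbf C)$ induces by base change a ring homomorphism $\mathcal E(g):\mathcal E(A)\to\mathcal E(B)$. Partition of unity on $A$: a finite collection $\{t_i\}_{i\in I}$ of elements of $\mathcal E(A)$ for which there exist $s_i\in\mathcal E(A)$, $i\in I$, with $\sum_{i\in I}s_it_i=1$. Localisation: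 for $t\in\mathcal E(A)$, $A_t:=colim(A\overset{t}{\to}A\overset{t}{\to}A\overset{t}{\to}\cdots)$, which is a commutative monoid with canonical monoid morphism $I_t:A\to A_t$; it is a flat $A$-module, $\mathcal E(I_t)(t)$ is invertible, and $I_t$ is universal among monoid morphisms $g:A\to B$ with $\mathcal E(g)(t)$ invertible. $Aff_{\mathbf C}:=Comm(\mathbf C)^{op}$, with $Spec(A)$ the object corresponding to $A$. A morphism $Spec(B)\to Spec(A)$ given by $f:A\to B$ is a Zariski open immersion if $f$ is flat ($-\otimes_AB:A\text{-}Mod\to B\text{-}Mod$ preserves finite limits), an epimorphism in $Comm(\mathbf C)$, and of finite presentation (for every filtered system $\{A'_i\}$ in $A/Comm(\mathbf C)$ the natural map $colim_i Hom_{A/Comm(\mathbf C)}(B,A'_i)\to Hom_{A/Comm(\mathbf C)}(B,colim_iA'_i)$ is an isomorphism). A family of Zariski open immersions $\{Spec(B_i)\to Spec(A)\}_{i\in I}$ is a Zariski open cover of $Spec(A)$ if there is a finite subset $I'\subseteq I$ such that $\{-\otimes_AB_i\}_{i\in I'}$ is conservative: for $M$ in $A\text{-}Mod$, $M=0$ if and only if $M\otimes_AB_i=0$ for every $i\in I'$. *)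

theory Defs
  imports "HOL-Algebra.Ring" "HOL-Algebra.Product_Groups" "HOL-Library.Countable_Set"
begin

section \<open>Categories\<close>

text \<open>
  Composition does not take the objects as arguments and hom-sets need not be disjoint.  Every
  category is of this form (tag arrows with source and target), and the category of modules over a
  monoid can reuse the arrows of the base category.  In return, the arrow part of a functor takes
  the source and the target as arguments.
\<close>

record ('o, 'm) cat =
  Ob  :: "'o set"
  Hom :: "'o \<Rightarrow> 'o \<Rightarrow> 'm set"
  Idt :: "'o \<Rightarrow> 'm"
  Cmp :: "'m \<Rightarrow> 'm \<Rightarrow> 'm"  (infixr "\<cdot>\<index>" 70)

locale category =
  fixes C :: "('o, 'm, 'x) cat_scheme" (structure)
  assumes hom_ob: "f \<in> Hom C X Y \<Longrightarrow> X \<in> Ob C \<and> Y \<in> Ob C"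
    and idt_hom: "X \<in> Ob C \<Longrightarrow> Idt C X \<in> Hom C X X"
    and cmp_hom: "\<lbrakk>f \<in> Hom C X Y; g \<in> Hom C Y Z\<rbrakk> \<Longrightarrow> g \<cdot> f \<in> Hom C X Z"
    and idt_left: "f \<in> Hom C X Y \<Longrightarrow> Idt C Y \<cdot> f = f"
    and idt_right: "f \<in> Hom C X Y \<Longrightarrow> f \<cdot> Idt C X = f"
    and cmp_assoc: "\<lbrakk>f \<in> Hom C W X; g \<in> Hom C X Y; h \<in> Hom C Y Z\<rbrakk>
                      \<Longrightarrow> (h \<cdot> g) \<cdot> f = h \<cdot> (g \<cdot> f)"

definition opcat :: "('o, 'm, 'x) cat_scheme \<Rightarrow> ('o, 'm) cat" where
  "opcat C = \<lparr>Ob = Ob C, Hom = (\<lambda>X Y. Hom C Y X), Idt = Idt C, Cmp = (\<lambda>g f. f \<cdot>\<^bsub>C\<^esub> g)\<rparr>"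

definition is_iso :: "('o, 'm, 'x) cat_scheme \<Rightarrow> 'o \<Rightarrow> 'o \<Rightarrow> 'm \<Rightarrow> bool" where
  "is_iso C X Y f \<longleftrightarrow> f \<in> Hom C X Y \<and>
     (\<exists>g\<in>Hom C Y X. g \<cdot>\<^bsub>C\<^esub> f = Idt C X \<and> f \<cdot>\<^bsub>C\<^esub> g = Idt C Y)"

definition is_mono :: "('o, 'm, 'x) cat_scheme \<Rightarrow> 'o \<Rightarrow> 'o \<Rightarrow> 'm \<Rightarrow> bool" where
  "is_mono C X Y f \<longleftrightarrow> f \<in> Hom C X Y \<and>
     (\<forall>W. \<forall>g\<in>Hom C W X. \<forall>h\<in>Hom C W X. f \<cdot>\<^bsub>C\<^esub> g = f \<cdot>\<^bsub>C\<^esub> h \<longrightarrow> g = h)"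

definition is_epi :: "('o, 'm, 'x) cat_scheme \<Rightarrow> 'o \<Rightarrow> 'o \<Rightarrow> 'm \<Rightarrow> bool" where
  "is_epi C X Y f \<longleftrightarrow> f \<in> Hom C X Y \<and>
     (\<forall>Z. \<forall>g\<in>Hom C Y Z. \<forall>h\<in>Hom C Y Z. g \<cdot>\<^bsub>C\<^esub> f = h \<cdot>\<^bsub>C\<^esub> f \<longrightarrow> g = h)"

definition is_zero_ob :: "('o, 'm, 'x) cat_scheme \<Rightarrow> 'o \<Rightarrow> bool" where
  "is_zero_ob C Z \<longleftrightarrow> Z \<in> Ob C \<and>
     (\<forall>X\<in>Ob C. (\<exists>!f. f \<in> Hom C X Z) \<and> (\<exists>!f. f \<in> Hom C Z X))"

definition is_coequalizer ::
  "('o, 'm, 'x) cat_scheme \<Rightarrow> 'o \<Rightarrow> 'o \<Rightarrow> 'm \<Rightarrow> 'm \<Rightarrow> 'o \<Rightarrow> 'm \<Rightarrow> bool" where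
  "is_coequalizer C X Y r s Q q \<longleftrightarrow>
     q \<in> Hom C Y Q \<and> q \<cdot>\<^bsub>C\<^esub> r = q \<cdot>\<^bsub>C\<^esub> s \<and>
     (\<forall>Z. \<forall>g\<in>Hom C Y Z. g \<cdot>\<^bsub>C\<^esub> r = g \<cdot>\<^bsub>C\<^esub> s \<longrightarrow>
        (\<exists>!h. h \<in> Hom C Q Z \<and> h \<cdot>\<^bsub>C\<^esub> q = g))"

definition under_cat ::
  "('o, 'm, 'x) cat_scheme \<Rightarrow> 'o \<Rightarrow> ('o \<times> 'm, 'm) cat" where
  "under_cat C X = \<lparr>
     Ob = {(Y, f). f \<in> Hom C X Y},
     Hom = (\<lambda>(Y, f) (Z, g). {h. f \<in> Hom C X Y \<and> g \<in> Hom C X Z \<and>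
                                 h \<in> Hom C Y Z \<and> h \<cdot>\<^bsub>C\<^esub> f = g}),
     Idt = (\<lambda>(Y, f). Idt C Y),
     Cmp = Cmp C\<rparr>"

definition prod_cat ::
  "('i, 'n) cat \<Rightarrow> ('j, 'k) cat \<Rightarrow> ('i \<times> 'j, 'n \<times> 'k) cat" where
  "prod_cat J K = \<lparr>
     Ob = Ob J \<times> Ob K,
     Hom = (\<lambda>(i, k) (j, l). Hom J i j \<times> Hom K k l),
     Idt = (\<lambda>(i, k). (Idt J i, Idt K k)),
     Cmp = (\<lambda>(u', v') (u, v). (u' \<cdot>\<^bsub>J\<^esub> u, v' \<cdot>\<^bsub>K\<^esub> v))\<rparr>"

definition nat_cat :: "(nat, unit) cat" where
  "nat_cat = \<lparr>Ob = UNIV, Hom = (\<lambda>m n. if m \<le> n then {()} else {}),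
              Idt = (\<lambda>_. ()), Cmp = (\<lambda>_ _. ())\<rparr>"

definition discrete_cat :: "'i set \<Rightarrow> ('i, unit) cat" where
  "discrete_cat S = \<lparr>Ob = S, Hom = (\<lambda>i j. if i \<in> S \<and> i = j then {()} else {}),
                     Idt = (\<lambda>_. ()), Cmp = (\<lambda>_ _. ())\<rparr>"


section \<open>Functors, limits and colimits\<close>

record ('i, 'n, 'o, 'm) ftor =
  FOb :: "'i \<Rightarrow> 'o"
  FAr :: "'i \<Rightarrow> 'i \<Rightarrow> 'n \<Rightarrow> 'm"

definition is_ftor ::
  "('i, 'n, 'y) cat_scheme \<Rightarrow> ('o, 'm, 'x) cat_scheme \<Rightarrow> ('i, 'n, 'o, 'm) ftor \<Rightarrow> bool" where
  "is_ftor J C F \<longleftrightarrow>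
     (\<forall>i\<in>Ob J. FOb F i \<in> Ob C) \<and>
     (\<forall>i j. \<forall>u\<in>Hom J i j. FAr F i j u \<in> Hom C (FOb F i) (FOb F j)) \<and>
     (\<forall>i\<in>Ob J. FAr F i i (Idt J i) = Idt C (FOb F i)) \<and>
     (\<forall>i j k. \<forall>u\<in>Hom J i j. \<forall>v\<in>Hom J j k.
        FAr F i k (v \<cdot>\<^bsub>J\<^esub> u) = FAr F j k v \<cdot>\<^bsub>C\<^esub> FAr F i j u)"

definition ftor_comp ::
  "('o, 'm, 'p, 'q) ftor \<Rightarrow> ('i, 'n, 'o, 'm) ftor \<Rightarrow> ('i, 'n, 'p, 'q) ftor" where
  "ftor_comp G F = \<lparr>FOb = (\<lambda>i. FOb G (FOb F i)),
                    FAr = (\<lambda>i j u. FAr G (FOb F i) (FOb F j) (FAr F i j u))\<rparr>"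

definition is_cone :: "('i, 'n, 'y) cat_scheme \<Rightarrow> ('o, 'm, 'x) cat_scheme \<Rightarrow>
    ('i, 'n, 'o, 'm) ftor \<Rightarrow> 'o \<Rightarrow> ('i \<Rightarrow> 'm) \<Rightarrow> bool" where
  "is_cone J C D L p \<longleftrightarrow> L \<in> Ob C \<and> (\<forall>i\<in>Ob J. p i \<in> Hom C L (FOb D i)) \<and>
     (\<forall>i j. \<forall>u\<in>Hom J i j. FAr D i j u \<cdot>\<^bsub>C\<^esub> p i = p j)"

definition is_limit :: "('i, 'n, 'y) cat_scheme \<Rightarrow> ('o, 'm, 'x) cat_scheme \<Rightarrow>
    ('i, 'n, 'o, 'm) ftor \<Rightarrow> 'o \<Rightarrow> ('i \<Rightarrow> 'm) \<Rightarrow> bool" where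
  "is_limit J C D L p \<longleftrightarrow> is_cone J C D L p \<and>
     (\<forall>L' p'. is_cone J C D L' p' \<longrightarrow>
        (\<exists>!h. h \<in> Hom C L' L \<and> (\<forall>i\<in>Ob J. p i \<cdot>\<^bsub>C\<^esub> h = p' i)))"

definition is_cocone :: "('i, 'n, 'y) cat_scheme \<Rightarrow> ('o, 'm, 'x) cat_scheme \<Rightarrow>
    ('i, 'n, 'o, 'm) ftor \<Rightarrow> 'o \<Rightarrow> ('i \<Rightarrow> 'm) \<Rightarrow> bool" where
  "is_cocone J C D L e \<longleftrightarrow> L \<in> Ob C \<and> (\<forall>i\<in>Ob J. e i \<in> Hom C (FOb D i) L) \<and>
     (\<forall>i j. \<forall>u\<in>Hom J i j. e j \<cdot>\<^bsub>C\<^esub> FAr D i j u = e i)"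

definition is_colimit :: "('i, 'n, 'y) cat_scheme \<Rightarrow> ('o, 'm, 'x) cat_scheme \<Rightarrow>
    ('i, 'n, 'o, 'm) ftor \<Rightarrow> 'o \<Rightarrow> ('i \<Rightarrow> 'm) \<Rightarrow> bool" where
  "is_colimit J C D L e \<longleftrightarrow> is_cocone J C D L e \<and>
     (\<forall>L' e'. is_cocone J C D L' e' \<longrightarrow>
        (\<exists>!h. h \<in> Hom C L L' \<and> (\<forall>i\<in>Ob J. h \<cdot>\<^bsub>C\<^esub> e i = e' i)))"

text \<open>
  Smallness is relative to a type \<open>'u\<close>: a set is small if its cardinality is strictly less than
  that of \<open>'u\<close>.  If \<open>'u\<close> has the cardinality of a Grothendieck universe, these are (up to
  bijection) the small sets of that universe.
\<close>

definition small_cat :: "('u, 'u) cat \<Rightarrow> bool" where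
  "small_cat J \<longleftrightarrow> category J \<and>
     (card_of (Ob J), card_of (UNIV :: 'u set)) \<in> ordLess \<and>
     (card_of (\<Union>i\<in>Ob J. \<Union>j\<in>Ob J. Hom J i j), card_of (UNIV :: 'u set)) \<in> ordLess"

text \<open>Up to isomorphism, every finite category has natural numbers as objects and arrows.\<close>

definition finite_cat :: "(nat, nat) cat \<Rightarrow> bool" where
  "finite_cat J \<longleftrightarrow> category J \<and> finite (Ob J) \<and>
     finite (\<Union>i\<in>Ob J. \<Union>j\<in>Ob J. Hom J i j)"

definition filtered_cat :: "('i, 'n) cat \<Rightarrow> bool" where
  "filtered_cat J \<longleftrightarrow> category J \<and> Ob J \<noteq> {} \<and>
     (\<forall>i\<in>Ob J. \<forall>j\<in>Ob J. \<exists>k\<in>Ob J. Hom J i k \<noteq> {} \<and> Hom J j k \<noteq> {}) \<and>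
     (\<forall>i j. \<forall>u\<in>Hom J i j. \<forall>v\<in>Hom J i j. \<exists>k. \<exists>w\<in>Hom J j k. w \<cdot>\<^bsub>J\<^esub> u = w \<cdot>\<^bsub>J\<^esub> v)"

text \<open>A directed preorder, seen as a category.\<close>

definition directed_cat :: "('i, 'n) cat \<Rightarrow> bool" where
  "directed_cat J \<longleftrightarrow> category J \<and> Ob J \<noteq> {} \<and>
     (\<forall>i j. \<forall>u\<in>Hom J i j. \<forall>v\<in>Hom J i j. u = v) \<and>
     (\<forall>i\<in>Ob J. \<forall>j\<in>Ob J. \<exists>k\<in>Ob J. Hom J i k \<noteq> {} \<and> Hom J j k \<noteq> {})"

definition has_small_limits :: "'u itself \<Rightarrow> ('o, 'm, 'x) cat_scheme \<Rightarrow> bool" where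
  "has_small_limits U C \<longleftrightarrow>
     (\<forall>(J :: ('u, 'u) cat) D. small_cat J \<and> is_ftor J C D \<longrightarrow> (\<exists>L p. is_limit J C D L p))"

definition has_small_colimits :: "'u itself \<Rightarrow> ('o, 'm, 'x) cat_scheme \<Rightarrow> bool" where
  "has_small_colimits U C \<longleftrightarrow>
     (\<forall>(J :: ('u, 'u) cat) D. small_cat J \<and> is_ftor J C D \<longrightarrow> (\<exists>L e. is_colimit J C D L e))"

definition preserves_small_colimits ::
  "'u itself \<Rightarrow> ('o, 'm, 'x) cat_scheme \<Rightarrow> ('p, 'q, 'y) cat_scheme \<Rightarrow>
   ('o, 'm, 'p, 'q) ftor \<Rightarrow> bool" where
  "preserves_small_colimits U C D F \<longleftrightarrow>
     (\<forall>(J :: ('u, 'u) cat) G L e. small_cat J \<and> is_ftor J C G \<and> is_colimit J C G L e \<longrightarrow>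
        is_colimit J D (ftor_comp F G) (FOb F L) (\<lambda>j. FAr F (FOb G j) L (e j)))"

definition preserves_finite_limits ::
  "('o, 'm, 'x) cat_scheme \<Rightarrow> ('p, 'q, 'y) cat_scheme \<Rightarrow> ('o, 'm, 'p, 'q) ftor \<Rightarrow> bool" where
  "preserves_finite_limits C D F \<longleftrightarrow>
     (\<forall>K G L p. finite_cat K \<and> is_ftor K C G \<and> is_limit K C G L p \<longrightarrow>
        is_limit K D (ftor_comp F G) (FOb F L) (\<lambda>k. FAr F L (FOb G k) (p k)))"

text \<open>
  The colimit of a diagram of sets \<open>S\<close> with transition maps \<open>T\<close>: the disjoint union modulo the
  equivalence relation generated by identifying each element with its images.
\<close>

definition colim_set :: "('i, 'n, 'y) cat_scheme \<Rightarrow> ('i \<Rightarrow> 's set) \<Rightarrow>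
    ('i \<Rightarrow> 'i \<Rightarrow> 'n \<Rightarrow> 's \<Rightarrow> 's) \<Rightarrow> ('i \<times> 's) set set" where
  "colim_set J S T =
     (let r = {((i, x), (j, T i j u x)) | i j u x. u \<in> Hom J i j \<and> x \<in> S i}
      in (SIGMA i:Ob J. S i) // (r \<union> r\<inverse>)\<^sup>*)"

text \<open>
  The canonical map from the colimit of the sets of arrows \<open>X \<rightarrow> G i\<close> to the set of arrows
  \<open>X \<rightarrow> L\<close>, where \<open>(L, e)\<close> is a cocone on \<open>G\<close>, is a bijection.
\<close>

definition hom_commutes_with_colim :: "('o, 'm, 'x) cat_scheme \<Rightarrow> 'o \<Rightarrow>
    ('i, 'n, 'y) cat_scheme \<Rightarrow> ('i, 'n, 'o, 'm) ftor \<Rightarrow> 'o \<Rightarrow> ('i \<Rightarrow> 'm) \<Rightarrow> bool" where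
  "hom_commutes_with_colim C X J G L e \<longleftrightarrow>
     bij_betw (\<lambda>c. the_elem ((\<lambda>(i, x). e i \<cdot>\<^bsub>C\<^esub> x) ` c))
       (colim_set J (\<lambda>i. Hom C X (FOb G i)) (\<lambda>i j u x. FAr G i j u \<cdot>\<^bsub>C\<^esub> x))
       (Hom C X L)"

definition hom_preserves_filtered_colims ::
  "'u itself \<Rightarrow> ('o, 'm, 'x) cat_scheme \<Rightarrow> 'o \<Rightarrow> bool" where
  "hom_preserves_filtered_colims U C X \<longleftrightarrow>
     (\<forall>(J :: ('u, 'u) cat) G L e.
        small_cat J \<and> filtered_cat J \<and> is_ftor J C G \<and> is_colimit J C G L e \<longrightarrow>
        hom_commutes_with_colim C X J G L e)"

definition hom_preserves_directed_colims ::
  "'u itself \<Rightarrow> ('o, 'm, 'x) cat_scheme \<Rightarrow> 'o \<Rightarrow> bool" where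
  "hom_preserves_directed_colims U C X \<longleftrightarrow>
     (\<forall>(J :: ('u, 'u) cat) G L e.
        small_cat J \<and> directed_cat J \<and> is_ftor J C G \<and> is_colimit J C G L e \<longrightarrow>
        hom_commutes_with_colim C X J G L e)"

text \<open>
  For \<open>D : J \<times> K \<rightarrow> M\<close>, let \<open>P = lim\<^sub>K D : J \<rightarrow> M\<close> (with limit cones \<open>\<pi> j\<close>) and
  \<open>Q = colim\<^sub>J D : K \<rightarrow> M\<close> (with colimit cocones \<open>\<lambda>j. \<iota> j k\<close>).  The canonical arrow \<open>c\<close> from
  \<open>X = colim\<^sub>J P\<close> to \<open>Y = lim\<^sub>K Q\<close> has to be an isomorphism.
\<close>

definition filtered_colims_commute_with_finite_lims ::
  "'u itself \<Rightarrow> ('o, 'm, 'x) cat_scheme \<Rightarrow> bool" where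
  "filtered_colims_commute_with_finite_lims U M \<longleftrightarrow>
     (\<forall>(J :: ('u, 'u) cat) K D P Q \<pi> \<iota> X a Y b c.
        small_cat J \<and> filtered_cat J \<and> finite_cat K \<and> is_ftor (prod_cat J K) M D \<and>
        is_ftor J M P \<and>
        (\<forall>j\<in>Ob J. is_limit K M
           \<lparr>FOb = (\<lambda>k. FOb D (j, k)), FAr = (\<lambda>k l v. FAr D (j, k) (j, l) (Idt J j, v))\<rparr>
           (FOb P j) (\<pi> j)) \<and>
        (\<forall>i j. \<forall>u\<in>Hom J i j. \<forall>k\<in>Ob K.
           \<pi> j k \<cdot>\<^bsub>M\<^esub> FAr P i j u = FAr D (i, k) (j, k) (u, Idt K k) \<cdot>\<^bsub>M\<^esub> \<pi> i k) \<and>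
        is_ftor K M Q \<and>
        (\<forall>k\<in>Ob K. is_colimit J M
           \<lparr>FOb = (\<lambda>j. FOb D (j, k)), FAr = (\<lambda>i j u. FAr D (i, k) (j, k) (u, Idt K k))\<rparr>
           (FOb Q k) (\<lambda>j. \<iota> j k)) \<and>
        (\<forall>k l. \<forall>v\<in>Hom K k l. \<forall>j\<in>Ob J.
           FAr Q k l v \<cdot>\<^bsub>M\<^esub> \<iota> j k = \<iota> j l \<cdot>\<^bsub>M\<^esub> FAr D (j, k) (j, l) (Idt J j, v)) \<and>
        is_colimit J M P X a \<and> is_limit K M Q Y b \<and>
        c \<in> Hom M X Y \<and>
        (\<forall>j\<in>Ob J. \<forall>k\<in>Ob K. b k \<cdot>\<^bsub>M\<^esub> (c \<cdot>\<^bsub>M\<^esub> a j) = \<iota> j k \<cdot>\<^bsub>M\<^esub> \<pi> j k)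
        \<longrightarrow> is_iso M X Y c)"


section \<open>Abelian categories\<close>

record ('o, 'm) add_cat = "('o, 'm) cat" +
  Add :: "'m \<Rightarrow> 'm \<Rightarrow> 'm"
  Zer :: "'o \<Rightarrow> 'o \<Rightarrow> 'm"

definition hom_group :: "('o, 'm, 'x) add_cat_scheme \<Rightarrow> 'o \<Rightarrow> 'o \<Rightarrow> 'm monoid" where
  "hom_group C X Y = \<lparr>carrier = Hom C X Y, monoid.mult = Add C, one = Zer C X Y\<rparr>"

definition end_ring :: "('o, 'm, 'x) add_cat_scheme \<Rightarrow> 'o \<Rightarrow> 'm ring" where
  "end_ring C X = \<lparr>carrier = Hom C X X, monoid.mult = Cmp C, one = Idt C X,
                   zero = Zer C X X, add = Add C\<rparr>"

locale preadditive_category = category C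
  for C :: "('o, 'm, 'x) add_cat_scheme" (structure) +
  assumes hom_comm_group: "\<lbrakk>X \<in> Ob C; Y \<in> Ob C\<rbrakk> \<Longrightarrow> comm_group (hom_group C X Y)"
    and cmp_add_left: "\<lbrakk>f \<in> Hom C X Y; g \<in> Hom C Y Z; h \<in> Hom C Y Z\<rbrakk>
                         \<Longrightarrow> Add C g h \<cdot> f = Add C (g \<cdot> f) (h \<cdot> f)"
    and cmp_add_right: "\<lbrakk>f \<in> Hom C X Y; g \<in> Hom C X Y; h \<in> Hom C Y Z\<rbrakk>
                         \<Longrightarrow> h \<cdot> Add C f g = Add C (h \<cdot> f) (h \<cdot> g)"

definition is_kernel ::
  "('o, 'm, 'x) add_cat_scheme \<Rightarrow> 'o \<Rightarrow> 'o \<Rightarrow> 'm \<Rightarrow> 'o \<Rightarrow> 'm \<Rightarrow> bool" where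
  "is_kernel C X Y f K k \<longleftrightarrow> k \<in> Hom C K X \<and> f \<cdot>\<^bsub>C\<^esub> k = Zer C K Y \<and>
     (\<forall>W. \<forall>g\<in>Hom C W X. f \<cdot>\<^bsub>C\<^esub> g = Zer C W Y \<longrightarrow> (\<exists>!h. h \<in> Hom C W K \<and> k \<cdot>\<^bsub>C\<^esub> h = g))"

definition is_cokernel ::
  "('o, 'm, 'x) add_cat_scheme \<Rightarrow> 'o \<Rightarrow> 'o \<Rightarrow> 'm \<Rightarrow> 'o \<Rightarrow> 'm \<Rightarrow> bool" where
  "is_cokernel C X Y f Q q \<longleftrightarrow> q \<in> Hom C Y Q \<and> q \<cdot>\<^bsub>C\<^esub> f = Zer C X Q \<and>
     (\<forall>Z. \<forall>g\<in>Hom C Y Z. g \<cdot>\<^bsub>C\<^esub> f = Zer C X Z \<longrightarrow> (\<exists>!h. h \<in> Hom C Q Z \<and> h \<cdot>\<^bsub>C\<^esub> q = g))"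

definition is_biproduct ::
  "('o, 'm, 'x) add_cat_scheme \<Rightarrow> 'o \<Rightarrow> 'o \<Rightarrow> 'o \<Rightarrow> 'm \<Rightarrow> 'm \<Rightarrow> 'm \<Rightarrow> 'm \<Rightarrow> bool" where
  "is_biproduct C X Y S i j p q \<longleftrightarrow>
     i \<in> Hom C X S \<and> j \<in> Hom C Y S \<and> p \<in> Hom C S X \<and> q \<in> Hom C S Y \<and>
     p \<cdot>\<^bsub>C\<^esub> i = Idt C X \<and> q \<cdot>\<^bsub>C\<^esub> j = Idt C Y \<and> q \<cdot>\<^bsub>C\<^esub> i = Zer C X Y \<and> p \<cdot>\<^bsub>C\<^esub> j = Zer C Y X \<and>
     Add C (i \<cdot>\<^bsub>C\<^esub> p) (j \<cdot>\<^bsub>C\<^esub> q) = Idt C S"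

locale abelian_category = preadditive_category C
  for C :: "('o, 'm, 'x) add_cat_scheme" (structure) +
  assumes ex_zero_ob: "\<exists>Z. is_zero_ob C Z"
    and ex_biproduct: "\<lbrakk>X \<in> Ob C; Y \<in> Ob C\<rbrakk> \<Longrightarrow> \<exists>S i j p q. is_biproduct C X Y S i j p q"
    and ex_kernel: "f \<in> Hom C X Y \<Longrightarrow> \<exists>K k. is_kernel C X Y f K k"
    and ex_cokernel: "f \<in> Hom C X Y \<Longrightarrow> \<exists>Q q. is_cokernel C X Y f Q q"
    and mono_kernel: "is_mono C X Y f \<Longrightarrow> \<exists>Z g. g \<in> Hom C Y Z \<and> is_kernel C Y Z g X f"
    and epi_cokernel: "is_epi C X Y f \<Longrightarrow> \<exists>W g. g \<in> Hom C W X \<and> is_cokernel C W X g Y f"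

text \<open>
  For a finite diagram \<open>G\<close> with cocone \<open>(L, e)\<close>, the canonical homomorphism from the colimit, in
  abelian groups, of the groups of arrows \<open>X \<rightarrow> G i\<close> to the group of arrows \<open>X \<rightarrow> L\<close> is an
  isomorphism.  The colimit is the direct sum modulo the subgroup generated by the differences of
  \<open>x\<close> in degree \<open>i\<close> and its image in degree \<open>j\<close>, for all \<open>u : i \<rightarrow> j\<close>.
\<close>

definition in_degree :: "('i \<Rightarrow> 'm monoid) \<Rightarrow> 'i set \<Rightarrow> 'i \<Rightarrow> 'm \<Rightarrow> 'i \<Rightarrow> 'm" where
  "in_degree H S i x = (\<lambda>k\<in>S. if k = i then x else \<one>\<^bsub>H k\<^esub>)"

definition hom_group_commutes_with_colim :: "('o, 'm, 'x) add_cat_scheme \<Rightarrow> 'o \<Rightarrow>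
    ('i, 'n, 'y) cat_scheme \<Rightarrow> ('i, 'n, 'o, 'm) ftor \<Rightarrow> 'o \<Rightarrow> ('i \<Rightarrow> 'm) \<Rightarrow> bool" where
  "hom_group_commutes_with_colim C X J G L e \<longleftrightarrow>
     (let H = (\<lambda>i. hom_group C X (FOb G i));
          S = sum_group (Ob J) H;
          N = generate S
                {in_degree H (Ob J) i x \<otimes>\<^bsub>S\<^esub>
                   inv\<^bsub>S\<^esub> in_degree H (Ob J) j (FAr G i j u \<cdot>\<^bsub>C\<^esub> x)
                 | i j u x. u \<in> Hom J i j \<and> x \<in> carrier (H i)}
      in (\<lambda>c. the_elem ((\<lambda>x. finprod (hom_group C X L) (\<lambda>i. e i \<cdot>\<^bsub>C\<^esub> x i) (Ob J)) ` c))
           \<in> iso (S Mod N) (hom_group C X L))"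


section \<open>Symmetric monoidal categories\<close>

record ('o, 'm) smon_cat = "('o, 'm) add_cat" +
  TObj    :: "'o \<Rightarrow> 'o \<Rightarrow> 'o"  (infixr "\<otimes>\<^sub>o\<index>" 75)
  TArr    :: "'m \<Rightarrow> 'm \<Rightarrow> 'm"  (infixr "\<otimes>\<^sub>a\<index>" 75)
  UnitOb  :: "'o"
  Assoc   :: "'o \<Rightarrow> 'o \<Rightarrow> 'o \<Rightarrow> 'm"
  LUnitor :: "'o \<Rightarrow> 'm"
  RUnitor :: "'o \<Rightarrow> 'm"
  Braid   :: "'o \<Rightarrow> 'o \<Rightarrow> 'm"

locale symmetric_monoidal_category = category C
  for C :: "('o, 'm, 'x) smon_cat_scheme" (structure) +
  assumes unit_ob: "UnitOb C \<in> Ob C"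
    and tensor_ob: "\<lbrakk>X \<in> Ob C; Y \<in> Ob C\<rbrakk> \<Longrightarrow> X \<otimes>\<^sub>o Y \<in> Ob C"
    and tensor_hom: "\<lbrakk>f \<in> Hom C X X'; g \<in> Hom C Y Y'\<rbrakk>
                       \<Longrightarrow> f \<otimes>\<^sub>a g \<in> Hom C (X \<otimes>\<^sub>o Y) (X' \<otimes>\<^sub>o Y')"
    and tensor_idt: "\<lbrakk>X \<in> Ob C; Y \<in> Ob C\<rbrakk> \<Longrightarrow> Idt C X \<otimes>\<^sub>a Idt C Y = Idt C (X \<otimes>\<^sub>o Y)"
    and tensor_cmp: "\<lbrakk>f \<in> Hom C X X'; f' \<in> Hom C X' X''; g \<in> Hom C Y Y'; g' \<in> Hom C Y' Y''\<rbrakk>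
                       \<Longrightarrow> (f' \<cdot> f) \<otimes>\<^sub>a (g' \<cdot> g) = (f' \<otimes>\<^sub>a g') \<cdot> (f \<otimes>\<^sub>a g)"
    and assoc_iso: "\<lbrakk>X \<in> Ob C; Y \<in> Ob C; Z \<in> Ob C\<rbrakk>
          \<Longrightarrow> is_iso C ((X \<otimes>\<^sub>o Y) \<otimes>\<^sub>o Z) (X \<otimes>\<^sub>o (Y \<otimes>\<^sub>o Z)) (Assoc C X Y Z)"
    and assoc_natural: "\<lbrakk>f \<in> Hom C X X'; g \<in> Hom C Y Y'; h \<in> Hom C Z Z'\<rbrakk>
          \<Longrightarrow> Assoc C X' Y' Z' \<cdot> ((f \<otimes>\<^sub>a g) \<otimes>\<^sub>a h) = (f \<otimes>\<^sub>a (g \<otimes>\<^sub>a h)) \<cdot> Assoc C X Y Z"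
    and lunitor_iso: "X \<in> Ob C \<Longrightarrow> is_iso C (UnitOb C \<otimes>\<^sub>o X) X (LUnitor C X)"
    and lunitor_natural: "f \<in> Hom C X Y
          \<Longrightarrow> LUnitor C Y \<cdot> (Idt C (UnitOb C) \<otimes>\<^sub>a f) = f \<cdot> LUnitor C X"
    and runitor_iso: "X \<in> Ob C \<Longrightarrow> is_iso C (X \<otimes>\<^sub>o UnitOb C) X (RUnitor C X)"
    and runitor_natural: "f \<in> Hom C X Y
          \<Longrightarrow> RUnitor C Y \<cdot> (f \<otimes>\<^sub>a Idt C (UnitOb C)) = f \<cdot> RUnitor C X"
    and braid_hom: "\<lbrakk>X \<in> Ob C; Y \<in> Ob C\<rbrakk> \<Longrightarrow> Braid C X Y \<in> Hom C (X \<otimes>\<^sub>o Y) (Y \<otimes>\<^sub>o X)"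
    and braid_natural: "\<lbrakk>f \<in> Hom C X X'; g \<in> Hom C Y Y'\<rbrakk>
          \<Longrightarrow> Braid C X' Y' \<cdot> (f \<otimes>\<^sub>a g) = (g \<otimes>\<^sub>a f) \<cdot> Braid C X Y"
    and braid_symmetric: "\<lbrakk>X \<in> Ob C; Y \<in> Ob C\<rbrakk>
          \<Longrightarrow> Braid C Y X \<cdot> Braid C X Y = Idt C (X \<otimes>\<^sub>o Y)"
    and pentagon: "\<lbrakk>W \<in> Ob C; X \<in> Ob C; Y \<in> Ob C; Z \<in> Ob C\<rbrakk>
          \<Longrightarrow> Assoc C W X (Y \<otimes>\<^sub>o Z) \<cdot> Assoc C (W \<otimes>\<^sub>o X) Y Z
            = (Idt C W \<otimes>\<^sub>a Assoc C X Y Z) \<cdot> Assoc C W (X \<otimes>\<^sub>o Y) Z \<cdot> (Assoc C W X Y \<otimes>\<^sub>a Idt C Z)"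
    and triangle: "\<lbrakk>X \<in> Ob C; Y \<in> Ob C\<rbrakk>
          \<Longrightarrow> (Idt C X \<otimes>\<^sub>a LUnitor C Y) \<cdot> Assoc C X (UnitOb C) Y = RUnitor C X \<otimes>\<^sub>a Idt C Y"
    and hexagon: "\<lbrakk>X \<in> Ob C; Y \<in> Ob C; Z \<in> Ob C\<rbrakk>
          \<Longrightarrow> Assoc C Y Z X \<cdot> Braid C X (Y \<otimes>\<^sub>o Z) \<cdot> Assoc C X Y Z
            = (Idt C Y \<otimes>\<^sub>a Braid C X Z) \<cdot> Assoc C Y X Z \<cdot> (Braid C X Y \<otimes>\<^sub>a Idt C Z)"

definition tensor_right :: "('o, 'm, 'x) smon_cat_scheme \<Rightarrow> 'o \<Rightarrow> ('o, 'm, 'o, 'm) ftor" where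
  "tensor_right C X = \<lparr>FOb = (\<lambda>Y. Y \<otimes>\<^sub>o\<^bsub>C\<^esub> X), FAr = (\<lambda>Y Z f. f \<otimes>\<^sub>a\<^bsub>C\<^esub> Idt C X)\<rparr>"


section \<open>Commutative monoid objects and modules\<close>

record ('o, 'm) cmon =
  MOb  :: "'o"
  Mult :: "'m"
  Eta  :: "'m"

definition is_cmonoid :: "('o, 'm, 'x) smon_cat_scheme \<Rightarrow> ('o, 'm) cmon \<Rightarrow> bool" where
  "is_cmonoid C A \<longleftrightarrow>
     MOb A \<in> Ob C \<and>
     Mult A \<in> Hom C (MOb A \<otimes>\<^sub>o\<^bsub>C\<^esub> MOb A) (MOb A) \<and>
     Eta A \<in> Hom C (UnitOb C) (MOb A) \<and>
     Mult A \<cdot>\<^bsub>C\<^esub> (Mult A \<otimes>\<^sub>a\<^bsub>C\<^esub> Idt C (MOb A))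
       = Mult A \<cdot>\<^bsub>C\<^esub> (Idt C (MOb A) \<otimes>\<^sub>a\<^bsub>C\<^esub> Mult A) \<cdot>\<^bsub>C\<^esub> Assoc C (MOb A) (MOb A) (MOb A) \<and>
     Mult A \<cdot>\<^bsub>C\<^esub> (Eta A \<otimes>\<^sub>a\<^bsub>C\<^esub> Idt C (MOb A)) = LUnitor C (MOb A) \<and>
     Mult A \<cdot>\<^bsub>C\<^esub> (Idt C (MOb A) \<otimes>\<^sub>a\<^bsub>C\<^esub> Eta A) = RUnitor C (MOb A) \<and>
     Mult A \<cdot>\<^bsub>C\<^esub> Braid C (MOb A) (MOb A) = Mult A"

definition Comm :: "('o, 'm, 'x) smon_cat_scheme \<Rightarrow> (('o, 'm) cmon, 'm) cat" where
  "Comm C = \<lparr>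
     Ob = {A. is_cmonoid C A},
     Hom = (\<lambda>A B. {f. is_cmonoid C A \<and> is_cmonoid C B \<and> f \<in> Hom C (MOb A) (MOb B) \<and>
                       f \<cdot>\<^bsub>C\<^esub> Mult A = Mult B \<cdot>\<^bsub>C\<^esub> (f \<otimes>\<^sub>a\<^bsub>C\<^esub> f) \<and> f \<cdot>\<^bsub>C\<^esub> Eta A = Eta B}),
     Idt = (\<lambda>A. Idt C (MOb A)),
     Cmp = Cmp C\<rparr>"

text \<open>Modules are right modules; since the monoids are commutative, this is only a convention.\<close>

record ('o, 'm) modl =
  Und :: "'o"
  Act :: "'m"

definition is_module ::
  "('o, 'm, 'x) smon_cat_scheme \<Rightarrow> ('o, 'm) cmon \<Rightarrow> ('o, 'm) modl \<Rightarrow> bool" where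
  "is_module C A M \<longleftrightarrow>
     Und M \<in> Ob C \<and>
     Act M \<in> Hom C (Und M \<otimes>\<^sub>o\<^bsub>C\<^esub> MOb A) (Und M) \<and>
     Act M \<cdot>\<^bsub>C\<^esub> (Act M \<otimes>\<^sub>a\<^bsub>C\<^esub> Idt C (MOb A))
       = Act M \<cdot>\<^bsub>C\<^esub> (Idt C (Und M) \<otimes>\<^sub>a\<^bsub>C\<^esub> Mult A) \<cdot>\<^bsub>C\<^esub> Assoc C (Und M) (MOb A) (MOb A) \<and>
     Act M \<cdot>\<^bsub>C\<^esub> (Idt C (Und M) \<otimes>\<^sub>a\<^bsub>C\<^esub> Eta A) = RUnitor C (Und M)"

definition Modl :: "('o, 'm, 'x) smon_cat_scheme \<Rightarrow> ('o, 'm) cmon \<Rightarrow>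
    (('o, 'm) modl, 'm) add_cat" where
  "Modl C A = \<lparr>
     Ob = {M. is_module C A M},
     Hom = (\<lambda>M N. {f. is_module C A M \<and> is_module C A N \<and> f \<in> Hom C (Und M) (Und N) \<and>
                       f \<cdot>\<^bsub>C\<^esub> Act M = Act N \<cdot>\<^bsub>C\<^esub> (f \<otimes>\<^sub>a\<^bsub>C\<^esub> Idt C (MOb A))}),
     Idt = (\<lambda>M. Idt C (Und M)),
     Cmp = Cmp C,
     Add = Add C,
     Zer = (\<lambda>M N. Zer C (Und M) (Und N))\<rparr>"

definition regular_module :: "('o, 'm) cmon \<Rightarrow> ('o, 'm) modl" where
  "regular_module A = \<lparr>Und = MOb A, Act = Mult A\<rparr>"

definition E_ring :: "('o, 'm, 'x) smon_cat_scheme \<Rightarrow> ('o, 'm) cmon \<Rightarrow> 'm ring" where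
  "E_ring C A = end_ring (Modl C A) (regular_module A)"

definition is_free_module ::
  "('o, 'm, 'x) smon_cat_scheme \<Rightarrow> ('o, 'm) cmon \<Rightarrow> nat \<Rightarrow> ('o, 'm) modl \<Rightarrow> bool" where
  "is_free_module C A r M \<longleftrightarrow>
     (\<exists>e. is_colimit (discrete_cat {..<r}) (Modl C A)
            \<lparr>FOb = (\<lambda>_. regular_module A), FAr = (\<lambda>_ _ _. Idt C (MOb A))\<rparr> M e)"

definition is_finitely_presented_module ::
  "'u itself \<Rightarrow> ('o, 'm, 'x) smon_cat_scheme \<Rightarrow> ('o, 'm) cmon \<Rightarrow> ('o, 'm) modl \<Rightarrow> bool" where
  "is_finitely_presented_module U C A M \<longleftrightarrow>
     M \<in> Ob (Modl C A) \<and> hom_preserves_directed_colims U (Modl C A) M"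


section \<open>Base change\<close>

text \<open>
  For a monoid morphism \<open>f : A \<rightarrow> B\<close>, the object underlying \<open>M \<otimes>\<^sub>A B\<close> is the coequalizer of
  \<open>(M \<otimes> A) \<otimes> B \<rightrightarrows> M \<otimes> B\<close>, where \<open>A\<close> acts on \<open>M\<close>, respectively (through \<open>f\<close>) on \<open>B\<close>.
\<close>

definition base_change_coeq :: "('o, 'm, 'x) smon_cat_scheme \<Rightarrow> ('o, 'm) cmon \<Rightarrow> ('o, 'm) cmon \<Rightarrow>
    'm \<Rightarrow> ('o, 'm) modl \<Rightarrow> 'o \<times> 'm" where
  "base_change_coeq C A B f M = (SOME (Q, q).
     is_coequalizer C
       ((Und M \<otimes>\<^sub>o\<^bsub>C\<^esub> MOb A) \<otimes>\<^sub>o\<^bsub>C\<^esub> MOb B) (Und M \<otimes>\<^sub>o\<^bsub>C\<^esub> MOb B)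
       (Act M \<otimes>\<^sub>a\<^bsub>C\<^esub> Idt C (MOb B))
       ((Idt C (Und M) \<otimes>\<^sub>a\<^bsub>C\<^esub> (Mult B \<cdot>\<^bsub>C\<^esub> (f \<otimes>\<^sub>a\<^bsub>C\<^esub> Idt C (MOb B))))
          \<cdot>\<^bsub>C\<^esub> Assoc C (Und M) (MOb A) (MOb B))
       Q q)"

definition base_change_ob :: "('o, 'm, 'x) smon_cat_scheme \<Rightarrow> ('o, 'm) cmon \<Rightarrow> ('o, 'm) cmon \<Rightarrow>
    'm \<Rightarrow> ('o, 'm) modl \<Rightarrow> ('o, 'm) modl" where
  "base_change_ob C A B f M =
     (let (Q, q) = base_change_coeq C A B f M in
      \<lparr>Und = Q,
       Act = (THE h. h \<in> Hom C (Q \<otimes>\<^sub>o\<^bsub>C\<^esub> MOb B) Q \<and>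
                h \<cdot>\<^bsub>C\<^esub> (q \<otimes>\<^sub>a\<^bsub>C\<^esub> Idt C (MOb B))
                  = q \<cdot>\<^bsub>C\<^esub> (Idt C (Und M) \<otimes>\<^sub>a\<^bsub>C\<^esub> Mult B) \<cdot>\<^bsub>C\<^esub> Assoc C (Und M) (MOb B) (MOb B))\<rparr>)"

definition base_change :: "('o, 'm, 'x) smon_cat_scheme \<Rightarrow> ('o, 'm) cmon \<Rightarrow> ('o, 'm) cmon \<Rightarrow>
    'm \<Rightarrow> (('o, 'm) modl, 'm, ('o, 'm) modl, 'm) ftor" where
  "base_change C A B f = \<lparr>
     FOb = base_change_ob C A B f,
     FAr = (\<lambda>M N g.
       let (Q, q) = base_change_coeq C A B f M; (R, r) = base_change_coeq C A B f N in
       THE h. h \<in> Hom C Q R \<and> h \<cdot>\<^bsub>C\<^esub> q = r \<cdot>\<^bsub>C\<^esub> (g \<otimes>\<^sub>a\<^bsub>C\<^esub> Idt C (MOb B)))\<rparr>"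

definition restrict_scalars ::
  "('o, 'm, 'x) smon_cat_scheme \<Rightarrow> ('o, 'm) cmon \<Rightarrow> 'm \<Rightarrow> ('o, 'm) modl" where
  "restrict_scalars C B f =
     \<lparr>Und = MOb B, Act = Mult B \<cdot>\<^bsub>C\<^esub> (Idt C (MOb B) \<otimes>\<^sub>a\<^bsub>C\<^esub> f)\<rparr>"


section \<open>The standing assumptions\<close>

text \<open>
  The groups of arrows in condition (C1) for arbitrary finite diagrams are compared as abelian
  groups.  In sets the condition would already fail for the empty diagram, whose colimit is 0.
\<close>

locale ag_base = abelian_category C + symmetric_monoidal_category C
  for C :: "('o, 'm, 'x) smon_cat_scheme" (structure) +
  fixes U :: "'u itself"
  assumes universe_uncountable: "uncountable (UNIV :: 'u set)"
    and small_limits: "has_small_limits U C"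
    and small_colimits: "has_small_colimits U C"
    and tensor_preserves_colims:
      "X \<in> Ob C \<Longrightarrow> preserves_small_colimits U C C (tensor_right C X)"
    and filtered_colims_finite_lims:
      "is_cmonoid C A \<Longrightarrow> filtered_colims_commute_with_finite_lims U (Modl C A)"
    and C1_unit: "hom_preserves_filtered_colims U C (UnitOb C)"
    and C1_finite:
      "\<lbrakk>is_cmonoid C A; finite_cat J; is_ftor J (Modl C A) G;
        \<And>i. i \<in> Ob J \<Longrightarrow> \<exists>r. is_free_module C A r (FOb G i);
        is_colimit J (Modl C A) G L e\<rbrakk>
       \<Longrightarrow> hom_group_commutes_with_colim (Modl C A) (regular_module A) J G L e"
    and C2:
      "\<lbrakk>is_cmonoid C A; M \<in> Ob (Modl C A)\<rbrakk>
       \<Longrightarrow> \<exists>(J :: ('u, 'u) cat) G e. small_cat J \<and> directed_cat J \<and> is_ftor J (Modl C A) G \<and>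
             (\<forall>j\<in>Ob J. is_finitely_presented_module U C A (FOb G j)) \<and>
             is_colimit J (Modl C A) G M e"


section \<open>Partitions of unity, localisation and Zariski covers\<close>

definition partition_of_unity :: "('o, 'm, 'x) smon_cat_scheme \<Rightarrow> ('o, 'm) cmon \<Rightarrow>
    'i set \<Rightarrow> ('i \<Rightarrow> 'm) \<Rightarrow> bool" where
  "partition_of_unity C A I t \<longleftrightarrow>
     finite I \<and> (\<forall>i\<in>I. t i \<in> carrier (E_ring C A)) \<and>
     (\<exists>s. (\<forall>i\<in>I. s i \<in> carrier (E_ring C A)) \<and>
          (\<Oplus>\<^bsub>E_ring C A\<^esub>i\<in>I. s i \<otimes>\<^bsub>E_ring C A\<^esub> t i) = \<one>\<^bsub>E_ring C A\<^esub>)"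

definition mult_sequence :: "('o, 'm, 'x) smon_cat_scheme \<Rightarrow> ('o, 'm) cmon \<Rightarrow> 'm \<Rightarrow>
    (nat, unit, ('o, 'm) modl, 'm) ftor" where
  "mult_sequence C A t = \<lparr>FOb = (\<lambda>_. regular_module A),
                          FAr = (\<lambda>m n _. t [^]\<^bsub>E_ring C A\<^esub> (n - m))\<rparr>"

text \<open>
  The monoid structure on \<open>A\<^sub>t\<close> is the one for which the coprojection \<open>e 0 : A \<rightarrow> A\<^sub>t\<close> is a monoid
  morphism inducing the \<open>A\<close>-module structure of the colimit.  There is exactly one such structure:
  it is \<open>A\<close>-bilinear, and every \<open>e n\<close> becomes \<open>e 0\<close> after applying the automorphism \<open>t ^ n\<close> of \<open>A\<^sub>t\<close>.
\<close>

definition is_localisation :: "('o, 'm, 'x) smon_cat_scheme \<Rightarrow> ('o, 'm) cmon \<Rightarrow> 'm \<Rightarrow>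
    ('o, 'm) cmon \<Rightarrow> 'm \<Rightarrow> bool" where
  "is_localisation C A t B j \<longleftrightarrow>
     j \<in> Hom (Comm C) A B \<and>
     (\<exists>e. is_colimit nat_cat (Modl C A) (mult_sequence C A t) (restrict_scalars C B j) e \<and> e 0 = j)"

definition localisation :: "('o, 'm, 'x) smon_cat_scheme \<Rightarrow> ('o, 'm) cmon \<Rightarrow> 'm \<Rightarrow>
    ('o, 'm) cmon \<times> 'm" where
  "localisation C A t = (SOME (B, j). is_localisation C A t B j)"

definition loc_monoid :: "('o, 'm, 'x) smon_cat_scheme \<Rightarrow> ('o, 'm) cmon \<Rightarrow> 'm \<Rightarrow> ('o, 'm) cmon" where
  "loc_monoid C A t = fst (localisation C A t)"

definition loc_map :: "('o, 'm, 'x) smon_cat_scheme \<Rightarrow> ('o, 'm) cmon \<Rightarrow> 'm \<Rightarrow> 'm" where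
  "loc_map C A t = snd (localisation C A t)"

definition is_flat_morphism :: "('o, 'm, 'x) smon_cat_scheme \<Rightarrow> ('o, 'm) cmon \<Rightarrow> ('o, 'm) cmon \<Rightarrow>
    'm \<Rightarrow> bool" where
  "is_flat_morphism C A B f \<longleftrightarrow>
     preserves_finite_limits (Modl C A) (Modl C B) (base_change C A B f)"

definition is_finitely_presented_morphism :: "'u itself \<Rightarrow> ('o, 'm, 'x) smon_cat_scheme \<Rightarrow>
    ('o, 'm) cmon \<Rightarrow> ('o, 'm) cmon \<Rightarrow> 'm \<Rightarrow> bool" where
  "is_finitely_presented_morphism U C A B f \<longleftrightarrow>
     hom_preserves_filtered_colims U (under_cat (Comm C) A) (B, f)"

text \<open>The object \<open>Spec A\<close> of \<open>Aff C\<close> is \<open>A\<close> itself.\<close>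

definition Aff :: "('o, 'm, 'x) smon_cat_scheme \<Rightarrow> (('o, 'm) cmon, 'm) cat" where
  "Aff C = opcat (Comm C)"

definition zariski_open_immersion :: "'u itself \<Rightarrow> ('o, 'm, 'x) smon_cat_scheme \<Rightarrow>
    ('o, 'm) cmon \<Rightarrow> ('o, 'm) cmon \<Rightarrow> 'm \<Rightarrow> bool" where
  "zariski_open_immersion U C B A f \<longleftrightarrow>
     f \<in> Hom (Aff C) B A \<and>
     is_flat_morphism C A B f \<and> is_epi (Comm C) A B f \<and> is_finitely_presented_morphism U C A B f"

definition zariski_open_cover :: "'u itself \<Rightarrow> ('o, 'm, 'x) smon_cat_scheme \<Rightarrow>
    'i set \<Rightarrow> ('i \<Rightarrow> ('o, 'm) cmon) \<Rightarrow> ('i \<Rightarrow> 'm) \<Rightarrow> ('o, 'm) cmon \<Rightarrow> bool" where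
  "zariski_open_cover U C I B f A \<longleftrightarrow>
     (\<forall>i\<in>I. zariski_open_immersion U C (B i) A (f i)) \<and>
     (\<exists>I'. I' \<subseteq> I \<and> finite I' \<and>
        (\<forall>M\<in>Ob (Modl C A). is_zero_ob (Modl C A) M \<longleftrightarrow>
           (\<forall>i\<in>I'. is_zero_ob (Modl C (B i)) (FOb (base_change C A (B i) (f i)) M))))"

end

theory Submission
  imports Defs
begin

text \<open>
  For an \<open>A\<close>-module \<open>M\<close> the base change \<open>M \<otimes>\<^sub>A A\<^sub>t\<close> is the colimit of \<open>M \<rightarrow> M \<rightarrow> \<dots>\<close> along the action
  of \<open>t\<close>.  Flatness of \<open>A \<rightarrow> A\<^sub>t\<close> is therefore the commutation of filtered colimits with finite
  limits, together with the fact that \<open>A\<close>-linear maps between \<open>A\<^sub>t\<close>-modules are \<open>A\<^sub>t\<close>-linear.  Maps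
  out of \<open>A\<^sub>t\<close> are determined on \<open>A\<close> and exist as soon as \<open>t\<close> becomes invertible; since filtered
  colimits of monoids are computed in the base category and \<open>1\<close> is finitely presented, an inverse of
  \<open>t\<close> in a filtered colimit already exists at a finite stage, which gives finite presentation.
  Finally, if all \<open>M \<otimes>\<^sub>A A\<^bsub>t i\<^esub>\<close> vanish, every map from a finitely presented module to \<open>M\<close> is
  annihilated by a power of each \<open>t i\<close>, hence by \<open>1\<close>; as \<open>M\<close> is a directed colimit of finitely
  presented modules, it is zero.
\<close>


section \<open>Typed arrows\<close>

text \<open>An element \<open>a\<close> at stage n of the telescope should be read as a t^-n, and
  every construction is dictated by this: stages i and k multiply into stage i + k, multiplication
  by t lowers the stage by one, and wherever t is invertible stage 0 determines all later ones.
  Three obstacles shape the argument. Both \<open>localisation\<close> and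
  \<open>base_change_coeq\<close> are arbitrary choices, so a convenient model does not suffice: one
  localisation is built by hand, any other is isomorphic to it as a colimit of modules, and
  afterwards only the telescope and the linearity of its coprojections are used. The commutation of
  filtered colimits with finite limits takes place over A, whereas flatness asks for a limit over
  the localisation, so a comparison limit over A has to be produced first and then recognised as one
  over the localisation. Additivity of the tensor product has to be derived from its preservation of
  the empty coproduct and of the coproduct of two copies of an object; without it neither zero
  arrows nor sums of scalars could be moved between modules.\<close>

datatype ('o, 'm) arrow = Null | Arr (src: 'o) (raw: 'm) (tgt: 'o)

context category
begin

definition ok :: "('o, 'm) arrow \<Rightarrow> bool" where
  "ok f \<longleftrightarrow> f \<noteq> Null \<and> raw f \<in> Hom C (src f) (tgt f)"

abbreviation ar :: "('o, 'm) arrow \<Rightarrow> 'o \<Rightarrow> 'o \<Rightarrow> bool" where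
  "ar f X Y \<equiv> ok f \<and> src f = X \<and> tgt f = Y"

text \<open>A bare arrow does not determine its source and target, since hom-sets may overlap. Typed
  copies carry both along, and sending ill-typed composites to \<open>Null\<close> turns commuting
  diagrams into equations that can be chained freely.\<close>

definition acomp :: "('o, 'm) arrow \<Rightarrow> ('o, 'm) arrow \<Rightarrow> ('o, 'm) arrow" (infixr "\<bullet>" 70) where
  "g \<bullet> f = (if ok f \<and> ok g \<and> tgt f = src g then Arr (src f) (raw g \<cdot> raw f) (tgt g) else Null)"

definition idn :: "'o \<Rightarrow> ('o, 'm) arrow" where
  "idn X = Arr X (Idt C X) X"

lemma ok_Null [simp]: "\<not> ok Null"
  by (simp add: ok_def)

lemma ok_Arr [simp]: "ok (Arr X f Y) \<longleftrightarrow> f \<in> Hom C X Y"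
  by (simp add: ok_def)

lemma arE:
  assumes "ar f X Y"
  obtains u where "u \<in> Hom C X Y" "f = Arr X u Y"
  using assms by (cases f) auto

lemma ar_Arr_raw: "ar f X Y \<Longrightarrow> Arr X (raw f) Y = f"
  by (cases f) auto

lemma arrow_eqI:
  "\<lbrakk>ok f; ok g; src f = src g; tgt f = tgt g; raw f = raw g\<rbrakk> \<Longrightarrow> f = g"
  by (cases f; cases g) auto

lemma ar_raw: "ar f X Y \<Longrightarrow> raw f \<in> Hom C X Y"
  by (cases f) auto

lemma ok_ob [simp]:
  assumes "ok f" shows "src f \<in> Ob C" "tgt f \<in> Ob C"
  using assms hom_ob by (auto simp: ok_def)

lemma ok_acomp [simp]:
  assumes "ok f" "ok g" "tgt f = src g"
  shows "ok (g \<bullet> f)" "src (g \<bullet> f) = src f" "tgt (g \<bullet> f) = tgt g" "raw (g \<bullet> f) = raw g \<cdot> raw f"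
  using assms cmp_hom by (cases f; cases g; auto simp: acomp_def)+

lemma Arr_acomp:
  "\<lbrakk>f \<in> Hom C X Y; g \<in> Hom C Y Z\<rbrakk> \<Longrightarrow> Arr Y g Z \<bullet> Arr X f Y = Arr X (g \<cdot> f) Z"
  by (simp add: acomp_def)

lemma ok_idn [simp]:
  "X \<in> Ob C \<Longrightarrow> ok (idn X)" "src (idn X) = X" "tgt (idn X) = X"
  by (simp_all add: idn_def idt_hom)

lemma idn_left [simp]: "\<lbrakk>ok f; tgt f = X\<rbrakk> \<Longrightarrow> idn X \<bullet> f = f"
  using idt_left by (cases f) (auto simp: idn_def acomp_def intro: idt_hom dest: hom_ob)

lemma idn_right [simp]: "\<lbrakk>ok f; src f = X\<rbrakk> \<Longrightarrow> f \<bullet> idn X = f"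
  using idt_right by (cases f) (auto simp: idn_def acomp_def intro: idt_hom dest: hom_ob)

text \<open>Since ill-typed composites are \<open>Null\<close>, associativity holds without side conditions.\<close>

lemma acomp_assoc: "(h \<bullet> g) \<bullet> f = h \<bullet> (g \<bullet> f)"
proof (cases "ok f \<and> ok g \<and> ok h \<and> tgt f = src g \<and> tgt g = src h")
  case True
  then obtain W X Y Z u v w where "f = Arr W u X" "g = Arr X v Y" "h = Arr Y w Z"
    and "u \<in> Hom C W X" "v \<in> Hom C X Y" "w \<in> Hom C Y Z"
    by (metis arE)
  then show ?thesis
    using cmp_assoc[of u W X v Y w Z] by (simp add: Arr_acomp cmp_hom[of u W X v Y] cmp_hom[of v X Y w Z])
next
  case False
  have *: "ok (b \<bullet> a) \<longleftrightarrow> ok a \<and> ok b \<and> tgt a = src b" for a b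
    by (metis acomp_def ok_acomp(1) ok_Null)
  have N: "\<not> (ok a \<and> ok b \<and> tgt a = src b) \<Longrightarrow> b \<bullet> a = Null" for a b
    by (auto simp: acomp_def)
  have "(h \<bullet> g) \<bullet> f = Null"
    using False by (intro N) (auto simp: *)
  moreover have "h \<bullet> (g \<bullet> f) = Null"
    using False by (intro N) (auto simp: *)
  ultimately show ?thesis by simp
qed

text \<open>In a right-nested chain the factors \<open>g\<close> and \<open>f\<close> are usually
  preceded by further arrows; this form applies an equation for their composite in front of such a
  remainder \<open>k\<close>.\<close>

lemma acomp_reassoc: "g \<bullet> f = h \<Longrightarrow> g \<bullet> f \<bullet> k = h \<bullet> k"
  by (simp add: acomp_assoc[symmetric])

lemma acomp_reassoc2: "g \<bullet> f = k \<bullet> h \<Longrightarrow> g \<bullet> f \<bullet> x = k \<bullet> h \<bullet> x"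
  by (simp add: acomp_assoc[symmetric])

definition aiso :: "('o, 'm) arrow \<Rightarrow> bool" where
  "aiso f \<longleftrightarrow> ok f \<and> (\<exists>g. ar g (tgt f) (src f) \<and> g \<bullet> f = idn (src f) \<and> f \<bullet> g = idn (tgt f))"

definition ainv :: "('o, 'm) arrow \<Rightarrow> ('o, 'm) arrow" where
  "ainv f = (SOME g. ar g (tgt f) (src f) \<and> g \<bullet> f = idn (src f) \<and> f \<bullet> g = idn (tgt f))"

lemma aiso_ok: "aiso f \<Longrightarrow> ok f"
  by (simp add: aiso_def)

lemma ainv:
  assumes "aiso f"
  shows "ok (ainv f)" "src (ainv f) = tgt f" "tgt (ainv f) = src f"
    "ainv f \<bullet> f = idn (src f)" "f \<bullet> ainv f = idn (tgt f)"
  using assms unfolding aiso_def ainv_def by (metis (mono_tags, lifting) someI_ex)+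

lemma aisoI: "\<lbrakk>ar f X Y; ar g Y X; g \<bullet> f = idn X; f \<bullet> g = idn Y\<rbrakk> \<Longrightarrow> aiso f"
  by (auto simp: aiso_def)

lemma ainv_reassoc:
  assumes "aiso f" "ok k"
  shows "tgt k = src f \<Longrightarrow> ainv f \<bullet> f \<bullet> k = k" "tgt k = tgt f \<Longrightarrow> f \<bullet> ainv f \<bullet> k = k"
  using assms by (simp_all add: acomp_assoc[symmetric] ainv)

lemmas ainv_simps [simp] = ainv ainv_reassoc aiso_ok

lemma aiso_cancel_left:
  assumes "aiso f" "ok g" "ok h" "tgt g = src f" "tgt h = src f" "f \<bullet> g = f \<bullet> h"
  shows "g = h"
  using assms by (metis ainv_reassoc(1))

lemma aiso_cancel_right:
  assumes "aiso f" "ok g" "ok h" "src g = tgt f" "src h = tgt f" "g \<bullet> f = h \<bullet> f"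
  shows "g = h"
  using assms by (metis acomp_assoc ainv(5) idn_right)

lemma is_iso_Arr: "is_iso C X Y f \<longleftrightarrow> aiso (Arr X f Y)"
proof
  assume "is_iso C X Y f"
  then obtain g where "f \<in> Hom C X Y" "g \<in> Hom C Y X" "g \<cdot> f = Idt C X" "f \<cdot> g = Idt C Y"
    by (auto simp: is_iso_def)
  then show "aiso (Arr X f Y)"
    by (intro aisoI[where g = "Arr Y g X" and X = X and Y = Y]) (auto simp: Arr_acomp idn_def)
next
  assume *: "aiso (Arr X f Y)"
  then have f: "f \<in> Hom C X Y" by (metis aiso_ok ok_Arr)
  obtain g where g: "ainv (Arr X f Y) = Arr Y g X" "g \<in> Hom C Y X"
    using ainv[OF *] by (metis arE arrow.sel(1) arrow.sel(3))
  with ainv(4,5)[OF *] f show "is_iso C X Y f"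
    by (auto simp: is_iso_def Arr_acomp idn_def)
qed

end

context symmetric_monoidal_category
begin

definition atens :: "('o, 'm) arrow \<Rightarrow> ('o, 'm) arrow \<Rightarrow> ('o, 'm) arrow" (infixr "\<star>" 75) where
  "f \<star> g = (if ok f \<and> ok g
     then Arr (src f \<otimes>\<^sub>o src g) (raw f \<otimes>\<^sub>a raw g) (tgt f \<otimes>\<^sub>o tgt g) else Null)"

definition al :: "'o \<Rightarrow> 'o \<Rightarrow> 'o \<Rightarrow> ('o, 'm) arrow" where
  "al X Y Z = Arr ((X \<otimes>\<^sub>o Y) \<otimes>\<^sub>o Z) (Assoc C X Y Z) (X \<otimes>\<^sub>o (Y \<otimes>\<^sub>o Z))"

definition lu :: "'o \<Rightarrow> ('o, 'm) arrow" where
  "lu X = Arr (UnitOb C \<otimes>\<^sub>o X) (LUnitor C X) X"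

definition ru :: "'o \<Rightarrow> ('o, 'm) arrow" where
  "ru X = Arr (X \<otimes>\<^sub>o UnitOb C) (RUnitor C X) X"

definition br :: "'o \<Rightarrow> 'o \<Rightarrow> ('o, 'm) arrow" where
  "br X Y = Arr (X \<otimes>\<^sub>o Y) (Braid C X Y) (Y \<otimes>\<^sub>o X)"

lemma ok_atens [simp]:
  assumes "ok f" "ok g"
  shows "ok (f \<star> g)" "src (f \<star> g) = src f \<otimes>\<^sub>o src g" "tgt (f \<star> g) = tgt f \<otimes>\<^sub>o tgt g"
    "raw (f \<star> g) = raw f \<otimes>\<^sub>a raw g"
  using assms tensor_hom by (auto simp: atens_def ok_def)

lemma Arr_atens:
  "\<lbrakk>f \<in> Hom C X X'; g \<in> Hom C Y Y'\<rbrakk>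
    \<Longrightarrow> Arr X f X' \<star> Arr Y g Y' = Arr (X \<otimes>\<^sub>o Y) (f \<otimes>\<^sub>a g) (X' \<otimes>\<^sub>o Y')"
  by (simp add: atens_def)

declare unit_ob [simp] tensor_ob [simp]

lemma atens_idn [simp]: "\<lbrakk>X \<in> Ob C; Y \<in> Ob C\<rbrakk> \<Longrightarrow> idn X \<star> idn Y = idn (X \<otimes>\<^sub>o Y)"
  by (simp add: idn_def atens_def idt_hom tensor_idt)

text \<open>Read from left to right this merges two layers of a tensor product into one; it is
  withheld in steps where the layers must stay apart for the next equation to apply.\<close>

lemma interchange [simp]:
  assumes "ok f" "ok f'" "ok g" "ok g'" "tgt f = src f'" "tgt g = src g'"
  shows "(f' \<star> g') \<bullet> (f \<star> g) = (f' \<bullet> f) \<star> (g' \<bullet> g)"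
proof -
  have "(raw f' \<cdot> raw f) \<otimes>\<^sub>a (raw g' \<cdot> raw g) = (raw f' \<otimes>\<^sub>a raw g') \<cdot> (raw f \<otimes>\<^sub>a raw g)"
    using assms by (intro tensor_cmp) (auto simp: ok_def)
  then have "raw ((f' \<star> g') \<bullet> (f \<star> g)) = raw ((f' \<bullet> f) \<star> (g' \<bullet> g))"
    using assms by simp
  then show ?thesis using assms
    by (intro arrow_eqI) auto
qed

lemma interchange_reassoc [simp]:
  assumes "ok f" "ok f'" "ok g" "ok g'" "tgt f = src f'" "tgt g = src g'"
  shows "(f' \<star> g') \<bullet> (f \<star> g) \<bullet> k = (f' \<bullet> f) \<star> (g' \<bullet> g) \<bullet> k"
  using assms by (simp add: acomp_assoc[symmetric])

lemma aiso_al: "\<lbrakk>X \<in> Ob C; Y \<in> Ob C; Z \<in> Ob C\<rbrakk> \<Longrightarrow> aiso (al X Y Z)"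
  using assoc_iso by (simp add: al_def is_iso_Arr)

lemma aiso_lu: "X \<in> Ob C \<Longrightarrow> aiso (lu X)"
  using lunitor_iso by (simp add: lu_def is_iso_Arr)

lemma aiso_ru: "X \<in> Ob C \<Longrightarrow> aiso (ru X)"
  using runitor_iso by (simp add: ru_def is_iso_Arr)

lemma al_simps [simp]:
  "\<lbrakk>X \<in> Ob C; Y \<in> Ob C; Z \<in> Ob C\<rbrakk> \<Longrightarrow> ok (al X Y Z)"
  "src (al X Y Z) = (X \<otimes>\<^sub>o Y) \<otimes>\<^sub>o Z" "tgt (al X Y Z) = X \<otimes>\<^sub>o (Y \<otimes>\<^sub>o Z)"
  using aiso_al by (auto simp del: ok_Arr) (simp_all add: al_def)

lemma lu_simps [simp]: "X \<in> Ob C \<Longrightarrow> ok (lu X)" "src (lu X) = UnitOb C \<otimes>\<^sub>o X" "tgt (lu X) = X"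
  using aiso_lu by (auto simp del: ok_Arr) (simp_all add: lu_def)

lemma ru_simps [simp]: "X \<in> Ob C \<Longrightarrow> ok (ru X)" "src (ru X) = X \<otimes>\<^sub>o UnitOb C" "tgt (ru X) = X"
  using aiso_ru by (auto simp del: ok_Arr) (simp_all add: ru_def)

lemma br_simps [simp]:
  "\<lbrakk>X \<in> Ob C; Y \<in> Ob C\<rbrakk> \<Longrightarrow> ok (br X Y)" "src (br X Y) = X \<otimes>\<^sub>o Y" "tgt (br X Y) = Y \<otimes>\<^sub>o X"
  by (simp_all add: br_def braid_hom)

declare aiso_al [simp] aiso_lu [simp] aiso_ru [simp]

lemma al_nat:
  assumes "ar f X X'" "ar g Y Y'" "ar h Z Z'"
  shows "al X' Y' Z' \<bullet> ((f \<star> g) \<star> h) = (f \<star> (g \<star> h)) \<bullet> al X Y Z"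
proof -
  have "X \<in> Ob C" "Y \<in> Ob C" "Z \<in> Ob C" "X' \<in> Ob C" "Y' \<in> Ob C" "Z' \<in> Ob C"
    using assms ok_ob by blast+
  then have a: "Assoc C X Y Z \<in> Hom C ((X \<otimes>\<^sub>o Y) \<otimes>\<^sub>o Z) (X \<otimes>\<^sub>o (Y \<otimes>\<^sub>o Z))"
    "Assoc C X' Y' Z' \<in> Hom C ((X' \<otimes>\<^sub>o Y') \<otimes>\<^sub>o Z') (X' \<otimes>\<^sub>o (Y' \<otimes>\<^sub>o Z'))"
    using al_simps(1) by (simp_all add: al_def)
  from assms obtain u v w where uvw: "f = Arr X u X'" "g = Arr Y v Y'" "h = Arr Z w Z'"
    and "u \<in> Hom C X X'" "v \<in> Hom C Y Y'" "w \<in> Hom C Z Z'"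
    by (metis arE)
  with a assoc_natural[of u X X' v Y Y' w Z Z'] show ?thesis
    unfolding uvw al_def by (simp add: Arr_atens Arr_acomp tensor_hom)
qed

lemma lu_nat:
  assumes "ar f X Y" shows "lu Y \<bullet> (idn (UnitOb C) \<star> f) = f \<bullet> lu X"
proof -
  have "X \<in> Ob C" "Y \<in> Ob C" using assms ok_ob by blast+
  then have a: "LUnitor C X \<in> Hom C (UnitOb C \<otimes>\<^sub>o X) X" "LUnitor C Y \<in> Hom C (UnitOb C \<otimes>\<^sub>o Y) Y"
    using lu_simps(1) by (simp_all add: lu_def)
  from assms obtain u where u: "f = Arr X u Y" "u \<in> Hom C X Y" by (metis arE)
  with a lunitor_natural[of u X Y] show ?thesis
    unfolding u(1) lu_def idn_def by (simp add: Arr_atens Arr_acomp tensor_hom idt_hom)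
qed

lemma ru_nat:
  assumes "ar f X Y" shows "ru Y \<bullet> (f \<star> idn (UnitOb C)) = f \<bullet> ru X"
proof -
  have "X \<in> Ob C" "Y \<in> Ob C" using assms ok_ob by blast+
  then have a: "RUnitor C X \<in> Hom C (X \<otimes>\<^sub>o UnitOb C) X" "RUnitor C Y \<in> Hom C (Y \<otimes>\<^sub>o UnitOb C) Y"
    using ru_simps(1) by (simp_all add: ru_def)
  from assms obtain u where u: "f = Arr X u Y" "u \<in> Hom C X Y" by (metis arE)
  with a runitor_natural[of u X Y] show ?thesis
    unfolding u(1) ru_def idn_def by (simp add: Arr_atens Arr_acomp tensor_hom idt_hom)
qed

lemma ru_inv_nat:
  assumes "ar f X Y" shows "ainv (ru Y) \<bullet> f = (f \<star> idn (UnitOb C)) \<bullet> ainv (ru X)"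
proof -
  have [simp]: "X \<in> Ob C" "Y \<in> Ob C" using assms ok_ob by blast+
  have "ru Y \<bullet> (f \<star> idn (UnitOb C)) \<bullet> ainv (ru X) = f"
    using assms by (simp add: acomp_assoc[symmetric] ru_nat[OF assms]) (simp add: acomp_assoc)
  then have "ainv (ru Y) \<bullet> f = ainv (ru Y) \<bullet> ru Y \<bullet> (f \<star> idn (UnitOb C)) \<bullet> ainv (ru X)"
    by simp
  then show ?thesis
    using assms by simp
qed

lemma br_nat:
  assumes "ar f X X'" "ar g Y Y'"
  shows "br X' Y' \<bullet> (f \<star> g) = (g \<star> f) \<bullet> br X Y"
proof -
  have ob: "X \<in> Ob C" "Y \<in> Ob C" "X' \<in> Ob C" "Y' \<in> Ob C"
    using assms ok_ob by blast+
  from assms obtain u v where uv: "f = Arr X u X'" "g = Arr Y v Y'"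
    and "u \<in> Hom C X X'" "v \<in> Hom C Y Y'"
    by (metis arE)
  with ob braid_natural[of u X X' v Y Y'] show ?thesis
    unfolding uv br_def by (simp add: Arr_atens Arr_acomp tensor_hom braid_hom)
qed

lemma br_br [simp]: "\<lbrakk>X \<in> Ob C; Y \<in> Ob C\<rbrakk> \<Longrightarrow> br Y X \<bullet> br X Y = idn (X \<otimes>\<^sub>o Y)"
  using braid_symmetric[of X Y] by (simp add: br_def Arr_acomp braid_hom idn_def)

lemma aiso_br [simp]: "\<lbrakk>X \<in> Ob C; Y \<in> Ob C\<rbrakk> \<Longrightarrow> aiso (br X Y)"
  by (rule aisoI[where g = "br Y X"]) auto

lemma apentagon:
  assumes "W \<in> Ob C" "X \<in> Ob C" "Y \<in> Ob C" "Z \<in> Ob C"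
  shows "al W X (Y \<otimes>\<^sub>o Z) \<bullet> al (W \<otimes>\<^sub>o X) Y Z
      = (idn W \<star> al X Y Z) \<bullet> al W (X \<otimes>\<^sub>o Y) Z \<bullet> (al W X Y \<star> idn Z)"
proof -
  have a: "Assoc C P Q R \<in> Hom C ((P \<otimes>\<^sub>o Q) \<otimes>\<^sub>o R) (P \<otimes>\<^sub>o (Q \<otimes>\<^sub>o R))"
    if "P \<in> Ob C" "Q \<in> Ob C" "R \<in> Ob C" for P Q R
    using al_simps(1)[OF that] by (simp add: al_def)
  have b: "(Idt C W \<otimes>\<^sub>a Assoc C X Y Z)
      \<in> Hom C (W \<otimes>\<^sub>o ((X \<otimes>\<^sub>o Y) \<otimes>\<^sub>o Z)) (W \<otimes>\<^sub>o X \<otimes>\<^sub>o Y \<otimes>\<^sub>o Z)"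
    "(Assoc C W X Y \<otimes>\<^sub>a Idt C Z)
      \<in> Hom C (((W \<otimes>\<^sub>o X) \<otimes>\<^sub>o Y) \<otimes>\<^sub>o Z) ((W \<otimes>\<^sub>o (X \<otimes>\<^sub>o Y)) \<otimes>\<^sub>o Z)"
    using assms by (auto intro!: tensor_hom a idt_hom)
  have c: "Assoc C W (X \<otimes>\<^sub>o Y) Z \<cdot> (Assoc C W X Y \<otimes>\<^sub>a Idt C Z)
      \<in> Hom C (((W \<otimes>\<^sub>o X) \<otimes>\<^sub>o Y) \<otimes>\<^sub>o Z) (W \<otimes>\<^sub>o ((X \<otimes>\<^sub>o Y) \<otimes>\<^sub>o Z))"
    by (rule cmp_hom[OF b(2) a]) (simp_all add: assms)
  show ?thesis
    using assms pentagon[OF assms]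
    by (simp add: al_def idn_def Arr_atens Arr_acomp tensor_hom a idt_hom b c)
qed

lemma atriangle:
  assumes "X \<in> Ob C" "Y \<in> Ob C"
  shows "(idn X \<star> lu Y) \<bullet> al X (UnitOb C) Y = ru X \<star> idn Y"
proof -
  have a: "Assoc C X (UnitOb C) Y \<in> Hom C ((X \<otimes>\<^sub>o UnitOb C) \<otimes>\<^sub>o Y) (X \<otimes>\<^sub>o (UnitOb C \<otimes>\<^sub>o Y))"
    using al_simps(1)[OF assms(1) unit_ob assms(2)] by (simp add: al_def)
  have "LUnitor C Y \<in> Hom C (UnitOb C \<otimes>\<^sub>o Y) Y" "RUnitor C X \<in> Hom C (X \<otimes>\<^sub>o UnitOb C) X"
    using lu_simps(1) ru_simps(1) assms by (simp_all add: lu_def ru_def)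
  with a assms triangle[OF assms] show ?thesis
    by (simp add: al_def lu_def ru_def idn_def Arr_atens Arr_acomp tensor_hom idt_hom)
qed

text \<open>By naturality of \<open>ru\<close>, tensoring with the unit is isomorphic to the
  identity functor, hence faithful. An identity may therefore be proved after tensoring with the
  unit.\<close>

lemma ru_faithful:
  assumes "ar f X Y" "ar g X Y" "f \<star> idn (UnitOb C) = g \<star> idn (UnitOb C)"
  shows "f = g"
proof -
  have "X \<in> Ob C" using assms by auto
  moreover have "f \<bullet> ru X = g \<bullet> ru X" using assms by (metis ru_nat)
  ultimately show ?thesis
    by (intro aiso_cancel_right[where f = "ru X", OF _ _ _ _ _ \<open>f \<bullet> ru X = g \<bullet> ru X\<close>]) (use assms in auto)
qed

text \<open>Kelly's argument.\<close>

lemma ru_tensor: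
  assumes [simp]: "X \<in> Ob C" "Y \<in> Ob C"
  shows "(idn X \<star> ru Y) \<bullet> al X Y (UnitOb C) = ru (X \<otimes>\<^sub>o Y)"
proof -
  let ?u = "UnitOb C"
  \<comment> \<open>Both sides are tensored with the unit and followed by the isomorphism
    \<open>al X Y ?u\<close>; there the triangle and the pentagon for X, Y and two copies of the
    unit apply.\<close>
  have "al X Y ?u \<bullet> (ru (X \<otimes>\<^sub>o Y) \<star> idn ?u)
      = al X Y ?u \<bullet> (idn (X \<otimes>\<^sub>o Y) \<star> lu ?u) \<bullet> al (X \<otimes>\<^sub>o Y) ?u ?u"
    by (simp add: atriangle)
  also have "\<dots> = (idn X \<star> (idn Y \<star> lu ?u)) \<bullet> al X Y (?u \<otimes>\<^sub>o ?u) \<bullet> al (X \<otimes>\<^sub>o Y) ?u ?u"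
    using al_nat[of "idn X" X X "idn Y" Y Y "lu ?u" "?u \<otimes>\<^sub>o ?u" ?u]
    by (simp add: acomp_assoc[symmetric])
  also have "\<dots> = (idn X \<star> (ru Y \<star> idn ?u)) \<bullet> al X (Y \<otimes>\<^sub>o ?u) ?u \<bullet> (al X Y ?u \<star> idn ?u)"
    by (simp add: apentagon atriangle)
  also have "\<dots> = al X Y ?u \<bullet> (((idn X \<star> ru Y) \<star> idn ?u) \<bullet> (al X Y ?u \<star> idn ?u))"
    using acomp_reassoc2[OF al_nat[of "idn X" X X "ru Y" "Y \<otimes>\<^sub>o ?u" Y "idn ?u" ?u ?u],
        of "al X Y ?u \<star> idn ?u"]
    by simp
  finally have "ru (X \<otimes>\<^sub>o Y) \<star> idn ?u = ((idn X \<star> ru Y) \<star> idn ?u) \<bullet> (al X Y ?u \<star> idn ?u)"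
    by (rule aiso_cancel_left[rotated -1]) auto
  then have "((idn X \<star> ru Y) \<bullet> al X Y ?u) \<star> idn ?u = ru (X \<otimes>\<^sub>o Y) \<star> idn ?u"
    by simp
  then show ?thesis
    by (rule ru_faithful[rotated 2]) auto
qed

text \<open>Needed to apply a scalar 1 \<rightarrow> A to a tensor product: inserting the unit to
  the right of X \<otimes> Y amounts to inserting it to the right of Y.\<close>

lemma al_ru_inv:
  assumes [simp]: "X \<in> Ob C" "Y \<in> Ob C"
  shows "al X Y (UnitOb C) \<bullet> ainv (ru (X \<otimes>\<^sub>o Y)) = idn X \<star> ainv (ru Y)"
proof -
  have "(idn X \<star> ainv (ru Y)) \<bullet> (idn X \<star> ru Y) \<bullet> al X Y (UnitOb C) \<bullet> ainv (ru (X \<otimes>\<^sub>o Y))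
      = (idn X \<star> ainv (ru Y))"
    by (simp add: acomp_reassoc[OF ru_tensor] del: interchange_reassoc)
  then show ?thesis by simp
qed

declare acomp_assoc [simp]

end


section \<open>Colimits\<close>

text \<open>
  Smallness is defined for categories whose objects and arrows have type \<open>'u\<close>; countable index
  categories are transported into \<open>'u\<close> along injections.
\<close>

definition enc_cat :: "('i \<Rightarrow> 'u) \<Rightarrow> ('n \<Rightarrow> 'v) \<Rightarrow> ('i, 'n) cat \<Rightarrow> ('u, 'v) cat" where
  "enc_cat p q J = \<lparr>
     Ob = p ` Ob J,
     Hom = (\<lambda>a b. if a \<in> range p \<and> b \<in> range p then q ` Hom J (inv_into UNIV p a) (inv_into UNIV p b) else {}),
     Idt = (\<lambda>a. q (Idt J (inv_into UNIV p a))),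
     Cmp = (\<lambda>g f. q (inv_into UNIV q g \<cdot>\<^bsub>J\<^esub> inv_into UNIV q f))\<rparr>"

definition enc_ftor :: "('i \<Rightarrow> 'u) \<Rightarrow> ('n \<Rightarrow> 'v) \<Rightarrow> ('i, 'n, 'o, 'm) ftor \<Rightarrow> ('u, 'v, 'o, 'm) ftor" where
  "enc_ftor p q G = \<lparr>FOb = (\<lambda>a. FOb G (inv_into UNIV p a)),
     FAr = (\<lambda>a b u. FAr G (inv_into UNIV p a) (inv_into UNIV p b) (inv_into UNIV q u))\<rparr>"

lemma hom_enc_cat:
  assumes "inj p"
  shows "u \<in> Hom (enc_cat p q J) a b \<longleftrightarrow> (\<exists>i j v. a = p i \<and> b = p j \<and> u = q v \<and> v \<in> Hom J i j)"
  using assms by (auto simp: enc_cat_def inj_eq)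

lemma ball_hom_enc_cat:
  assumes "inj p"
  shows "(\<forall>a b. \<forall>u\<in>Hom (enc_cat p q J) a b. P a b u)
    \<longleftrightarrow> (\<forall>i j. \<forall>v\<in>Hom J i j. P (p i) (p j) (q v))"
  unfolding Ball_def hom_enc_cat[OF assms] by blast

lemma category_enc_cat:
  assumes "category J" "inj p" "inj q"
  shows "category (enc_cat p q J)"
proof -
  interpret J: category J by fact
  have ob: "Ob (enc_cat p q J) = p ` Ob J" and idt: "\<And>i. Idt (enc_cat p q J) (p i) = q (Idt J i)"
    and cmp: "\<And>u v. q v \<cdot>\<^bsub>enc_cat p q J\<^esub> q u = q (v \<cdot>\<^bsub>J\<^esub> u)"
    using assms(2,3) by (simp_all add: enc_cat_def)
  note [simp] = hom_enc_cat[OF assms(2)] inj_eq[OF assms(2)] inj_eq[OF assms(3)]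
  show ?thesis
  proof
    show "f \<in> Hom (enc_cat p q J) X Y \<Longrightarrow> X \<in> Ob (enc_cat p q J) \<and> Y \<in> Ob (enc_cat p q J)" for f X Y
      using J.hom_ob by (auto simp: ob)
    show "X \<in> Ob (enc_cat p q J) \<Longrightarrow> Idt (enc_cat p q J) X \<in> Hom (enc_cat p q J) X X" for X
      using J.idt_hom by (auto simp: ob idt)
    show "\<lbrakk>f \<in> Hom (enc_cat p q J) X Y; g \<in> Hom (enc_cat p q J) Y Z\<rbrakk>
        \<Longrightarrow> g \<cdot>\<^bsub>enc_cat p q J\<^esub> f \<in> Hom (enc_cat p q J) X Z" for f g X Y Z
      using J.cmp_hom by (auto simp: cmp)
    show "f \<in> Hom (enc_cat p q J) X Y \<Longrightarrow> Idt (enc_cat p q J) Y \<cdot>\<^bsub>enc_cat p q J\<^esub> f = f" for f X Y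
      using J.idt_left by (auto simp: cmp idt)
    show "f \<in> Hom (enc_cat p q J) X Y \<Longrightarrow> f \<cdot>\<^bsub>enc_cat p q J\<^esub> Idt (enc_cat p q J) X = f" for f X Y
      using J.idt_right by (auto simp: cmp idt)
    show "\<lbrakk>f \<in> Hom (enc_cat p q J) W X; g \<in> Hom (enc_cat p q J) X Y; h \<in> Hom (enc_cat p q J) Y Z\<rbrakk>
      \<Longrightarrow> (h \<cdot>\<^bsub>enc_cat p q J\<^esub> g) \<cdot>\<^bsub>enc_cat p q J\<^esub> f
        = h \<cdot>\<^bsub>enc_cat p q J\<^esub> (g \<cdot>\<^bsub>enc_cat p q J\<^esub> f)" for f g h W X Y Z
      using J.cmp_assoc by (auto simp: cmp)
  qed
qed

lemma is_ftor_enc: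
  assumes "is_ftor J M G" and p: "inj p" and q: "inj q"
  shows "is_ftor (enc_cat p q J) M (enc_ftor p q G)"
  unfolding is_ftor_def
proof (intro conjI allI ballI)
  have G: "\<And>i. i \<in> Ob J \<Longrightarrow> FOb G i \<in> Ob M"
    "\<And>i j u. u \<in> Hom J i j \<Longrightarrow> FAr G i j u \<in> Hom M (FOb G i) (FOb G j)"
    "\<And>i. i \<in> Ob J \<Longrightarrow> FAr G i i (Idt J i) = Idt M (FOb G i)"
    "\<And>i j k u v. \<lbrakk>u \<in> Hom J i j; v \<in> Hom J j k\<rbrakk>
      \<Longrightarrow> FAr G i k (v \<cdot>\<^bsub>J\<^esub> u) = FAr G j k v \<cdot>\<^bsub>M\<^esub> FAr G i j u"
    using assms(1) unfolding is_ftor_def by blast+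
  have ob: "Ob (enc_cat p q J) = p ` Ob J" and idt: "\<And>i. Idt (enc_cat p q J) (p i) = q (Idt J i)"
    and cmp: "\<And>u v. q v \<cdot>\<^bsub>enc_cat p q J\<^esub> q u = q (v \<cdot>\<^bsub>J\<^esub> u)"
    and F: "\<And>i. FOb (enc_ftor p q G) (p i) = FOb G i"
      "\<And>i j u. FAr (enc_ftor p q G) (p i) (p j) (q u) = FAr G i j u"
    using p q by (simp_all add: enc_cat_def enc_ftor_def)
  show "i \<in> Ob (enc_cat p q J) \<Longrightarrow> FOb (enc_ftor p q G) i \<in> Ob M" for i
    using G(1) by (auto simp: ob F)
  show "u \<in> Hom (enc_cat p q J) i j
      \<Longrightarrow> FAr (enc_ftor p q G) i j u \<in> Hom M (FOb (enc_ftor p q G) i) (FOb (enc_ftor p q G) j)" for i j u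
    using G(2) by (auto simp: hom_enc_cat[OF p] F)
  show "i \<in> Ob (enc_cat p q J)
      \<Longrightarrow> FAr (enc_ftor p q G) i i (Idt (enc_cat p q J) i) = Idt M (FOb (enc_ftor p q G) i)" for i
    using G(3) by (auto simp: ob F idt)
  show "FAr (enc_ftor p q G) i k (v \<cdot>\<^bsub>enc_cat p q J\<^esub> u)
      = FAr (enc_ftor p q G) j k v \<cdot>\<^bsub>M\<^esub> FAr (enc_ftor p q G) i j u"
    if "u \<in> Hom (enc_cat p q J) i j" "v \<in> Hom (enc_cat p q J) j k" for i j k u v
  proof -
    from that obtain i' j' k' u' v' where *: "i = p i'" "j = p j'" "k = p k'" "u = q u'" "v = q v'"
      "u' \<in> Hom J i' j'" "v' \<in> Hom J j' k'"
      unfolding hom_enc_cat[OF p] using injD[OF p] by metis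
    show ?thesis
      unfolding *(1-5) cmp F by (rule G(4)[OF *(6,7)])
  qed
qed

lemma is_cocone_enc:
  assumes "inj p" "inj q"
  shows "is_cocone (enc_cat p q J) M (enc_ftor p q G) L e \<longleftrightarrow> is_cocone J M G L (\<lambda>i. e (p i))"
  using assms unfolding is_cocone_def ball_hom_enc_cat[OF assms(1)]
  by (simp add: enc_ftor_def) (simp add: enc_cat_def)

lemma is_cone_enc:
  assumes "inj p" "inj q"
  shows "is_cone (enc_cat p q J) M (enc_ftor p q G) L e \<longleftrightarrow> is_cone J M G L (\<lambda>i. e (p i))"
  using assms unfolding is_cone_def ball_hom_enc_cat[OF assms(1)]
  by (simp add: enc_ftor_def) (simp add: enc_cat_def)

text \<open>Along an injection every family extends to the larger type, so quantifying over
  restricted families is quantifying over all families. This transports universal properties along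
  an encoding.\<close>

lemma all_reindex:
  assumes "inj p"
  shows "(\<forall>x e. P x (\<lambda>i. e (p i))) \<longleftrightarrow> (\<forall>x e. P x e)"
proof (intro iffI allI)
  fix x e
  assume "\<forall>x e. P x (\<lambda>i. e (p i))"
  from this[rule_format, of x "\<lambda>a. e (inv_into UNIV p a)"] show "P x e"
    using assms by simp
qed blast

lemma is_colimit_enc:
  assumes "inj p" "inj q"
  shows "is_colimit (enc_cat p q J) M (enc_ftor p q G) L e \<longleftrightarrow> is_colimit J M G L (\<lambda>i. e (p i))"
proof -
  have ob: "Ob (enc_cat p q J) = p ` Ob J" by (simp add: enc_cat_def)
  have "(\<forall>L' e'. is_cocone J M G L' (\<lambda>i. e' (p i)) \<longrightarrow> Q L' (\<lambda>i. e' (p i)))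
      \<longleftrightarrow> (\<forall>L' e'. is_cocone J M G L' e' \<longrightarrow> Q L' e')" for Q
    by (rule all_reindex[OF assms(1), of "\<lambda>L' e'. is_cocone J M G L' e' \<longrightarrow> Q L' e'"])
  from this[of "\<lambda>L' e'. \<exists>!h. h \<in> Hom M L L' \<and> (\<forall>i\<in>Ob J. h \<cdot>\<^bsub>M\<^esub> e (p i) = e' i)"] show ?thesis
    using assms unfolding is_colimit_def by (simp add: is_cocone_enc ob)
qed

lemma is_limit_enc:
  assumes "inj p" "inj q"
  shows "is_limit (enc_cat p q J) M (enc_ftor p q G) L e \<longleftrightarrow> is_limit J M G L (\<lambda>i. e (p i))"
proof -
  have ob: "Ob (enc_cat p q J) = p ` Ob J" by (simp add: enc_cat_def)
  have "(\<forall>L' e'. is_cone J M G L' (\<lambda>i. e' (p i)) \<longrightarrow> Q L' (\<lambda>i. e' (p i)))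
      \<longleftrightarrow> (\<forall>L' e'. is_cone J M G L' e' \<longrightarrow> Q L' e')" for Q
    by (rule all_reindex[OF assms(1), of "\<lambda>L' e'. is_cone J M G L' e' \<longrightarrow> Q L' e'"])
  from this[of "\<lambda>L' e'. \<exists>!h. h \<in> Hom M L' L \<and> (\<forall>i\<in>Ob J. e (p i) \<cdot>\<^bsub>M\<^esub> h = e' i)"] show ?thesis
    using assms unfolding is_limit_def by (simp add: is_cone_enc ob)
qed

text \<open>Smallness is a strict cardinality bound, so countable categories are small because the
  universe type is uncountable.\<close>

lemma countable_ordLess_uncountable:
  assumes "countable A" "uncountable B"
  shows "(card_of A, card_of B) \<in> ordLess"
proof -
  have "(card_of B, card_of A) \<notin> ordLeq"
  proof
    assume "(card_of B, card_of A) \<in> ordLeq"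
    then obtain f where "inj_on f B" "f ` B \<subseteq> A"
      unfolding card_of_ordLeq[symmetric] by blast
    then show False
      using assms by (meson countable_image_inj_on countable_subset)
  qed
  then show ?thesis
    by (rule iffD1[OF not_ordLeq_iff_ordLess[OF card_of_Well_order card_of_Well_order]])
qed

lemma small_cat_enc:
  assumes "category J" "inj (p :: 'i::countable \<Rightarrow> 'u)" "inj (q :: 'n::countable \<Rightarrow> 'u)"
    and "uncountable (UNIV :: 'u set)"
  shows "small_cat (enc_cat p q J)"
proof -
  have "(\<Union>i\<in>Ob (enc_cat p q J). \<Union>j\<in>Ob (enc_cat p q J). Hom (enc_cat p q J) i j) \<subseteq> range q"
    using assms(2) by (auto simp: hom_enc_cat)
  then have "countable (\<Union>i\<in>Ob (enc_cat p q J). \<Union>j\<in>Ob (enc_cat p q J). Hom (enc_cat p q J) i j)"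
    by (rule countable_subset) simp
  moreover have "countable (Ob (enc_cat p q J))"
    by (simp add: enc_cat_def)
  ultimately show ?thesis
    using assms by (simp add: small_cat_def category_enc_cat countable_ordLess_uncountable)
qed

lemma ex_inj_countable:
  assumes "uncountable (UNIV :: 'u set)"
  shows "\<exists>p :: 'i::countable \<Rightarrow> 'u. inj p"
proof -
  have "infinite (UNIV :: 'u set)"
    using assms countable_finite by blast
  then obtain f :: "nat \<Rightarrow> 'u" where "inj f"
    using infinite_countable_subset by blast
  then have "inj (f \<circ> (to_nat :: 'i \<Rightarrow> nat))"
    by (intro inj_compose) auto
  then show ?thesis by blast
qed

section \<open>Diagrams, cocones and colimits of typed arrows\<close>

context category
begin

definition tdiag ::
  "('i, 'n, 'y) cat_scheme \<Rightarrow> ('i \<Rightarrow> 'o) \<Rightarrow> ('i \<Rightarrow> 'i \<Rightarrow> 'n \<Rightarrow> ('o, 'm) arrow) \<Rightarrow> bool" where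
  "tdiag J X D \<longleftrightarrow> (\<forall>i\<in>Ob J. X i \<in> Ob C) \<and> (\<forall>i j. \<forall>u\<in>Hom J i j. ar (D i j u) (X i) (X j)) \<and>
     (\<forall>i\<in>Ob J. D i i (Idt J i) = idn (X i)) \<and>
     (\<forall>i j k. \<forall>u\<in>Hom J i j. \<forall>v\<in>Hom J j k. D i k (v \<cdot>\<^bsub>J\<^esub> u) = D j k v \<bullet> D i j u)"

definition tcocone :: "('i, 'n, 'y) cat_scheme \<Rightarrow> ('i \<Rightarrow> 'o) \<Rightarrow>
    ('i \<Rightarrow> 'i \<Rightarrow> 'n \<Rightarrow> ('o, 'm) arrow) \<Rightarrow> 'o \<Rightarrow> ('i \<Rightarrow> ('o, 'm) arrow) \<Rightarrow> bool" where
  "tcocone J X D L e \<longleftrightarrow> L \<in> Ob C \<and> (\<forall>i\<in>Ob J. ar (e i) (X i) L) \<and>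
     (\<forall>i j. \<forall>u\<in>Hom J i j. e j \<bullet> D i j u = e i)"

definition tcolim :: "('i, 'n, 'y) cat_scheme \<Rightarrow> ('i \<Rightarrow> 'o) \<Rightarrow>
    ('i \<Rightarrow> 'i \<Rightarrow> 'n \<Rightarrow> ('o, 'm) arrow) \<Rightarrow> 'o \<Rightarrow> ('i \<Rightarrow> ('o, 'm) arrow) \<Rightarrow> bool" where
  "tcolim J X D L e \<longleftrightarrow> tcocone J X D L e \<and>
     (\<forall>Z d. tcocone J X D Z d \<longrightarrow> (\<exists>!h. ar h L Z \<and> (\<forall>i\<in>Ob J. h \<bullet> e i = d i)))"

text \<open>The passage from typed diagrams back to the functors in which the standing assumptions
  are phrased.\<close>

definition rftor :: "('i \<Rightarrow> 'o) \<Rightarrow> ('i \<Rightarrow> 'i \<Rightarrow> 'n \<Rightarrow> ('o, 'm) arrow) \<Rightarrow> ('i, 'n, 'o, 'm) ftor" where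
  "rftor X D = \<lparr>FOb = X, FAr = (\<lambda>i j u. raw (D i j u))\<rparr>"

lemma tdiagD:
  assumes "tdiag J X D"
  shows "i \<in> Ob J \<Longrightarrow> X i \<in> Ob C" "u \<in> Hom J i j \<Longrightarrow> ok (D i j u)"
    "u \<in> Hom J i j \<Longrightarrow> src (D i j u) = X i" "u \<in> Hom J i j \<Longrightarrow> tgt (D i j u) = X j"
    "i \<in> Ob J \<Longrightarrow> D i i (Idt J i) = idn (X i)"
    "\<lbrakk>u \<in> Hom J i j; v \<in> Hom J j k\<rbrakk> \<Longrightarrow> D i k (v \<cdot>\<^bsub>J\<^esub> u) = D j k v \<bullet> D i j u"
  using assms by (auto simp: tdiag_def)

lemma tcoconeD:
  assumes "tcocone J X D L e"
  shows "L \<in> Ob C" "i \<in> Ob J \<Longrightarrow> ok (e i)" "i \<in> Ob J \<Longrightarrow> src (e i) = X i" "i \<in> Ob J \<Longrightarrow> tgt (e i) = L"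
    "u \<in> Hom J i j \<Longrightarrow> e j \<bullet> D i j u = e i"
  using assms by (auto simp: tcocone_def)

lemma tcolimD:
  assumes "tcolim J X D L e"
  shows "L \<in> Ob C" "i \<in> Ob J \<Longrightarrow> ok (e i)" "i \<in> Ob J \<Longrightarrow> src (e i) = X i" "i \<in> Ob J \<Longrightarrow> tgt (e i) = L"
    "u \<in> Hom J i j \<Longrightarrow> e j \<bullet> D i j u = e i"
  using assms by (auto simp: tcolim_def tcocone_def)

lemma tcolim_factor:
  assumes "tcolim J X D L e" "tcocone J X D Z d"
  obtains h where "ok h" "src h = L" "tgt h = Z" "\<And>i. i \<in> Ob J \<Longrightarrow> h \<bullet> e i = d i"
  using assms unfolding tcolim_def by metis

lemma tcolim_cocone: "tcolim J X D L e \<Longrightarrow> tcocone J X D L e"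
  by (simp add: tcolim_def)

text \<open>The coprojections are jointly epic: composed with them, \<open>h\<close> yields a cocone
  that has exactly one factorisation. Most identities between maps out of a colimit are checked
  stage by stage in this form.\<close>

lemma tcolim_eqI:
  assumes "tcolim J X D L e" "category J" "ok h" "src h = L" "ok h'" "src h' = L" "tgt h = tgt h'"
    "\<And>i. i \<in> Ob J \<Longrightarrow> h \<bullet> e i = h' \<bullet> e i"
  shows "h = h'"
proof -
  interpret J: category J by fact
  have "tcocone J X D (tgt h) (\<lambda>i. h \<bullet> e i)"
    using assms unfolding tcocone_def
    by (auto simp: tcolimD[OF assms(1)] acomp_assoc)
  then have "\<exists>!k. ar k L (tgt h) \<and> (\<forall>i\<in>Ob J. k \<bullet> e i = h \<bullet> e i)"
    using assms(1) by (simp add: tcolim_def)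
  moreover have "ar h L (tgt h) \<and> (\<forall>i\<in>Ob J. h \<bullet> e i = h \<bullet> e i)"
    "ar h' L (tgt h) \<and> (\<forall>i\<in>Ob J. h' \<bullet> e i = h \<bullet> e i)"
    using assms by auto
  ultimately show ?thesis by blast
qed

lemma tcolimI:
  assumes "tcocone J X D L e"
    and "\<And>Z d. tcocone J X D Z d \<Longrightarrow> \<exists>h. ar h L Z \<and> (\<forall>i\<in>Ob J. h \<bullet> e i = d i)"
    and "\<And>h h'. \<lbrakk>ok h; ok h'; src h = L; src h' = L; tgt h = tgt h'; \<And>i. i \<in> Ob J \<Longrightarrow> h \<bullet> e i = h' \<bullet> e i\<rbrakk>
           \<Longrightarrow> h = h'"
  shows "tcolim J X D L e"
  unfolding tcolim_def
proof (intro conjI allI impI)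
  fix Z d assume "tcocone J X D Z d"
  from assms(2)[OF this] obtain h where h: "ar h L Z" "\<forall>i\<in>Ob J. h \<bullet> e i = d i" by blast
  show "\<exists>!h. ar h L Z \<and> (\<forall>i\<in>Ob J. h \<bullet> e i = d i)"
  proof (rule ex1I[of _ h])
    show "ar h L Z \<and> (\<forall>i\<in>Ob J. h \<bullet> e i = d i)" using h by simp
  next
    fix k assume "ar k L Z \<and> (\<forall>i\<in>Ob J. k \<bullet> e i = d i)"
    with h show "k = h" by - (rule assms(3), simp_all)
  qed
qed fact

lemma tcolim_cong:
  assumes "tcolim J X D L e" "category J"
    "\<And>i. i \<in> Ob J \<Longrightarrow> X i = X' i" "\<And>i j u. u \<in> Hom J i j \<Longrightarrow> D i j u = D' i j u"
    "\<And>i. i \<in> Ob J \<Longrightarrow> e i = e' i"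
  shows "tcolim J X' D' L e'"
proof -
  interpret J: category J by fact
  have *: "tcocone J X D Z d \<longleftrightarrow> tcocone J X' D' Z d" for Z d
    unfolding tcocone_def using assms(3,4) by simp
  have e: "tcocone J X D L e'"
    using tcolimD[OF assms(1)] assms(5) J.hom_ob unfolding tcocone_def by (metis (no_types, lifting))
  show ?thesis
    unfolding tcolim_def
  proof (intro conjI allI impI)
    show "tcocone J X' D' L e'" using e * by blast
    fix Z d assume "tcocone J X' D' Z d"
    then have "\<exists>!h. ar h L Z \<and> (\<forall>i\<in>Ob J. h \<bullet> e i = d i)"
      using * assms(1) unfolding tcolim_def by blast
    moreover have "(\<forall>i\<in>Ob J. h \<bullet> e i = d i) \<longleftrightarrow> (\<forall>i\<in>Ob J. h \<bullet> e' i = d i)" for h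
      using assms(5) by simp
    ultimately show "\<exists>!h. ar h L Z \<and> (\<forall>i\<in>Ob J. h \<bullet> e' i = d i)" by simp
  qed
qed

lemma tcolim_iso:
  assumes J: "category J" and L: "tcolim J X D L e" and h: "ok h" "src h = L" "tgt h = M"
    and k: "ok k" "src k = M" "tgt k = L" and kh: "k \<bullet> h = idn L" "h \<bullet> k = idn M"
  shows "tcolim J X D M (\<lambda>i. h \<bullet> e i)"
proof -
  note [simp] = tcolimD[OF L] h k kh acomp_assoc
  have [simp]: "M \<in> Ob C" using ok_ob(2)[OF h(1)] by simp
  interpret J: category J by fact
  show ?thesis
  proof (rule tcolimI)
    show "tcocone J X D M (\<lambda>i. h \<bullet> e i)"
      unfolding tcocone_def by simp
  next
    fix Z d assume d: "tcocone J X D Z d"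
    obtain f where [simp]: "ok f" "src f = L" "tgt f = Z" and f: "\<And>i. i \<in> Ob J \<Longrightarrow> f \<bullet> e i = d i"
      by (rule tcolim_factor[OF L d]) auto
    have "(f \<bullet> k) \<bullet> h \<bullet> e i = d i" if "i \<in> Ob J" for i
      using acomp_reassoc[OF kh(1), of "e i"] f that by (simp add: acomp_assoc)
    then show "\<exists>f. ar f M Z \<and> (\<forall>i\<in>Ob J. f \<bullet> h \<bullet> e i = d i)"
      by (intro exI[of _ "f \<bullet> k"]) simp
  next
    fix f g assume fg [simp]: "ok f" "ok g" "src f = M" "src g = M" "tgt f = tgt g"
      and *: "\<And>i. i \<in> Ob J \<Longrightarrow> f \<bullet> h \<bullet> e i = g \<bullet> h \<bullet> e i"
    have "f \<bullet> h = g \<bullet> h"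
      by (rule tcolim_eqI[OF L J]) (simp_all add: *)
    then have "(f \<bullet> h) \<bullet> k = (g \<bullet> h) \<bullet> k" by simp
    then show "f = g" by simp
  qed
qed

lemma is_cocone_iff_tcocone:
  assumes "category J" "tdiag J X D"
  shows "is_cocone J C (rftor X D) L e \<longleftrightarrow> tcocone J X D L (\<lambda>i. Arr (X i) (e i) L)"
proof -
  interpret J: category J by fact
  have "Arr (X j) (e j) L \<bullet> D i j u = Arr (X i) (e i) L \<longleftrightarrow> e j \<cdot> raw (D i j u) = e i"
    if "u \<in> Hom J i j" "e j \<in> Hom C (X j) L" for i j u
    using that tdiagD[OF assms(2)] by (simp add: acomp_def)
  then show ?thesis
    unfolding is_cocone_def tcocone_def rftor_def using J.hom_ob by auto
qed

lemma is_colimit_iff_tcolim: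
  assumes "category J" "tdiag J X D"
  shows "is_colimit J C (rftor X D) L e \<longleftrightarrow> tcolim J X D L (\<lambda>i. Arr (X i) (e i) L)"
proof -
  interpret J: category J by fact
  note co = is_cocone_iff_tcocone[OF assms]
  show ?thesis
  proof
    assume *: "is_colimit J C (rftor X D) L e"
    then have e: "\<And>i. i \<in> Ob J \<Longrightarrow> e i \<in> Hom C (X i) L"
      by (auto simp: is_colimit_def is_cocone_def rftor_def)
    show "tcolim J X D L (\<lambda>i. Arr (X i) (e i) L)"
      unfolding tcolim_def
    proof (intro conjI allI impI)
      show "tcocone J X D L (\<lambda>i. Arr (X i) (e i) L)"
        using * co by (simp add: is_colimit_def)
      fix Z d assume d: "tcocone J X D Z d"
      have d': "Arr (X i) (raw (d i)) Z = d i" if "i \<in> Ob J" for i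
        using tcoconeD[OF d] that by (intro ar_Arr_raw) auto
      have "tcocone J X D Z (\<lambda>i. Arr (X i) (raw (d i)) Z)"
        using d d' J.hom_ob unfolding tcocone_def by (metis (no_types, lifting))
      then have "\<exists>!h. h \<in> Hom C L Z \<and> (\<forall>i\<in>Ob J. h \<cdot> e i = raw (d i))"
        using * co by (simp add: is_colimit_def)
      then obtain h where h: "h \<in> Hom C L Z" "\<forall>i\<in>Ob J. h \<cdot> e i = raw (d i)"
        and u: "\<And>k. k \<in> Hom C L Z \<and> (\<forall>i\<in>Ob J. k \<cdot> e i = raw (d i)) \<Longrightarrow> k = h"
        by blast
      show "\<exists>!h. ar h L Z \<and> (\<forall>i\<in>Ob J. h \<bullet> Arr (X i) (e i) L = d i)"
      proof (rule ex1I[of _ "Arr L h Z"])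
        show "ar (Arr L h Z) L Z \<and> (\<forall>i\<in>Ob J. Arr L h Z \<bullet> Arr (X i) (e i) L = d i)"
          using h e d' by (auto simp: Arr_acomp)
      next
        fix k assume k: "ar k L Z \<and> (\<forall>i\<in>Ob J. k \<bullet> Arr (X i) (e i) L = d i)"
        then have "raw k \<in> Hom C L Z \<and> (\<forall>i\<in>Ob J. raw k \<cdot> e i = raw (d i))"
          using e by (metis ok_acomp(4) ar_raw arrow.sel ok_Arr)
        then have "raw k = h" by (rule u)
        then show "k = Arr L h Z" using k ar_Arr_raw by metis
      qed
    qed
  next
    assume *: "tcolim J X D L (\<lambda>i. Arr (X i) (e i) L)"
    then have e: "\<And>i. i \<in> Ob J \<Longrightarrow> e i \<in> Hom C (X i) L"
      by (auto simp: tcolim_def tcocone_def)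
    show "is_colimit J C (rftor X D) L e"
      unfolding is_colimit_def
    proof (intro conjI allI impI)
      show "is_cocone J C (rftor X D) L e"
        using * co by (simp add: tcolim_def)
      fix Z d assume d: "is_cocone J C (rftor X D) Z d"
      then have "tcocone J X D Z (\<lambda>i. Arr (X i) (d i) Z)" by (simp add: co)
      then obtain h where h: "ar h L Z" "\<And>i. i \<in> Ob J \<Longrightarrow> h \<bullet> Arr (X i) (e i) L = Arr (X i) (d i) Z"
        and u: "\<And>k. ar k L Z \<and> (\<forall>i\<in>Ob J. k \<bullet> Arr (X i) (e i) L = Arr (X i) (d i) Z) \<Longrightarrow> k = h"
        using * unfolding tcolim_def by (metis (no_types, lifting))
      show "\<exists>!h. h \<in> Hom C L Z \<and> (\<forall>i\<in>Ob J. h \<cdot> e i = d i)"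
      proof (rule ex1I[of _ "raw h"])
        show "raw h \<in> Hom C L Z \<and> (\<forall>i\<in>Ob J. raw h \<cdot> e i = d i)"
          using h e by (metis ok_acomp(4) ar_raw arrow.sel ok_Arr)
      next
        fix k assume "k \<in> Hom C L Z \<and> (\<forall>i\<in>Ob J. k \<cdot> e i = d i)"
        then have "Arr L k Z = h" using e by (intro u) (simp add: Arr_acomp)
        then show "k = raw h" by auto
      qed
    qed
  qed
qed

lemma tcolim_iff_is_colimit:
  assumes "category J" "tdiag J X D" "\<And>i. i \<in> Ob J \<Longrightarrow> ar (e i) (X i) L"
  shows "tcolim J X D L e \<longleftrightarrow> is_colimit J C (rftor X D) L (\<lambda>i. raw (e i))"
proof -
  have "e i = Arr (X i) (raw (e i)) L" if "i \<in> Ob J" for i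
    using ar_Arr_raw[OF assms(3)[OF that]] by simp
  then show ?thesis
    unfolding is_colimit_iff_tcolim[OF assms(1,2)] using assms(1)
    by (auto elim!: tcolim_cong)
qed

lemma is_colimit_cong:
  assumes "is_colimit J C F L e" "category J" "\<And>i. i \<in> Ob J \<Longrightarrow> FOb F i = FOb G i"
    "\<And>i j u. u \<in> Hom J i j \<Longrightarrow> FAr F i j u = FAr G i j u"
    "\<And>i. i \<in> Ob J \<Longrightarrow> e i = d i"
  shows "is_colimit J C G L d"
proof -
  interpret J: category J by fact
  have *: "is_cocone J C F Z c \<longleftrightarrow> is_cocone J C G Z c" for Z c
    unfolding is_cocone_def using assms(3,4) by simp
  have d: "is_cocone J C F L d"
    using assms(1,5) J.hom_ob unfolding is_colimit_def is_cocone_def by (metis (no_types, lifting))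
  show ?thesis
    unfolding is_colimit_def
  proof (intro conjI allI impI)
    show "is_cocone J C G L d" using d * by blast
    fix Z c assume "is_cocone J C G Z c"
    then have "\<exists>!h. h \<in> Hom C L Z \<and> (\<forall>i\<in>Ob J. h \<cdot> e i = c i)"
      using * assms(1) unfolding is_colimit_def by blast
    moreover have "(\<forall>i\<in>Ob J. h \<cdot> e i = c i) \<longleftrightarrow> (\<forall>i\<in>Ob J. h \<cdot> d i = c i)" for h
      using assms(5) by simp
    ultimately show "\<exists>!h. h \<in> Hom C L Z \<and> (\<forall>i\<in>Ob J. h \<cdot> d i = c i)" by simp
  qed
qed

lemma is_ftor_rftor:
  assumes "category J" "tdiag J X D" shows "is_ftor J C (rftor X D)"
proof -
  interpret J: category J by fact
  have "raw (D j k v \<bullet> D i j u) = raw (D j k v) \<cdot> raw (D i j u)"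
    if "u \<in> Hom J i j" "v \<in> Hom J j k" for i j k u v
    using that tdiagD[OF assms(2)] by simp
  moreover have "raw (D i j u) \<in> Hom C (X i) (X j)" if "u \<in> Hom J i j" for i j u
    using that tdiagD[OF assms(2)] by (metis ar_raw)
  ultimately show ?thesis
    using assms(2) unfolding is_ftor_def rftor_def
    by (simp add: tdiagD J.idt_hom) (simp add: idn_def)
qed

end

section \<open>Tensor products of colimits\<close>

context symmetric_monoidal_category
begin

text \<open>The property that \<open>tensor_preserves_colims\<close> grants to small categories,
  detached from their type, so that countable categories on other index types can share it.\<close>

definition tens_adm :: "('i, 'n, 'y) cat_scheme \<Rightarrow> bool" where
  "tens_adm J \<longleftrightarrow> category J \<and> (\<forall>X D L e Z. Z \<in> Ob C \<and> tdiag J X D \<and> tcolim J X D L e \<longrightarrow>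
     tcolim J (\<lambda>i. X i \<otimes>\<^sub>o Z) (\<lambda>i j u. D i j u \<star> idn Z) (L \<otimes>\<^sub>o Z) (\<lambda>i. e i \<star> idn Z))"

lemma tens_adm_category: "tens_adm J \<Longrightarrow> category J"
  unfolding tens_adm_def by (elim conjE)

lemma tens_admD:
  "\<lbrakk>tens_adm J; Z \<in> Ob C; tdiag J X D; tcolim J X D L e\<rbrakk>
   \<Longrightarrow> tcolim J (\<lambda>i. X i \<otimes>\<^sub>o Z) (\<lambda>i j u. D i j u \<star> idn Z) (L \<otimes>\<^sub>o Z) (\<lambda>i. e i \<star> idn Z)"
  unfolding tens_adm_def by blast

lemma tdiag_tens:
  assumes "tdiag J X D" "tdiag J Y E" "category J"
  shows "tdiag J (\<lambda>i. X i \<otimes>\<^sub>o Y i) (\<lambda>i j u. D i j u \<star> E i j u)"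
proof -
  interpret J: category J by fact
  show ?thesis
    using tdiagD[OF assms(1)] tdiagD[OF assms(2)] unfolding tdiag_def by simp
qed

lemma tdiag_const: "Z \<in> Ob C \<Longrightarrow> tdiag J (\<lambda>_. Z) (\<lambda>_ _ _. idn Z)"
  by (simp add: tdiag_def)

text \<open>The braiding is a natural isomorphism from Z \<otimes> X to X \<otimes> Z and carries
  the statement over from the other side.\<close>

lemma tens_adm_left:
  assumes J: "tens_adm J" and Z [simp]: "Z \<in> Ob C" and D: "tdiag J X D" and L: "tcolim J X D L e"
  shows "tcolim J (\<lambda>i. Z \<otimes>\<^sub>o X i) (\<lambda>i j u. idn Z \<star> D i j u) (Z \<otimes>\<^sub>o L) (\<lambda>i. idn Z \<star> e i)"
proof -
  interpret J: category J using J by (rule tens_adm_category)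
  note c = tens_admD[OF J Z D L]
  note [simp] = tdiagD(1-5)[OF D] tcolimD[OF L]
  have e_br: "(idn Z \<star> e i) \<bullet> br (X i) Z = br L Z \<bullet> (e i \<star> idn Z)" if "i \<in> Ob J" for i
    using that by (intro br_nat[symmetric]) auto
  show ?thesis
  proof (rule tcolimI)
    show "tcocone J (\<lambda>i. Z \<otimes>\<^sub>o X i) (\<lambda>i j u. idn Z \<star> D i j u) (Z \<otimes>\<^sub>o L) (\<lambda>i. idn Z \<star> e i)"
      unfolding tcocone_def using J.hom_ob by auto
  next
    fix W d assume d: "tcocone J (\<lambda>i. Z \<otimes>\<^sub>o X i) (\<lambda>i j u. idn Z \<star> D i j u) W d"
    note [simp] = tcoconeD[OF d]
    have "d j \<bullet> br (X j) Z \<bullet> (D i j u \<star> idn Z) = d i \<bullet> br (X i) Z" if u: "u \<in> Hom J i j" for i j u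
    proof -
      have "br (X j) Z \<bullet> (D i j u \<star> idn Z) = (idn Z \<star> D i j u) \<bullet> br (X i) Z"
        using u by (intro br_nat) (auto dest: J.hom_ob)
      then show ?thesis
        using acomp_reassoc[OF tcoconeD(5)[OF d u], of "br (X i) Z"] by simp
    qed
    then have "tcocone J (\<lambda>i. X i \<otimes>\<^sub>o Z) (\<lambda>i j u. D i j u \<star> idn Z) W (\<lambda>i. d i \<bullet> br (X i) Z)"
      unfolding tcocone_def by simp
    from tcolim_factor[OF c this] obtain h where h: "ok h" "src h = L \<otimes>\<^sub>o Z" "tgt h = W"
      and hd: "\<And>i. i \<in> Ob J \<Longrightarrow> h \<bullet> (e i \<star> idn Z) = d i \<bullet> br (X i) Z" by blast
    have "(h \<bullet> br Z L) \<bullet> (idn Z \<star> e i) = d i" if "i \<in> Ob J" for i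
    proof -
      have "br Z L \<bullet> (idn Z \<star> e i) = (e i \<star> idn Z) \<bullet> br Z (X i)"
        using that by (intro br_nat) auto
      then show ?thesis
        using that acomp_reassoc[OF hd[OF that], of "br Z (X i)"] by simp
    qed
    then show "\<exists>h. ar h (Z \<otimes>\<^sub>o L) W \<and> (\<forall>i\<in>Ob J. h \<bullet> (idn Z \<star> e i) = d i)"
      using h by (intro exI[of _ "h \<bullet> br Z L"]) auto
  next
    fix h h'
    assume [simp]: "ok h" "ok h'" "src h = Z \<otimes>\<^sub>o L" "src h' = Z \<otimes>\<^sub>o L" "tgt h = tgt h'"
      and *: "\<And>i. i \<in> Ob J \<Longrightarrow> h \<bullet> (idn Z \<star> e i) = h' \<bullet> (idn Z \<star> e i)"
    have "h \<bullet> br L Z = h' \<bullet> br L Z"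
    proof (rule tcolim_eqI[OF c])
      fix i assume i: "i \<in> Ob J"
      show "(h \<bullet> br L Z) \<bullet> (e i \<star> idn Z) = (h' \<bullet> br L Z) \<bullet> (e i \<star> idn Z)"
        using acomp_reassoc[OF *[OF i], of "br (X i) Z"] by (simp add: e_br[OF i])
    qed (auto intro: J.category_axioms)
    then show "h = h'"
      by (rule aiso_cancel_right[rotated -1]) auto
  qed
qed

text \<open>The diagonal of a filtered category is final.\<close>

lemma tcolim_tens:
  assumes J: "tens_adm J" and F: "filtered_cat J"
    and D: "tdiag J X D" and L: "tcolim J X D L e"
    and E: "tdiag J Y E" and M: "tcolim J Y E M f"
  shows "tcolim J (\<lambda>i. X i \<otimes>\<^sub>o Y i) (\<lambda>i j u. D i j u \<star> E i j u) (L \<otimes>\<^sub>o M) (\<lambda>i. e i \<star> f i)"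
proof -
  interpret J: category J using J by (rule tens_adm_category)
  note [simp] = tdiagD(1-5)[OF D] tcolimD[OF L] tdiagD(1-5)[OF E] tcolimD[OF M]
  note DE = tdiagD(6)[OF D] tdiagD(6)[OF E]
  have fil: "\<exists>k u v. u \<in> Hom J i k \<and> v \<in> Hom J j k" if "i \<in> Ob J" "j \<in> Ob J" for i j
    using F that unfolding filtered_cat_def by blast
  have fil2: "\<exists>k w. w \<in> Hom J j k \<and> w \<cdot>\<^bsub>J\<^esub> u = w \<cdot>\<^bsub>J\<^esub> v" if "u \<in> Hom J i j" "v \<in> Hom J i j" for i j u v
    using F that unfolding filtered_cat_def by blast
  \<comment> \<open>One variable is treated at a time. A mixed stage (i, j) factors through the
    diagonal stage of any k above both i and j, where \<open>h\<close> and \<open>h'\<close>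
    agree.\<close>
  have eqI: "h = h'"
    if [simp]: "ok h" "ok h'" "src h = L \<otimes>\<^sub>o M" "src h' = L \<otimes>\<^sub>o M" "tgt h = tgt h'"
      and *: "\<And>i. i \<in> Ob J \<Longrightarrow> h \<bullet> (e i \<star> f i) = h' \<bullet> (e i \<star> f i)" for h h'
  proof (rule tcolim_eqI[OF tens_adm_left[OF J _ E M]])
    fix j assume j [simp]: "j \<in> Ob J"
    show "h \<bullet> (idn L \<star> f j) = h' \<bullet> (idn L \<star> f j)"
    proof (rule tcolim_eqI[OF tens_admD[OF J _ D L]])
      fix i assume i [simp]: "i \<in> Ob J"
      obtain k u v where uv [simp]: "u \<in> Hom J i k" "v \<in> Hom J j k" using fil i j by blast
      then have k [simp]: "k \<in> Ob J" using J.hom_ob by blast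
      have "e i \<star> f j = (e k \<star> f k) \<bullet> (D i k u \<star> E j k v)"
        using tcolimD(5)[OF L uv(1)] tcolimD(5)[OF M uv(2)] by simp
      then show "(h \<bullet> (idn L \<star> f j)) \<bullet> (e i \<star> idn (Y j)) = (h' \<bullet> (idn L \<star> f j)) \<bullet> (e i \<star> idn (Y j))"
        using acomp_reassoc[OF *[OF k], of "D i k u \<star> E j k v"] by simp
    qed (auto intro: J.category_axioms)
  qed (auto intro: J.category_axioms)
  show ?thesis
  proof (rule tcolimI)
    show "tcocone J (\<lambda>i. X i \<otimes>\<^sub>o Y i) (\<lambda>i j u. D i j u \<star> E i j u) (L \<otimes>\<^sub>o M) (\<lambda>i. e i \<star> f i)"
      unfolding tcocone_def using J.hom_ob by auto
  next
    fix Z d assume d: "tcocone J (\<lambda>i. X i \<otimes>\<^sub>o Y i) (\<lambda>i j u. D i j u \<star> E i j u) Z d"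
    note [simp] = tcoconeD(1-4)[OF d]
    \<comment> \<open>The prospective value on the mixed stage (i, j): both factors are transported
      to a common k, followed by \<open>d k\<close>. The choice is harmless, since \<open>wd\<close>
      shows that all such k, u and v give the same arrow.\<close>
    define g where "g i j = (SOME x. \<exists>k u v. u \<in> Hom J i k \<and> v \<in> Hom J j k \<and> x = d k \<bullet> (D i k u \<star> E j k v))"
      for i j
    have step: "d l \<bullet> (D i l (w \<cdot>\<^bsub>J\<^esub> u) \<star> E j l (w \<cdot>\<^bsub>J\<^esub> v)) = d k \<bullet> (D i k u \<star> E j k v)"
      if [simp]: "u \<in> Hom J i k" "v \<in> Hom J j k" and w [simp]: "w \<in> Hom J k l" for i j k l u v w
    proof -
      have [simp]: "i \<in> Ob J" "j \<in> Ob J" "k \<in> Ob J" "l \<in> Ob J" using that J.hom_ob by blast+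
      show ?thesis
        using acomp_reassoc[OF tcoconeD(5)[OF d w], of "D i k u \<star> E j k v"]
        by (simp add: DE[OF that(1) w] DE[OF that(2) w])
    qed
    have wd: "d k \<bullet> (D i k u \<star> E j k v) = d k' \<bullet> (D i k' u' \<star> E j k' v')"
      if uv: "u \<in> Hom J i k" "v \<in> Hom J j k" and uv': "u' \<in> Hom J i k'" "v' \<in> Hom J j k'"
      for i j k k' u u' v v'
    proof -
      obtain l w w' where w: "w \<in> Hom J k l" "w' \<in> Hom J k' l"
        using fil uv uv' J.hom_ob by metis
      \<comment> \<open>Over the common bound l the two routes from i may still differ, and so may
        those from j; \<open>a\<close> equalises the former and then \<open>b\<close> the
        latter.\<close>
      obtain m a where a: "a \<in> Hom J l m" "a \<cdot>\<^bsub>J\<^esub> (w \<cdot>\<^bsub>J\<^esub> u) = a \<cdot>\<^bsub>J\<^esub> (w' \<cdot>\<^bsub>J\<^esub> u')"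
        using fil2[OF J.cmp_hom[OF uv(1) w(1)] J.cmp_hom[OF uv'(1) w(2)]] by blast
      obtain n b where b: "b \<in> Hom J m n"
        "b \<cdot>\<^bsub>J\<^esub> (a \<cdot>\<^bsub>J\<^esub> (w \<cdot>\<^bsub>J\<^esub> v)) = b \<cdot>\<^bsub>J\<^esub> (a \<cdot>\<^bsub>J\<^esub> (w' \<cdot>\<^bsub>J\<^esub> v'))"
        using fil2[OF J.cmp_hom[OF J.cmp_hom[OF uv(2) w(1)] a(1)] J.cmp_hom[OF J.cmp_hom[OF uv'(2) w(2)] a(1)]]
        by blast
      have "d k \<bullet> (D i k u \<star> E j k v) = d l \<bullet> (D i l (w \<cdot>\<^bsub>J\<^esub> u) \<star> E j l (w \<cdot>\<^bsub>J\<^esub> v))"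
        by (rule step[OF uv w(1), symmetric])
      also have "\<dots> = d m \<bullet> (D i m (a \<cdot>\<^bsub>J\<^esub> (w \<cdot>\<^bsub>J\<^esub> u)) \<star> E j m (a \<cdot>\<^bsub>J\<^esub> (w \<cdot>\<^bsub>J\<^esub> v)))"
        by (rule step[OF J.cmp_hom[OF uv(1) w(1)] J.cmp_hom[OF uv(2) w(1)] a(1), symmetric])
      also have "\<dots> = d n \<bullet> (D i n (b \<cdot>\<^bsub>J\<^esub> (a \<cdot>\<^bsub>J\<^esub> (w \<cdot>\<^bsub>J\<^esub> u))) \<star> E j n (b \<cdot>\<^bsub>J\<^esub> (a \<cdot>\<^bsub>J\<^esub> (w \<cdot>\<^bsub>J\<^esub> v))))"
        by (rule step[OF J.cmp_hom[OF J.cmp_hom[OF uv(1) w(1)] a(1)] J.cmp_hom[OF J.cmp_hom[OF uv(2) w(1)] a(1)] b(1), symmetric])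
      also have "\<dots> = d n \<bullet> (D i n (b \<cdot>\<^bsub>J\<^esub> (a \<cdot>\<^bsub>J\<^esub> (w' \<cdot>\<^bsub>J\<^esub> u'))) \<star> E j n (b \<cdot>\<^bsub>J\<^esub> (a \<cdot>\<^bsub>J\<^esub> (w' \<cdot>\<^bsub>J\<^esub> v'))))"
        by (simp add: a b)
      also have "\<dots> = d m \<bullet> (D i m (a \<cdot>\<^bsub>J\<^esub> (w' \<cdot>\<^bsub>J\<^esub> u')) \<star> E j m (a \<cdot>\<^bsub>J\<^esub> (w' \<cdot>\<^bsub>J\<^esub> v')))"
        by (rule step[OF J.cmp_hom[OF J.cmp_hom[OF uv'(1) w(2)] a(1)] J.cmp_hom[OF J.cmp_hom[OF uv'(2) w(2)] a(1)] b(1)])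
      also have "\<dots> = d l \<bullet> (D i l (w' \<cdot>\<^bsub>J\<^esub> u') \<star> E j l (w' \<cdot>\<^bsub>J\<^esub> v'))"
        by (rule step[OF J.cmp_hom[OF uv'(1) w(2)] J.cmp_hom[OF uv'(2) w(2)] a(1)])
      also have "\<dots> = d k' \<bullet> (D i k' u' \<star> E j k' v')"
        by (rule step[OF uv' w(2)])
      finally show ?thesis .
    qed
    have g: "g i j = d k \<bullet> (D i k u \<star> E j k v)" if "u \<in> Hom J i k" "v \<in> Hom J j k" for i j k u v
      unfolding g_def
    proof (rule someI2)
      show "\<exists>k' u' v'. u' \<in> Hom J i k' \<and> v' \<in> Hom J j k' \<and> d k \<bullet> (D i k u \<star> E j k v) = d k' \<bullet> (D i k' u' \<star> E j k' v')"
        using that by blast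
      show "x = d k \<bullet> (D i k u \<star> E j k v)"
        if "\<exists>k u v. u \<in> Hom J i k \<and> v \<in> Hom J j k \<and> x = d k \<bullet> (D i k u \<star> E j k v)" for x
        using wd \<open>u \<in> Hom J i k\<close> \<open>v \<in> Hom J j k\<close> that by blast
    qed
    have g_ok [simp]: "ok (g i j)" "src (g i j) = X i \<otimes>\<^sub>o Y j" "tgt (g i j) = Z"
      if ij: "i \<in> Ob J" "j \<in> Ob J" for i j
    proof -
      obtain k u v where uv: "u \<in> Hom J i k" "v \<in> Hom J j k" using fil[OF ij] by blast
      then have "k \<in> Ob J" using J.hom_ob by blast
      with uv ij show "ok (g i j)" "src (g i j) = X i \<otimes>\<^sub>o Y j" "tgt (g i j) = Z"
        by (simp_all add: g[OF uv])
    qed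
    have g_left: "g i' j \<bullet> (D i i' w \<star> idn (Y j)) = g i j" if w: "w \<in> Hom J i i'" and j: "j \<in> Ob J" for i i' j w
    proof -
      have [simp]: "i \<in> Ob J" "i' \<in> Ob J" "j \<in> Ob J" using j J.hom_ob[OF w] by auto
      obtain k u v where uv: "u \<in> Hom J i' k" "v \<in> Hom J j k" using fil[of i' j] by auto
      then have "k \<in> Ob J" using J.hom_ob by blast
      with uv w show ?thesis
        by (simp add: g[OF uv] g[OF J.cmp_hom[OF w uv(1)] uv(2)] DE[OF w uv(1)])
    qed
    have g_right: "g i j' \<bullet> (idn (X i) \<star> E j j' w) = g i j" if w: "w \<in> Hom J j j'" and i: "i \<in> Ob J" for i j j' w
    proof -
      have [simp]: "i \<in> Ob J" "j' \<in> Ob J" "j \<in> Ob J" using i J.hom_ob[OF w] by auto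
      obtain k u v where uv: "u \<in> Hom J i k" "v \<in> Hom J j' k" using fil[of i j'] by auto
      then have "k \<in> Ob J" using J.hom_ob by blast
      with uv w show ?thesis
        by (simp add: g[OF uv] g[OF uv(1) J.cmp_hom[OF w uv(2)]] DE[OF w uv(2)])
    qed
    \<comment> \<open>For fixed j the arrows \<open>g i j\<close> are glued over i; the resulting
      arrows \<open>h j\<close> are glued over j afterwards.\<close>
    have "\<exists>h. ar h (L \<otimes>\<^sub>o Y j) Z \<and> (\<forall>i\<in>Ob J. h \<bullet> (e i \<star> idn (Y j)) = g i j)" if j: "j \<in> Ob J" for j
    proof -
      have "tcocone J (\<lambda>i. X i \<otimes>\<^sub>o Y j) (\<lambda>i k u. D i k u \<star> idn (Y j)) Z (\<lambda>i. g i j)"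
        using j by (simp add: tcocone_def g_left)
      with tcolim_factor[OF tens_admD[OF J _ D L, of "Y j"]] j show ?thesis
        by (metis tdiagD(1)[OF E])
    qed
    then obtain h where h: "\<And>j. j \<in> Ob J \<Longrightarrow> ar (h j) (L \<otimes>\<^sub>o Y j) Z"
      and hg: "\<And>i j. \<lbrakk>i \<in> Ob J; j \<in> Ob J\<rbrakk> \<Longrightarrow> h j \<bullet> (e i \<star> idn (Y j)) = g i j"
      by metis
    note [simp] = h
    have "h j' \<bullet> (idn L \<star> E j j' w) = h j" if w [simp]: "w \<in> Hom J j j'" for j j' w
    proof -
      have [simp]: "j \<in> Ob J" "j' \<in> Ob J" using J.hom_ob[OF w] by auto
      show ?thesis
      proof (rule tcolim_eqI[OF tens_admD[OF J _ D L]])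
        fix i assume i [simp]: "i \<in> Ob J"
        have "h j' \<bullet> (e i \<star> idn (Y j')) \<bullet> (idn (X i) \<star> E j j' w) = g i j"
          by (simp add: acomp_reassoc[OF hg] g_right del: interchange)
        then show "(h j' \<bullet> (idn L \<star> E j j' w)) \<bullet> (e i \<star> idn (Y j)) = h j \<bullet> (e i \<star> idn (Y j))"
          by (simp add: hg)
      qed (auto intro: J.category_axioms)
    qed
    then have "tcocone J (\<lambda>j. L \<otimes>\<^sub>o Y j) (\<lambda>i j u. idn L \<star> E i j u) Z h"
      by (simp add: tcocone_def)
    from tcolim_factor[OF tens_adm_left[OF J _ E M] this]
    obtain k where k [simp]: "ok k" "src k = L \<otimes>\<^sub>o M" "tgt k = Z"
      and kh: "\<And>j. j \<in> Ob J \<Longrightarrow> k \<bullet> (idn L \<star> f j) = h j" by auto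
    have "k \<bullet> (e i \<star> f i) = d i" if i [simp]: "i \<in> Ob J" for i
    proof -
      have "k \<bullet> (e i \<star> f i) = k \<bullet> (idn L \<star> f i) \<bullet> (e i \<star> idn (Y i))"
        by simp
      also have "\<dots> = g i i"
        by (simp add: acomp_reassoc[OF kh] hg del: interchange)
      also have "\<dots> = d i"
        using g[OF J.idt_hom[OF i] J.idt_hom[OF i]] by simp
      finally show ?thesis .
    qed
    then show "\<exists>h. ar h (L \<otimes>\<^sub>o M) Z \<and> (\<forall>i\<in>Ob J. h \<bullet> (e i \<star> f i) = d i)"
      using k by blast
  qed (use eqI in blast)
qed

end

section \<open>Small and countable index categories\<close>

context ag_base
begin

lemma tens_adm_of_preserves:
  assumes J: "category J"
    and P: "\<And>G L e Z. \<lbrakk>is_ftor J C G; is_colimit J C G L e; Z \<in> Ob C\<rbrakk> \<Longrightarrow>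
      is_colimit J C (ftor_comp (tensor_right C Z) G) (L \<otimes>\<^sub>o Z) (\<lambda>j. e j \<otimes>\<^sub>a Idt C Z)"
  shows "tens_adm J"
  unfolding tens_adm_def
proof (intro conjI allI impI)
  fix X D L e Z
  assume *: "Z \<in> Ob C \<and> tdiag J X D \<and> tcolim J X D L e"
  then have D: "tdiag J X D" and L: "tcolim J X D L e" and Z: "Z \<in> Ob C" by auto
  interpret J: category J by fact
  note [simp] = tdiagD[OF D] tcolimD[OF L]
  have rid: "raw (idn Z) = Idt C Z" by (simp add: idn_def)
  have e: "ar (e i) (X i) L" if "i \<in> Ob J" for i
    using that by simp
  have "is_colimit J C (ftor_comp (tensor_right C Z) (rftor X D)) (L \<otimes>\<^sub>o Z) (\<lambda>j. raw (e j) \<otimes>\<^sub>a Idt C Z)"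
    using P[OF is_ftor_rftor[OF J D] _ Z] tcolim_iff_is_colimit[OF J D e] L by blast
  then have "is_colimit J C (rftor (\<lambda>i. X i \<otimes>\<^sub>o Z) (\<lambda>i j u. D i j u \<star> idn Z)) (L \<otimes>\<^sub>o Z) (\<lambda>i. raw (e i \<star> idn Z))"
    by (rule is_colimit_cong[OF _ J])
      (simp_all add: ftor_comp_def tensor_right_def rftor_def Z rid)
  moreover have "tdiag J (\<lambda>i. X i \<otimes>\<^sub>o Z) (\<lambda>i j u. D i j u \<star> idn Z)"
    by (rule tdiag_tens[OF D tdiag_const[OF Z] J])
  ultimately show "tcolim J (\<lambda>i. X i \<otimes>\<^sub>o Z) (\<lambda>i j u. D i j u \<star> idn Z) (L \<otimes>\<^sub>o Z) (\<lambda>i. e i \<star> idn Z)"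
    using Z by (subst tcolim_iff_is_colimit[OF J]) auto
qed fact

lemma tens_adm_small: "small_cat (J :: ('u, 'u) cat) \<Longrightarrow> tens_adm J"
  using tensor_preserves_colims
  by (intro tens_adm_of_preserves)
    (auto simp: small_cat_def preserves_small_colimits_def tensor_right_def)

lemma countable_inj: obtains p :: "'i::countable \<Rightarrow> 'u" where "inj p"
  using ex_inj_countable[OF universe_uncountable] by blast

lemma tens_adm_countable:
  assumes "category (J :: ('i::countable, 'n::countable) cat)" shows "tens_adm J"
proof (rule tens_adm_of_preserves[OF assms])
  fix G L e Z
  assume *: "is_ftor J C G" "is_colimit J C G L e" "Z \<in> Ob C"
  obtain p :: "'i \<Rightarrow> 'u" where p: "inj p" by (rule countable_inj)
  obtain q :: "'n \<Rightarrow> 'u" where q: "inj q" by (rule countable_inj)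
  have "is_colimit (enc_cat p q J) C (enc_ftor p q G) L (\<lambda>a. e (inv_into UNIV p a))"
    using * p q by (simp add: is_colimit_enc)
  moreover have "small_cat (enc_cat p q J)"
    using small_cat_enc[OF assms p q universe_uncountable] .
  ultimately have "is_colimit (enc_cat p q J) C (ftor_comp (tensor_right C Z) (enc_ftor p q G))
      (L \<otimes>\<^sub>o Z) (\<lambda>j. e (inv_into UNIV p j) \<otimes>\<^sub>a Idt C Z)"
    using tensor_preserves_colims[OF *(3)] is_ftor_enc[OF *(1) p q]
    by (auto simp: preserves_small_colimits_def tensor_right_def)
  moreover have "ftor_comp (tensor_right C Z) (enc_ftor p q G) = enc_ftor p q (ftor_comp (tensor_right C Z) G)"
    by (simp add: ftor_comp_def enc_ftor_def)
  ultimately show "is_colimit J C (ftor_comp (tensor_right C Z) G) (L \<otimes>\<^sub>o Z) (\<lambda>j. e j \<otimes>\<^sub>a Idt C Z)"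
    using p q by (simp add: is_colimit_enc)
qed

lemma ex_tcolim_small:
  assumes "small_cat (J :: ('u, 'u) cat)" "tdiag J X D"
  obtains L e where "tcolim J X D L e"
proof -
  have J: "category J" using assms by (simp add: small_cat_def)
  from small_colimits assms is_ftor_rftor[OF J assms(2)]
  obtain L e where "is_colimit J C (rftor X D) L e"
    unfolding has_small_colimits_def by blast
  then show ?thesis using that is_colimit_iff_tcolim[OF J assms(2)] by blast
qed

lemma ex_tcolim_countable:
  assumes J: "category (J :: ('i::countable, 'n::countable) cat)" and D: "tdiag J X D"
  obtains L e where "tcolim J X D L e"
proof -
  obtain p :: "'i \<Rightarrow> 'u" where p: "inj p" by (rule countable_inj)
  obtain q :: "'n \<Rightarrow> 'u" where q: "inj q" by (rule countable_inj)
  from small_colimits small_cat_enc[OF J p q universe_uncountable] is_ftor_enc[OF is_ftor_rftor[OF J D] p q]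
  obtain L e where "is_colimit (enc_cat p q J) C (enc_ftor p q (rftor X D)) L e"
    unfolding has_small_colimits_def by blast
  then have "is_colimit J C (rftor X D) L (\<lambda>i. e (p i))"
    using p q by (simp add: is_colimit_enc)
  then show ?thesis using that is_colimit_iff_tcolim[OF J D] by blast
qed

lemma ex_limit_countable:
  assumes J: "category (J :: ('i::countable, 'n::countable) cat)" and G: "is_ftor J C G"
  obtains L e where "is_limit J C G L e"
proof -
  obtain p :: "'i \<Rightarrow> 'u" where p: "inj p" by (rule countable_inj)
  obtain q :: "'n \<Rightarrow> 'u" where q: "inj q" by (rule countable_inj)
  from small_limits small_cat_enc[OF J p q universe_uncountable] is_ftor_enc[OF G p q]
  obtain L e where "is_limit (enc_cat p q J) C (enc_ftor p q G) L e"
    unfolding has_small_limits_def by blast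
  then show ?thesis using that p q by (simp add: is_limit_enc)
qed

end


section \<open>Telescopes, coequalizers and additivity of the tensor product\<close>

lemma category_nat_cat: "category nat_cat"
  by unfold_locales (auto simp: nat_cat_def split: if_splits)

lemma hom_nat_cat [simp]: "u \<in> Hom nat_cat m n \<longleftrightarrow> m \<le> n"
  by (simp add: nat_cat_def)

lemma ob_nat_cat [simp]: "Ob nat_cat = UNIV"
  by (simp add: nat_cat_def)

lemma filtered_nat_cat: "filtered_cat nat_cat"
proof -
  have "\<exists>k. Hom nat_cat i k \<noteq> {} \<and> Hom nat_cat j k \<noteq> {}" for i j
    by (intro exI[of _ "max i j"]) (auto simp: nat_cat_def)
  moreover have "\<exists>k. \<exists>w\<in>Hom nat_cat j k. w \<cdot>\<^bsub>nat_cat\<^esub> u = w \<cdot>\<^bsub>nat_cat\<^esub> v" for j :: nat and u v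
    by (intro exI[of _ j] bexI[of _ "()"]) auto
  ultimately show ?thesis
    by (simp add: filtered_cat_def category_nat_cat)
qed

lemma category_discrete_cat: "category (discrete_cat S)"
  by unfold_locales (auto simp: discrete_cat_def split: if_splits)

text \<open>The arrows \<open>1, 2 : False \<rightarrow> True\<close> are the parallel pair, \<open>0\<close> stands for both identities.\<close>

definition par_cat :: "(bool, nat) cat" where
  "par_cat = \<lparr>Ob = UNIV, Hom = (\<lambda>a b. if a = b then {0} else if b then {1, 2} else {}),
     Idt = (\<lambda>_. 0), Cmp = (+)\<rparr>"

lemma category_par_cat: "category par_cat"
  by unfold_locales (auto simp: par_cat_def split: if_splits)

context category
begin

declare acomp_assoc [simp]

primrec apow :: "('o, 'm) arrow \<Rightarrow> nat \<Rightarrow> ('o, 'm) arrow" where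
  "apow t 0 = idn (src t)"
| "apow t (Suc n) = t \<bullet> apow t n"

lemma apow_simps [simp]:
  assumes "ok t" "tgt t = src t"
  shows "ok (apow t n)" "src (apow t n) = src t" "tgt (apow t n) = src t"
  using assms by (induction n) auto

lemma apow_add:
  assumes "ok t" "tgt t = src t"
  shows "apow t (m + n) = apow t m \<bullet> apow t n"
  using assms by (induction m) auto

lemma apow_commute:
  assumes "ok t" "tgt t = src t" "ok t'" "tgt t' = src t'" "ok f" "src f = src t" "tgt f = src t'"
    "f \<bullet> t = t' \<bullet> f"
  shows "f \<bullet> apow t n = apow t' n \<bullet> f"
proof (induction n)
  case (Suc n)
  then show ?case
    using assms acomp_reassoc2[OF assms(8), of "apow t n"] by simp
qed (use assms in simp)

lemma apow_Suc2:
  assumes "ok t" "tgt t = src t" shows "apow t n \<bullet> t = t \<bullet> apow t n"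
  using apow_commute[of t t t n] assms by simp

text \<open>\<open>L\<close> is the colimit of the telescope of the endomorphism \<open>t\<close>, with coprojections \<open>e n\<close>.\<close>

definition tel :: "('o, 'm) arrow \<Rightarrow> 'o \<Rightarrow> (nat \<Rightarrow> ('o, 'm) arrow) \<Rightarrow> bool" where
  "tel t L e \<longleftrightarrow> ok t \<and> tgt t = src t \<and> tcolim nat_cat (\<lambda>_. src t) (\<lambda>m n _. apow t (n - m)) L e"

lemma tdiag_tel:
  assumes "ok t" "tgt t = src t"
  shows "tdiag nat_cat (\<lambda>_. src t) (\<lambda>m n _. apow t (n - m))"
proof -
  have "apow t (k - i) = apow t (k - j) \<bullet> apow t (j - i)" if "i \<le> j" "j \<le> k" for i j k
  proof -
    have "k - i = (k - j) + (j - i)" using that by simp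
    then show ?thesis using apow_add[OF assms] by metis
  qed
  note * = this
  show ?thesis
    unfolding tdiag_def
  proof (intro conjI allI ballI)
    show "apow t (k - i) = apow t (k - j) \<bullet> apow t (j - i)"
      if "u \<in> Hom nat_cat i j" "v \<in> Hom nat_cat j k" for i j k u v
      using that by (intro *) auto
  qed (use assms in auto)
qed

text \<open>The arrows n \<rightarrow> n + 1 generate \<open>nat_cat\<close>, so compatibility
  between consecutive stages is enough.\<close>

lemma tel_cocone:
  assumes t: "ok t" "tgt t = src t"
  shows "tcocone nat_cat (\<lambda>_. src t) (\<lambda>m n _. apow t (n - m)) Z d \<longleftrightarrow>
    Z \<in> Ob C \<and> (\<forall>n. ar (d n) (src t) Z \<and> d (Suc n) \<bullet> t = d n)"
proof (intro iffI conjI allI)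
  assume d: "tcocone nat_cat (\<lambda>_. src t) (\<lambda>m n _. apow t (n - m)) Z d"
  show "Z \<in> Ob C" using tcoconeD[OF d] by simp
  fix n show "ok (d n)" "src (d n) = src t" "tgt (d n) = Z" using tcoconeD[OF d] by simp_all
  have "d (Suc n) \<bullet> apow t (Suc n - n) = d n"
    by (rule tcoconeD(5)[OF d]) simp
  then show "d (Suc n) \<bullet> t = d n" using t by (simp add: Suc_diff_le)
next
  assume d: "Z \<in> Ob C \<and> (\<forall>n. ar (d n) (src t) Z \<and> d (Suc n) \<bullet> t = d n)"
  have "d (m + k) \<bullet> apow t k = d m" for m k
  proof (induction k)
    case (Suc k)
    have "d (m + Suc k) \<bullet> apow t (Suc k) = (d (Suc (m + k)) \<bullet> t) \<bullet> apow t k" by simp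
    also have "\<dots> = d m" using d Suc by metis
    finally show ?case .
  qed (use d t in simp)
  then have "d n \<bullet> apow t (n - m) = d m" if "m \<le> n" for m n
    using that by (metis le_add_diff_inverse)
  then show "tcocone nat_cat (\<lambda>_. src t) (\<lambda>m n _. apow t (n - m)) Z d"
    using d by (auto simp: tcocone_def)
qed

lemma telD:
  assumes "tel t L e"
  shows "ok t" "tgt t = src t" "L \<in> Ob C" "ok (e n)" "src (e n) = src t" "tgt (e n) = L"
    "e (Suc n) \<bullet> t = e n"
  using assms tel_cocone[of t L e] by (auto simp: tel_def dest: tcolim_cocone)

lemma tel_factor:
  assumes "tel t L e" "\<And>n. ok (d n)" "\<And>n. src (d n) = src t" "\<And>n. tgt (d n) = Z"
    "\<And>n. d (Suc n) \<bullet> t = d n"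
  obtains h where "ok h" "src h = L" "tgt h = Z" "\<And>n. h \<bullet> e n = d n"
proof -
  have "Z \<in> Ob C" using ok_ob(2)[OF assms(2)[of 0]] assms(4) by simp
  then have "tcocone nat_cat (\<lambda>_. src t) (\<lambda>m n _. apow t (n - m)) Z d"
    using assms telD(1,2)[OF assms(1)] by (simp add: tel_cocone)
  moreover have "tcolim nat_cat (\<lambda>_. src t) (\<lambda>m n _. apow t (n - m)) L e"
    using assms(1) by (simp add: tel_def)
  ultimately have "\<exists>!h. ar h L Z \<and> (\<forall>i\<in>Ob nat_cat. h \<bullet> e i = d i)"
    unfolding tcolim_def by blast
  then obtain h where "ar h L Z" "\<forall>n. h \<bullet> e n = d n" by auto
  then show ?thesis by (intro that[of h]) simp_all
qed

lemma tel_eqI: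
  assumes "tel t L e" "ok h" "src h = L" "ok h'" "src h' = L" "tgt h = tgt h'"
    "\<And>n. h \<bullet> e n = h' \<bullet> e n"
  shows "h = h'"
  using assms unfolding tel_def by (metis tcolim_eqI[OF _ category_nat_cat])

lemma telI:
  assumes "ok t" "tgt t = src t" "L \<in> Ob C" "\<And>n. ar (e n) (src t) L" "\<And>n. e (Suc n) \<bullet> t = e n"
    and "\<And>Z d. \<lbrakk>Z \<in> Ob C; \<And>n. ok (d n); \<And>n. src (d n) = src t; \<And>n. tgt (d n) = Z; \<And>n. d (Suc n) \<bullet> t = d n\<rbrakk>
           \<Longrightarrow> \<exists>h. ar h L Z \<and> (\<forall>n. h \<bullet> e n = d n)"
    and "\<And>h h'. \<lbrakk>ok h; ok h'; src h = L; src h' = L; tgt h = tgt h'; \<And>n. h \<bullet> e n = h' \<bullet> e n\<rbrakk> \<Longrightarrow> h = h'"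
  shows "tel t L e"
  unfolding tel_def
proof (intro conjI tcolimI)
  show "tcocone nat_cat (\<lambda>_. src t) (\<lambda>m n _. apow t (n - m)) L e"
    using assms(1-5) by (simp add: tel_cocone)
  show "\<exists>h. ar h L Z \<and> (\<forall>i\<in>Ob nat_cat. h \<bullet> e i = d i)"
    if "tcocone nat_cat (\<lambda>_. src t) (\<lambda>m n _. apow t (n - m)) Z d" for Z d
    using that assms(1,2) assms(6)[of Z d] by (simp add: tel_cocone)
  show "h = h'" if "ok h" "ok h'" "src h = L" "src h' = L" "tgt h = tgt h'"
    "\<And>i. i \<in> Ob nat_cat \<Longrightarrow> h \<bullet> e i = h' \<bullet> e i" for h h'
    by (rule assms(7)) (use that in auto)
qed fact+

lemma tel_shift:
  assumes "tel t L e"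
  shows "e (m + k) \<bullet> apow t k = e m"
proof (induction k)
  case (Suc k)
  have "e (m + Suc k) \<bullet> apow t (Suc k) = (e (Suc (m + k)) \<bullet> t) \<bullet> apow t k" by simp
  also have "\<dots> = e m" by (simp only: telD(7)[OF assms] Suc)
  finally show ?case .
qed (use telD[OF assms] in simp)

definition tcoeq :: "('o, 'm) arrow \<Rightarrow> ('o, 'm) arrow \<Rightarrow> ('o, 'm) arrow \<Rightarrow> bool" where
  "tcoeq r s q \<longleftrightarrow> ok r \<and> ok s \<and> ok q \<and> src s = src r \<and> tgt s = tgt r \<and> src q = tgt r \<and>
     q \<bullet> r = q \<bullet> s \<and> (\<forall>g. ok g \<and> src g = tgt r \<and> g \<bullet> r = g \<bullet> s \<longrightarrow>
       (\<exists>!h. ar h (tgt q) (tgt g) \<and> h \<bullet> q = g))"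

lemma tcoeqD:
  assumes "tcoeq r s q"
  shows "ok r" "ok s" "ok q" "src s = src r" "tgt s = tgt r" "src q = tgt r" "q \<bullet> r = q \<bullet> s"
  using assms by (simp_all add: tcoeq_def)

lemma tcoeq_factor:
  assumes "tcoeq r s q" "ok g" "src g = tgt r" "g \<bullet> r = g \<bullet> s"
  obtains h where "ok h" "src h = tgt q" "tgt h = tgt g" "h \<bullet> q = g"
  using assms unfolding tcoeq_def by metis

lemma tcoeq_eqI:
  assumes "tcoeq r s q" "ok h" "ok h'" "src h = tgt q" "src h' = tgt q" "tgt h = tgt h'"
    "h \<bullet> q = h' \<bullet> q"
  shows "h = h'"
proof -
  note q = tcoeqD[OF assms(1)]
  have eq: "(h \<bullet> q) \<bullet> r = (h \<bullet> q) \<bullet> s" using q(7) by simp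
  have hq: "ok (h \<bullet> q)" "src (h \<bullet> q) = tgt r" "tgt (h \<bullet> q) = tgt h"
    using assms(2,4) q by simp_all
  have "\<exists>!k. ar k (tgt q) (tgt (h \<bullet> q)) \<and> k \<bullet> q = h \<bullet> q"
    using assms(1) hq(1,2) eq unfolding tcoeq_def by blast
  then show ?thesis using assms hq(3) by auto
qed

lemma is_coequalizer_iff_tcoeq:
  assumes "r \<in> Hom C X Y" "s \<in> Hom C X Y"
  shows "is_coequalizer C X Y r s Q q \<longleftrightarrow> tcoeq (Arr X r Y) (Arr X s Y) (Arr Y q Q)"
proof -
  have "(\<forall>Z. \<forall>g\<in>Hom C Y Z. g \<cdot> r = g \<cdot> s \<longrightarrow> (\<exists>!h. h \<in> Hom C Q Z \<and> h \<cdot> q = g)) \<longleftrightarrow>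
    (\<forall>g. ok g \<and> src g = Y \<and> g \<bullet> Arr X r Y = g \<bullet> Arr X s Y \<longrightarrow>
       (\<exists>!h. ar h Q (tgt g) \<and> h \<bullet> Arr Y q Q = g))" (is "?L \<longleftrightarrow> ?R") if q: "q \<in> Hom C Y Q"
  proof
    assume L: ?L
    show ?R
    proof (intro allI impI)
      fix g assume g: "ok g \<and> src g = Y \<and> g \<bullet> Arr X r Y = g \<bullet> Arr X s Y"
      then obtain Z u where u: "g = Arr Y u Z" "u \<in> Hom C Y Z" by (metis arE)
      with g assms have "u \<cdot> r = u \<cdot> s" by (simp add: Arr_acomp)
      with L u(2) obtain h where h: "h \<in> Hom C Q Z" "h \<cdot> q = u"
        and uni: "\<And>k. k \<in> Hom C Q Z \<and> k \<cdot> q = u \<Longrightarrow> k = h" by metis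
      show "\<exists>!h. ar h Q (tgt g) \<and> h \<bullet> Arr Y q Q = g"
      proof (rule ex1I[of _ "Arr Q h Z"])
        show "ar (Arr Q h Z) Q (tgt g) \<and> Arr Q h Z \<bullet> Arr Y q Q = g"
          using h q by (simp add: u Arr_acomp)
      next
        fix k assume k: "ar k Q (tgt g) \<and> k \<bullet> Arr Y q Q = g"
        then obtain k' where k': "k = Arr Q k' Z" "k' \<in> Hom C Q Z" by (metis arE u(1) arrow.sel(3))
        with k q have "k' \<cdot> q = u" by (simp add: u Arr_acomp)
        with k' uni show "k = Arr Q h Z" by blast
      qed
    qed
  next
    assume R: ?R
    show ?L
    proof (intro allI ballI impI)
      fix Z u assume u: "u \<in> Hom C Y Z" "u \<cdot> r = u \<cdot> s"
      then have "ok (Arr Y u Z) \<and> src (Arr Y u Z) = Y \<and> Arr Y u Z \<bullet> Arr X r Y = Arr Y u Z \<bullet> Arr X s Y"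
        using assms by (simp add: Arr_acomp)
      with R obtain h where h: "ar h Q Z" "h \<bullet> Arr Y q Q = Arr Y u Z"
        and uni: "\<And>k. ar k Q Z \<and> k \<bullet> Arr Y q Q = Arr Y u Z \<Longrightarrow> k = h" by (metis arrow.sel(3))
      then obtain h' where h': "h = Arr Q h' Z" "h' \<in> Hom C Q Z" by (metis arE)
      show "\<exists>!h. h \<in> Hom C Q Z \<and> h \<cdot> q = u"
      proof (rule ex1I[of _ h'])
        show "h' \<in> Hom C Q Z \<and> h' \<cdot> q = u" using h h' q by (simp add: Arr_acomp)
      next
        fix k assume "k \<in> Hom C Q Z \<and> k \<cdot> q = u"
        then have "Arr Q k Z = h" using q by (intro uni) (simp add: Arr_acomp)
        then show "k = h'" using h' by simp
      qed
    qed
  qed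
  moreover have "Arr Y q Q \<bullet> Arr X r Y = Arr Y q Q \<bullet> Arr X s Y \<longleftrightarrow> q \<cdot> r = q \<cdot> s" if "q \<in> Hom C Y Q"
    using that assms by (simp add: Arr_acomp)
  ultimately show ?thesis
    using assms unfolding is_coequalizer_def tcoeq_def arrow.sel ok_Arr
    by (cases "q \<in> Hom C Y Q") (simp_all only: simp_thms)
qed

definition par_ob :: "('o, 'm) arrow \<Rightarrow> bool \<Rightarrow> 'o" where
  "par_ob r b = (if b then tgt r else src r)"

definition par_ar :: "('o, 'm) arrow \<Rightarrow> ('o, 'm) arrow \<Rightarrow> bool \<Rightarrow> bool \<Rightarrow> nat \<Rightarrow> ('o, 'm) arrow" where
  "par_ar r s a b u = (if a = b then idn (par_ob r a) else if u = 1 then r else s)"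

lemma tdiag_par:
  assumes "ok r" "ok s" "src s = src r" "tgt s = tgt r"
  shows "tdiag par_cat (par_ob r) (par_ar r s)"
  using assms unfolding tdiag_def par_cat_def par_ar_def par_ob_def by (auto split: if_splits)

lemma tcocone_par:
  assumes "ok r" "ok s" "src s = src r" "tgt s = tgt r"
  shows "tcocone par_cat (par_ob r) (par_ar r s) Z d \<longleftrightarrow>
    ar (d True) (tgt r) Z \<and> d True \<bullet> r = d False \<and> d True \<bullet> s = d False"
proof
  assume "ar (d True) (tgt r) Z \<and> d True \<bullet> r = d False \<and> d True \<bullet> s = d False"
  moreover then have "ar (d False) (src r) Z" using assms by (metis ok_acomp(1-3))
  moreover have "Z \<in> Ob C" using calculation ok_ob by blast
  ultimately show "tcocone par_cat (par_ob r) (par_ar r s) Z d"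
    using assms unfolding tcocone_def par_cat_def par_ar_def par_ob_def
    by (auto split: if_splits simp: all_bool_eq)
qed (use assms in \<open>auto simp: tcocone_def par_cat_def par_ar_def par_ob_def all_bool_eq split: if_splits\<close>)

text \<open>The component of a cocone at \<open>False\<close> is forced by the one at
  \<open>True\<close>. Existence of coequalizers and their stability under the tensor product
  thereby become instances of the statements on colimits.\<close>

lemma tcolim_par:
  assumes rs: "ok r" "ok s" "src s = src r" "tgt s = tgt r"
  shows "tcolim par_cat (par_ob r) (par_ar r s) L e \<longleftrightarrow>
    tcoeq r s (e True) \<and> tgt (e True) = L \<and> e False = e True \<bullet> r"
proof
  assume L: "tcolim par_cat (par_ob r) (par_ar r s) L e"
  then have e: "ar (e True) (tgt r) L" "e True \<bullet> r = e False" "e True \<bullet> s = e False"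
    using tcocone_par[OF rs] by (auto simp: tcolim_def)
  have "\<exists>!h. ar h L (tgt g) \<and> h \<bullet> e True = g" if g: "ok g" "src g = tgt r" "g \<bullet> r = g \<bullet> s" for g
  proof -
    have "tcocone par_cat (par_ob r) (par_ar r s) (tgt g) (\<lambda>b. if b then g else g \<bullet> r)"
      using g by (simp add: tcocone_par[OF rs])
    then have "\<exists>!h. ar h L (tgt g) \<and> (\<forall>b. h \<bullet> e b = (if b then g else g \<bullet> r))"
      using L unfolding tcolim_def by (simp add: par_cat_def)
    moreover have "(\<forall>b. h \<bullet> e b = (if b then g else g \<bullet> r)) \<longleftrightarrow> h \<bullet> e True = g" for h
      using e by (auto simp: all_bool_eq simp flip: e(2))
    ultimately show ?thesis by simp
  qed
  with e rs show "tcoeq r s (e True) \<and> tgt (e True) = L \<and> e False = e True \<bullet> r"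
    by (simp add: tcoeq_def)
next
  assume q: "tcoeq r s (e True) \<and> tgt (e True) = L \<and> e False = e True \<bullet> r"
  show "tcolim par_cat (par_ob r) (par_ar r s) L e"
    unfolding tcolim_def
  proof (intro conjI allI impI)
    show "tcocone par_cat (par_ob r) (par_ar r s) L e"
      using q by (simp add: tcocone_par[OF rs] tcoeq_def)
    fix Z d assume "tcocone par_cat (par_ob r) (par_ar r s) Z d"
    then have d: "ar (d True) (tgt r) Z" "d True \<bullet> r = d False" "d True \<bullet> s = d False"
      by (auto simp: tcocone_par[OF rs])
    then have "\<exists>!h. ar h L Z \<and> h \<bullet> e True = d True"
      using q unfolding tcoeq_def by metis
    moreover have "(\<forall>b\<in>Ob par_cat. h \<bullet> e b = d b) \<longleftrightarrow> h \<bullet> e True = d True" for h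
      using q d(2) acomp_reassoc[of h "e True" "d True" r] by (auto simp: par_cat_def all_bool_eq)
    ultimately show "\<exists>!h. ar h L Z \<and> (\<forall>b\<in>Ob par_cat. h \<bullet> e b = d b)" by simp
  qed
qed

end

context symmetric_monoidal_category
begin

lemma apow_tens:
  assumes "ok t" "tgt t = src t" "ok s" "tgt s = src s"
  shows "apow t n \<star> apow s n = apow (t \<star> s) n"
  by (induction n) (use assms in \<open>simp_all flip: interchange\<close>)

lemma apow_idn: "Z \<in> Ob C \<Longrightarrow> apow (idn Z) n = idn Z"
  by (induction n) simp_all

end

section \<open>Telescopes and coequalizers under the tensor product\<close>

context ag_base
begin

lemma tens_adm_nat: "tens_adm nat_cat"
  by (rule tens_adm_countable[OF category_nat_cat])

lemma ex_tel:
  assumes "ok t" "tgt t = src t" obtains L e where "tel t L e"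
  using ex_tcolim_countable[OF category_nat_cat tdiag_tel[OF assms]] assms that
  unfolding tel_def by blast

lemma tel_tens_right:
  assumes "tel t L e" "Z \<in> Ob C"
  shows "tel (t \<star> idn Z) (L \<otimes>\<^sub>o Z) (\<lambda>n. e n \<star> idn Z)"
proof -
  note t = telD(1,2)[OF assms(1)]
  have "tcolim nat_cat (\<lambda>_. src t \<otimes>\<^sub>o Z) (\<lambda>m n _. apow t (n - m) \<star> idn Z) (L \<otimes>\<^sub>o Z) (\<lambda>n. e n \<star> idn Z)"
    using tens_admD[OF tens_adm_nat assms(2) tdiag_tel[OF t]] assms(1) by (simp add: tel_def)
  moreover have "apow t k \<star> idn Z = apow (t \<star> idn Z) k" for k
    using apow_tens[of t "idn Z" k] t assms(2) by (simp add: apow_idn)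
  ultimately show ?thesis
    using t assms(2) by (simp add: tel_def)
qed

lemma tel_tens_left:
  assumes "tel t L e" "Z \<in> Ob C"
  shows "tel (idn Z \<star> t) (Z \<otimes>\<^sub>o L) (\<lambda>n. idn Z \<star> e n)"
proof -
  note t = telD(1,2)[OF assms(1)]
  have "tcolim nat_cat (\<lambda>_. Z \<otimes>\<^sub>o src t) (\<lambda>m n _. idn Z \<star> apow t (n - m)) (Z \<otimes>\<^sub>o L) (\<lambda>n. idn Z \<star> e n)"
    using tens_adm_left[OF tens_adm_nat assms(2) tdiag_tel[OF t]] assms(1) by (simp add: tel_def)
  moreover have "idn Z \<star> apow t k = apow (idn Z \<star> t) k" for k
    using apow_tens[of "idn Z" t k] t assms(2) by (simp add: apow_idn)
  ultimately show ?thesis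
    using t assms(2) by (simp add: tel_def)
qed

text \<open>Because the diagonal is final, equal stages of the two factors suffice. The product on a
  localisation is defined through this presentation of L \<otimes> L.\<close>

lemma tel_tens:
  assumes "tel t L e" "tel s M f"
  shows "tel (t \<star> s) (L \<otimes>\<^sub>o M) (\<lambda>n. e n \<star> f n)"
proof -
  note t = telD(1,2)[OF assms(1)] telD(1,2)[OF assms(2)]
  have "tcolim nat_cat (\<lambda>_. src t \<otimes>\<^sub>o src s) (\<lambda>m n _. apow t (n - m) \<star> apow s (n - m))
      (L \<otimes>\<^sub>o M) (\<lambda>n. e n \<star> f n)"
    using tcolim_tens[OF tens_adm_nat filtered_nat_cat tdiag_tel[OF t(1,2)] _ tdiag_tel[OF t(3,4)]] assms
    by (simp add: tel_def)
  then show ?thesis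
    using t by (simp add: tel_def apow_tens)
qed

lemma ex_tcoeq:
  assumes "ok r" "ok s" "src s = src r" "tgt s = tgt r"
  obtains q where "tcoeq r s q"
  using ex_tcolim_countable[OF category_par_cat tdiag_par[OF assms]] tcolim_par[OF assms] by metis

lemma tcoeq_tens:
  assumes "tcoeq r s q" "Z \<in> Ob C"
  shows "tcoeq (r \<star> idn Z) (s \<star> idn Z) (q \<star> idn Z)"
proof -
  note rs = tcoeqD(1,2,4,5)[OF assms(1)]
  note [simp] = rs tcoeqD(3,6)[OF assms(1)] assms(2)
  define e where "e b = (if b then q else q \<bullet> r)" for b
  have "tcolim par_cat (par_ob r) (par_ar r s) (tgt q) e"
    using assms(1) by (simp add: tcolim_par e_def)
  from tens_admD[OF tens_adm_countable[OF category_par_cat] assms(2) tdiag_par[OF rs] this]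
  have "tcolim par_cat (\<lambda>i. par_ob r i \<otimes>\<^sub>o Z) (\<lambda>i j u. par_ar r s i j u \<star> idn Z) (tgt q \<otimes>\<^sub>o Z) (\<lambda>i. e i \<star> idn Z)" .
  then have "tcolim par_cat (par_ob (r \<star> idn Z)) (par_ar (r \<star> idn Z) (s \<star> idn Z)) (tgt q \<otimes>\<^sub>o Z) (\<lambda>i. e i \<star> idn Z)"
    by (rule tcolim_cong[OF _ category_par_cat]) (auto simp: par_ob_def par_ar_def)
  then show ?thesis
    by (simp add: tcolim_par e_def)
qed

section \<open>Zero arrows, sums and additivity of the tensor product\<close>

definition zer :: "'o \<Rightarrow> 'o \<Rightarrow> ('o, 'm) arrow" where
  "zer X Y = Arr X (Zer C X Y) Y"

definition aadd :: "('o, 'm) arrow \<Rightarrow> ('o, 'm) arrow \<Rightarrow> ('o, 'm) arrow" where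
  "aadd f g = Arr (src f) (Add C (raw f) (raw g)) (tgt f)"

lemma Zer_hom: "\<lbrakk>X \<in> Ob C; Y \<in> Ob C\<rbrakk> \<Longrightarrow> Zer C X Y \<in> Hom C X Y"
  using hom_comm_group[THEN comm_group.axioms(2), THEN group.is_monoid, THEN monoid.one_closed]
  by (simp add: hom_group_def)

lemma Add_hom: "\<lbrakk>f \<in> Hom C X Y; g \<in> Hom C X Y\<rbrakk> \<Longrightarrow> Add C f g \<in> Hom C X Y"
  using monoid.m_closed[OF group.is_monoid[OF comm_group.axioms(2)[OF hom_comm_group]]] hom_ob
  by (fastforce simp: hom_group_def)

lemma Add_Zer: "f \<in> Hom C X Y \<Longrightarrow> Add C f (Zer C X Y) = f"
  using monoid.r_one[OF group.is_monoid[OF comm_group.axioms(2)[OF hom_comm_group]]] hom_ob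
  by (fastforce simp: hom_group_def)

lemma Add_commute: "\<lbrakk>f \<in> Hom C X Y; g \<in> Hom C X Y\<rbrakk> \<Longrightarrow> Add C f g = Add C g f"
  using comm_monoid.m_comm[OF comm_group.axioms(1)[OF hom_comm_group]] hom_ob
  by (fastforce simp: hom_group_def)

lemma Add_assoc:
  "\<lbrakk>f \<in> Hom C X Y; g \<in> Hom C X Y; h \<in> Hom C X Y\<rbrakk> \<Longrightarrow> Add C (Add C f g) h = Add C f (Add C g h)"
  using monoid.m_assoc[OF group.is_monoid[OF comm_group.axioms(2)[OF hom_comm_group]]] hom_ob
  by (fastforce simp: hom_group_def)

lemma Add_idem:
  assumes "f \<in> Hom C X Y" "Add C f f = f" shows "f = Zer C X Y"
proof -
  have "group (hom_group C X Y)"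
    using assms hom_ob hom_comm_group comm_group.axioms(2) by blast
  from group.l_cancel_one[OF this, of f f] assms show ?thesis
    by (simp add: hom_group_def)
qed

lemma zer_simps [simp]:
  "\<lbrakk>X \<in> Ob C; Y \<in> Ob C\<rbrakk> \<Longrightarrow> ok (zer X Y)" "src (zer X Y) = X" "tgt (zer X Y) = Y"
  by (simp_all add: zer_def Zer_hom)

lemma aadd_simps [simp]:
  "\<lbrakk>ok f; ok g; src g = src f; tgt g = tgt f\<rbrakk> \<Longrightarrow> ok (aadd f g)"
  "src (aadd f g) = src f" "tgt (aadd f g) = tgt f"
  by (auto simp: aadd_def ok_def Add_hom)

lemma aadd_zer [simp]:
  assumes "ok f" "src f = X" "tgt f = Y" shows "aadd f (zer X Y) = f" "aadd (zer X Y) f = f"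
proof -
  obtain u where u: "f = Arr X u Y" "u \<in> Hom C X Y" using assms by (metis arE)
  then have "X \<in> Ob C" "Y \<in> Ob C" using hom_ob by blast+
  with u show "aadd f (zer X Y) = f" "aadd (zer X Y) f = f"
    by (simp_all add: aadd_def zer_def Add_Zer Add_commute[OF Zer_hom[of X Y]])
qed

lemma aadd_comp_left:
  assumes "ok f" "ok g" "ok h" "src g = tgt f" "src h = tgt f" "tgt h = tgt g"
  shows "aadd g h \<bullet> f = aadd (g \<bullet> f) (h \<bullet> f)"
proof -
  obtain u v w X Y Z where "f = Arr X u Y" "g = Arr Y v Z" "h = Arr Y w Z"
    "u \<in> Hom C X Y" "v \<in> Hom C Y Z" "w \<in> Hom C Y Z"
    using assms by (metis arE)
  then show ?thesis
    by (simp add: aadd_def Arr_acomp Add_hom cmp_add_left)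
qed

lemma aadd_comp_right:
  assumes "ok f" "ok g" "ok h" "src g = src f" "tgt g = tgt f" "src h = tgt f"
  shows "h \<bullet> aadd f g = aadd (h \<bullet> f) (h \<bullet> g)"
proof -
  obtain u v w X Y Z where "f = Arr X u Y" "g = Arr X v Y" "h = Arr Y w Z"
    "u \<in> Hom C X Y" "v \<in> Hom C X Y" "w \<in> Hom C Y Z"
    using assms by (metis arE)
  then show ?thesis
    by (simp add: aadd_def Arr_acomp Add_hom cmp_add_right)
qed

lemma zer_left [simp]:
  assumes "ok f" "tgt f = Y" "Z \<in> Ob C" shows "zer Y Z \<bullet> f = zer (src f) Z"
proof -
  obtain u X where u: "f = Arr X u Y" "u \<in> Hom C X Y" using assms by (metis arE)
  have z: "Zer C Y Z \<in> Hom C Y Z" using assms u hom_ob Zer_hom by blast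
  have "Add C (Zer C Y Z \<cdot> u) (Zer C Y Z \<cdot> u) = Zer C Y Z \<cdot> u"
    using cmp_add_left[OF u(2) z z] Add_Zer[OF z] by simp
  then have "Zer C Y Z \<cdot> u = Zer C X Z"
    using cmp_hom[OF u(2) z] by (intro Add_idem)
  then show ?thesis using u z by (simp add: zer_def Arr_acomp)
qed

lemma zer_right [simp]:
  assumes "ok f" "src f = Y" "X \<in> Ob C" shows "f \<bullet> zer X Y = zer X (tgt f)"
proof -
  obtain u Z where u: "f = Arr Y u Z" "u \<in> Hom C Y Z" using assms by (metis arE)
  have z: "Zer C X Y \<in> Hom C X Y" using assms u hom_ob Zer_hom by blast
  have "Add C (u \<cdot> Zer C X Y) (u \<cdot> Zer C X Y) = u \<cdot> Zer C X Y"
    using cmp_add_right[OF z z u(2)] Add_Zer[OF z] by simp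
  then have "u \<cdot> Zer C X Y = Zer C X Z"
    using cmp_hom[OF z u(2)] by (intro Add_idem)
  then show ?thesis using u z by (simp add: zer_def Arr_acomp)
qed

text \<open>A zero arrow factors through a zero object Z. As the colimit of the empty diagram, Z
  stays initial after tensoring with W, so every arrow out of Z \<otimes> W is zero.\<close>

lemma zer_tens:
  assumes [simp]: "X \<in> Ob C" "Y \<in> Ob C" "W \<in> Ob C"
  shows "zer X Y \<star> idn W = zer (X \<otimes>\<^sub>o W) (Y \<otimes>\<^sub>o W)"
proof -
  let ?J = "discrete_cat {} :: (nat, unit) cat"
  let ?D = "\<lambda>_ _ _. Null"
  obtain Z where Z: "is_zero_ob C Z" using ex_zero_ob by blast
  then have [simp]: "Z \<in> Ob C" by (simp add: is_zero_ob_def)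
  have init: "f = g" if "ok f" "ok g" "src f = Z" "src g = Z" "tgt f = tgt g" for f g
  proof -
    have "tgt g \<in> Ob C" using that ok_ob by simp
    then have "\<exists>!u. u \<in> Hom C Z (tgt g)" using Z by (auto simp: is_zero_ob_def)
    moreover have "raw f \<in> Hom C Z (tgt g)" "raw g \<in> Hom C Z (tgt g)"
      using that by (auto intro: ar_raw)
    ultimately have "raw f = raw g" by blast
    with that show ?thesis by (intro arrow_eqI) auto
  qed
  have D: "tdiag ?J (\<lambda>_. Z) ?D" by (simp add: tdiag_def discrete_cat_def)
  have "tcolim ?J (\<lambda>_. Z) ?D Z (\<lambda>_. Null)"
  proof (rule tcolimI)
    show "tcocone ?J (\<lambda>_. Z) ?D Z (\<lambda>_. Null)" by (simp add: tcocone_def discrete_cat_def)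
    show "\<exists>h. ar h Z V \<and> (\<forall>i\<in>Ob ?J. h \<bullet> Null = d i)" if "tcocone ?J (\<lambda>_. Z) ?D V d" for V d
      using that by (intro exI[of _ "zer Z V"]) (auto simp: tcocone_def discrete_cat_def)
  qed (use init in blast)
  from tens_admD[OF tens_adm_countable[OF category_discrete_cat] assms(3) D this]
  have "zer Z Y \<star> idn W = zer (Z \<otimes>\<^sub>o W) (Y \<otimes>\<^sub>o W)"
    by (rule tcolim_eqI[OF _ category_discrete_cat]) (auto simp: discrete_cat_def)
  moreover have "zer X Y \<star> idn W = (zer Z Y \<star> idn W) \<bullet> (zer X Z \<star> idn W)"
    by simp
  ultimately show ?thesis by simp
qed

text \<open>The sum of f and g factors through the biproduct of two copies of X, and this biproduct,
  being a coproduct, is preserved by the tensor product.\<close>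

lemma aadd_tens:
  assumes [simp]: "ok f" "ok g" "src f = X" "src g = X" "tgt f = Y" "tgt g = Y" "W \<in> Ob C"
  shows "aadd f g \<star> idn W = aadd (f \<star> idn W) (g \<star> idn W)"
proof -
  have [simp]: "X \<in> Ob C" "Y \<in> Ob C" using assms(1,3,5) ok_ob by blast+
  let ?J = "discrete_cat {..<2} :: (nat, unit) cat"
  obtain S i' j' p' q' where bi: "is_biproduct C X X S i' j' p' q'"
    using ex_biproduct[of X X] by auto
  define i j p q where ijpq: "i = Arr X i' S" "j = Arr X j' S" "p = Arr S p' X" "q = Arr S q' X"
  have b [simp]: "ok i" "ok j" "ok p" "ok q" "src i = X" "src j = X" "src p = S" "src q = S"
    "tgt i = S" "tgt j = S" "tgt p = X" "tgt q = X" "p \<bullet> i = idn X" "q \<bullet> j = idn X"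
    "q \<bullet> i = zer X X" "p \<bullet> j = zer X X" "aadd (i \<bullet> p) (j \<bullet> q) = idn S"
    using bi by (simp_all add: is_biproduct_def ijpq Arr_acomp idn_def zer_def aadd_def)
  have [simp]: "S \<in> Ob C" using ok_ob(2)[of i] by simp
  define e where "e k = (if k = 0 then i else j)" for k :: nat
  have D: "tdiag ?J (\<lambda>_. X) (\<lambda>_ _ _. idn X)" by (rule tdiag_const) simp
  \<comment> \<open>The biproduct is presented as a colimit over a two-point index set, the form in
    which its preservation is available.\<close>
  have "tcolim ?J (\<lambda>_. X) (\<lambda>_ _ _. idn X) S e"
  proof (rule tcolimI)
    show "tcocone ?J (\<lambda>_. X) (\<lambda>_ _ _. idn X) S e"
      by (auto simp: tcocone_def discrete_cat_def e_def)
  next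
    fix Z d assume "tcocone ?J (\<lambda>_. X) (\<lambda>_ _ _. idn X) Z d"
    then have "ar (d k) X Z" if "k < 2" for k
      using that by (auto simp: tcocone_def discrete_cat_def)
    from this[of 0] this[of 1] have [simp]: "ok (d 0)" "src (d 0) = X" "tgt (d 0) = Z"
        "ok (d (Suc 0))" "src (d (Suc 0)) = X" "tgt (d (Suc 0)) = Z" by auto
    have [simp]: "Z \<in> Ob C" using ok_ob(2)[of "d 0"] by simp
    let ?h = "aadd (d 0 \<bullet> p) (d (Suc 0) \<bullet> q)"
    have "?h \<bullet> i = d 0" "?h \<bullet> j = d (Suc 0)" by (simp_all add: aadd_comp_left)
    then have "?h \<bullet> e k = d k" if "k < 2" for k
      using that by (cases "k = 0") (auto simp: e_def less_2_cases_iff)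
    then show "\<exists>h. ar h S Z \<and> (\<forall>k\<in>Ob ?J. h \<bullet> e k = d k)"
      by (intro exI[of _ ?h]) (simp add: discrete_cat_def)
  next
    fix h h' assume h [simp]: "ok h" "ok h'" "src h = S" "src h' = S" "tgt h = tgt h'"
      and *: "\<And>k. k \<in> Ob ?J \<Longrightarrow> h \<bullet> e k = h' \<bullet> e k"
    have hi: "h \<bullet> i = h' \<bullet> i" "h \<bullet> j = h' \<bullet> j"
      using *[of 0] *[of 1] by (simp_all add: discrete_cat_def e_def)
    have "h = h \<bullet> aadd (i \<bullet> p) (j \<bullet> q)" by (simp del: b(1-16) add: b(17))
    also have "\<dots> = aadd (h' \<bullet> i \<bullet> p) (h' \<bullet> j \<bullet> q)"
      using acomp_reassoc2[OF hi(1), of p] acomp_reassoc2[OF hi(2), of q]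
      by (subst aadd_comp_right) auto
    also have "\<dots> = h' \<bullet> aadd (i \<bullet> p) (j \<bullet> q)" by (subst aadd_comp_right) auto
    finally show "h = h'" by simp
  qed
  note T = tens_admD[OF tens_adm_countable[OF category_discrete_cat] assms(7) D this]
  have "i \<bullet> p \<bullet> i = i" "j \<bullet> q \<bullet> j = j" "i \<bullet> p \<bullet> j = zer X S" "j \<bullet> q \<bullet> i = zer X S" by simp_all
  \<comment> \<open>The decomposition of the identity of S survives tensoring: both sides agree on
    the two preserved coprojections.\<close>
  then have id: "aadd ((i \<bullet> p) \<star> idn W) ((j \<bullet> q) \<star> idn W) = idn (S \<otimes>\<^sub>o W)"
    by - (rule tcolim_eqI[OF T category_discrete_cat],
      auto simp: discrete_cat_def e_def aadd_comp_left zer_tens)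
  \<comment> \<open>The factorisation of f + g as the diagonal i + j followed by the copairing f p +
    g q.\<close>
  have "aadd f g = aadd (f \<bullet> p) (g \<bullet> q) \<bullet> aadd i j"
    by (simp add: aadd_comp_left aadd_comp_right acomp_reassoc[OF b(13)])
  then have "aadd f g \<star> idn W
      = (aadd (f \<bullet> p) (g \<bullet> q) \<star> idn W) \<bullet> aadd ((i \<bullet> p) \<star> idn W) ((j \<bullet> q) \<star> idn W) \<bullet> (aadd i j \<star> idn W)"
    by (simp add: id)
  also have "\<dots> = aadd (f \<star> idn W) (g \<star> idn W)"
    by (simp add: aadd_comp_left aadd_comp_right)
  finally show ?thesis .
qed

lemma aadd_tens_left:
  assumes [simp]: "ok f" "ok g" "src f = X" "src g = X" "tgt f = Y" "tgt g = Y" "W \<in> Ob C"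
  shows "idn W \<star> aadd f g = aadd (idn W \<star> f) (idn W \<star> g)"
proof -
  have [simp]: "X \<in> Ob C" "Y \<in> Ob C" using assms(1,3,5) ok_ob by blast+
  have *: "idn W \<star> h = br Y W \<bullet> (h \<star> idn W) \<bullet> br W X" if "ok h" "src h = X" "tgt h = Y" for h
    using acomp_reassoc2[OF br_nat[of h X Y "idn W" W W], of "br W X"] that by simp
  show ?thesis
    by (simp add: * aadd_tens[where X = X and Y = Y] aadd_comp_left aadd_comp_right)
qed

end


section \<open>Monoids, modules and scalars\<close>

lemma regular_module_sel [simp]: "Und (regular_module A) = MOb A" "Act (regular_module A) = Mult A"
  by (simp_all add: regular_module_def)

context symmetric_monoidal_category
begin

definition mm :: "('o, 'm) cmon \<Rightarrow> ('o, 'm) arrow" where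
  "mm A = Arr (MOb A \<otimes>\<^sub>o MOb A) (Mult A) (MOb A)"

definition ee :: "('o, 'm) cmon \<Rightarrow> ('o, 'm) arrow" where
  "ee A = Arr (UnitOb C) (Eta A) (MOb A)"

definition act :: "('o, 'm) cmon \<Rightarrow> ('o, 'm) modl \<Rightarrow> ('o, 'm) arrow" where
  "act A M = Arr (Und M \<otimes>\<^sub>o MOb A) (Act M) (Und M)"

lemma mm_st [simp]: "src (mm A) = MOb A \<otimes>\<^sub>o MOb A" "tgt (mm A) = MOb A" "raw (mm A) = Mult A"
  by (simp_all add: mm_def)

lemma ee_st [simp]: "src (ee A) = UnitOb C" "tgt (ee A) = MOb A" "raw (ee A) = Eta A"
  by (simp_all add: ee_def)

lemma act_st [simp]: "src (act A M) = Und M \<otimes>\<^sub>o MOb A" "tgt (act A M) = Und M" "raw (act A M) = Act M"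
  by (simp_all add: act_def)

lemma act_regular [simp]: "act A (regular_module A) = mm A"
  by (simp add: act_def mm_def)

lemma raw_struct:
  "raw (idn X) = Idt C X" "raw (al X Y Z) = Assoc C X Y Z" "raw (lu X) = LUnitor C X"
  "raw (ru X) = RUnitor C X" "raw (br X Y) = Braid C X Y"
  by (simp_all add: idn_def al_def lu_def ru_def br_def)

lemma eq_iff_raw:
  "\<lbrakk>ok f; ok g; src f = src g; tgt f = tgt g\<rbrakk> \<Longrightarrow> f = g \<longleftrightarrow> raw f = raw g"
  using arrow_eqI by blast

lemma is_cmonoid_iff:
  "is_cmonoid C A \<longleftrightarrow> MOb A \<in> Ob C \<and> ok (mm A) \<and> ok (ee A) \<and>
     mm A \<bullet> (mm A \<star> idn (MOb A)) = mm A \<bullet> (idn (MOb A) \<star> mm A) \<bullet> al (MOb A) (MOb A) (MOb A) \<and>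
     mm A \<bullet> (ee A \<star> idn (MOb A)) = lu (MOb A) \<and>
     mm A \<bullet> (idn (MOb A) \<star> ee A) = ru (MOb A) \<and>
     mm A \<bullet> br (MOb A) (MOb A) = mm A"
proof (cases "MOb A \<in> Ob C \<and> ok (mm A) \<and> ok (ee A)")
  case True
  then show ?thesis
    unfolding is_cmonoid_def by (simp add: eq_iff_raw raw_struct) (simp add: mm_def ee_def)
next
  case False
  then show ?thesis
    unfolding is_cmonoid_def mm_def ee_def by auto
qed

lemma cmonD:
  assumes "is_cmonoid C A"
  shows "MOb A \<in> Ob C" "ok (mm A)" "ok (ee A)"
    "mm A \<bullet> (mm A \<star> idn (MOb A)) = mm A \<bullet> (idn (MOb A) \<star> mm A) \<bullet> al (MOb A) (MOb A) (MOb A)"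
    "mm A \<bullet> (ee A \<star> idn (MOb A)) = lu (MOb A)"
    "mm A \<bullet> (idn (MOb A) \<star> ee A) = ru (MOb A)"
    "mm A \<bullet> br (MOb A) (MOb A) = mm A"
  using assms unfolding is_cmonoid_iff by blast+

lemma is_module_iff:
  assumes A: "is_cmonoid C A"
  shows "is_module C A M \<longleftrightarrow> Und M \<in> Ob C \<and> ok (act A M) \<and>
     act A M \<bullet> (act A M \<star> idn (MOb A)) = act A M \<bullet> (idn (Und M) \<star> mm A) \<bullet> al (Und M) (MOb A) (MOb A) \<and>
     act A M \<bullet> (idn (Und M) \<star> ee A) = ru (Und M)"
proof (cases "Und M \<in> Ob C \<and> ok (act A M)")
  case True
  then show ?thesis
    unfolding is_module_def using cmonD(1-3)[OF A] by (simp add: eq_iff_raw raw_struct) (simp add: act_def)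
next
  case False
  then show ?thesis
    unfolding is_module_def act_def by auto
qed

lemma modD:
  assumes "is_cmonoid C A" "is_module C A M"
  shows "Und M \<in> Ob C" "ok (act A M)"
    "act A M \<bullet> (act A M \<star> idn (MOb A)) = act A M \<bullet> (idn (Und M) \<star> mm A) \<bullet> al (Und M) (MOb A) (MOb A)"
    "act A M \<bullet> (idn (Und M) \<star> ee A) = ru (Und M)"
  using assms(2) unfolding is_module_iff[OF assms(1)] by blast+

lemma is_module_regular: "is_cmonoid C A \<Longrightarrow> is_module C A (regular_module A)"
  by (simp add: is_module_iff) (simp add: is_cmonoid_iff)

definition chom :: "('o, 'm) cmon \<Rightarrow> ('o, 'm) cmon \<Rightarrow> ('o, 'm) arrow \<Rightarrow> bool" where
  "chom A B f \<longleftrightarrow> is_cmonoid C A \<and> is_cmonoid C B \<and> ar f (MOb A) (MOb B) \<and>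
     f \<bullet> mm A = mm B \<bullet> (f \<star> f) \<and> f \<bullet> ee A = ee B"

definition mhom :: "('o, 'm) cmon \<Rightarrow> ('o, 'm) modl \<Rightarrow> ('o, 'm) modl \<Rightarrow> ('o, 'm) arrow \<Rightarrow> bool" where
  "mhom A M N f \<longleftrightarrow> is_module C A M \<and> is_module C A N \<and> ar f (Und M) (Und N) \<and>
     f \<bullet> act A M = act A N \<bullet> (f \<star> idn (MOb A))"

lemma chomD:
  assumes "chom A B f"
  shows "is_cmonoid C A" "is_cmonoid C B" "ok f" "src f = MOb A" "tgt f = MOb B"
    "f \<bullet> mm A = mm B \<bullet> (f \<star> f)" "f \<bullet> ee A = ee B"
  using assms by (auto simp: chom_def)

lemma mhomD:
  assumes "mhom A M N f"
  shows "is_module C A M" "is_module C A N" "ok f" "src f = Und M" "tgt f = Und N"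
    "f \<bullet> act A M = act A N \<bullet> (f \<star> idn (MOb A))"
  using assms by (auto simp: mhom_def)

lemma Comm_sel [simp]:
  "Ob (Comm C) = {A. is_cmonoid C A}" "Idt (Comm C) A = Idt C (MOb A)" "Cmp (Comm C) = Cmp C"
  by (simp_all add: Comm_def)

lemma Modl_sel [simp]:
  "Ob (Modl C A) = {M. is_module C A M}" "Idt (Modl C A) M = Idt C (Und M)" "Cmp (Modl C A) = Cmp C"
  "Add (Modl C A) = Add C" "Zer (Modl C A) M N = Zer C (Und M) (Und N)"
  by (simp_all add: Modl_def)

lemma hom_Comm: "u \<in> Hom (Comm C) A B \<longleftrightarrow> chom A B (Arr (MOb A) u (MOb B))"
proof (cases "is_cmonoid C A \<and> is_cmonoid C B \<and> u \<in> Hom C (MOb A) (MOb B)")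
  case True
  then show ?thesis
    using cmonD(1-3)[of A] cmonD(1-3)[of B]
    by (simp add: Comm_def chom_def eq_iff_raw)
next
  case False
  then show ?thesis by (auto simp: Comm_def chom_def)
qed

lemma hom_Modl:
  assumes A: "is_cmonoid C A"
  shows "u \<in> Hom (Modl C A) M N \<longleftrightarrow> mhom A M N (Arr (Und M) u (Und N))"
proof (cases "is_module C A M \<and> is_module C A N \<and> u \<in> Hom C (Und M) (Und N)")
  case True
  then show ?thesis
    using cmonD(1-3)[OF A] modD(1,2)[OF A, of M] modD(1,2)[OF A, of N]
    by (simp add: Modl_def mhom_def eq_iff_raw raw_struct)
next
  case False
  then show ?thesis by (auto simp: Modl_def mhom_def)
qed

lemma raw_hom_Comm: "chom A B f \<Longrightarrow> raw f \<in> Hom (Comm C) A B"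
  by (metis hom_Comm ar_Arr_raw chomD(3-5))

lemma raw_hom_Modl: "\<lbrakk>is_cmonoid C A; mhom A M N f\<rbrakk> \<Longrightarrow> raw f \<in> Hom (Modl C A) M N"
  by (metis hom_Modl ar_Arr_raw mhomD(3-5))

lemma chom_comp:
  assumes f: "chom A B f" and g: "chom B D g" shows "chom A D (g \<bullet> f)"
proof -
  note [simp] = chomD(1-5)[OF f] chomD(2-5)[OF g] cmonD(1-3)[OF chomD(1)[OF f]]
    cmonD(1-3)[OF chomD(1)[OF g]] cmonD(1-3)[OF chomD(2)[OF g]]
  show ?thesis
    unfolding chom_def
    using acomp_reassoc2[OF chomD(6)[OF g], of "f \<star> f"] by (simp add: chomD(6)[OF f] chomD(7)[OF f] chomD(7)[OF g])
qed

lemma mhom_comp: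
  assumes A: "is_cmonoid C A" and f: "mhom A M N f" and g: "mhom A N P g" shows "mhom A M P (g \<bullet> f)"
proof -
  note [simp] = mhomD(1-5)[OF f] mhomD(2-5)[OF g] cmonD(1-3)[OF A]
    modD(1,2)[OF A mhomD(1)[OF f]] modD(1,2)[OF A mhomD(1)[OF g]] modD(1,2)[OF A mhomD(2)[OF g]]
  show ?thesis
    unfolding mhom_def
    using acomp_reassoc2[OF mhomD(6)[OF g], of "f \<star> idn (MOb A)"] by (simp add: mhomD(6)[OF f])
qed

lemma chom_idn: "is_cmonoid C A \<Longrightarrow> chom A A (idn (MOb A))"
  using cmonD(1-3)[of A] by (simp add: chom_def)

lemma mhom_idn: "\<lbrakk>is_cmonoid C A; is_module C A M\<rbrakk> \<Longrightarrow> mhom A M M (idn (Und M))"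
  using cmonD(1-3)[of A] modD(1,2)[of A M] by (simp add: mhom_def)

lemma mhom_apow:
  assumes A: "is_cmonoid C A" and t: "mhom A M M t" shows "mhom A M M (apow t n)"
proof (induction n)
  case 0
  then show ?case using mhom_idn[OF A mhomD(1)[OF t]] by (simp add: mhomD(4)[OF t])
next
  case (Suc n)
  then show ?case using mhom_comp[OF A Suc t] by simp
qed

lemma category_Comm: "category (Comm C)"
proof
  show "f \<in> Hom (Comm C) X Y \<Longrightarrow> X \<in> Ob (Comm C) \<and> Y \<in> Ob (Comm C)" for f X Y
    by (simp add: hom_Comm chom_def)
  show "X \<in> Ob (Comm C) \<Longrightarrow> Idt (Comm C) X \<in> Hom (Comm C) X X" for X
    using chom_idn[of X] by (simp add: hom_Comm idn_def)
  show "\<lbrakk>f \<in> Hom (Comm C) X Y; g \<in> Hom (Comm C) Y Z\<rbrakk> \<Longrightarrow> Cmp (Comm C) g f \<in> Hom (Comm C) X Z" for f g X Y Z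
    using chom_comp[of X Y "Arr (MOb X) f (MOb Y)" Z "Arr (MOb Y) g (MOb Z)"]
      chomD(3)[of X Y "Arr (MOb X) f (MOb Y)"] chomD(3)[of Y Z "Arr (MOb Y) g (MOb Z)"]
    by (simp add: hom_Comm Arr_acomp)
  show "f \<in> Hom (Comm C) X Y \<Longrightarrow> Cmp (Comm C) (Idt (Comm C) Y) f = f" for f X Y
    using idt_left by (auto simp: Comm_def)
  show "f \<in> Hom (Comm C) X Y \<Longrightarrow> Cmp (Comm C) f (Idt (Comm C) X) = f" for f X Y
    using idt_right by (auto simp: Comm_def)
  show "\<lbrakk>f \<in> Hom (Comm C) W X; g \<in> Hom (Comm C) X Y; h \<in> Hom (Comm C) Y Z\<rbrakk>
     \<Longrightarrow> Cmp (Comm C) (Cmp (Comm C) h g) f = Cmp (Comm C) h (Cmp (Comm C) g f)" for f g h W X Y Z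
    by (simp add: Comm_def) (metis cmp_assoc)
qed

lemma category_Modl:
  assumes A: "is_cmonoid C A" shows "category (Modl C A)"
proof
  show "f \<in> Hom (Modl C A) X Y \<Longrightarrow> X \<in> Ob (Modl C A) \<and> Y \<in> Ob (Modl C A)" for f X Y
    by (simp add: hom_Modl[OF A] mhom_def)
  show "X \<in> Ob (Modl C A) \<Longrightarrow> Idt (Modl C A) X \<in> Hom (Modl C A) X X" for X
    using mhom_idn[OF A, of X] by (simp add: hom_Modl[OF A] idn_def)
  show "\<lbrakk>f \<in> Hom (Modl C A) X Y; g \<in> Hom (Modl C A) Y Z\<rbrakk>
      \<Longrightarrow> Cmp (Modl C A) g f \<in> Hom (Modl C A) X Z" for f g X Y Z
    using mhom_comp[OF A, of X Y "Arr (Und X) f (Und Y)" Z "Arr (Und Y) g (Und Z)"]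
      mhomD(3)[of A X Y "Arr (Und X) f (Und Y)"] mhomD(3)[of A Y Z "Arr (Und Y) g (Und Z)"]
    by (simp add: hom_Modl[OF A] Arr_acomp)
  show "f \<in> Hom (Modl C A) X Y \<Longrightarrow> Cmp (Modl C A) (Idt (Modl C A) Y) f = f" for f X Y
    using idt_left by (auto simp: Modl_def)
  show "f \<in> Hom (Modl C A) X Y \<Longrightarrow> Cmp (Modl C A) f (Idt (Modl C A) X) = f" for f X Y
    using idt_right by (auto simp: Modl_def)
  show "\<lbrakk>f \<in> Hom (Modl C A) W X; g \<in> Hom (Modl C A) X Y; h \<in> Hom (Modl C A) Y Z\<rbrakk>
     \<Longrightarrow> Cmp (Modl C A) (Cmp (Modl C A) h g) f = Cmp (Modl C A) h (Cmp (Modl C A) g f)" for f g h W X Y Z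
    by (simp add: Modl_def) (metis cmp_assoc)
qed

lemma category_under_Comm: "category (under_cat (Comm C) A)"
proof -
  interpret K: category "Comm C" by (rule category_Comm)
  let ?K = "under_cat (Comm C) A"
  have hom: "h \<in> Hom ?K X Y \<longleftrightarrow> snd X \<in> Hom (Comm C) A (fst X) \<and> snd Y \<in> Hom (Comm C) A (fst Y) \<and>
      h \<in> Hom (Comm C) (fst X) (fst Y) \<and> h \<cdot> snd X = snd Y" for h X Y
    by (cases X; cases Y) (simp add: under_cat_def)
  have ob: "X \<in> Ob ?K \<longleftrightarrow> snd X \<in> Hom (Comm C) A (fst X)" for X
    by (cases X) (simp add: under_cat_def)
  have [simp]: "Idt ?K X = Idt (Comm C) (fst X)" "Cmp ?K = Cmp (Comm C)" for X
    by (simp_all add: under_cat_def split: prod.split)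
  show ?thesis
  proof
    show "f \<in> Hom ?K X Y \<Longrightarrow> X \<in> Ob ?K \<and> Y \<in> Ob ?K" for f X Y
      by (simp add: hom ob)
    show "X \<in> Ob ?K \<Longrightarrow> Idt ?K X \<in> Hom ?K X X" for X
      using K.idt_hom[of "fst X"] K.idt_left[of "snd X" A "fst X"] K.hom_ob[of "snd X" A "fst X"]
      by (simp add: hom ob)
    show "\<lbrakk>f \<in> Hom ?K X Y; g \<in> Hom ?K Y Z\<rbrakk> \<Longrightarrow> Cmp ?K g f \<in> Hom ?K X Z" for f g X Y Z
      using K.cmp_hom[of f "fst X" "fst Y" g "fst Z"]
        K.cmp_assoc[of "snd X" A "fst X" f "fst Y" g "fst Z"]
      by (simp add: hom)
    show "f \<in> Hom ?K X Y \<Longrightarrow> Cmp ?K (Idt ?K Y) f = f" for f X Y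
      using K.idt_left[of f "fst X" "fst Y"] by (simp add: hom)
    show "f \<in> Hom ?K X Y \<Longrightarrow> Cmp ?K f (Idt ?K X) = f" for f X Y
      using K.idt_right[of f "fst X" "fst Y"] by (simp add: hom)
    show "\<lbrakk>f \<in> Hom ?K W X; g \<in> Hom ?K X Y; h \<in> Hom ?K Y Z\<rbrakk>
        \<Longrightarrow> Cmp ?K (Cmp ?K h g) f = Cmp ?K h (Cmp ?K g f)" for f g h W X Y Z
      using K.cmp_assoc[of f "fst W" "fst X" g "fst Y" h "fst Z"] by (simp add: hom)
  qed
qed

text \<open>An arrow x : 1 \<rightarrow> A plays the role of an element of A; this is multiplication
  m \<mapsto> m x on M, the unit being inserted by the inverse of \<open>ru\<close>.\<close>

definition sc :: "('o, 'm) cmon \<Rightarrow> ('o, 'm) modl \<Rightarrow> ('o, 'm) arrow \<Rightarrow> ('o, 'm) arrow" where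
  "sc A M x = act A M \<bullet> (idn (Und M) \<star> x) \<bullet> ainv (ru (Und M))"

lemma sc_simps [simp]:
  assumes "is_cmonoid C A" "is_module C A M" "ok x" "src x = UnitOb C" "tgt x = MOb A"
  shows "ok (sc A M x)" "src (sc A M x) = Und M" "tgt (sc A M x) = Und M"
  using assms modD(1,2)[of A M] by (simp_all add: sc_def)

text \<open>The unit of A provides a section of the action, so the action is a split
  epimorphism.\<close>

lemma act_epi:
  assumes A: "is_cmonoid C A" and M: "is_module C A M"
    and "ok f" "ok g" "src f = Und M" "src g = Und M" "f \<bullet> act A M = g \<bullet> act A M"
  shows "f = g"
proof -
  note [simp] = cmonD(1-3)[OF A] modD(1,2)[OF A M] assms(3-6)
  have *: "act A M \<bullet> (idn (Und M) \<star> ee A) \<bullet> ainv (ru (Und M)) = idn (Und M)"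
    using acomp_reassoc[OF modD(4)[OF A M], of "ainv (ru (Und M))"] by simp
  have "f = (f \<bullet> act A M) \<bullet> (idn (Und M) \<star> ee A) \<bullet> ainv (ru (Und M))"
    by (simp add: *)
  also have "\<dots> = g" by (simp add: assms(7) *)
  finally show ?thesis .
qed

lemma sc_nat:
  assumes A: "is_cmonoid C A" and f: "mhom A M N f" and x [simp]: "ok x" "src x = UnitOb C" "tgt x = MOb A"
  shows "f \<bullet> sc A M x = sc A N x \<bullet> f"
proof -
  note M = mhomD(1)[OF f] and N = mhomD(2)[OF f]
  note [simp] = cmonD(1-3)[OF A] modD(1,2)[OF A M] modD(1,2)[OF A N] mhomD(3-5)[OF f]
  have "f \<bullet> sc A M x = act A N \<bullet> (f \<star> x) \<bullet> ainv (ru (Und M))"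
    using acomp_reassoc2[OF mhomD(6)[OF f], of "(idn (Und M) \<star> x) \<bullet> ainv (ru (Und M))"]
    by (simp add: sc_def)
  also have "\<dots> = sc A N x \<bullet> f"
    using ru_inv_nat[of f "Und M" "Und N"] by (simp add: sc_def)
  finally show ?thesis .
qed

text \<open>Associativity in the form (m a) x = m (a x); \<open>al_ru_inv\<close> takes the inserted
  unit past the associator.\<close>

lemma act_scalar:
  assumes A: "is_cmonoid C A" and M: "is_module C A M"
    and x [simp]: "ok x" "src x = UnitOb C" "tgt x = MOb A"
  shows "sc A M x \<bullet> act A M = act A M \<bullet> (idn (Und M) \<star> sc A (regular_module A) x)"
proof -
  let ?M = "Und M" and ?A = "MOb A" and ?u = "UnitOb C"
  note [simp] = cmonD(1-3)[OF A] modD(1,2)[OF A M]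
  have "sc A M x \<bullet> act A M = act A M \<bullet> (idn ?M \<star> x) \<bullet> (act A M \<star> idn ?u) \<bullet> ainv (ru (?M \<otimes>\<^sub>o ?A))"
    using ru_inv_nat[of "act A M" "?M \<otimes>\<^sub>o ?A" ?M] by (simp add: sc_def)
  also have "\<dots> = (act A M \<bullet> (act A M \<star> idn ?A)) \<bullet> (idn (?M \<otimes>\<^sub>o ?A) \<star> x) \<bullet> ainv (ru (?M \<otimes>\<^sub>o ?A))"
    by simp
  also have "\<dots> = act A M \<bullet> (idn ?M \<star> mm A) \<bullet> (al ?M ?A ?A \<bullet> ((idn ?M \<star> idn ?A) \<star> x)) \<bullet> ainv (ru (?M \<otimes>\<^sub>o ?A))"
    by (simp only: modD(3)[OF A M]) simp
  also have "al ?M ?A ?A \<bullet> ((idn ?M \<star> idn ?A) \<star> x) = (idn ?M \<star> (idn ?A \<star> x)) \<bullet> al ?M ?A ?u"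
    by (rule al_nat) auto
  finally show ?thesis
    by (simp add: al_ru_inv sc_def)
qed

text \<open>Commutativity of A turns linearity in the left factor into linearity in the right
  one.\<close>

lemma mm_flip:
  assumes A: "is_cmonoid C A" and f [simp]: "ok f" "src f = MOb A" "tgt f = MOb A"
    and fm: "f \<bullet> mm A = mm A \<bullet> (f \<star> idn (MOb A))"
  shows "f \<bullet> mm A = mm A \<bullet> (idn (MOb A) \<star> f)"
proof -
  let ?A = "MOb A"
  note [simp] = cmonD(1-3)[OF A]
  have "mm A \<bullet> (idn ?A \<star> f) = mm A \<bullet> br ?A ?A \<bullet> (idn ?A \<star> f)"
    using acomp_reassoc[OF cmonD(7)[OF A]] by simp
  also have "br ?A ?A \<bullet> (idn ?A \<star> f) = (f \<star> idn ?A) \<bullet> br ?A ?A"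
    by (rule br_nat) auto
  also have "mm A \<bullet> (f \<star> idn ?A) \<bullet> br ?A ?A = f \<bullet> mm A \<bullet> br ?A ?A"
    using acomp_reassoc2[OF fm] by simp
  also have "\<dots> = f \<bullet> mm A" by (simp add: cmonD(7)[OF A])
  finally show ?thesis by simp
qed

text \<open>The elements of \<E>(A) in typed form.\<close>

abbreviation rend :: "('o, 'm) cmon \<Rightarrow> ('o, 'm) arrow \<Rightarrow> bool" where
  "rend A r \<equiv> mhom A (regular_module A) (regular_module A) r"

lemma rendD:
  assumes "is_cmonoid C A" "rend A r"
  shows "ok r" "src r = MOb A" "tgt r = MOb A"
    "r \<bullet> mm A = mm A \<bullet> (r \<star> idn (MOb A))" "r \<bullet> mm A = mm A \<bullet> (idn (MOb A) \<star> r)"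
proof -
  note r = mhomD[OF assms(2), simplified]
  show "ok r" "src r = MOb A" "tgt r = MOb A" "r \<bullet> mm A = mm A \<bullet> (r \<star> idn (MOb A))" by fact+
  show "r \<bullet> mm A = mm A \<bullet> (idn (MOb A) \<star> r)"
    by (rule mm_flip[OF assms(1) r(3-6)])
qed

text \<open>An endomorphism is determined by its value at the unit, r a = r (a 1) = a (r 1). Hence
  \<E>(A) consists of multiplications by elements 1 \<rightarrow> A.\<close>

lemma sc_regular:
  assumes A: "is_cmonoid C A" and r: "rend A r"
  shows "sc A (regular_module A) (r \<bullet> ee A) = r"
proof -
  let ?A = "MOb A"
  note [simp] = cmonD(1-3)[OF A] rendD(1-3)[OF A r]
  have "sc A (regular_module A) (r \<bullet> ee A) = mm A \<bullet> (idn ?A \<star> r) \<bullet> (idn ?A \<star> ee A) \<bullet> ainv (ru ?A)"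
    by (simp add: sc_def)
  also have "\<dots> = r \<bullet> mm A \<bullet> (idn ?A \<star> ee A) \<bullet> ainv (ru ?A)"
    by (rule acomp_reassoc2[OF rendD(5)[OF A r], symmetric])
  also have "\<dots> = r \<bullet> ru ?A \<bullet> ainv (ru ?A)"
    by (simp only: acomp_reassoc[OF cmonD(6)[OF A]])
  also have "\<dots> = r" by simp
  finally show ?thesis .
qed

text \<open>The action of \<E>(A) on an arbitrary module: r acts as multiplication by the element r
  1.\<close>

definition smul :: "('o, 'm) cmon \<Rightarrow> ('o, 'm) modl \<Rightarrow> ('o, 'm) arrow \<Rightarrow> ('o, 'm) arrow" where
  "smul A M r = sc A M (r \<bullet> ee A)"

lemma smul_simps [simp]:
  assumes "is_cmonoid C A" "is_module C A M" "rend A r"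
  shows "ok (smul A M r)" "src (smul A M r) = Und M" "tgt (smul A M r) = Und M"
  using assms cmonD(1-3)[of A] rendD(1-3)[of A r] by (simp_all add: smul_def)

lemma smul_act:
  assumes A: "is_cmonoid C A" and M: "is_module C A M" and r: "rend A r"
  shows "smul A M r \<bullet> act A M = act A M \<bullet> (idn (Und M) \<star> r)"
  using act_scalar[OF A M, of "r \<bullet> ee A"] sc_regular[OF A r] cmonD(1-3)[OF A] rendD(1-3)[OF A r]
  by (simp add: smul_def)

lemma smul_regular:
  assumes "is_cmonoid C A" "rend A r" shows "smul A (regular_module A) r = r"
  using sc_regular assms by (simp add: smul_def)

lemma smul_nat:
  assumes A: "is_cmonoid C A" and f: "mhom A M N f" and r: "rend A r"
  shows "f \<bullet> smul A M r = smul A N r \<bullet> f"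
  using sc_nat[OF A f] cmonD(1-3)[OF A] rendD(1-3)[OF A r] by (simp add: smul_def)

text \<open>The rule m a \<mapsto> m (r a) pins the endomorphism down because the action is epic;
  compatibility of \<open>smul\<close> with composition, units and sums is read off from it.\<close>

lemma smul_unique:
  assumes A: "is_cmonoid C A" and M: "is_module C A M" and r: "rend A r"
    and "ok f" "src f = Und M" "f \<bullet> act A M = act A M \<bullet> (idn (Und M) \<star> r)"
  shows "f = smul A M r"
  by (rule act_epi[OF A M]) (use assms in \<open>simp_all add: smul_act\<close>)

lemma smul_comp:
  assumes A: "is_cmonoid C A" and M: "is_module C A M" and r: "rend A r" and s: "rend A s"
  shows "smul A M (r \<bullet> s) = smul A M r \<bullet> smul A M s"
proof (rule smul_unique[symmetric, OF A M mhom_comp[OF A s r]])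
  note [simp] = cmonD(1-3)[OF A] modD(1,2)[OF A M] rendD(1-3)[OF A r] rendD(1-3)[OF A s]
    smul_simps[OF A M r] smul_simps[OF A M s]
  show "(smul A M r \<bullet> smul A M s) \<bullet> act A M = act A M \<bullet> (idn (Und M) \<star> (r \<bullet> s))"
    using acomp_reassoc2[OF smul_act[OF A M r], of "idn (Und M) \<star> s"]
    by (simp add: smul_act[OF A M s])
qed (use assms in simp_all)

lemma smul_idn:
  assumes A: "is_cmonoid C A" and M: "is_module C A M" shows "smul A M (idn (MOb A)) = idn (Und M)"
proof -
  have "rend A (idn (MOb A))" using mhom_idn[OF A is_module_regular[OF A]] by simp
  from smul_unique[symmetric, OF A M this] show ?thesis
    using cmonD(1-3)[OF A] modD(1,2)[OF A M] by simp
qed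

text \<open>The map m a \<mapsto> m (r a) commutes with a further factor b because r (a b) = (r a)
  b. The comparison takes place on (M \<otimes> A) \<otimes> A, where associativity of the action
  applies.\<close>

lemma smul_mhom:
  assumes A: "is_cmonoid C A" and M: "is_module C A M" and r: "rend A r"
  shows "mhom A M M (smul A M r)"
proof -
  let ?M = "Und M" and ?A = "MOb A"
  note [simp] = cmonD(1-3)[OF A] modD(1,2)[OF A M] rendD(1-3)[OF A r] smul_simps[OF A M r]
  note sa = smul_act[OF A M r] and aa = modD(3)[OF A M]
  have [simp]: "ok (act A M \<star> idn ?A)" by simp
  have "(smul A M r \<bullet> act A M) \<bullet> (act A M \<star> idn ?A) = smul A M r \<bullet> act A M \<bullet> (idn ?M \<star> mm A) \<bullet> al ?M ?A ?A"
    using aa by simp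
  also have "\<dots> = act A M \<bullet> (idn ?M \<star> (r \<bullet> mm A)) \<bullet> al ?M ?A ?A"
    using acomp_reassoc2[OF sa, of "(idn ?M \<star> mm A) \<bullet> al ?M ?A ?A"] by simp
  also have "\<dots> = act A M \<bullet> (idn ?M \<star> mm A) \<bullet> (idn ?M \<star> (r \<star> idn ?A)) \<bullet> al ?M ?A ?A"
    by (simp add: rendD(4)[OF A r])
  also have "(idn ?M \<star> (r \<star> idn ?A)) \<bullet> al ?M ?A ?A = al ?M ?A ?A \<bullet> ((idn ?M \<star> r) \<star> idn ?A)"
    by (rule al_nat[symmetric]) auto
  also have "act A M \<bullet> (idn ?M \<star> mm A) \<bullet> al ?M ?A ?A \<bullet> ((idn ?M \<star> r) \<star> idn ?A)
      = act A M \<bullet> (act A M \<star> idn ?A) \<bullet> ((idn ?M \<star> r) \<star> idn ?A)"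
    using acomp_reassoc2[OF aa, of "(idn ?M \<star> r) \<star> idn ?A"] by simp
  also have "\<dots> = (act A M \<bullet> (smul A M r \<star> idn ?A)) \<bullet> (act A M \<star> idn ?A)"
    by (simp add: sa)
  finally have *: "(smul A M r \<bullet> act A M) \<bullet> (act A M \<star> idn ?A)
      = (act A M \<bullet> (smul A M r \<star> idn ?A)) \<bullet> (act A M \<star> idn ?A)" .
  \<comment> \<open>By the unit law the action tensored with A has a section, so it can be cancelled
    from \<open>*\<close>.\<close>
  have u: "(act A M \<star> idn ?A) \<bullet> (((idn ?M \<star> ee A) \<bullet> ainv (ru ?M)) \<star> idn ?A) = idn (?M \<otimes>\<^sub>o ?A)"
    using acomp_reassoc[OF modD(4)[OF A M], of "ainv (ru ?M)"] by simp
  have "smul A M r \<bullet> act A M = act A M \<bullet> (smul A M r \<star> idn ?A)"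
    using acomp_reassoc[OF *, of "((idn ?M \<star> ee A) \<bullet> ainv (ru ?M)) \<star> idn ?A"] u
    by (simp del: interchange interchange_reassoc)
  then show ?thesis
    using M by (simp add: mhom_def)
qed

text \<open>\<open>restrict_scalars\<close> treats only B itself; here every B-module is viewed as
  an A-module along g.\<close>

definition rmod :: "('o, 'm) cmon \<Rightarrow> ('o, 'm) arrow \<Rightarrow> ('o, 'm) modl \<Rightarrow> ('o, 'm) modl" where
  "rmod B g N = \<lparr>Und = Und N, Act = raw (act B N \<bullet> (idn (Und N) \<star> g))\<rparr>"

lemma Und_rmod [simp]: "Und (rmod B g N) = Und N"
  by (simp add: rmod_def)

lemma act_rmod:
  assumes g: "chom A B g" and N: "is_module C B N"
  shows "act A (rmod B g N) = act B N \<bullet> (idn (Und N) \<star> g)"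
proof -
  note [simp] = chomD(3-5)[OF g] modD(1,2)[OF chomD(2)[OF g] N]
  have "ar (act B N \<bullet> (idn (Und N) \<star> g)) (Und N \<otimes>\<^sub>o MOb A) (Und N)" by simp
  from ar_Arr_raw[OF this] show ?thesis by (simp add: act_def rmod_def)
qed

lemma is_module_rmod:
  assumes g: "chom A B g" and N: "is_module C B N"
  shows "is_module C A (rmod B g N)"
proof -
  let ?N = "Und N" and ?A = "MOb A" and ?B = "MOb B"
  note AB = chomD(1,2)[OF g]
  note [simp] = chomD(3-5)[OF g] modD(1,2)[OF AB(2) N] cmonD(1-3)[OF AB(1)] cmonD(1-3)[OF AB(2)]
  note a = act_rmod[OF g N]
  have "act A (rmod B g N) \<bullet> (act A (rmod B g N) \<star> idn ?A)
      = (act B N \<bullet> (act B N \<star> idn ?B)) \<bullet> ((idn ?N \<star> g) \<star> g)"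
    by (simp add: a)
  also have "\<dots> = act B N \<bullet> (idn ?N \<star> mm B) \<bullet> al ?N ?B ?B \<bullet> ((idn ?N \<star> g) \<star> g)"
    by (simp only: modD(3)[OF AB(2) N]) simp
  also have "al ?N ?B ?B \<bullet> ((idn ?N \<star> g) \<star> g) = (idn ?N \<star> (g \<star> g)) \<bullet> al ?N ?A ?A"
    by (rule al_nat) auto
  also have "act B N \<bullet> (idn ?N \<star> mm B) \<bullet> (idn ?N \<star> (g \<star> g)) \<bullet> al ?N ?A ?A
      = act A (rmod B g N) \<bullet> (idn ?N \<star> mm A) \<bullet> al ?N ?A ?A"
    by (simp add: a chomD(6)[OF g])
  finally show ?thesis
    unfolding is_module_iff[OF AB(1)]
    by (simp add: a chomD(7)[OF g] modD(4)[OF AB(2) N])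
qed

lemma rmod_regular:
  assumes g: "chom A B g" shows "rmod B g (regular_module B) = restrict_scalars C B (raw g)"
  using chomD(3-5)[OF g] cmonD(1-3)[OF chomD(2)[OF g]]
  by (simp add: rmod_def restrict_scalars_def raw_struct)

lemma sc_rmod:
  assumes g: "chom A B g" and N: "is_module C B N" and x: "ok x" "src x = UnitOb C" "tgt x = MOb A"
  shows "sc A (rmod B g N) x = sc B N (g \<bullet> x)"
  using chomD(3-5)[OF g] modD(1,2)[OF chomD(2)[OF g] N] x
  by (simp add: sc_def act_rmod[OF g N])

lemma mhom_rmod:
  assumes g: "chom A B g" and f: "mhom B M N f"
  shows "mhom A (rmod B g M) (rmod B g N) f"
proof -
  note M = mhomD(1)[OF f] and N = mhomD(2)[OF f]
  note [simp] = chomD(3-5)[OF g] modD(1,2)[OF chomD(2)[OF g] M] modD(1,2)[OF chomD(2)[OF g] N]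
    cmonD(1-3)[OF chomD(1)[OF g]] cmonD(1-3)[OF chomD(2)[OF g]] mhomD(3-5)[OF f]
  show ?thesis
    using is_module_rmod[OF g M] is_module_rmod[OF g N]
      acomp_reassoc2[OF mhomD(6)[OF f], of "idn (Und M) \<star> g"]
    by (simp add: mhom_def act_rmod[OF g M] act_rmod[OF g N])
qed

lemma mhom_of_chom:
  assumes g: "chom A B g"
  shows "mhom A (regular_module A) (rmod B g (regular_module B)) g"
proof -
  note [simp] = chomD(3-5)[OF g] cmonD(1-3)[OF chomD(1)[OF g]] cmonD(1-3)[OF chomD(2)[OF g]]
  note B = is_module_regular[OF chomD(2)[OF g]]
  show ?thesis
    using is_module_rmod[OF g B] is_module_regular[OF chomD(1)[OF g]]
    by (simp add: mhom_def act_rmod[OF g B] chomD(6)[OF g])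
qed

end

section \<open>Zero modules, sums of linear maps and telescopes of modules\<close>

context ag_base
begin

lemma mhom_zer:
  assumes A: "is_cmonoid C A" and M: "is_module C A M" and N: "is_module C A N"
  shows "mhom A M N (zer (Und M) (Und N))"
  using M N modD(1,2)[OF A M] modD(1,2)[OF A N] cmonD(1)[OF A]
  by (simp add: mhom_def zer_tens)

lemma mhom_aadd:
  assumes A: "is_cmonoid C A" and f: "mhom A M N f" and g: "mhom A M N g"
  shows "mhom A M N (aadd f g)"
proof -
  note [simp] = cmonD(1)[OF A] mhomD(1-5)[OF f] mhomD(1-5)[OF g]
    modD(1,2)[OF A mhomD(1)[OF f]] modD(1,2)[OF A mhomD(2)[OF f]]
  show ?thesis
    by (simp add: mhom_def aadd_comp_left aadd_comp_right mhomD(6)[OF f] mhomD(6)[OF g]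
        aadd_tens[where X = "Und M" and Y = "Und N"])
qed

lemma smul_aadd:
  assumes A: "is_cmonoid C A" and M: "is_module C A M" and r: "rend A r" and s: "rend A s"
  shows "smul A M (aadd r s) = aadd (smul A M r) (smul A M s)"
proof (rule smul_unique[symmetric, OF A M mhom_aadd[OF A r s]])
  note [simp] = cmonD(1-3)[OF A] modD(1,2)[OF A M] rendD(1-3)[OF A r] rendD(1-3)[OF A s]
    smul_simps[OF A M r] smul_simps[OF A M s]
  show "aadd (smul A M r) (smul A M s) \<bullet> act A M = act A M \<bullet> (idn (Und M) \<star> aadd r s)"
    by (simp add: aadd_comp_left aadd_comp_right smul_act[OF A M r] smul_act[OF A M s]
        aadd_tens_left[where X = "MOb A" and Y = "MOb A"])
qed (use assms in simp_all)

text \<open>Zero arrows of C are linear because the tensor product preserves them, so zero objects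
  among modules are recognised by their identity alone.\<close>

lemma is_zero_ob_Modl:
  assumes A: "is_cmonoid C A"
  shows "is_zero_ob (Modl C A) M \<longleftrightarrow> is_module C A M \<and> idn (Und M) = zer (Und M) (Und M)"
proof (intro iffI conjI)
  assume Z: "is_zero_ob (Modl C A) M"
  then show M: "is_module C A M" by (simp add: is_zero_ob_def)
  have "raw (idn (Und M)) = raw (zer (Und M) (Und M))"
    using Z M raw_hom_Modl[OF A mhom_idn[OF A M]] raw_hom_Modl[OF A mhom_zer[OF A M M]]
    unfolding is_zero_ob_def by (metis Modl_sel(1) mem_Collect_eq)
  then show "idn (Und M) = zer (Und M) (Und M)"
    using modD(1)[OF A M] by (intro arrow_eqI) simp_all
next
  assume *: "is_module C A M \<and> idn (Und M) = zer (Und M) (Und M)"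
  then have M: "is_module C A M" and z: "idn (Und M) = zer (Und M) (Und M)" by auto
  note [simp] = modD(1)[OF A M]
  have 1: "f = zer (Und N) (Und M)" if "mhom A N M f" for f N
  proof -
    note [simp] = mhomD(3-5)[OF that] modD(1)[OF A mhomD(1)[OF that]]
    have "f = idn (Und M) \<bullet> f" by simp
    also have "\<dots> = zer (Und N) (Und M)" by (simp only: z) simp
    finally show ?thesis .
  qed
  have 2: "f = zer (Und M) (Und N)" if "mhom A M N f" for f N
  proof -
    note [simp] = mhomD(3-5)[OF that] modD(1)[OF A mhomD(2)[OF that]]
    have "f = f \<bullet> idn (Und M)" by simp
    also have "\<dots> = zer (Und M) (Und N)" by (simp only: z) simp
    finally show ?thesis .
  qed
  show "is_zero_ob (Modl C A) M"
    unfolding is_zero_ob_def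
  proof (intro conjI ballI)
    show "M \<in> Ob (Modl C A)" using M by simp
    fix N assume "N \<in> Ob (Modl C A)"
    then have N: "is_module C A N" by simp
    show "\<exists>!f. f \<in> Hom (Modl C A) N M"
      using raw_hom_Modl[OF A mhom_zer[OF A N M]] 1[of N] hom_Modl[OF A] by (metis arrow.sel(2))
    show "\<exists>!f. f \<in> Hom (Modl C A) M N"
      using raw_hom_Modl[OF A mhom_zer[OF A M N]] 2[of N] hom_Modl[OF A] by (metis arrow.sel(2))
  qed
qed

text \<open>For the regular module this is \<open>mult_sequence\<close>; general modules occur in
  base change.\<close>

definition mseq :: "('o, 'm) modl \<Rightarrow> ('o, 'm) arrow \<Rightarrow> (nat, unit, ('o, 'm) modl, 'm) ftor" where
  "mseq M t = \<lparr>FOb = (\<lambda>_. M), FAr = (\<lambda>m n _. raw (apow t (n - m)))\<rparr>"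

text \<open>Tensoring with A preserves the telescope, so compatibility with the actions can be
  tested on the stages.\<close>

lemma tel_linear:
  assumes A: "is_cmonoid C A" and t: "tel t (Und L) e" and e: "\<And>n. mhom A M L (e n)"
    and h: "ok h" "src h = Und L" "tgt h = Und Z" and d: "\<And>n. mhom A M Z (h \<bullet> e n)"
  shows "mhom A L Z h"
proof -
  note M = mhomD(1)[OF e] and L = mhomD(2)[OF e] and Z = mhomD(2)[OF d]
  note [simp] = cmonD(1)[OF A] modD(1,2)[OF A M] modD(1,2)[OF A L] modD(1,2)[OF A Z] mhomD(3-5)[OF e] h
  have "h \<bullet> act A L = act A Z \<bullet> (h \<star> idn (MOb A))"
  proof (rule tel_eqI[OF tel_tens_right[OF t cmonD(1)[OF A]]])
    fix n
    have "act A L \<bullet> (e n \<star> idn (MOb A)) = e n \<bullet> act A M"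
      by (rule mhomD(6)[OF e, symmetric])
    then show "(h \<bullet> act A L) \<bullet> (e n \<star> idn (MOb A)) = (act A Z \<bullet> (h \<star> idn (MOb A))) \<bullet> (e n \<star> idn (MOb A))"
      using mhomD(6)[OF d[of n]] by simp
  qed simp_all
  then show ?thesis using L Z by (simp add: mhom_def)
qed

lemma is_ftor_mseq:
  assumes A: "is_cmonoid C A" and t: "mhom A M M t"
  shows "is_ftor nat_cat (Modl C A) (mseq M t)"
proof -
  note [simp] = mhomD(3-5)[OF t] mhomD(1)[OF t]
  have "raw (apow t (k - i)) = raw (apow t (k - j)) \<cdot> raw (apow t (j - i))" if "i \<le> j" "j \<le> k" for i j k
  proof -
    have "k - i = (k - j) + (j - i)" using that by simp
    then have "apow t (k - i) = apow t (k - j) \<bullet> apow t (j - i)"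
      using apow_add[of t "k - j" "j - i"] by simp
    then show ?thesis by simp
  qed
  note * = this
  show ?thesis
    unfolding is_ftor_def
  proof (intro conjI allI ballI)
    show "FAr (mseq M t) i k (v \<cdot>\<^bsub>nat_cat\<^esub> u) = FAr (mseq M t) j k v \<cdot>\<^bsub>Modl C A\<^esub> FAr (mseq M t) i j u"
      if "u \<in> Hom nat_cat i j" "v \<in> Hom nat_cat j k" for i j k u v
      using *[of i j k] that by (simp add: mseq_def)
    show "FAr (mseq M t) i j u \<in> Hom (Modl C A) (FOb (mseq M t) i) (FOb (mseq M t) j)" for i j u
      using raw_hom_Modl[OF A mhom_apow[OF A t]] by (simp add: mseq_def)
  qed (simp_all add: mseq_def raw_struct)
qed

lemma is_cocone_mseq:
  assumes A: "is_cmonoid C A" and t: "mhom A M M t"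
  shows "is_cocone nat_cat (Modl C A) (mseq M t) Z d \<longleftrightarrow> is_module C A Z \<and>
    (\<forall>n. mhom A M Z (Arr (Und M) (d n) (Und Z))) \<and>
    (\<forall>n. Arr (Und M) (d (Suc n)) (Und Z) \<bullet> t = Arr (Und M) (d n) (Und Z))"
proof -
  note [simp] = mhomD(1-5)[OF t]
  let ?d = "\<lambda>n. Arr (Und M) (d n) (Und Z)"
  have "(\<forall>m n. \<forall>u\<in>Hom nat_cat m n. d n \<cdot> raw (apow t (n - m)) = d m) \<longleftrightarrow> (\<forall>n. ?d (Suc n) \<bullet> t = ?d n)"
    if Z: "is_module C A Z" and d: "\<And>n. mhom A M Z (?d n)"
  proof -
    have dn [simp]: "d n \<in> Hom C (Und M) (Und Z)" for n using mhomD(3)[OF d] by simp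
    have "(\<forall>m n. \<forall>u\<in>Hom nat_cat m n. d n \<cdot> raw (apow t (n - m)) = d m)
        \<longleftrightarrow> (\<forall>m n. \<forall>u\<in>Hom nat_cat m n. ?d n \<bullet> apow t (n - m) = ?d m)"
      by (simp add: eq_iff_raw)
    also have "\<dots> \<longleftrightarrow> tcocone nat_cat (\<lambda>_. src t) (\<lambda>m n _. apow t (n - m)) (Und Z) ?d"
      using modD(1)[OF A Z] by (simp add: tcocone_def)
    also have "\<dots> \<longleftrightarrow> (\<forall>n. ?d (Suc n) \<bullet> t = ?d n)"
      using tel_cocone[of t "Und Z" ?d] modD(1)[OF A Z] by simp
    finally show ?thesis .
  qed
  moreover have "(\<forall>n. d n \<in> Hom (Modl C A) M Z) \<longleftrightarrow> (\<forall>n. mhom A M Z (?d n))"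
    by (simp add: hom_Modl[OF A])
  ultimately show ?thesis
    unfolding is_cocone_def by (auto simp: mseq_def)
qed

text \<open>The forgetful functor to C reflects this kind of colimit: the factorisation exists in C,
  and \<open>tel_linear\<close> makes it linear.\<close>

lemma is_colimit_mseq:
  assumes A: "is_cmonoid C A" and t: "mhom A M M t"
    and L: "tel t (Und L) e" and e: "\<And>n. mhom A M L (e n)"
  shows "is_colimit nat_cat (Modl C A) (mseq M t) L (\<lambda>n. raw (e n))"
proof -
  have Lm: "is_module C A L" by (rule mhomD(2)[OF e])
  have e_raw: "Arr (Und M) (raw (e n)) (Und L) = e n" for n
    using mhomD(3-5)[OF e] by (intro ar_Arr_raw) simp
  show ?thesis
    unfolding is_colimit_def
  proof (intro conjI allI impI)
    show "is_cocone nat_cat (Modl C A) (mseq M t) L (\<lambda>n. raw (e n))"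
      using telD(7)[OF L] by (simp add: is_cocone_mseq[OF A t] e_raw e Lm)
    fix Z d assume "is_cocone nat_cat (Modl C A) (mseq M t) Z d"
    then have Z: "is_module C A Z" and d: "\<And>n. mhom A M Z (Arr (Und M) (d n) (Und Z))"
      and dt: "\<And>n. Arr (Und M) (d (Suc n)) (Und Z) \<bullet> t = Arr (Und M) (d n) (Und Z)"
      by (auto simp: is_cocone_mseq[OF A t])
    obtain h where h: "ok h" "src h = Und L" "tgt h = Und Z" "\<And>n. h \<bullet> e n = Arr (Und M) (d n) (Und Z)"
      using tel_factor[OF L, of "\<lambda>n. Arr (Und M) (d n) (Und Z)" "Und Z"] mhomD(3)[OF d] dt mhomD(4)[OF t]
      by auto
    have hm: "mhom A L Z h"
      using tel_linear[OF A L e h(1-3)] d by (simp add: h(4))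
    show "\<exists>!h. h \<in> Hom (Modl C A) L Z \<and> (\<forall>i\<in>Ob nat_cat. h \<cdot>\<^bsub>Modl C A\<^esub> raw (e i) = d i)"
    proof (rule ex1I[of _ "raw h"])
      have "raw h \<cdot> raw (e n) = d n" for n
        using ok_acomp(4)[of "e n" h] mhomD(3-5)[OF e] h by simp
      then show "raw h \<in> Hom (Modl C A) L Z \<and> (\<forall>i\<in>Ob nat_cat. raw h \<cdot>\<^bsub>Modl C A\<^esub> raw (e i) = d i)"
        using raw_hom_Modl[OF A hm] by simp
    next
      fix k assume k: "k \<in> Hom (Modl C A) L Z \<and> (\<forall>i\<in>Ob nat_cat. k \<cdot>\<^bsub>Modl C A\<^esub> raw (e i) = d i)"
      then have km: "mhom A L Z (Arr (Und L) k (Und Z))" by (simp add: hom_Modl[OF A])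
      have "Arr (Und L) k (Und Z) = h"
      proof (rule tel_eqI[OF L])
        show "Arr (Und L) k (Und Z) \<bullet> e n = h \<bullet> e n" for n
          using k mhomD(3)[OF km] mhomD(3-5)[OF e] d[THEN mhomD(3)] by (simp add: eq_iff_raw h(4))
      qed (use mhomD(3)[OF km] h in simp_all)
      then show "k = raw h" by auto
    qed
  qed
qed

end


section \<open>Localisation\<close>

lemma (in category) is_colimit_unique:
  assumes J: "category J" and D: "is_ftor J C D"
    and L: "is_colimit J C D L e" and M: "is_colimit J C D M d"
  shows "\<exists>h k. h \<in> Hom C L M \<and> k \<in> Hom C M L \<and> k \<cdot> h = Idt C L \<and> h \<cdot> k = Idt C M \<and>
    (\<forall>i\<in>Ob J. h \<cdot> e i = d i)"
proof -
  have fac: "\<exists>!h. h \<in> Hom C P Q \<and> (\<forall>i\<in>Ob J. h \<cdot> a i = b i)"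
    if "is_colimit J C D P a" "is_cocone J C D Q b" for P Q a b
    using that by (simp add: is_colimit_def)
  have co: "is_cocone J C D L e" "is_cocone J C D M d"
    using L M by (simp_all add: is_colimit_def)
  have e: "e i \<in> Hom C (FOb D i) L" and d: "d i \<in> Hom C (FOb D i) M" if "i \<in> Ob J" for i
    using that co by (simp_all add: is_cocone_def)
  have LM: "L \<in> Ob C" "M \<in> Ob C" using co by (simp_all add: is_cocone_def)
  obtain h where h: "h \<in> Hom C L M" "\<And>i. i \<in> Ob J \<Longrightarrow> h \<cdot> e i = d i"
    using fac[OF L co(2)] by blast
  obtain k where k: "k \<in> Hom C M L" "\<And>i. i \<in> Ob J \<Longrightarrow> k \<cdot> d i = e i"
    using fac[OF M co(1)] by blast
  have "k \<cdot> h = Idt C L"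
  proof -
    have "(k \<cdot> h) \<cdot> e i = e i" if "i \<in> Ob J" for i
      using that h k by (simp add: cmp_assoc[OF e[OF that] h(1) k(1)])
    then have "k \<cdot> h \<in> Hom C L L \<and> (\<forall>i\<in>Ob J. (k \<cdot> h) \<cdot> e i = e i)"
      using cmp_hom[OF h(1) k(1)] by blast
    moreover have "Idt C L \<in> Hom C L L \<and> (\<forall>i\<in>Ob J. Idt C L \<cdot> e i = e i)"
      using idt_hom[OF LM(1)] idt_left[OF e] by blast
    ultimately show ?thesis using fac[OF L co(1)] by blast
  qed
  moreover have "h \<cdot> k = Idt C M"
  proof -
    have "(h \<cdot> k) \<cdot> d i = d i" if "i \<in> Ob J" for i
      using that h k by (simp add: cmp_assoc[OF d[OF that] k(1) h(1)])
    then have "h \<cdot> k \<in> Hom C M M \<and> (\<forall>i\<in>Ob J. (h \<cdot> k) \<cdot> d i = d i)"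
      using cmp_hom[OF k(1) h(1)] by blast
    moreover have "Idt C M \<in> Hom C M M \<and> (\<forall>i\<in>Ob J. Idt C M \<cdot> d i = d i)"
      using idt_hom[OF LM(2)] idt_left[OF d] by blast
    ultimately show ?thesis using fac[OF M co(2)] by blast
  qed
  ultimately show ?thesis using h k by blast
qed

section \<open>Existence of the localisation and its uniqueness as a colimit\<close>

context ag_base
begin

lemma rend_apow:
  assumes A: "is_cmonoid C A" and t: "rend A t" shows "rend A (apow t n)"
  by (rule mhom_apow[OF A t])

text \<open>Linearity in either factor pulls the powers out of the product one after the
  other.\<close>

lemma mm_apow:
  assumes A: "is_cmonoid C A" and t: "rend A t"
  shows "mm A \<bullet> (apow t k \<star> apow t l) = apow t (k + l) \<bullet> mm A"
proof -
  note tk = rendD[OF A rend_apow[OF A t, of k]] and tl = rendD[OF A rend_apow[OF A t, of l]]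
  note [simp] = tk(1-3) tl(1-3) cmonD(1-3)[OF A] rendD(1-3)[OF A t]
  have "mm A \<bullet> (apow t k \<star> apow t l) = mm A \<bullet> (apow t k \<star> idn (MOb A)) \<bullet> (idn (MOb A) \<star> apow t l)"
    by simp
  also have "\<dots> = apow t k \<bullet> mm A \<bullet> (idn (MOb A) \<star> apow t l)"
    by (rule acomp_reassoc2[OF tk(4)[symmetric]])
  also have "\<dots> = apow t k \<bullet> apow t l \<bullet> mm A"
    by (simp only: tl(5))
  finally show ?thesis by (simp add: apow_add)
qed

text \<open>The ring power appends its factor on the right, \<open>apow\<close> on the left; the
  orders agree because powers of t commute with t.\<close>

lemma E_ring_pow:
  assumes A: "is_cmonoid C A" and t: "rend A t"
  shows "raw t [^]\<^bsub>E_ring C A\<^esub> n = raw (apow t n)"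
proof (induction n)
  case 0
  then show ?case using rendD[OF A t] by (simp add: E_ring_def end_ring_def nat_pow_def raw_struct)
next
  case (Suc n)
  have "raw t [^]\<^bsub>E_ring C A\<^esub> (Suc n) = raw (apow t n) \<cdot> raw t"
    using Suc by (simp add: nat_pow_def) (simp add: E_ring_def end_ring_def)
  also have "\<dots> = raw (apow t n \<bullet> t)"
    using rendD[OF A t] by simp
  finally show ?case using rendD(1-3)[OF A t] by (simp only: apow_Suc2 apow.simps)
qed

lemma mult_sequence_mseq:
  assumes "is_cmonoid C A" "rend A t"
  shows "mult_sequence C A (raw t) = mseq (regular_module A) t"
  by (simp add: mult_sequence_def mseq_def E_ring_pow[OF assms])

text \<open>With e n read as a \<mapsto> a t^-n, this names the whole telescope. In contrast to
  \<open>is_localisation\<close> the colimit is taken in C, and linearity of the coprojections is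
  recorded separately.\<close>

definition is_loc :: "('o, 'm) cmon \<Rightarrow> ('o, 'm) arrow \<Rightarrow> ('o, 'm) cmon \<Rightarrow> (nat \<Rightarrow> ('o, 'm) arrow) \<Rightarrow> bool" where
  "is_loc A t B e \<longleftrightarrow> rend A t \<and> chom A B (e 0) \<and> tel t (MOb B) e \<and>
     (\<forall>n. mhom A (regular_module A) (rmod B (e 0) (regular_module B)) (e n))"

text \<open>Fractions multiply by adding the exponents of their denominators. The product is first
  defined on the diagonal stages of L \<otimes> L, and the monoid laws are inherited from A stage by
  stage.\<close>

lemma ex_is_loc:
  assumes A: "is_cmonoid C A" and t: "rend A t"
  obtains B e where "is_loc A t B e"
proof -
  let ?A = "MOb A" and ?u = "UnitOb C"
  note [simp] = cmonD(1-3)[OF A] rendD(1-3)[OF A t]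
  obtain L e where L: "tel t L e" by (rule ex_tel[of t]) simp_all
  note [simp] = telD(3-6)[OF L]
  note LL = tel_tens[OF L L] and LLL = tel_tens[OF tel_tens[OF L L] L]
  \<comment> \<open>Two elements of stage n multiply into stage 2 n, so passing from n to n + 1
    costs two steps; these are absorbed by (t a) (t b) = t^2 a b.\<close>
  have 1: "(e (2 * Suc n) \<bullet> mm A) \<bullet> (t \<star> t) = e (2 * n) \<bullet> mm A" for n
  proof -
    have "mm A \<bullet> (t \<star> t) = apow t 2 \<bullet> mm A"
      using mm_apow[OF A t, of 1 1] by (simp add: numeral_2_eq_2)
    then show ?thesis
      using acomp_reassoc[OF tel_shift[OF L, of "2 * n" 2], of "mm A"] by simp
  qed
  obtain m where m [simp]: "ok m" "src m = L \<otimes>\<^sub>o L" "tgt m = L"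
    and m_diag: "\<And>n. m \<bullet> (e n \<star> e n) = e (2 * n) \<bullet> mm A"
    by (rule tel_factor[OF LL, of "\<lambda>n. e (2 * n) \<bullet> mm A" L]) (use 1 in simp_all)
  \<comment> \<open>Both arguments are moved to the common stage i + k, by t^k and t^i respectively;
    the resulting surplus t^(i+k) brings stage 2 (i + k) back to i + k.\<close>
  have m_e: "m \<bullet> (e i \<star> e k) = e (i + k) \<bullet> mm A" for i k
  proof -
    have "m \<bullet> (e i \<star> e k) = m \<bullet> (e (i + k) \<star> e (i + k)) \<bullet> (apow t k \<star> apow t i)"
      using tel_shift[OF L, of i k] tel_shift[OF L, of k i] by (simp add: add.commute)
    also have "\<dots> = e (2 * (i + k)) \<bullet> mm A \<bullet> (apow t k \<star> apow t i)"
      using acomp_reassoc[OF m_diag[of "i + k"], of "apow t k \<star> apow t i"] by simp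
    also have "\<dots> = (e ((i + k) + (i + k)) \<bullet> apow t (i + k)) \<bullet> mm A"
      by (simp only: mult_2 mm_apow[OF A t] acomp_assoc add.commute[of k i])
    finally show ?thesis by (simp only: tel_shift[OF L])
  qed
  define B where "B = \<lparr>MOb = L, Mult = raw m, Eta = raw (e 0 \<bullet> ee A)\<rparr>"
  have [simp]: "MOb B = L" "Mult B = raw m" "Eta B = raw (e 0 \<bullet> ee A)" by (simp_all add: B_def)
  have mB [simp]: "mm B = m" using ar_Arr_raw[of m "L \<otimes>\<^sub>o L" L] unfolding mm_def[of B] by simp
  have eB [simp]: "ee B = e 0 \<bullet> ee A"
    using ar_Arr_raw[of "e 0 \<bullet> ee A" ?u L] unfolding ee_def[of B] by simp
  have B: "is_cmonoid C B"
    unfolding is_cmonoid_iff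
  proof (intro conjI)
    show "mm B \<bullet> (mm B \<star> idn (MOb B)) = mm B \<bullet> (idn (MOb B) \<star> mm B) \<bullet> al (MOb B) (MOb B) (MOb B)"
    proof (rule tel_eqI[OF LLL])
      fix n
      have "m \<bullet> (m \<star> idn L) \<bullet> ((e n \<star> e n) \<star> e n) = m \<bullet> (e (2 * n) \<star> e n) \<bullet> (mm A \<star> idn ?A)"
        by (simp add: m_diag)
      also have "\<dots> = e (3 * n) \<bullet> mm A \<bullet> (mm A \<star> idn ?A)"
        using acomp_reassoc2[OF m_e[of "2 * n" n], of "mm A \<star> idn ?A"] by simp
      also have "\<dots> = e (n + 2 * n) \<bullet> mm A \<bullet> (idn ?A \<star> mm A) \<bullet> al ?A ?A ?A"
        by (simp only: cmonD(4)[OF A]) simp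
      also have "\<dots> = m \<bullet> (e n \<star> e (2 * n)) \<bullet> (idn ?A \<star> mm A) \<bullet> al ?A ?A ?A"
        using acomp_reassoc2[OF m_e[of n "2 * n", symmetric], of "(idn ?A \<star> mm A) \<bullet> al ?A ?A ?A"] by simp
      also have "\<dots> = m \<bullet> (idn L \<star> m) \<bullet> (e n \<star> (e n \<star> e n)) \<bullet> al ?A ?A ?A"
        by (simp add: m_diag)
      also have "(e n \<star> (e n \<star> e n)) \<bullet> al ?A ?A ?A = al L L L \<bullet> ((e n \<star> e n) \<star> e n)"
        by (rule al_nat[symmetric]) simp_all
      finally show "(mm B \<bullet> (mm B \<star> idn (MOb B))) \<bullet> ((e n \<star> e n) \<star> e n)
          = (mm B \<bullet> (idn (MOb B) \<star> mm B) \<bullet> al (MOb B) (MOb B) (MOb B)) \<bullet> ((e n \<star> e n) \<star> e n)"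
        by (simp del: interchange interchange_reassoc)
    qed simp_all
    show "mm B \<bullet> (ee B \<star> idn (MOb B)) = lu (MOb B)"
    proof (rule tel_eqI[OF tel_tens_left[OF L unit_ob]])
      fix n
      have "m \<bullet> (e 0 \<star> e n) \<bullet> (ee A \<star> idn ?A) = e n \<bullet> lu ?A"
        using acomp_reassoc2[OF m_e[of 0 n], of "ee A \<star> idn ?A"] cmonD(5)[OF A] by simp
      then show "(mm B \<bullet> (ee B \<star> idn (MOb B))) \<bullet> (idn ?u \<star> e n) = lu (MOb B) \<bullet> (idn ?u \<star> e n)"
        using lu_nat[of "e n" ?A L] by simp
    qed simp_all
    show "mm B \<bullet> (idn (MOb B) \<star> ee B) = ru (MOb B)"
    proof (rule tel_eqI[OF tel_tens_right[OF L unit_ob]])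
      fix n
      have "m \<bullet> (e n \<star> e 0) \<bullet> (idn ?A \<star> ee A) = e n \<bullet> ru ?A"
        using acomp_reassoc2[OF m_e[of n 0], of "idn ?A \<star> ee A"] cmonD(6)[OF A] by simp
      then show "(mm B \<bullet> (idn (MOb B) \<star> ee B)) \<bullet> (e n \<star> idn ?u) = ru (MOb B) \<bullet> (e n \<star> idn ?u)"
        using ru_nat[of "e n" ?A L] by simp
    qed simp_all
    show "mm B \<bullet> br (MOb B) (MOb B) = mm B"
    proof (rule tel_eqI[OF LL])
      fix n
      have "m \<bullet> br L L \<bullet> (e n \<star> e n) = m \<bullet> (e n \<star> e n) \<bullet> br ?A ?A"
        using br_nat[of "e n" ?A L "e n" ?A L] by simp
      also have "\<dots> = e (2 * n) \<bullet> mm A \<bullet> br ?A ?A"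
        using acomp_reassoc2[OF m_diag] by simp
      finally show "(mm B \<bullet> br (MOb B) (MOb B)) \<bullet> (e n \<star> e n) = mm B \<bullet> (e n \<star> e n)"
        by (simp add: m_diag cmonD(7)[OF A])
    qed simp_all
  qed simp_all
  have j: "chom A B (e 0)"
    using A B m_e[of 0 0] by (simp add: chom_def)
  have "mhom A (regular_module A) (rmod B (e 0) (regular_module B)) (e n)" for n
    using is_module_regular[OF A] is_module_rmod[OF j is_module_regular[OF B]] m_e[of n 0]
    by (simp add: mhom_def act_rmod[OF j is_module_regular[OF B]])
  with j t L have "is_loc A t B e" by (simp add: is_loc_def)
  then show ?thesis by (rule that)
qed

lemma is_loc_is_localisation:
  assumes A: "is_cmonoid C A" and B: "is_loc A t B e"
  shows "is_localisation C A (raw t) B (raw (e 0))"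
proof -
  from B have t: "rend A t" and j: "chom A B (e 0)" and L: "tel t (MOb B) e"
    and e: "\<And>n. mhom A (regular_module A) (rmod B (e 0) (regular_module B)) (e n)"
    by (auto simp: is_loc_def)
  have "is_colimit nat_cat (Modl C A) (mult_sequence C A (raw t)) (restrict_scalars C B (raw (e 0))) (\<lambda>n. raw (e n))"
    using is_colimit_mseq[OF A t, of "rmod B (e 0) (regular_module B)" e] L e
    by (simp add: mult_sequence_mseq[OF A t] rmod_regular[OF j] restrict_scalars_def)
  then show ?thesis
    unfolding is_localisation_def using raw_hom_Comm[OF j] by (intro conjI exI[of _ "\<lambda>n. raw (e n)"]) simp_all
qed

text \<open>Nothing is known about a given localisation except that it is a colimit of modules.
  Uniqueness of colimits provides an isomorphism from the one constructed above, along which the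
  telescope in C is transported.\<close>

lemma is_localisation_is_loc:
  assumes A: "is_cmonoid C A" and t: "rend A t" and B: "is_localisation C A (raw t) B j"
  obtains e where "is_loc A t B e" "raw (e 0) = j"
proof -
  from B obtain d where jC: "j \<in> Hom (Comm C) A B"
    and co: "is_colimit nat_cat (Modl C A) (mult_sequence C A (raw t)) (restrict_scalars C B j) d"
    and d0: "d 0 = j"
    by (auto simp: is_localisation_def)
  define J where "J = Arr (MOb A) j (MOb B)"
  have J: "chom A B J" and rJ: "raw J = j" using jC by (simp_all add: J_def hom_Comm)
  define N where "N = rmod B J (regular_module B)"
  have N: "N = restrict_scalars C B j" using rmod_regular[OF J] by (simp add: N_def rJ)
  have UN: "Und N = MOb B" by (simp add: N_def)
  interpret M: category "Modl C A" by (rule category_Modl[OF A])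
  obtain B' e where B': "is_loc A t B' e" by (rule ex_is_loc[OF A t])
  define N' where "N' = rmod B' (e 0) (regular_module B')"
  from B' have j': "chom A B' (e 0)" and L: "tel t (MOb B') e"
    and e: "\<And>n. mhom A (regular_module A) N' (e n)"
    by (auto simp: is_loc_def N'_def)
  have UN': "Und N' = MOb B'" by (simp add: N'_def)
  have co': "is_colimit nat_cat (Modl C A) (mult_sequence C A (raw t)) N' (\<lambda>n. raw (e n))"
    using is_colimit_mseq[OF A t, of N' e] L e by (simp add: mult_sequence_mseq[OF A t] UN')
  have F: "is_ftor nat_cat (Modl C A) (mult_sequence C A (raw t))"
    using is_ftor_mseq[OF A t] by (simp add: mult_sequence_mseq[OF A t])
  obtain h k where hk: "h \<in> Hom (Modl C A) N' N" "k \<in> Hom (Modl C A) N N'"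
    "k \<cdot> h = Idt C (MOb B')" "h \<cdot> k = Idt C (MOb B)" "\<And>n. h \<cdot> raw (e n) = d n"
    using M.is_colimit_unique[OF category_nat_cat F co' co[folded N]] by (auto simp: UN UN')
  define H K where "H = Arr (MOb B') h (MOb B)" and "K = Arr (MOb B) k (MOb B')"
  have H: "mhom A N' N H" and K: "mhom A N N' K"
    using hk(1,2) by (simp_all add: hom_Modl[OF A] H_def K_def UN UN')
  note [simp] = mhomD(3-5)[OF H, unfolded UN UN'] mhomD(3-5)[OF K, unfolded UN UN'] telD[OF L] mhomD(3-5)[OF e, unfolded UN']
    rendD(1-3)[OF A t]
  have KH: "K \<bullet> H = idn (MOb B')" "H \<bullet> K = idn (MOb B)"
    using mhomD(3)[OF H] mhomD(3)[OF K] hk(3,4) by (simp_all add: H_def K_def Arr_acomp idn_def)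
  have "raw H = h" by (simp add: H_def)
  then have He: "raw (H \<bullet> e n) = d n" for n
    using ok_acomp(4)[of "e n" H] hk(5) by simp
  define f where "f n = H \<bullet> e n" for n
  have f0: "f 0 = J"
    using He[of 0] chomD(3-5)[OF J] by (intro arrow_eqI) (simp_all add: f_def d0 rJ)
  have "tel t (MOb B) f"
    using L tcolim_iso[OF category_nat_cat _ _ _ _ _ _ _ KH] unfolding f_def tel_def by simp
  moreover have "mhom A (regular_module A) N (f n)" for n
    unfolding f_def by (rule mhom_comp[OF A e H])
  ultimately have "is_loc A t B f"
    using t J by (simp add: is_loc_def f0 N_def)
  moreover have "raw (f 0) = j" by (simp add: f0 rJ)
  ultimately show ?thesis by (rule that)
qed

lemma loc_monoid_is_loc:
  assumes A: "is_cmonoid C A" and t: "rend A t"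
  obtains e where "is_loc A t (loc_monoid C A (raw t)) e" "raw (e 0) = loc_map C A (raw t)"
proof -
  have "\<exists>p. case p of (B, j) \<Rightarrow> is_localisation C A (raw t) B j"
    using ex_is_loc[OF A t] is_loc_is_localisation[OF A] by (metis case_prodI)
  then have "case localisation C A (raw t) of (B, j) \<Rightarrow> is_localisation C A (raw t) B j"
    unfolding localisation_def by (rule someI_ex)
  then have "is_localisation C A (raw t) (loc_monoid C A (raw t)) (loc_map C A (raw t))"
    by (simp add: loc_monoid_def loc_map_def case_prod_beta)
  from is_localisation_is_loc[OF A t this] that show ?thesis by blast
qed

section \<open>Invertibility of t and the universal property of the localisation\<close>

lemma mm_flip_left:
  assumes A: "is_cmonoid C A" and f [simp]: "ok f" "src f = MOb A" "tgt f = MOb A"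
    and fm: "f \<bullet> mm A = mm A \<bullet> (idn (MOb A) \<star> f)"
  shows "rend A f"
proof -
  let ?A = "MOb A"
  note [simp] = cmonD(1-3)[OF A]
  have "idn ?A \<star> f = br ?A ?A \<bullet> (f \<star> idn ?A) \<bullet> br ?A ?A"
    using acomp_reassoc2[OF br_nat[of f ?A ?A "idn ?A" ?A ?A], of "br ?A ?A"] by simp
  then have "f \<bullet> mm A \<bullet> br ?A ?A = (mm A \<bullet> br ?A ?A) \<bullet> (f \<star> idn ?A)"
    using acomp_reassoc2[OF fm, of "br ?A ?A"] by simp
  then have "f \<bullet> mm A = mm A \<bullet> (f \<star> idn ?A)"
    by (simp only: cmonD(7)[OF A])
  then show ?thesis using is_module_regular[OF A] by (simp add: mhom_def)
qed

lemma rend_sc: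
  assumes A: "is_cmonoid C A" and x: "ok x" "src x = UnitOb C" "tgt x = MOb A"
  shows "rend A (sc A (regular_module A) x)"
  using act_scalar[OF A is_module_regular[OF A] x] sc_simps[OF A is_module_regular[OF A] x]
  by (intro mm_flip_left[OF A]) simp_all

lemma rend_ainv:
  assumes A: "is_cmonoid C A" and r: "rend A r" and iso [simp]: "aiso r"
  shows "rend A (ainv r)"
proof -
  let ?A = "MOb A"
  note [simp] = cmonD(1-3)[OF A] rendD(1-3)[OF A r]
  have "ainv r \<bullet> mm A = ainv r \<bullet> mm A \<bullet> (r \<star> idn ?A) \<bullet> (ainv r \<star> idn ?A)" by simp
  also have "\<dots> = ainv r \<bullet> r \<bullet> mm A \<bullet> (ainv r \<star> idn ?A)"
    by (simp only: acomp_reassoc2[OF rendD(4)[OF A r]])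
  also have "\<dots> = mm A \<bullet> (ainv r \<star> idn ?A)" by simp
  finally show ?thesis using is_module_regular[OF A] by (simp add: mhom_def)
qed

text \<open>This endomorphism of B is multiplication by g (t 1), that is, the image of t under
  \<E>(A) \<rightarrow> \<E>(B).\<close>

lemma rend_smul_rmod:
  assumes g: "chom A B g" and t: "rend A t"
  shows "rend B (smul A (rmod B g (regular_module B)) t)"
  using rend_sc[OF chomD(2)[OF g], of "g \<bullet> t \<bullet> ee A"] sc_rmod[OF g is_module_regular[OF chomD(2)[OF g]], of "t \<bullet> ee A"]
    chomD(3-5)[OF g] rendD(1-3)[OF chomD(1)[OF g] t] cmonD(1-3)[OF chomD(1)[OF g]]
  by (simp add: smul_def)

lemma mhom_rmod_of_chom:
  assumes j: "chom A B j" and f: "chom B Z f"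
  shows "mhom A (rmod B j (regular_module B)) (rmod Z (f \<bullet> j) (regular_module Z)) f"
proof -
  note R = is_module_regular[OF chomD(2)[OF j]] and Z = is_module_regular[OF chomD(2)[OF f]]
  note jf = chom_comp[OF j f]
  note [simp] = chomD(3-5)[OF j] chomD(3-5)[OF f] cmonD(1-3)[OF chomD(1)[OF j]]
    cmonD(1-3)[OF chomD(2)[OF j]] cmonD(1-3)[OF chomD(2)[OF f]]
  have "f \<bullet> mm B \<bullet> (idn (MOb B) \<star> j) = mm Z \<bullet> (f \<star> (f \<bullet> j))"
    using acomp_reassoc2[OF chomD(6)[OF f], of "idn (MOb B) \<star> j"] by simp
  then show ?thesis
    using is_module_rmod[OF j R] is_module_rmod[OF jf Z]
    by (simp add: mhom_def act_rmod[OF j R] act_rmod[OF jf Z])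
qed

text \<open>\<E>(B) acts on every B-module, so an inverse of multiplication by x on B itself acts as
  an inverse on N.\<close>

lemma aiso_sc:
  assumes B: "is_cmonoid C B" and N: "is_module C B N" and x [simp]: "ok x" "src x = UnitOb C" "tgt x = MOb B"
    and iso: "aiso (sc B (regular_module B) x)"
  shows "aiso (sc B N x)"
proof -
  let ?T = "sc B (regular_module B) x" and ?S = "ainv (sc B (regular_module B) x)"
  note R = is_module_regular[OF B]
  note [simp] = cmonD(1-3)[OF B] modD(1,2)[OF B N] sc_simps[OF B R x, simplified] sc_simps[OF B N x] iso
  have S: "rend B ?S" by (rule rend_ainv[OF B rend_sc[OF B x] iso])
  note [simp] = smul_simps[OF B N S]
  note sa = smul_act[OF B N S] and ta = act_scalar[OF B N x]
  show ?thesis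
  proof (rule aisoI[of _ "Und N" "Und N" "smul B N ?S"])
    show "smul B N ?S \<bullet> sc B N x = idn (Und N)"
      by (rule act_epi[OF B N]) (use acomp_reassoc2[OF sa, of "idn (Und N) \<star> ?T"] in \<open>simp_all add: ta\<close>)
    show "sc B N x \<bullet> smul B N ?S = idn (Und N)"
      by (rule act_epi[OF B N]) (use acomp_reassoc2[OF ta, of "idn (Und N) \<star> ?S"] in \<open>simp_all add: sa\<close>)
  qed simp_all
qed

lemma is_locD:
  assumes "is_loc A t B e"
  shows "rend A t" "chom A B (e 0)" "is_cmonoid C A" "is_cmonoid C B" "tel t (MOb B) e"
    "mhom A (regular_module A) (rmod B (e 0) (regular_module B)) (e n)"
    "is_module C A (rmod B (e 0) (regular_module B))"
  using assms unfolding is_loc_def mhom_def chom_def by blast+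

text \<open>Linearity of \<open>e (Suc n)\<close> moves t onto A, where it is the transition map of
  the telescope.\<close>

lemma loc_smul_e:
  assumes B: "is_loc A t B e"
  shows "smul A (rmod B (e 0) (regular_module B)) t \<bullet> e (Suc n) = e n"
  using smul_nat[OF is_locD(3)[OF B] is_locD(6)[OF B, of "Suc n"] is_locD(1)[OF B]]
    smul_regular[OF is_locD(3)[OF B] is_locD(1)[OF B]] telD(7)[OF is_locD(5)[OF B], of n]
  by simp

text \<open>The inverse is the shift of stages, a t^-n \<mapsto> a t^-(n+1).\<close>

lemma loc_smul_aiso:
  assumes B: "is_loc A t B e"
  shows "aiso (smul A (rmod B (e 0) (regular_module B)) t)" (is "aiso ?T")
proof -
  note A = is_locD(3)[OF B] and t = is_locD(1)[OF B] and N = is_locD(7)[OF B] and L = is_locD(5)[OF B]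
  note [simp] = telD[OF L] rendD(1-3)[OF A t] smul_simps[OF A N t, simplified]
  obtain s where s [simp]: "ok s" "src s = MOb B" "tgt s = MOb B" and se: "\<And>n. s \<bullet> e n = e (Suc n)"
    by (rule tel_factor[OF L, of "\<lambda>n. e (Suc n)" "MOb B"]) simp_all
  have Te: "?T \<bullet> e n = e n \<bullet> t" for n
    using smul_nat[OF A is_locD(6)[OF B] t] smul_regular[OF A t] by simp
  show ?thesis
  proof (rule aisoI[of _ "MOb B" "MOb B" s])
    show "s \<bullet> ?T = idn (MOb B)"
      by (rule tel_eqI[OF L]) (simp_all add: Te acomp_reassoc[OF se])
    show "?T \<bullet> s = idn (MOb B)"
      by (rule tel_eqI[OF L]) (simp_all add: se loc_smul_e[OF B])
  qed simp_all
qed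

lemma loc_module_aiso:
  assumes B: "is_loc A t B e" and N: "is_module C B N"
  shows "aiso (smul A (rmod B (e 0) N) t)"
proof -
  note A = is_locD(3)[OF B] and t = is_locD(1)[OF B] and j = is_locD(2)[OF B] and Bm = is_locD(4)[OF B]
  note [simp] = rendD(1-3)[OF A t] cmonD(1-3)[OF A] chomD(3-5)[OF j]
  have "aiso (sc B (regular_module B) (e 0 \<bullet> t \<bullet> ee A))"
    using loc_smul_aiso[OF B] sc_rmod[OF j is_module_regular[OF Bm], of "t \<bullet> ee A"] by (simp add: smul_def)
  then have "aiso (sc B N (e 0 \<bullet> t \<bullet> ee A))"
    by (rule aiso_sc[OF Bm N, rotated -1]) simp_all
  then show ?thesis
    using sc_rmod[OF j N, of "t \<bullet> ee A"] by (simp add: smul_def)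
qed

text \<open>Linearity of the coprojections over A is the case k = 0. For larger k both sides agree
  after multiplication by t, which is invertible on B.\<close>

lemma loc_mult:
  assumes B: "is_loc A t B e"
  shows "mm B \<bullet> (e i \<star> e k) = e (i + k) \<bullet> mm A"
proof (induction k)
  note A = is_locD(3)[OF B] and t = is_locD(1)[OF B] and j = is_locD(2)[OF B] and Bm = is_locD(4)[OF B]
  note R = is_module_regular[OF Bm]
  note [simp] = rendD(1-3)[OF A t] cmonD(1-3)[OF A] cmonD(1-3)[OF Bm] chomD(3-5)[OF j] telD[OF is_locD(5)[OF B]]
  case 0
  show ?case using mhomD(6)[OF is_locD(6)[OF B, of i]] by (simp add: act_rmod[OF j R])
next
  note A = is_locD(3)[OF B] and t = is_locD(1)[OF B] and j = is_locD(2)[OF B] and Bm = is_locD(4)[OF B]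
  note R = is_module_regular[OF Bm]
  let ?T = "smul A (rmod B (e 0) (regular_module B)) t"
  note [simp] = rendD(1-3)[OF A t] cmonD(1-3)[OF A] cmonD(1-3)[OF Bm] chomD(3-5)[OF j] telD[OF is_locD(5)[OF B]]
    smul_simps[OF A is_locD(7)[OF B] t, simplified]
  case (Suc k)
  note T = rendD(5)[OF Bm rend_smul_rmod[OF j t]]
  have "?T \<bullet> mm B \<bullet> (e i \<star> e (Suc k)) = mm B \<bullet> (e i \<star> e k)"
    using acomp_reassoc2[OF T, of "e i \<star> e (Suc k)"] loc_smul_e[OF B, of k] by simp
  also have "\<dots> = ?T \<bullet> e (i + Suc k) \<bullet> mm A"
    using Suc acomp_reassoc[OF loc_smul_e[OF B, of "i + k"], of "mm A"] by simp
  finally show ?case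
    by (rule aiso_cancel_left[OF loc_smul_aiso[OF B], rotated -1]) simp_all
qed

lemma aiso_smul_cod:
  assumes B: "is_loc A t B e" and g: "chom B Z g"
  shows "aiso (smul A (rmod Z (g \<bullet> e 0) (regular_module Z)) t)"
proof -
  note A = is_locD(3)[OF B] and t = is_locD(1)[OF B] and j = is_locD(2)[OF B]
  note Z = is_module_regular[OF chomD(2)[OF g]]
  note [simp] = rendD(1-3)[OF A t] cmonD(1-3)[OF A] chomD(3-5)[OF j] chomD(3-5)[OF g]
  show ?thesis
    using loc_module_aiso[OF B is_module_rmod[OF g Z]]
      sc_rmod[OF j is_module_rmod[OF g Z], of "t \<bullet> ee A"] sc_rmod[OF g Z, of "e 0 \<bullet> t \<bullet> ee A"]
      sc_rmod[OF chom_comp[OF j g] Z, of "t \<bullet> ee A"]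
    by (simp add: smul_def)
qed

text \<open>On the target t^n g(a t^-n) = g(a), and t is invertible there; so g is determined by its
  stage 0.\<close>

lemma loc_epi:
  assumes B: "is_loc A t B e" and g: "chom B Z g" and h: "chom B Z h" and gh: "g \<bullet> e 0 = h \<bullet> e 0"
  shows "g = h"
proof -
  note A = is_locD(3)[OF B] and t = is_locD(1)[OF B] and j = is_locD(2)[OF B] and L = is_locD(5)[OF B]
  note Z = is_module_regular[OF chomD(2)[OF g]] and R = is_module_regular[OF is_locD(4)[OF B]]
  let ?N = "rmod B (e 0) (regular_module B)" and ?P = "rmod Z (g \<bullet> e 0) (regular_module Z)"
  note jg = chom_comp[OF j g]
  note N = is_module_rmod[OF j R] and P = is_module_rmod[OF jg Z]
  note [simp] = rendD(1-3)[OF A t] cmonD(1-3)[OF A] cmonD(1-3)[OF is_locD(4)[OF B]] cmonD(1-3)[OF chomD(2)[OF g]]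
    chomD(3-5)[OF g] chomD(3-5)[OF h] telD[OF L] smul_simps[OF A P t, simplified]
  have lin: "mhom A ?N ?P f" if f: "chom B Z f" and fe: "f \<bullet> e 0 = g \<bullet> e 0" for f
    using mhom_rmod_of_chom[OF j f] by (simp add: fe)
  have step: "smul A ?P t \<bullet> f \<bullet> e (Suc n) = f \<bullet> e n" if f: "chom B Z f" and fe: "f \<bullet> e 0 = g \<bullet> e 0" for f n
    using acomp_reassoc2[OF smul_nat[OF A lin[OF that] t], of "e (Suc n)"] loc_smul_e[OF B, of n] by simp
  have "g \<bullet> e n = h \<bullet> e n" for n
  proof (induction n)
    case (Suc n)
    then have "smul A ?P t \<bullet> g \<bullet> e (Suc n) = smul A ?P t \<bullet> h \<bullet> e (Suc n)"
      using step[OF g] step[OF h gh[symmetric]] by simp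
    then show ?case
      by (rule aiso_cancel_left[OF aiso_smul_cod[OF B g], rotated -1]) simp_all
  qed (rule gh)
  then show ?thesis by - (rule tel_eqI[OF L], simp_all)
qed

text \<open>The value at a t^-n is forced to be t^-n g(a), with t inverted on Z; multiplicativity is
  then checked on the stages.\<close>

lemma loc_universal:
  assumes B: "is_loc A t B e" and g: "chom A Z g"
    and iso: "aiso (smul A (rmod Z g (regular_module Z)) t)" (is "aiso ?S")
  obtains h where "chom B Z h" "h \<bullet> e 0 = g"
proof -
  note A = is_locD(3)[OF B] and t = is_locD(1)[OF B] and L = is_locD(5)[OF B] and Bm = is_locD(4)[OF B]
  note Zm = chomD(2)[OF g]
  note Z = is_module_regular[OF Zm]
  let ?N = "rmod Z g (regular_module Z)" and ?Z = "MOb Z"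
  note N = is_module_rmod[OF g Z]
  note [simp] = rendD(1-3)[OF A t] cmonD(1-3)[OF A] cmonD(1-3)[OF Bm] cmonD(1-3)[OF Zm]
    chomD(3-5)[OF g] telD[OF L] smul_simps[OF A N t, simplified] iso
  let ?P = "ainv ?S"
  have P: "rend Z ?P" by (rule rend_ainv[OF Zm rend_smul_rmod[OF g t] iso])
  have gt: "g \<bullet> t = ?S \<bullet> g"
    using smul_nat[OF A mhom_of_chom[OF g] t] smul_regular[OF A t] by simp
  have Pgt: "(apow ?P (Suc n) \<bullet> g) \<bullet> t = apow ?P n \<bullet> g" for n
  proof -
    have "apow ?P (Suc n) = apow ?P n \<bullet> ?P" by (simp add: apow_Suc2)
    then show ?thesis by (simp add: gt)
  qed
  obtain h where h [simp]: "ok h" "src h = MOb B" "tgt h = ?Z" and he: "\<And>n. h \<bullet> e n = apow ?P n \<bullet> g"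
    by (rule tel_factor[OF L, of "\<lambda>n. apow ?P n \<bullet> g" ?Z]) (use Pgt in simp_all)
  have he0: "h \<bullet> e 0 = g" using he[of 0] by simp
  have "h \<bullet> mm B = mm Z \<bullet> (h \<star> h)"
  proof (rule tel_eqI[OF tel_tens[OF L L]])
    fix n
    have "h \<bullet> mm B \<bullet> (e n \<star> e n) = apow ?P (n + n) \<bullet> g \<bullet> mm A"
      using acomp_reassoc2[OF he[of "n + n"], of "mm A"] loc_mult[OF B, of n n] by simp
    also have "\<dots> = (apow ?P (n + n) \<bullet> mm Z) \<bullet> (g \<star> g)"
      by (simp add: chomD(6)[OF g])
    also have "\<dots> = mm Z \<bullet> (apow ?P n \<star> apow ?P n) \<bullet> (g \<star> g)"
      by (simp only: mm_apow[OF Zm P, symmetric] acomp_assoc)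
    also have "\<dots> = mm Z \<bullet> (h \<star> h) \<bullet> (e n \<star> e n)"
      by (simp add: he)
    finally show "(h \<bullet> mm B) \<bullet> (e n \<star> e n) = (mm Z \<bullet> (h \<star> h)) \<bullet> (e n \<star> e n)"
      by (simp del: interchange interchange_reassoc)
  qed simp_all
  moreover have "h \<bullet> ee B = ee Z"
    using chomD(7)[OF is_locD(2)[OF B]] acomp_reassoc[OF he0, of "ee A"] chomD(7)[OF g] by simp
  ultimately have "chom B Z h"
    using Bm Zm by (simp add: chom_def)
  then show ?thesis using he0 by (rule that)
qed

end


section \<open>Finite presentation\<close>

context category
begin

text \<open>\<open>colim_set\<close> divides by the equivalence relation generated by the transition
  maps. Over a filtered category two elements are related iff they become equal at a common later
  stage, so bijectivity splits into a surjectivity and an injectivity condition on single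
  stages.\<close>

lemma hom_commutes_filtered_iff:
  assumes F: "filtered_cat J" and G: "is_ftor J C G" and L: "is_cocone J C G L e"
  shows "hom_commutes_with_colim C X J G L e \<longleftrightarrow>
    (\<forall>z\<in>Hom C X L. \<exists>i\<in>Ob J. \<exists>x\<in>Hom C X (FOb G i). e i \<cdot> x = z) \<and>
    (\<forall>i\<in>Ob J. \<forall>x\<in>Hom C X (FOb G i). \<forall>y\<in>Hom C X (FOb G i). e i \<cdot> x = e i \<cdot> y \<longrightarrow>
       (\<exists>k. \<exists>u\<in>Hom J i k. FAr G i k u \<cdot> x = FAr G i k u \<cdot> y))"
proof -
  interpret J: category J using F by (simp add: filtered_cat_def)
  have fil: "\<exists>k u v. u \<in> Hom J i k \<and> v \<in> Hom J j k" if "i \<in> Ob J" "j \<in> Ob J" for i j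
    using F that unfolding filtered_cat_def by blast
  have fil2: "\<exists>k w. w \<in> Hom J j k \<and> w \<cdot>\<^bsub>J\<^esub> u = w \<cdot>\<^bsub>J\<^esub> v" if "u \<in> Hom J i j" "v \<in> Hom J i j" for i j u v
    using F that unfolding filtered_cat_def by blast
  define S where "S i = Hom C X (FOb G i)" for i
  define T where "T i j u x = FAr G i j u \<cdot> x" for i j u x
  define E where "E p = (case p of (i, x) \<Rightarrow> e i \<cdot> x)" for p
  define V where "V = (SIGMA i:Ob J. S i)"
  define r where "r = {((i, x), (j, T i j u x)) | i j u x. u \<in> Hom J i j \<and> x \<in> S i}"
  define R where "R = (r \<union> r\<inverse>)\<^sup>*"
  have FG: "FAr G i j u \<in> Hom C (FOb G i) (FOb G j)" if "u \<in> Hom J i j" for i j u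
    using G that by (simp add: is_ftor_def)
  have TS: "T i j u x \<in> S j" if "u \<in> Hom J i j" "x \<in> S i" for i j u x
    using cmp_hom[OF _ FG] that by (simp add: T_def S_def)
  have Tc: "T i k (v \<cdot>\<^bsub>J\<^esub> u) x = T j k v (T i j u x)" if "u \<in> Hom J i j" "v \<in> Hom J j k" "x \<in> S i" for i j k u v x
    using G that cmp_assoc[OF _ FG[OF that(1)] FG[OF that(2)], of x X] by (simp add: is_ftor_def T_def S_def)
  have Tid: "T i i (Idt J i) x = x" if "i \<in> Ob J" "x \<in> S i" for i x
    using G that idt_left by (simp add: is_ftor_def T_def S_def)
  have e: "e i \<in> Hom C (FOb G i) L" if "i \<in> Ob J" for i
    using L that by (simp add: is_cocone_def)
  have ET: "e j \<cdot> T i j u x = e i \<cdot> x" if "u \<in> Hom J i j" "x \<in> S i" for i j u x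
  proof -
    have "e j \<cdot> FAr G i j u = e i" using L that by (simp add: is_cocone_def)
    then show ?thesis
      using cmp_assoc[OF _ FG[OF that(1)] e, of x X] that J.hom_ob[OF that(1)] by (simp add: T_def S_def)
  qed
  \<comment> \<open>Equality at a common later stage; on \<open>V\<close> it will be identified with
    the generated relation \<open>R\<close>.\<close>
  define Q where "Q p q \<longleftrightarrow> p \<in> V \<and> q \<in> V \<and>
    (\<exists>k u v. u \<in> Hom J (fst p) k \<and> v \<in> Hom J (fst q) k \<and> T (fst p) k u (snd p) = T (fst q) k v (snd q))" for p q
  have Qrefl: "Q p p" if "p \<in> V" for p
  proof -
    have "fst p \<in> Ob J" using that by (auto simp: V_def)
    then show ?thesis using that J.idt_hom unfolding Q_def by blast
  qed
  have Qsym: "Q q p" if "Q p q" for p q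
    using that unfolding Q_def by metis
  have Qtrans: "Q p s" if pq: "Q p q" and qs: "Q q s" for p q s
  proof -
    obtain i x where p: "p = (i, x)" "x \<in> S i" using pq by (auto simp: Q_def V_def)
    obtain j y where q: "q = (j, y)" "y \<in> S j" using pq by (auto simp: Q_def V_def)
    obtain l z where s: "s = (l, z)" "z \<in> S l" using qs by (auto simp: Q_def V_def)
    obtain k u v where uv: "u \<in> Hom J i k" "v \<in> Hom J j k" "T i k u x = T j k v y"
      using pq by (auto simp: Q_def p q)
    obtain m a b where ab: "a \<in> Hom J j m" "b \<in> Hom J l m" "T j m a y = T l m b z"
      using qs by (auto simp: Q_def q s)
    obtain n c d where cd: "c \<in> Hom J k n" "d \<in> Hom J m n"
      using fil J.hom_ob[OF uv(1)] J.hom_ob[OF ab(1)] by blast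
    note cv = J.cmp_hom[OF uv(2) cd(1)] and da = J.cmp_hom[OF ab(1) cd(2)]
    \<comment> \<open>Stage n lies above both witnesses, but the two arrows from j to n need not
      agree; w equalises them.\<close>
    obtain o' w where w: "w \<in> Hom J n o'" "w \<cdot>\<^bsub>J\<^esub> (c \<cdot>\<^bsub>J\<^esub> v) = w \<cdot>\<^bsub>J\<^esub> (d \<cdot>\<^bsub>J\<^esub> a)"
      using fil2[OF cv da] by blast
    note cu = J.cmp_hom[OF uv(1) cd(1)] and db = J.cmp_hom[OF ab(2) cd(2)]
    have "T i o' (w \<cdot>\<^bsub>J\<^esub> (c \<cdot>\<^bsub>J\<^esub> u)) x = T n o' w (T k n c (T i k u x))"
      by (simp only: Tc[OF cu w(1) p(2)] Tc[OF uv(1) cd(1) p(2)])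
    also have "\<dots> = T j o' (w \<cdot>\<^bsub>J\<^esub> (c \<cdot>\<^bsub>J\<^esub> v)) y"
      by (simp only: uv(3) Tc[OF cv w(1) q(2)] Tc[OF uv(2) cd(1) q(2)])
    also have "\<dots> = T n o' w (T m n d (T j m a y))"
      by (simp only: w(2) Tc[OF da w(1) q(2)] Tc[OF ab(1) cd(2) q(2)])
    also have "\<dots> = T l o' (w \<cdot>\<^bsub>J\<^esub> (d \<cdot>\<^bsub>J\<^esub> b)) z"
      by (simp only: ab(3) Tc[OF db w(1) s(2)] Tc[OF ab(2) cd(2) s(2)])
    finally show ?thesis
      using pq qs J.cmp_hom[OF cu w(1)] J.cmp_hom[OF db w(1)] by (auto simp: Q_def p(1) s(1))
  qed
  have Qr: "Q p q" if pq: "(p, q) \<in> r" for p q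
  proof -
    obtain i j u x where *: "p = (i, x)" "q = (j, T i j u x)" "u \<in> Hom J i j" "x \<in> S i"
      using pq unfolding r_def by blast
    have "i \<in> Ob J" "j \<in> Ob J" using J.hom_ob[OF *(3)] by auto
    note ij = this
    have "\<exists>k u' v. u' \<in> Hom J i k \<and> v \<in> Hom J j k \<and> T i k u' x = T j k v (T i j u x)"
      using ij *(3) J.idt_hom Tid[OF ij(2) TS[OF *(3,4)]]
      by (intro exI[of _ j] exI[of _ u] exI[of _ "Idt J j"]) simp
    then show ?thesis
      using ij *(4) TS[OF *(3,4)] unfolding Q_def V_def *(1,2) by simp
  qed
  have RQ: "Q p q" if "(p, q) \<in> R" "p \<in> V" for p q
    using that(1) unfolding R_def
  proof (induction rule: rtrancl_induct)
    case (step a b)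
    then show ?case using Qr Qsym Qtrans by blast
  qed (use Qrefl[OF that(2)] in simp)
  have QR: "(p, q) \<in> R" if Q: "Q p q" for p q
  proof -
    obtain k u v where *: "u \<in> Hom J (fst p) k" "v \<in> Hom J (fst q) k" "T (fst p) k u (snd p) = T (fst q) k v (snd q)"
      using Q unfolding Q_def by blast
    have "snd p \<in> S (fst p)" "snd q \<in> S (fst q)" using Q by (auto simp: Q_def V_def)
    then have "(p, (k, T (fst p) k u (snd p))) \<in> r" "(q, (k, T (fst p) k u (snd p))) \<in> r"
      using * unfolding r_def by (cases p; cases q; force)+
    then show ?thesis unfolding R_def by (meson UnI1 UnI2 converse_iff converse_rtrancl_into_rtrancl r_into_rtrancl)
  qed
  have cls: "R `` {p} = {q. Q p q}" if "p \<in> V" for p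
    using RQ[OF _ that] QR by blast
  have EQ: "E p = E q" if pq: "Q p q" for p q
  proof -
    obtain k u v where *: "u \<in> Hom J (fst p) k" "v \<in> Hom J (fst q) k" "T (fst p) k u (snd p) = T (fst q) k v (snd q)"
      using pq unfolding Q_def by blast
    have "snd p \<in> S (fst p)" "snd q \<in> S (fst q)" using pq by (auto simp: Q_def V_def)
    then have "e (fst p) \<cdot> snd p = e (fst q) \<cdot> snd q"
      using ET[OF *(1), of "snd p"] ET[OF *(2), of "snd q"] *(3) by metis
    then show ?thesis by (simp add: E_def case_prod_beta)
  qed
  \<comment> \<open>Extracting an element with \<open>the_elem\<close> is legitimate because
    \<open>E\<close> is constant on each class, by \<open>EQ\<close>.\<close>
  define \<phi> where "\<phi> c = the_elem (E ` c)" for c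
  have phi: "\<phi> (R `` {p}) = E p" if p: "p \<in> V" for p
  proof -
    have "E ` (R `` {p}) = {E p}"
      unfolding cls[OF p]
    proof (intro equalityI subsetI)
      fix z assume "z \<in> E ` {q. Q p q}"
      then obtain q where "Q p q" "z = E q" by blast
      then show "z \<in> {E p}" using EQ[of p q] by simp
    qed (use Qrefl[OF p] in blast)
    then show ?thesis by (simp add: \<phi>_def)
  qed
  have clseq: "R `` {p} = R `` {q} \<longleftrightarrow> Q p q" if "p \<in> V" "q \<in> V" for p q
    unfolding cls[OF that(1)] cls[OF that(2)] using Qrefl[OF that(2)] Qsym Qtrans by blast
  have quot: "colim_set J S T = (\<lambda>p. R `` {p}) ` V"
    unfolding colim_set_def Let_def r_def[symmetric] R_def[symmetric] V_def[symmetric] quotient_def by blast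
  have "hom_commutes_with_colim C X J G L e \<longleftrightarrow> bij_betw \<phi> (colim_set J S T) (Hom C X L)"
    unfolding hom_commutes_with_colim_def S_def T_def \<phi>_def E_def by (simp add: case_prod_beta')
  also have "\<dots> \<longleftrightarrow> inj_on \<phi> ((\<lambda>p. R `` {p}) ` V) \<and> E ` V = Hom C X L"
    unfolding quot bij_betw_def by (simp add: image_image phi cong: image_cong)
  also have "inj_on \<phi> ((\<lambda>p. R `` {p}) ` V) \<longleftrightarrow> (\<forall>p\<in>V. \<forall>q\<in>V. E p = E q \<longrightarrow> Q p q)"
    unfolding inj_on_def by (simp add: phi clseq)
  also have "\<dots> \<longleftrightarrow> (\<forall>i\<in>Ob J. \<forall>x\<in>S i. \<forall>y\<in>S i. e i \<cdot> x = e i \<cdot> y \<longrightarrow> (\<exists>k. \<exists>u\<in>Hom J i k. T i k u x = T i k u y))"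
    (is "?A \<longleftrightarrow> ?B")
  proof
    assume A: ?A
    show ?B
    proof (intro ballI impI)
      fix i x y assume i: "i \<in> Ob J" and xy: "x \<in> S i" "y \<in> S i" and eq: "e i \<cdot> x = e i \<cdot> y"
      then have "Q (i, x) (i, y)" using A by (simp add: V_def E_def)
      then obtain k u v where uv: "u \<in> Hom J i k" "v \<in> Hom J i k" "T i k u x = T i k v y" by (auto simp: Q_def)
      \<comment> \<open>The witness of \<open>Q\<close> may use two different arrows u and v out of
        i; equalising them gives the single arrow that the criterion asks for.\<close>
      obtain l w where w: "w \<in> Hom J k l" "w \<cdot>\<^bsub>J\<^esub> u = w \<cdot>\<^bsub>J\<^esub> v" using fil2[OF uv(1,2)] by blast
      have "T i l (w \<cdot>\<^bsub>J\<^esub> u) x = T i l (w \<cdot>\<^bsub>J\<^esub> v) y"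
        by (simp only: Tc[OF uv(1) w(1) xy(1)] Tc[OF uv(2) w(1) xy(2)] uv(3))
      then show "\<exists>k. \<exists>u\<in>Hom J i k. T i k u x = T i k u y"
        using w(2) J.cmp_hom[OF uv(1) w(1)] by metis
    qed
  next
    assume B: ?B
    show ?A
    proof (intro ballI impI)
      fix p q assume pq: "p \<in> V" "q \<in> V" "E p = E q"
      then obtain i x j y where p: "p = (i, x)" "i \<in> Ob J" "x \<in> S i" and q: "q = (j, y)" "j \<in> Ob J" "y \<in> S j"
        by (auto simp: V_def)
      obtain k u v where uv: "u \<in> Hom J i k" "v \<in> Hom J j k" using fil[OF p(2) q(2)] by blast
      have "e k \<cdot> T i k u x = e k \<cdot> T j k v y"
        using pq(3) ET[OF uv(1) p(3)] ET[OF uv(2) q(3)] by (simp add: E_def p(1) q(1))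
      then obtain l w where w: "w \<in> Hom J k l" "T k l w (T i k u x) = T k l w (T j k v y)"
        using B TS[OF uv(1) p(3)] TS[OF uv(2) q(3)] J.hom_ob[OF uv(1)] by metis
      then show "Q p q"
        using Tc[OF uv(1) w(1) p(3)] Tc[OF uv(2) w(1) q(3)] J.cmp_hom[OF uv(1) w(1)] J.cmp_hom[OF uv(2) w(1)] pq(1,2)
        unfolding Q_def p(1) q(1) by (metis fst_conv snd_conv)
    qed
  qed
  also have "E ` V = Hom C X L \<longleftrightarrow> (\<forall>z\<in>Hom C X L. \<exists>i\<in>Ob J. \<exists>x\<in>S i. e i \<cdot> x = z)"
  proof -
    have "E ` V \<subseteq> Hom C X L" using cmp_hom[OF _ e] by (auto simp: V_def E_def S_def)
    moreover have "z \<in> E ` V \<longleftrightarrow> (\<exists>i\<in>Ob J. \<exists>x\<in>S i. e i \<cdot> x = z)" for z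
      by (force simp: V_def E_def image_iff)
    ultimately show ?thesis by blast
  qed
  finally show ?thesis by (auto simp: S_def T_def)
qed

end

section \<open>Monoids under A and their filtered colimits\<close>

context symmetric_monoidal_category
begin

lemma hom_under_Comm:
  "h \<in> Hom (under_cat (Comm C) A) X Y \<longleftrightarrow>
    chom A (fst X) (Arr (MOb A) (snd X) (MOb (fst X))) \<and> chom A (fst Y) (Arr (MOb A) (snd Y) (MOb (fst Y))) \<and>
    chom (fst X) (fst Y) (Arr (MOb (fst X)) h (MOb (fst Y))) \<and>
    Arr (MOb (fst X)) h (MOb (fst Y)) \<bullet> Arr (MOb A) (snd X) (MOb (fst X)) = Arr (MOb A) (snd Y) (MOb (fst Y))"
  (is "_ \<longleftrightarrow> ?R")
proof -
  have "h \<in> Hom (under_cat (Comm C) A) X Y \<longleftrightarrow>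
    chom A (fst X) (Arr (MOb A) (snd X) (MOb (fst X))) \<and> chom A (fst Y) (Arr (MOb A) (snd Y) (MOb (fst Y))) \<and>
    chom (fst X) (fst Y) (Arr (MOb (fst X)) h (MOb (fst Y))) \<and> h \<cdot> snd X = snd Y"
    by (cases X; cases Y) (simp add: under_cat_def hom_Comm)
  also have "\<dots> \<longleftrightarrow> ?R"
    using chomD(3)[of A "fst X" "Arr (MOb A) (snd X) (MOb (fst X))"]
      chomD(3)[of "fst X" "fst Y" "Arr (MOb (fst X)) h (MOb (fst Y))"]
    by (auto simp: Arr_acomp)
  finally show ?thesis .
qed

lemma ob_under_Comm:
  "X \<in> Ob (under_cat (Comm C) A) \<longleftrightarrow> chom A (fst X) (Arr (MOb A) (snd X) (MOb (fst X)))"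
  by (cases X) (simp add: under_cat_def hom_Comm)

lemma under_Comm_sel [simp]:
  "Cmp (under_cat (Comm C) A) = Cmp C" "Idt (under_cat (Comm C) A) X = Idt C (MOb (fst X))"
  by (simp_all add: under_cat_def case_prod_beta)

end

context ag_base
begin

text \<open>Since the diagonal is final, Q \<otimes> Q is the colimit of the squares of the stages,
  so the multiplications glue. The monoid laws are inherited because the further tensor products
  involved are colimits of stages too.\<close>

lemma ex_monoid_filtered_colimit:
  assumes sm: "tens_adm J" and F: "filtered_cat J"
    and D: "tdiag J (\<lambda>i. MOb (B i)) D" and Q: "tcolim J (\<lambda>i. MOb (B i)) D Q q"
    and hom: "\<And>i j u. u \<in> Hom J i j \<Longrightarrow> chom (B i) (B j) (D i j u)"
    and mon: "\<And>i. i \<in> Ob J \<Longrightarrow> is_cmonoid C (B i)"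
  obtains P where "MOb P = Q" "\<And>i. i \<in> Ob J \<Longrightarrow> chom (B i) P (q i)"
proof -
  interpret J: category J using sm by (rule tens_adm_category)
  let ?u = "UnitOb C"
  note [simp] = tcolimD[OF Q] cmonD(1-3)[OF mon] tdiagD(1-5)[OF D]
  note QQ = tcolim_tens[OF sm F D Q D Q] and DD = tdiag_tens[OF D D J.category_axioms]
  note QQQ = tcolim_tens[OF sm F DD QQ D Q]
  have fil: "\<exists>k u v. u \<in> Hom J i k \<and> v \<in> Hom J j k" if "i \<in> Ob J" "j \<in> Ob J" for i j
    using F that unfolding filtered_cat_def by blast
  have "tcocone J (\<lambda>i. MOb (B i) \<otimes>\<^sub>o MOb (B i)) (\<lambda>i j u. D i j u \<star> D i j u) Q (\<lambda>i. q i \<bullet> mm (B i))"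
    unfolding tcocone_def
  proof (intro conjI ballI allI)
    fix i j u assume u: "u \<in> Hom J i j"
    then have ij: "i \<in> Ob J" "j \<in> Ob J" using J.hom_ob by blast+
    have "q j \<bullet> mm (B j) \<bullet> (D i j u \<star> D i j u) = (q j \<bullet> D i j u) \<bullet> mm (B i)"
      by (simp only: chomD(6)[OF hom[OF u], symmetric] acomp_assoc)
    then show "(q j \<bullet> mm (B j)) \<bullet> (D i j u \<star> D i j u) = q i \<bullet> mm (B i)"
      by (simp only: tcolimD(5)[OF Q u] acomp_assoc)
  qed simp_all
  from tcolim_factor[OF QQ this] obtain m where m [simp]: "ok m" "src m = Q \<otimes>\<^sub>o Q" "tgt m = Q"
    and mq: "\<And>i. i \<in> Ob J \<Longrightarrow> m \<bullet> (q i \<star> q i) = q i \<bullet> mm (B i)" by blast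
  \<comment> \<open>The unit is taken from a single stage, available because a filtered category is
    nonempty. Two stages yield the same unit by comparison at a common bound.\<close>
  obtain i0 where i0 [simp]: "i0 \<in> Ob J" using F by (auto simp: filtered_cat_def)
  define eta where "eta = q i0 \<bullet> ee (B i0)"
  have eta [simp]: "ok eta" "src eta = ?u" "tgt eta = Q" by (simp_all add: eta_def)
  have qe: "q i \<bullet> ee (B i) = eta" if i: "i \<in> Ob J" for i
  proof -
    have *: "q k \<bullet> ee (B k) = q i \<bullet> ee (B i)" if u: "u \<in> Hom J i k" for i k u
      using acomp_reassoc[OF tcolimD(5)[OF Q u], of "ee (B i)"] chomD(7)[OF hom[OF u]] by simp
    then show ?thesis using fil[OF i i0] by (metis eta_def)
  qed
  define P where "P = \<lparr>MOb = Q, Mult = raw m, Eta = raw eta\<rparr>"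
  have [simp]: "MOb P = Q" "Mult P = raw m" "Eta P = raw eta" by (simp_all add: P_def)
  have [simp]: "mm P = m" using ar_Arr_raw[of m "Q \<otimes>\<^sub>o Q" Q] unfolding mm_def[of P] by simp
  have [simp]: "ee P = eta" using ar_Arr_raw[of eta ?u Q] unfolding ee_def[of P] by simp
  have P: "is_cmonoid C P"
    unfolding is_cmonoid_iff
  proof (intro conjI)
    show "mm P \<bullet> (mm P \<star> idn (MOb P)) = mm P \<bullet> (idn (MOb P) \<star> mm P) \<bullet> al (MOb P) (MOb P) (MOb P)"
    proof (rule tcolim_eqI[OF QQQ J.category_axioms])
      fix i assume i [simp]: "i \<in> Ob J"
      let ?B = "MOb (B i)"
      have "m \<bullet> (m \<star> idn Q) \<bullet> ((q i \<star> q i) \<star> q i) = m \<bullet> (q i \<star> q i) \<bullet> (mm (B i) \<star> idn ?B)"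
        by (simp add: mq)
      also have "\<dots> = q i \<bullet> mm (B i) \<bullet> (mm (B i) \<star> idn ?B)"
        using acomp_reassoc2[OF mq[OF i], of "mm (B i) \<star> idn ?B"] by simp
      also have "\<dots> = q i \<bullet> mm (B i) \<bullet> (idn ?B \<star> mm (B i)) \<bullet> al ?B ?B ?B"
        by (simp only: cmonD(4)[OF mon[OF i]])
      also have "\<dots> = m \<bullet> (q i \<star> q i) \<bullet> (idn ?B \<star> mm (B i)) \<bullet> al ?B ?B ?B"
        using acomp_reassoc2[OF mq[OF i, symmetric], of "(idn ?B \<star> mm (B i)) \<bullet> al ?B ?B ?B"] by simp
      also have "\<dots> = m \<bullet> (idn Q \<star> m) \<bullet> (q i \<star> (q i \<star> q i)) \<bullet> al ?B ?B ?B"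
        by (simp add: mq)
      also have "(q i \<star> (q i \<star> q i)) \<bullet> al ?B ?B ?B = al Q Q Q \<bullet> ((q i \<star> q i) \<star> q i)"
        by (rule al_nat[symmetric]) simp_all
      finally show "(mm P \<bullet> (mm P \<star> idn (MOb P))) \<bullet> ((q i \<star> q i) \<star> q i)
          = (mm P \<bullet> (idn (MOb P) \<star> mm P) \<bullet> al (MOb P) (MOb P) (MOb P)) \<bullet> ((q i \<star> q i) \<star> q i)"
        by (simp del: interchange interchange_reassoc)
    qed simp_all
    show "mm P \<bullet> (ee P \<star> idn (MOb P)) = lu (MOb P)"
    proof (rule tcolim_eqI[OF tens_adm_left[OF sm unit_ob D Q] J.category_axioms])
      fix i assume i [simp]: "i \<in> Ob J"
      have "m \<bullet> (q i \<star> q i) \<bullet> (ee (B i) \<star> idn (MOb (B i))) = q i \<bullet> lu (MOb (B i))"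
        using acomp_reassoc2[OF mq[OF i], of "ee (B i) \<star> idn (MOb (B i))"] cmonD(5)[OF mon[OF i]] by simp
      then show "(mm P \<bullet> (ee P \<star> idn (MOb P))) \<bullet> (idn ?u \<star> q i) = lu (MOb P) \<bullet> (idn ?u \<star> q i)"
        using lu_nat[of "q i" "MOb (B i)" Q] by (simp add: qe)
    qed simp_all
    show "mm P \<bullet> (idn (MOb P) \<star> ee P) = ru (MOb P)"
    proof (rule tcolim_eqI[OF tens_admD[OF sm unit_ob D Q] J.category_axioms])
      fix i assume i [simp]: "i \<in> Ob J"
      have "m \<bullet> (q i \<star> q i) \<bullet> (idn (MOb (B i)) \<star> ee (B i)) = q i \<bullet> ru (MOb (B i))"
        using acomp_reassoc2[OF mq[OF i], of "idn (MOb (B i)) \<star> ee (B i)"] cmonD(6)[OF mon[OF i]] by simp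
      then show "(mm P \<bullet> (idn (MOb P) \<star> ee P)) \<bullet> (q i \<star> idn ?u) = ru (MOb P) \<bullet> (q i \<star> idn ?u)"
        using ru_nat[of "q i" "MOb (B i)" Q] by (simp add: qe)
    qed simp_all
    show "mm P \<bullet> br (MOb P) (MOb P) = mm P"
    proof (rule tcolim_eqI[OF QQ J.category_axioms])
      fix i assume i [simp]: "i \<in> Ob J"
      have "m \<bullet> br Q Q \<bullet> (q i \<star> q i) = m \<bullet> (q i \<star> q i) \<bullet> br (MOb (B i)) (MOb (B i))"
        using br_nat[of "q i" "MOb (B i)" Q "q i" "MOb (B i)" Q] by simp
      also have "\<dots> = q i \<bullet> mm (B i) \<bullet> br (MOb (B i)) (MOb (B i))"
        using acomp_reassoc2[OF mq[OF i]] by simp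
      finally show "(mm P \<bullet> br (MOb P) (MOb P)) \<bullet> (q i \<star> q i) = mm P \<bullet> (q i \<star> q i)"
        by (simp add: mq cmonD(7)[OF mon[OF i]])
    qed simp_all
  qed simp_all
  have "chom (B i) P (q i)" if "i \<in> Ob J" for i
    using that P mon[OF that] by (simp add: chom_def mq qe)
  then show ?thesis by (intro that[of P]) simp_all
qed

text \<open>A colimit of monoids under A is known only through morphisms to such monoids. The
  colimit formed in C carries a monoid structure as well, and maps in both directions identify the
  two; this makes the hypothesis on the unit object applicable.\<close>

lemma forget_filtered_colimit:
  assumes J: "small_cat (J :: ('u, 'u) cat)" and F: "filtered_cat J"
    and G: "is_ftor J (under_cat (Comm C) A) G"
    and L: "is_colimit J (under_cat (Comm C) A) G L e"
  defines "B \<equiv> \<lambda>i. fst (FOb G i)" and "g \<equiv> \<lambda>i. Arr (MOb A) (snd (FOb G i)) (MOb (fst (FOb G i)))"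
    and "D \<equiv> \<lambda>i j u. Arr (MOb (fst (FOb G i))) (FAr G i j u) (MOb (fst (FOb G j)))"
    and "f \<equiv> \<lambda>i. Arr (MOb (fst (FOb G i))) (e i) (MOb (fst L))"
    and "gL \<equiv> Arr (MOb A) (snd L) (MOb (fst L))"
  shows "\<And>i. i \<in> Ob J \<Longrightarrow> chom A (B i) (g i)" "chom A (fst L) gL"
    "\<And>i j u. u \<in> Hom J i j \<Longrightarrow> chom (B i) (B j) (D i j u) \<and> D i j u \<bullet> g i = g j"
    "\<And>i. i \<in> Ob J \<Longrightarrow> chom (B i) (fst L) (f i) \<and> f i \<bullet> g i = gL"
    "tdiag J (\<lambda>i. MOb (B i)) D"
    "tcolim J (\<lambda>i. MOb (B i)) D (MOb (fst L)) f"
proof -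
  let ?K = "under_cat (Comm C) A"
  interpret K: category ?K by (rule category_under_Comm)
  have Jc: "category J" using J by (simp add: small_cat_def)
  interpret J: category J by fact
  have L1: "L \<in> Ob ?K" "\<And>i. i \<in> Ob J \<Longrightarrow> e i \<in> Hom ?K (FOb G i) L"
    "\<And>i j u. u \<in> Hom J i j \<Longrightarrow> e j \<cdot> FAr G i j u = e i"
    using L by (simp_all add: is_colimit_def is_cocone_def)
  have G1: "\<And>i. i \<in> Ob J \<Longrightarrow> FOb G i \<in> Ob ?K" "\<And>i j u. u \<in> Hom J i j \<Longrightarrow> FAr G i j u \<in> Hom ?K (FOb G i) (FOb G j)"
    "\<And>i. i \<in> Ob J \<Longrightarrow> FAr G i i (Idt J i) = Idt C (MOb (B i))"
    "\<And>i j k u v. \<lbrakk>u \<in> Hom J i j; v \<in> Hom J j k\<rbrakk> \<Longrightarrow> FAr G i k (v \<cdot>\<^bsub>J\<^esub> u) = FAr G j k v \<cdot> FAr G i j u"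
    using G by (simp_all add: is_ftor_def B_def)
  show g: "chom A (B i) (g i)" if "i \<in> Ob J" for i
    using G1(1)[OF that] by (simp add: ob_under_Comm B_def g_def)
  show gL: "chom A (fst L) gL" using L1(1) by (simp add: ob_under_Comm gL_def)
  show D: "chom (B i) (B j) (D i j u) \<and> D i j u \<bullet> g i = g j" if "u \<in> Hom J i j" for i j u
    using G1(2)[OF that] by (simp add: hom_under_Comm B_def D_def g_def)
  show f: "chom (B i) (fst L) (f i) \<and> f i \<bullet> g i = gL" if "i \<in> Ob J" for i
    using L1(2)[OF that] by (simp add: hom_under_Comm B_def f_def g_def gL_def)
  have mon: "is_cmonoid C (B i)" if "i \<in> Ob J" for i using g[OF that] by (simp add: chom_def)
  have Dok: "ok (D i j u)" if "u \<in> Hom J i j" for i j u using D[OF that] by (simp add: chom_def)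
  have fok: "ok (f i)" if "i \<in> Ob J" for i using f[OF that] by (simp add: chom_def)
  have st: "src (D i j u) = MOb (B i)" "tgt (D i j u) = MOb (B j)" "src (f i) = MOb (B i)" "tgt (f i) = MOb (fst L)" for i j u
    by (simp_all add: D_def f_def B_def)
  show Dd: "tdiag J (\<lambda>i. MOb (B i)) D"
    unfolding tdiag_def
  proof (intro conjI ballI allI)
    fix i j k u v assume uv: "u \<in> Hom J i j" "v \<in> Hom J j k"
    show "D i k (v \<cdot>\<^bsub>J\<^esub> u) = D j k v \<bullet> D i j u"
      using Dok[OF uv(1)] Dok[OF uv(2)] by (simp add: D_def Arr_acomp G1(4)[OF uv])
  qed (use cmonD(1)[OF mon] Dok st G1(3) in \<open>auto simp: D_def idn_def B_def\<close>)
  have sm: "tens_adm J" by (rule tens_adm_small[OF J])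
  obtain Q q where Q: "tcolim J (\<lambda>i. MOb (B i)) D Q q" by (rule ex_tcolim_small[OF J Dd])
  obtain P where PQ: "MOb P = Q" and q: "\<And>i. i \<in> Ob J \<Longrightarrow> chom (B i) P (q i)"
    by (rule ex_monoid_filtered_colimit[OF sm F Dd Q]) (use D mon in auto)
  note [simp] = PQ tcolimD[OF Q] chomD(3-5)[OF gL] cmonD(1-3)[OF mon] cmonD(1-3)[OF chomD(2)[OF gL]]
    chomD(3-5)[OF g] fok st
  obtain i0 where i0 [simp]: "i0 \<in> Ob J" using F by (auto simp: filtered_cat_def)
  note [simp] = cmonD(1-3)[OF chomD(2)[OF q[OF i0]], simplified]
  have qg: "q i \<bullet> g i = q i0 \<bullet> g i0" if i: "i \<in> Ob J" for i
  proof -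
    have "q k \<bullet> g k = q i \<bullet> g i" if u: "u \<in> Hom J i k" for i k u
      using acomp_reassoc[OF tcolimD(5)[OF Q u], of "g i"] D[OF u] by simp
    then show ?thesis using F i i0 unfolding filtered_cat_def by (metis ex_in_conv)
  qed
  \<comment> \<open>The structure map from A, taken at one stage; \<open>qg\<close> shows that every
    stage gives the same one.\<close>
  define \<gamma> where "\<gamma> = q i0 \<bullet> g i0"
  have \<gamma>: "chom A P \<gamma>" unfolding \<gamma>_def by (rule chom_comp[OF g[OF i0] q[OF i0]])
  note [simp] = chomD(3-5)[OF \<gamma>, simplified]
  define P' where "P' = (P, raw \<gamma>)"
  have P'[simp]: "fst P' = P" "Arr (MOb A) (snd P') Q = \<gamma>"
    using ar_Arr_raw[of \<gamma> "MOb A" Q] by (simp_all add: P'_def)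
  have "is_cocone J ?K G P' (\<lambda>i. raw (q i))"
    unfolding is_cocone_def
  proof (intro conjI ballI allI)
    show "P' \<in> Ob ?K" using \<gamma> by (simp add: ob_under_Comm)
    show "raw (q i) \<in> Hom ?K (FOb G i) P'" if i: "i \<in> Ob J" for i
      using g[OF i] \<gamma> q[OF i] qg[OF i] ar_Arr_raw[of "q i" "MOb (B i)" Q] i
      by (simp add: hom_under_Comm flip: B_def g_def \<gamma>_def) (simp add: g_def B_def)
    show "raw (q j) \<cdot>\<^bsub>?K\<^esub> FAr G i j u = raw (q i)" if u: "u \<in> Hom J i j" for i j u
    proof -
      have "raw (q j) \<cdot> raw (D i j u) = raw (q i)"
        using ok_acomp(4)[of "D i j u" "q j"] tcolimD(5)[OF Q u] Dok[OF u] J.hom_ob[OF u] by simp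
      moreover have "raw (D i j u) = FAr G i j u" by (simp add: D_def)
      ultimately show ?thesis using u Dok[OF u] J.hom_ob[OF u] by simp
    qed
  qed
  then obtain h where h: "h \<in> Hom ?K L P'" "\<And>i. i \<in> Ob J \<Longrightarrow> h \<cdot> e i = raw (q i)"
    using L unfolding is_colimit_def by (metis under_Comm_sel(1))
  define H where "H = Arr (MOb (fst L)) h Q"
  have H: "chom (fst L) P H" using h(1) by (simp add: hom_under_Comm H_def)
  note [simp] = chomD(3-5)[OF H, simplified]
  have Hg: "H \<bullet> gL = \<gamma>" using h(1) by (simp add: hom_under_Comm H_def gL_def)
  have Hf: "H \<bullet> f i = q i" if "i \<in> Ob J" for i
  proof (rule arrow_eqI)
    have "raw H = h" "raw (f i) = e i" by (simp_all add: H_def f_def)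
    then show "raw (H \<bullet> f i) = raw (q i)" using that h(2) by simp
  qed (use that in simp_all)
  have "tcocone J (\<lambda>i. MOb (B i)) D (MOb (fst L)) f"
    unfolding tcocone_def
  proof (intro conjI ballI allI)
    fix i j u assume u: "u \<in> Hom J i j"
    then show "f j \<bullet> D i j u = f i"
      using Dok[OF u] fok J.hom_ob[OF u] L1(3)[OF u] by (simp add: f_def D_def Arr_acomp)
  qed simp_all
  from tcolim_factor[OF Q this] obtain K where K [simp]: "ok K" "src K = Q" "tgt K = MOb (fst L)"
    and Kq: "\<And>i. i \<in> Ob J \<Longrightarrow> K \<bullet> q i = f i" by blast
  have HK: "H \<bullet> K = idn Q"
    by (rule tcolim_eqI[OF Q Jc]) (simp_all add: Kq Hf)
  \<comment> \<open>Uniqueness of endomorphisms of \<open>L\<close> is available only among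
    morphisms of monoids under A, so K must first be shown multiplicative, unital and compatible
    with the structure maps.\<close>
  have KH: "K \<bullet> H = idn (MOb (fst L))"
  proof -
    have "K \<bullet> mm P = mm (fst L) \<bullet> (K \<star> K)"
    proof (rule tcolim_eqI[OF tcolim_tens[OF sm F Dd Q Dd Q] Jc])
      fix i assume i [simp]: "i \<in> Ob J"
      have fi: "chom (B i) (fst L) (f i)" using f[OF i] by simp
      show "(K \<bullet> mm P) \<bullet> (q i \<star> q i) = (mm (fst L) \<bullet> (K \<star> K)) \<bullet> (q i \<star> q i)"
        using acomp_reassoc[OF Kq[OF i], of "mm (B i)"]
        by (simp add: chomD(6)[OF q[OF i], symmetric] chomD(6)[OF fi] Kq)
    qed simp_all
    moreover have "K \<bullet> ee P = ee (fst L)"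
      using acomp_reassoc[OF Kq[OF i0], of "ee (B i0)"] f[OF i0] chomD(7)[OF q[OF i0]] by (simp add: chom_def)
    ultimately have "chom P (fst L) K"
      using chomD(2)[OF gL] chomD(2)[OF \<gamma>] by (simp add: chom_def)
    moreover have Kg: "K \<bullet> \<gamma> = gL"
      using acomp_reassoc[OF Kq[OF i0], of "g i0"] f[OF i0] by (simp add: \<gamma>_def)
    ultimately have KHc: "chom (fst L) (fst L) (K \<bullet> H)" "(K \<bullet> H) \<bullet> gL = gL"
      using chom_comp[OF H] Hg by auto
    have rK: "Arr (MOb (fst L)) (raw (K \<bullet> H)) (MOb (fst L)) = K \<bullet> H"
      by (rule ar_Arr_raw) simp
    have 1: "raw (K \<bullet> H) \<in> Hom ?K L L" using KHc gL rK by (simp add: hom_under_Comm gL_def del: ok_acomp)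
    have 2: "raw (K \<bullet> H) \<cdot> e i = e i" if "i \<in> Ob J" for i
    proof -
      have "raw ((K \<bullet> H) \<bullet> f i) = raw (f i)" using that by (simp add: Hf Kq)
      then show ?thesis using that fok[OF that] ok_acomp(4)[of "f i" "K \<bullet> H"] by (simp add: f_def)
    qed
    have 3: "Idt C (MOb (fst L)) \<in> Hom ?K L L" using K.idt_hom[OF L1(1)] by simp
    have 4: "Idt C (MOb (fst L)) \<cdot> e i = e i" if "i \<in> Ob J" for i
      using fok[OF that] idt_left by (simp add: f_def)
    have "\<exists>!h. h \<in> Hom ?K L L \<and> (\<forall>i\<in>Ob J. h \<cdot> e i = e i)"
      using L unfolding is_colimit_def under_Comm_sel(1) by blast
    with 1 2 3 4 have "raw (K \<bullet> H) = Idt C (MOb (fst L))" by blast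
    then show ?thesis using rK by (simp add: idn_def)
  qed
  have "tcolim J (\<lambda>i. MOb (B i)) D (MOb (fst L)) (\<lambda>i. K \<bullet> q i)"
    by (rule tcolim_iso[OF Jc Q _ _ _ _ _ _ HK KH]) simp_all
  then show "tcolim J (\<lambda>i. MOb (B i)) D (MOb (fst L)) f"
    by (rule tcolim_cong[OF _ Jc]) (simp_all add: Kq)
qed

lemma loc_finitely_presented:
  assumes B: "is_loc A t B e"
  shows "is_finitely_presented_morphism U C A B (raw (e 0))"
  unfolding is_finitely_presented_morphism_def hom_preserves_filtered_colims_def
proof (intro allI impI, elim conjE)
  fix J :: "('u, 'u) cat" and G L d
  assume J: "small_cat J" and F: "filtered_cat J" and G: "is_ftor J (under_cat (Comm C) A) G"
    and L: "is_colimit J (under_cat (Comm C) A) G L d"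
  let ?K = "under_cat (Comm C) A"
  interpret K: category ?K by (rule category_under_Comm)
  have Jc: "category J" using J by (simp add: small_cat_def)
  note A = is_locD(3)[OF B] and t = is_locD(1)[OF B] and j = is_locD(2)[OF B]
  define R where "R i = fst (FOb G i)" for i
  define g where "g i = Arr (MOb A) (snd (FOb G i)) (MOb (R i))" for i
  define D where "D i k u = Arr (MOb (R i)) (FAr G i k u) (MOb (R k))" for i k u
  define f where "f i = Arr (MOb (R i)) (d i) (MOb (fst L))" for i
  define gL where "gL = Arr (MOb A) (snd L) (MOb (fst L))"
  note defs = R_def g_def D_def f_def gL_def
  note c = forget_filtered_colimit[OF J F G L, folded R_def, folded g_def D_def f_def gL_def]
  note g = c(1) and gL = c(2) and Dc = c(3) and fc = c(4) and Dd = c(5) and col = c(6)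
  note [simp] = cmonD(1-3)[OF A] rendD(1-3)[OF A t] chomD(3-5)[OF g] chomD(3-5)[OF gL] chomD(3-5)[OF j]
    cmonD(1-3)[OF chomD(2)[OF g]] cmonD(1-3)[OF chomD(2)[OF gL]]
  have jr: "Arr (MOb A) (raw (e 0)) (MOb B) = e 0" by (rule ar_Arr_raw) simp
  have Lc: "is_cocone J ?K G L d" using L by (simp add: is_colimit_def)
  have surj: "\<exists>i\<in>Ob J. \<exists>x\<in>Hom ?K (B, raw (e 0)) (FOb G i). d i \<cdot> x = z" if z: "z \<in> Hom ?K (B, raw (e 0)) L" for z
  proof -
    define Z where "Z = Arr (MOb B) z (MOb (fst L))"
    have Z: "chom B (fst L) Z" and Zj: "Z \<bullet> e 0 = gL"
      using z by (simp_all add: hom_under_Comm Z_def jr gL_def)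
    define S where "S i = smul A (rmod (R i) (g i) (regular_module (R i))) t" for i
    define SL where "SL = smul A (rmod (fst L) gL (regular_module (fst L))) t"
    have SLi [simp]: "aiso SL" using aiso_smul_cod[OF B Z] by (simp add: Zj SL_def)
    have Sr: "rend (R i) (S i)" if "i \<in> Ob J" for i
      unfolding S_def by (rule rend_smul_rmod[OF g[OF that] t])
    note SLr = rend_smul_rmod[OF gL t, folded SL_def]
    note [simp] = rendD(1-3)[OF chomD(2)[OF gL] SLr] rendD(1-3)[OF chomD(2)[OF g] Sr]
    have fS: "f i \<bullet> S i = SL \<bullet> f i" if i: "i \<in> Ob J" for i
      using smul_nat[OF A mhom_rmod_of_chom[OF g[OF i] conjunct1[OF fc[OF i]]] t] fc[OF i]
      by (simp add: S_def SL_def)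
    have DS: "D i k u \<bullet> S i = S k \<bullet> D i k u" if u: "u \<in> Hom J i k" for i k u
    proof -
      have i: "i \<in> Ob J" using category.hom_ob[OF Jc u] by simp
      show ?thesis
        using smul_nat[OF A mhom_rmod_of_chom[OF g[OF i] conjunct1[OF Dc[OF u]]] t] Dc[OF u]
        by (simp add: S_def)
    qed
    \<comment> \<open>The inverse of t in the colimit, as an element with source 1. By (C1) it comes
      from an element of some stage i.\<close>
    let ?s = "ainv SL \<bullet> ee (fst L)"
    have colC: "is_colimit J C (rftor (\<lambda>i. MOb (R i)) D) (MOb (fst L)) d"
      using col is_colimit_iff_tcolim[OF Jc Dd] by (simp add: f_def)
    have ftC: "is_ftor J C (rftor (\<lambda>i. MOb (R i)) D)" by (rule is_ftor_rftor[OF Jc Dd])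
    have "hom_commutes_with_colim C (UnitOb C) J (rftor (\<lambda>i. MOb (R i)) D) (MOb (fst L)) d"
      using C1_unit J F colC ftC unfolding hom_preserves_filtered_colims_def by blast
    then have ex: "\<And>z. z \<in> Hom C (UnitOb C) (MOb (fst L)) \<Longrightarrow> \<exists>i\<in>Ob J. \<exists>x\<in>Hom C (UnitOb C) (MOb (R i)). d i \<cdot> x = z"
      and uni: "\<And>i x y. \<lbrakk>i \<in> Ob J; x \<in> Hom C (UnitOb C) (MOb (R i)); y \<in> Hom C (UnitOb C) (MOb (R i)); d i \<cdot> x = d i \<cdot> y\<rbrakk>
        \<Longrightarrow> \<exists>k. \<exists>u\<in>Hom J i k. raw (D i k u) \<cdot> x = raw (D i k u) \<cdot> y"
      using hom_commutes_filtered_iff[OF F ftC, of "MOb (fst L)" d "UnitOb C"] colC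
      by (simp_all add: is_colimit_def rftor_def)
    have "raw ?s \<in> Hom C (UnitOb C) (MOb (fst L))" by (rule ar_raw) simp
    then obtain i y' where i: "i \<in> Ob J" and y': "y' \<in> Hom C (UnitOb C) (MOb (R i))" "d i \<cdot> y' = raw ?s"
      using ex by blast
    define y where "y = Arr (UnitOb C) y' (MOb (R i))"
    note fi = conjunct1[OF fc[OF i]]
    note [simp] = chomD(3-5)[OF fi] i
    have y [simp]: "ok y" "src y = UnitOb C" "tgt y = MOb (R i)" "raw y = y'" using y' by (simp_all add: y_def)
    have rf: "raw (f i) = d i" for i by (simp add: f_def)
    have fy: "f i \<bullet> y = ?s"
    proof (rule arrow_eqI)
      show "raw (f i \<bullet> y) = raw ?s" using y'(2) ok_acomp(4)[of y "f i"] rf by simp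
    qed simp_all
    \<comment> \<open>At stage i the equation t y = 1 is known only after passing to the colimit,
      hence it holds at some later stage k.\<close>
    have "f i \<bullet> S i \<bullet> y = f i \<bullet> ee (R i)"
      using acomp_reassoc2[OF fS[OF i], of y] fy chomD(7)[OF fi] by simp
    then have "raw (f i \<bullet> S i \<bullet> y) = raw (f i \<bullet> ee (R i))" by simp
    then have "d i \<cdot> raw (S i \<bullet> y) = d i \<cdot> raw (ee (R i))"
      by (simp only: ok_acomp fi chomD(3-5)[OF fi] rendD(1-3)[OF chomD(2)[OF g[OF i]] Sr[OF i]] y rf
          cmonD(1-3)[OF chomD(2)[OF g[OF i]]] ee_st)
    moreover have "raw (S i \<bullet> y) \<in> Hom C (UnitOb C) (MOb (R i))" "raw (ee (R i)) \<in> Hom C (UnitOb C) (MOb (R i))"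
      by (rule ar_raw, simp)+
    ultimately obtain k u where u: "u \<in> Hom J i k" and Du: "raw (D i k u) \<cdot> raw (S i \<bullet> y) = raw (D i k u) \<cdot> raw (ee (R i))"
      using uni[OF i] by blast
    have k [simp]: "k \<in> Ob J" using category.hom_ob[OF Jc u] by simp
    note Dh = conjunct1[OF Dc[OF u]]
    note [simp] = chomD(3-5)[OF Dh]
    have "D i k u \<bullet> S i \<bullet> y = D i k u \<bullet> ee (R i)"
    proof (rule arrow_eqI)
      show "raw (D i k u \<bullet> S i \<bullet> y) = raw (D i k u \<bullet> ee (R i))"
        using Du ok_acomp(4)[of "S i \<bullet> y" "D i k u"] ok_acomp(4)[of "ee (R i)" "D i k u"] by simp
    qed simp_all
    then have Sw: "S k \<bullet> D i k u \<bullet> y = ee (R k)"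
      using acomp_reassoc2[OF DS[OF u], of y] chomD(7)[OF Dh] by simp
    let ?w = "D i k u \<bullet> y"
    let ?W = "sc (R k) (regular_module (R k)) ?w"
    note Rk = chomD(2)[OF g[OF k]]
    note Rm = is_module_regular[OF Rk]
    note [simp] = sc_simps[OF Rk Rm, of ?w, simplified]
    \<comment> \<open>From t w = 1 for the element w at stage k, multiplication by w inverts
      multiplication by t.\<close>
    have SW: "S k \<bullet> ?W = idn (MOb (R k))"
    proof -
      have "S k \<bullet> ?W = S k \<bullet> mm (R k) \<bullet> (idn (MOb (R k)) \<star> ?w) \<bullet> ainv (ru (MOb (R k)))"
        by (simp add: sc_def)
      also have "\<dots> = mm (R k) \<bullet> (idn (MOb (R k)) \<star> ee (R k)) \<bullet> ainv (ru (MOb (R k)))"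
        using acomp_reassoc2[OF rendD(5)[OF Rk Sr[OF k]], of "(idn (MOb (R k)) \<star> ?w) \<bullet> ainv (ru (MOb (R k)))"] Sw by simp
      also have "\<dots> = ru (MOb (R k)) \<bullet> ainv (ru (MOb (R k)))"
        by (simp only: acomp_reassoc[OF cmonD(6)[OF Rk]])
      finally show ?thesis by simp
    qed
    moreover have "?W \<bullet> S k = S k \<bullet> ?W"
      by (rule sc_nat[OF Rk Sr[OF k], symmetric]) simp_all
    ultimately have "aiso (S k)"
      by (intro aisoI[of "S k" "MOb (R k)" "MOb (R k)" ?W]) simp_all
    then obtain h where h: "chom B (R k) h" "h \<bullet> e 0 = g k"
      unfolding S_def using loc_universal[OF B g[OF k]] by blast
    have hr: "Arr (MOb B) (raw h) (MOb (R k)) = h"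
      using chomD(3-5)[OF h(1)] by (intro ar_Arr_raw) simp
    have "raw h \<in> Hom ?K (B, raw (e 0)) (FOb G k)"
      using h j g[OF k] by (simp add: hom_under_Comm jr flip: R_def g_def) (simp add: hr g_def R_def[symmetric])
    moreover have "d k \<cdot> raw h = z"
    proof -
      note fk = conjunct1[OF fc[OF k]]
      have "f k \<bullet> h = Z"
        by (rule loc_epi[OF B chom_comp[OF h(1) fk] Z]) (use h(2) fc[OF k] Zj in simp)
      then have "raw (f k \<bullet> h) = z" by (simp add: Z_def)
      then show ?thesis using chomD(3-5)[OF fk] chomD(3-5)[OF h(1)] by (simp add: rf)
    qed
    ultimately show ?thesis using k by blast
  qed
  \<comment> \<open>Two arrows out of B under A with the same target coincide, so the injectivity
    half of the criterion is met by the identity of the stage.\<close>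
  have inj: "x = y" if xy: "x \<in> Hom ?K (B, raw (e 0)) X" "y \<in> Hom ?K (B, raw (e 0)) X" for x y X
  proof -
    have "Arr (MOb B) x (MOb (fst X)) = Arr (MOb B) y (MOb (fst X))"
      by (rule loc_epi[OF B, where Z = "fst X"]) (use xy in \<open>simp_all add: hom_under_Comm jr\<close>)
    then show ?thesis by simp
  qed
  show "hom_commutes_with_colim ?K (B, raw (e 0)) J G L d"
    unfolding K.hom_commutes_filtered_iff[OF F G Lc] using surj inj category.idt_hom[OF Jc]
    by (metis under_Comm_sel(1))
qed

end


section \<open>Base change to a localisation\<close>

context symmetric_monoidal_category
begin

text \<open>The action of \<open>B\<close> on the free module \<open>X \<otimes> B\<close>.\<close>

definition fmul :: "('o, 'm) cmon \<Rightarrow> 'o \<Rightarrow> ('o, 'm) arrow" where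
  "fmul B X = (idn X \<star> mm B) \<bullet> al X (MOb B) (MOb B)"

lemma fmul_simps [simp]:
  assumes "is_cmonoid C B" "X \<in> Ob C"
  shows "ok (fmul B X)" "src (fmul B X) = (X \<otimes>\<^sub>o MOb B) \<otimes>\<^sub>o MOb B" "tgt (fmul B X) = X \<otimes>\<^sub>o MOb B"
  using assms cmonD(1-3)[of B] by (simp_all add: fmul_def)

lemma fmul_nat:
  assumes B: "is_cmonoid C B" and g [simp]: "ok g" "src g = X" "tgt g = Y"
  shows "fmul B Y \<bullet> ((g \<star> idn (MOb B)) \<star> idn (MOb B)) = (g \<star> idn (MOb B)) \<bullet> fmul B X"
proof -
  have [simp]: "X \<in> Ob C" "Y \<in> Ob C" using g ok_ob by blast+
  note [simp] = cmonD(1-3)[OF B]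
  show ?thesis
    using al_nat[of g X Y "idn (MOb B)" "MOb B" "MOb B" "idn (MOb B)" "MOb B" "MOb B"]
    by (simp add: fmul_def)
qed

text \<open>Pentagon and naturality of the associator. With Y = B and f the multiplication it gives
  associativity of the free module; with Y = A it covers the arrow \<open>bcs\<close> of the
  defining pair of the base change.\<close>

lemma fmul_linear:
  assumes B: "is_cmonoid C B" and [simp]: "X \<in> Ob C" "Y \<in> Ob C"
    and f [simp]: "ok f" "src f = Y \<otimes>\<^sub>o MOb B" "tgt f = MOb B"
    and lin: "f \<bullet> (idn Y \<star> mm B) \<bullet> al Y (MOb B) (MOb B) = mm B \<bullet> (f \<star> idn (MOb B))"
  defines "s \<equiv> (idn X \<star> f) \<bullet> al X Y (MOb B)"
  shows "fmul B X \<bullet> (s \<star> idn (MOb B)) = s \<bullet> fmul B (X \<otimes>\<^sub>o Y)"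
proof -
  let ?B = "MOb B"
  note [simp] = cmonD(1-3)[OF B]
  have "fmul B X \<bullet> (s \<star> idn ?B)
      = (idn X \<star> mm B) \<bullet> (al X ?B ?B \<bullet> ((idn X \<star> f) \<star> idn ?B)) \<bullet> (al X Y ?B \<star> idn ?B)"
    by (simp add: fmul_def s_def)
  also have "al X ?B ?B \<bullet> ((idn X \<star> f) \<star> idn ?B) = (idn X \<star> (f \<star> idn ?B)) \<bullet> al X (Y \<otimes>\<^sub>o ?B) ?B"
    by (rule al_nat) simp_all
  also have "(idn X \<star> mm B) \<bullet> ((idn X \<star> (f \<star> idn ?B)) \<bullet> al X (Y \<otimes>\<^sub>o ?B) ?B) \<bullet> (al X Y ?B \<star> idn ?B)
      = (idn X \<star> (f \<bullet> (idn Y \<star> mm B) \<bullet> al Y ?B ?B)) \<bullet> al X (Y \<otimes>\<^sub>o ?B) ?B \<bullet> (al X Y ?B \<star> idn ?B)"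
    unfolding lin by simp
  also have "\<dots> = (idn X \<star> (f \<bullet> (idn Y \<star> mm B))) \<bullet> (idn X \<star> al Y ?B ?B) \<bullet> al X (Y \<otimes>\<^sub>o ?B) ?B \<bullet> (al X Y ?B \<star> idn ?B)"
    by simp
  also have "\<dots> = (idn X \<star> (f \<bullet> (idn Y \<star> mm B))) \<bullet> al X Y (?B \<otimes>\<^sub>o ?B) \<bullet> al (X \<otimes>\<^sub>o Y) ?B ?B"
    by (simp only: apentagon assms(2,3) cmonD(1)[OF B])
  also have "\<dots> = (idn X \<star> f) \<bullet> ((idn X \<star> (idn Y \<star> mm B)) \<bullet> al X Y (?B \<otimes>\<^sub>o ?B)) \<bullet> al (X \<otimes>\<^sub>o Y) ?B ?B"
    by simp
  also have "(idn X \<star> (idn Y \<star> mm B)) \<bullet> al X Y (?B \<otimes>\<^sub>o ?B) = al X Y ?B \<bullet> ((idn X \<star> idn Y) \<star> mm B)"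
    by (rule al_nat[symmetric]) simp_all
  finally show ?thesis by (simp add: fmul_def s_def)
qed

lemma fmul_assoc:
  assumes B: "is_cmonoid C B" and [simp]: "X \<in> Ob C"
  shows "fmul B X \<bullet> (fmul B X \<star> idn (MOb B))
    = fmul B X \<bullet> (idn (X \<otimes>\<^sub>o MOb B) \<star> mm B) \<bullet> al (X \<otimes>\<^sub>o MOb B) (MOb B) (MOb B)"
  using fmul_linear[OF B, of X "MOb B" "mm B"] cmonD(1-4)[OF B] by (simp add: fmul_def)

lemma fmul_unit:
  assumes B: "is_cmonoid C B" and [simp]: "X \<in> Ob C"
  shows "fmul B X \<bullet> (idn (X \<otimes>\<^sub>o MOb B) \<star> ee B) = ru (X \<otimes>\<^sub>o MOb B)"
proof -
  let ?B = "MOb B"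
  note [simp] = cmonD(1-3)[OF B]
  have "fmul B X \<bullet> (idn (X \<otimes>\<^sub>o ?B) \<star> ee B) = (idn X \<star> mm B) \<bullet> (al X ?B ?B \<bullet> ((idn X \<star> idn ?B) \<star> ee B))"
    by (simp add: fmul_def)
  also have "al X ?B ?B \<bullet> ((idn X \<star> idn ?B) \<star> ee B) = (idn X \<star> (idn ?B \<star> ee B)) \<bullet> al X ?B (UnitOb C)"
    by (rule al_nat) simp_all
  also have "(idn X \<star> mm B) \<bullet> \<dots> = (idn X \<star> ru ?B) \<bullet> al X ?B (UnitOb C)"
    using cmonD(6)[OF B] by simp
  finally show ?thesis by (simp add: ru_tensor)
qed

text \<open>\<open>bcq\<close> is the coequalizer \<open>M \<otimes> B \<rightarrow> M \<otimes>\<^sub>A B\<close> of \<open>bcr\<close> and \<open>bcs\<close>.\<close>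

definition bcr :: "('o, 'm) cmon \<Rightarrow> ('o, 'm) cmon \<Rightarrow> ('o, 'm) modl \<Rightarrow> ('o, 'm) arrow" where
  "bcr A B M = act A M \<star> idn (MOb B)"

definition bcs :: "('o, 'm) cmon \<Rightarrow> ('o, 'm) cmon \<Rightarrow> ('o, 'm) arrow \<Rightarrow> ('o, 'm) modl \<Rightarrow> ('o, 'm) arrow" where
  "bcs A B j M = (idn (Und M) \<star> (mm B \<bullet> (j \<star> idn (MOb B)))) \<bullet> al (Und M) (MOb A) (MOb B)"

definition bcq :: "('o, 'm) cmon \<Rightarrow> ('o, 'm) cmon \<Rightarrow> ('o, 'm) arrow \<Rightarrow> ('o, 'm) modl \<Rightarrow> ('o, 'm) arrow" where
  "bcq A B j M = (let (Q, q) = base_change_coeq C A B (raw j) M in Arr (Und M \<otimes>\<^sub>o MOb B) q Q)"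

abbreviation bcN :: "('o, 'm) cmon \<Rightarrow> ('o, 'm) cmon \<Rightarrow> ('o, 'm) arrow \<Rightarrow> ('o, 'm) modl \<Rightarrow> ('o, 'm) modl" where
  "bcN A B j M \<equiv> FOb (base_change C A B (raw j)) M"

lemma Und_bcN: "Und (bcN A B j M) = tgt (bcq A B j M)"
  by (simp add: base_change_def base_change_ob_def bcq_def case_prod_beta)

lemma bc_rs [simp]:
  assumes j: "chom A B j" and M: "is_module C A M"
  shows "ok (bcr A B M)" "src (bcr A B M) = (Und M \<otimes>\<^sub>o MOb A) \<otimes>\<^sub>o MOb B" "tgt (bcr A B M) = Und M \<otimes>\<^sub>o MOb B"
    "ok (bcs A B j M)" "src (bcs A B j M) = (Und M \<otimes>\<^sub>o MOb A) \<otimes>\<^sub>o MOb B" "tgt (bcs A B j M) = Und M \<otimes>\<^sub>o MOb B"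
  using modD(1,2)[OF chomD(1)[OF j] M] cmonD(1-3)[OF chomD(1)[OF j]] cmonD(1-3)[OF chomD(2)[OF j]] chomD(3-5)[OF j]
  by (simp_all add: bcr_def bcs_def)

end

section \<open>The module structure and functoriality of base change\<close>

context ag_base
begin

text \<open>Coequalizers exist in C, so the choice in \<open>base_change_coeq\<close> picks a
  genuine one.\<close>

lemma bcq_coeq:
  assumes j: "chom A B j" and M: "is_module C A M"
  shows "tcoeq (bcr A B M) (bcs A B j M) (bcq A B j M)"
proof -
  note [simp] = modD(1,2)[OF chomD(1)[OF j] M] cmonD(1-3)[OF chomD(1)[OF j]] cmonD(1-3)[OF chomD(2)[OF j]] chomD(3-5)[OF j]
  let ?X = "(Und M \<otimes>\<^sub>o MOb A) \<otimes>\<^sub>o MOb B" and ?Y = "Und M \<otimes>\<^sub>o MOb B"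
  have r: "raw (bcr A B M) = Act M \<otimes>\<^sub>a Idt C (MOb B)"
    by (simp add: bcr_def raw_struct)
  have s: "raw (bcs A B j M) = (Idt C (Und M) \<otimes>\<^sub>a (Mult B \<cdot> (raw j \<otimes>\<^sub>a Idt C (MOb B)))) \<cdot> Assoc C (Und M) (MOb A) (MOb B)"
    by (simp add: bcs_def raw_struct)
  have rs: "Arr ?X (raw (bcr A B M)) ?Y = bcr A B M" "Arr ?X (raw (bcs A B j M)) ?Y = bcs A B j M"
    using bc_rs[OF j M] by (intro ar_Arr_raw; simp)+
  have rs': "raw (bcr A B M) \<in> Hom C ?X ?Y" "raw (bcs A B j M) \<in> Hom C ?X ?Y"
    using bc_rs[OF j M] by (intro ar_raw; simp)+
  have iff: "is_coequalizer C ?X ?Y (raw (bcr A B M)) (raw (bcs A B j M)) Q q \<longleftrightarrow> tcoeq (bcr A B M) (bcs A B j M) (Arr ?Y q Q)" for Q q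
    using is_coequalizer_iff_tcoeq[OF rs'] rs by simp
  obtain q where q: "tcoeq (bcr A B M) (bcs A B j M) q"
    using bc_rs[OF j M] ex_tcoeq[of "bcr A B M" "bcs A B j M"] by auto
  then obtain q' Q where "q = Arr ?Y q' Q"
    using tcoeqD(3,6)[OF q] bc_rs[OF j M] by (metis arE)
  with q have "\<exists>p. case p of (Q, q) \<Rightarrow> is_coequalizer C ?X ?Y (raw (bcr A B M)) (raw (bcs A B j M)) Q q"
    using iff by auto
  then have "case base_change_coeq C A B (raw j) M of (Q, q) \<Rightarrow>
      is_coequalizer C ?X ?Y (raw (bcr A B M)) (raw (bcs A B j M)) Q q"
    unfolding base_change_coeq_def r[symmetric] s[symmetric] by (rule someI_ex)
  then show ?thesis by (simp add: bcq_def case_prod_beta iff)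
qed

lemma bcq_simps [simp]:
  assumes j: "chom A B j" and M: "is_module C A M"
  shows "ok (bcq A B j M)" "src (bcq A B j M) = Und M \<otimes>\<^sub>o MOb B"
  using tcoeqD(3,6)[OF bcq_coeq[OF assms]] bc_rs[OF assms] by simp_all

text \<open>The free action respects the parallel pair, and the coequalizer stays one after
  tensoring with B. Hence the action descends in exactly one way, which justifies the definite
  description in \<open>base_change_ob\<close>.\<close>

lemma bc_act:
  assumes j: "chom A B j" and M: "is_module C A M"
  shows "ok (act B (bcN A B j M))"
    "act B (bcN A B j M) \<bullet> (bcq A B j M \<star> idn (MOb B)) = bcq A B j M \<bullet> fmul B (Und M)"
proof -
  let ?q = "bcq A B j M" and ?B = "MOb B" and ?N = "bcN A B j M"
  note A = chomD(1)[OF j] and B = chomD(2)[OF j]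
  note [simp] = modD(1,2)[OF A M] cmonD(1-3)[OF A] cmonD(1-3)[OF B] chomD(3-5)[OF j] bcq_simps[OF j M]
    fmul_simps[OF B] bc_rs[OF j M]
  have [simp]: "tgt ?q \<in> Ob C" using ok_ob(2)[OF bcq_simps(1)[OF j M]] .
  note co = tcoeq_tens[OF bcq_coeq[OF j M] cmonD(1)[OF B]]
  have r: "fmul B (Und M) \<bullet> (bcr A B M \<star> idn ?B) = bcr A B M \<bullet> fmul B (Und M \<otimes>\<^sub>o MOb A)"
    unfolding bcr_def by (rule fmul_nat[OF B]) simp_all
  have s: "fmul B (Und M) \<bullet> (bcs A B j M \<star> idn ?B) = bcs A B j M \<bullet> fmul B (Und M \<otimes>\<^sub>o MOb A)"
    unfolding bcs_def
  proof (rule fmul_linear[OF B])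
    have "(mm B \<bullet> (j \<star> idn ?B)) \<bullet> (idn (MOb A) \<star> mm B) \<bullet> al (MOb A) ?B ?B
        = mm B \<bullet> (idn ?B \<star> mm B) \<bullet> ((j \<star> (idn ?B \<star> idn ?B)) \<bullet> al (MOb A) ?B ?B)"
      by simp
    also have "(j \<star> (idn ?B \<star> idn ?B)) \<bullet> al (MOb A) ?B ?B = al ?B ?B ?B \<bullet> ((j \<star> idn ?B) \<star> idn ?B)"
      by (rule al_nat[symmetric]) simp_all
    also have "mm B \<bullet> (idn ?B \<star> mm B) \<bullet> al ?B ?B ?B \<bullet> ((j \<star> idn ?B) \<star> idn ?B)
        = mm B \<bullet> (mm B \<star> idn ?B) \<bullet> ((j \<star> idn ?B) \<star> idn ?B)"
      using acomp_reassoc2[OF cmonD(4)[OF B], of "(j \<star> idn ?B) \<star> idn ?B"] by simp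
    finally show "(mm B \<bullet> (j \<star> idn ?B)) \<bullet> (idn (MOb A) \<star> mm B) \<bullet> al (MOb A) ?B ?B
        = mm B \<bullet> ((mm B \<bullet> (j \<star> idn ?B)) \<star> idn ?B)" by simp
  qed simp_all
  have "(?q \<bullet> fmul B (Und M)) \<bullet> (bcr A B M \<star> idn ?B) = (?q \<bullet> fmul B (Und M)) \<bullet> (bcs A B j M \<star> idn ?B)"
    using acomp_reassoc2[OF tcoeqD(7)[OF bcq_coeq[OF j M]], of "fmul B (Und M \<otimes>\<^sub>o MOb A)"] by (simp add: r s)
  then obtain h where h: "ok h" "src h = tgt ?q \<otimes>\<^sub>o ?B" "tgt h = tgt ?q" "h \<bullet> (?q \<star> idn ?B) = ?q \<bullet> fmul B (Und M)"
    by (rule tcoeq_factor[OF co, rotated 2]) simp_all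
  obtain Q q where Qq: "base_change_coeq C A B (raw j) M = (Q, q)" by (cases "base_change_coeq C A B (raw j) M")
  then have q: "?q = Arr (Und M \<otimes>\<^sub>o ?B) q Q" by (simp add: bcq_def)
  have rf: "raw (fmul B (Und M)) = (Idt C (Und M) \<otimes>\<^sub>a Mult B) \<cdot> Assoc C (Und M) ?B ?B"
    by (simp add: fmul_def raw_struct)
  have iff: "u \<in> Hom C (Q \<otimes>\<^sub>o ?B) Q \<and> u \<cdot> (q \<otimes>\<^sub>a Idt C ?B) = q \<cdot> (Idt C (Und M) \<otimes>\<^sub>a Mult B) \<cdot> Assoc C (Und M) ?B ?B
      \<longleftrightarrow> ar (Arr (Q \<otimes>\<^sub>o ?B) u Q) (Q \<otimes>\<^sub>o ?B) Q \<and> Arr (Q \<otimes>\<^sub>o ?B) u Q \<bullet> (?q \<star> idn ?B) = ?q \<bullet> fmul B (Und M)" for u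
  proof -
    have "raw (?q \<star> idn ?B) = q \<otimes>\<^sub>a Idt C ?B" "raw ?q = q" "tgt ?q = Q"
      by (simp add: raw_struct) (simp_all add: q)
    then show ?thesis by (simp add: eq_iff_raw rf cong: conj_cong)
  qed
  have hr: "Arr (Q \<otimes>\<^sub>o ?B) (raw h) Q = h" using h q by (intro ar_Arr_raw) simp
  have "Act ?N = (THE u. u \<in> Hom C (Q \<otimes>\<^sub>o ?B) Q \<and> u \<cdot> (q \<otimes>\<^sub>a Idt C ?B) = q \<cdot> (Idt C (Und M) \<otimes>\<^sub>a Mult B) \<cdot> Assoc C (Und M) ?B ?B)"
    by (simp add: base_change_def base_change_ob_def Qq)
  also have "\<dots> = raw h"
    unfolding iff
  proof (rule the_equality)
    show "ar (Arr (Q \<otimes>\<^sub>o ?B) (raw h) Q) (Q \<otimes>\<^sub>o ?B) Q \<and> Arr (Q \<otimes>\<^sub>o ?B) (raw h) Q \<bullet> (?q \<star> idn ?B) = ?q \<bullet> fmul B (Und M)"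
      using h q unfolding hr by simp
    fix u assume u: "ar (Arr (Q \<otimes>\<^sub>o ?B) u Q) (Q \<otimes>\<^sub>o ?B) Q \<and> Arr (Q \<otimes>\<^sub>o ?B) u Q \<bullet> (?q \<star> idn ?B) = ?q \<bullet> fmul B (Und M)"
    have "Arr (Q \<otimes>\<^sub>o ?B) u Q = h"
      by (rule tcoeq_eqI[OF co]) (use u h arg_cong[OF q, of tgt] in simp_all)
    then show "u = raw h" by auto
  qed
  finally have "act B ?N = h" using hr by (simp add: act_def Und_bcN q)
  with h show "ok (act B ?N)" "act B ?N \<bullet> (?q \<star> idn ?B) = ?q \<bullet> fmul B (Und M)" by simp_all
qed

text \<open>The laws hold on the free module M \<otimes> B and descend, because the coequalizer
  remains epic after tensoring with B or with the unit.\<close>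

lemma bc_module:
  assumes j: "chom A B j" and M: "is_module C A M"
  shows "is_module C B (bcN A B j M)"
proof -
  let ?q = "bcq A B j M" and ?B = "MOb B" and ?N = "bcN A B j M" and ?X = "Und M" and ?u = "UnitOb C"
  note A = chomD(1)[OF j] and B = chomD(2)[OF j]
  note q = bcq_coeq[OF j M]
  note ac = bc_act(2)[OF j M]
  note [simp] = modD(1,2)[OF A M] cmonD(1-3)[OF A] cmonD(1-3)[OF B] bcq_simps[OF j M]
    fmul_simps[OF B] bc_act(1)[OF j M] Und_bcN bc_rs[OF j M]
  have [simp]: "tgt ?q \<in> Ob C" using ok_ob(2)[OF bcq_simps(1)[OF j M]] .
  show ?thesis
    unfolding is_module_iff[OF B]
  proof (intro conjI)
    show "act B ?N \<bullet> (act B ?N \<star> idn ?B) = act B ?N \<bullet> (idn (Und ?N) \<star> mm B) \<bullet> al (Und ?N) ?B ?B"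
    proof (rule tcoeq_eqI[OF tcoeq_tens[OF tcoeq_tens[OF q cmonD(1)[OF B]] cmonD(1)[OF B]]])
      have "act B ?N \<bullet> (act B ?N \<star> idn ?B) \<bullet> ((?q \<star> idn ?B) \<star> idn ?B)
          = act B ?N \<bullet> (?q \<star> idn ?B) \<bullet> (fmul B ?X \<star> idn ?B)"
        by (simp add: ac)
      also have "\<dots> = ?q \<bullet> fmul B ?X \<bullet> (fmul B ?X \<star> idn ?B)"
        by (simp only: acomp_reassoc2[OF ac])
      also have "\<dots> = ?q \<bullet> fmul B ?X \<bullet> (idn (?X \<otimes>\<^sub>o ?B) \<star> mm B) \<bullet> al (?X \<otimes>\<^sub>o ?B) ?B ?B"
        by (simp only: fmul_assoc[OF B modD(1)[OF A M]])
      also have "\<dots> = act B ?N \<bullet> (?q \<star> idn ?B) \<bullet> (idn (?X \<otimes>\<^sub>o ?B) \<star> mm B) \<bullet> al (?X \<otimes>\<^sub>o ?B) ?B ?B"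
        by (simp only: acomp_reassoc2[OF ac])
      also have "\<dots> = act B ?N \<bullet> (idn (Und ?N) \<star> mm B) \<bullet> ((?q \<star> (idn ?B \<star> idn ?B)) \<bullet> al (?X \<otimes>\<^sub>o ?B) ?B ?B)"
        by simp
      also have "(?q \<star> (idn ?B \<star> idn ?B)) \<bullet> al (?X \<otimes>\<^sub>o ?B) ?B ?B = al (Und ?N) ?B ?B \<bullet> ((?q \<star> idn ?B) \<star> idn ?B)"
        by (rule al_nat[symmetric]) simp_all
      finally show "(act B ?N \<bullet> (act B ?N \<star> idn ?B)) \<bullet> ((?q \<star> idn ?B) \<star> idn ?B)
          = (act B ?N \<bullet> (idn (Und ?N) \<star> mm B) \<bullet> al (Und ?N) ?B ?B) \<bullet> ((?q \<star> idn ?B) \<star> idn ?B)"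
        by (simp del: interchange interchange_reassoc)
    qed simp_all
    show "act B ?N \<bullet> (idn (Und ?N) \<star> ee B) = ru (Und ?N)"
    proof (rule tcoeq_eqI[OF tcoeq_tens[OF q unit_ob]])
      have "act B ?N \<bullet> (?q \<star> idn ?B) \<bullet> (idn (?X \<otimes>\<^sub>o ?B) \<star> ee B) = ?q \<bullet> ru (?X \<otimes>\<^sub>o ?B)"
        by (simp only: acomp_reassoc2[OF ac] fmul_unit[OF B modD(1)[OF A M]])
      also have "\<dots> = ru (Und ?N) \<bullet> (?q \<star> idn ?u)"
        by (rule ru_nat[symmetric]) simp
      finally show "(act B ?N \<bullet> (idn (Und ?N) \<star> ee B)) \<bullet> (?q \<star> idn ?u) = ru (Und ?N) \<bullet> (?q \<star> idn ?u)"
        by simp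
    qed simp_all
  qed simp_all
qed

text \<open>The typed value of the base change functor on an arrow; its last argument is a bare
  arrow because \<open>FAr\<close> expects one.\<close>

definition bcf :: "('o, 'm) cmon \<Rightarrow> ('o, 'm) cmon \<Rightarrow> ('o, 'm) arrow \<Rightarrow> ('o, 'm) modl \<Rightarrow> ('o, 'm) modl \<Rightarrow> 'm \<Rightarrow> ('o, 'm) arrow" where
  "bcf A B j M N g = Arr (Und (bcN A B j M)) (FAr (base_change C A B (raw j)) M N g) (Und (bcN A B j N))"

text \<open>A linear g tensored with B respects the relations (m a) \<otimes> b = m \<otimes> a b,
  hence descends; the coequalizer is epic, so the descended arrow is the one described in
  \<open>base_change\<close>.\<close>

lemma bcf_eq:
  assumes j: "chom A B j" and g: "mhom A M N g"
  shows "ok (bcf A B j M N (raw g))"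
    "bcf A B j M N (raw g) \<bullet> bcq A B j M = bcq A B j N \<bullet> (g \<star> idn (MOb B))"
proof -
  let ?q = "bcq A B j M" and ?r = "bcq A B j N" and ?B = "MOb B"
  note A = chomD(1)[OF j] and B = chomD(2)[OF j] and M = mhomD(1)[OF g] and N = mhomD(2)[OF g]
  note [simp] = modD(1,2)[OF A M] modD(1,2)[OF A N] cmonD(1-3)[OF A] cmonD(1-3)[OF B] chomD(3-5)[OF j]
    bcq_simps[OF j M] bcq_simps[OF j N] bc_rs[OF j M] bc_rs[OF j N] mhomD(3-5)[OF g]
  have r: "(g \<star> idn ?B) \<bullet> bcr A B M = bcr A B N \<bullet> ((g \<star> idn (MOb A)) \<star> idn ?B)"
    using mhomD(6)[OF g] by (simp add: bcr_def)
  have s: "(g \<star> idn ?B) \<bullet> bcs A B j M = bcs A B j N \<bullet> ((g \<star> idn (MOb A)) \<star> idn ?B)"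
    using al_nat[of g "Und M" "Und N" "idn (MOb A)" "MOb A" "MOb A" "idn ?B" ?B ?B]
    by (simp add: bcs_def)
  have "(?r \<bullet> (g \<star> idn ?B)) \<bullet> bcr A B M = (?r \<bullet> (g \<star> idn ?B)) \<bullet> bcs A B j M"
    using acomp_reassoc2[OF tcoeqD(7)[OF bcq_coeq[OF j N]], of "(g \<star> idn (MOb A)) \<star> idn ?B"]
    by (simp add: r s)
  then obtain h where h: "ok h" "src h = tgt ?q" "tgt h = tgt ?r" "h \<bullet> ?q = ?r \<bullet> (g \<star> idn ?B)"
    by (rule tcoeq_factor[OF bcq_coeq[OF j M], rotated 2]) simp_all
  obtain Q q where Qq: "base_change_coeq C A B (raw j) M = (Q, q)" by (cases "base_change_coeq C A B (raw j) M")
  then have q: "?q = Arr (Und M \<otimes>\<^sub>o ?B) q Q" by (simp add: bcq_def)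
  obtain R r where Rr: "base_change_coeq C A B (raw j) N = (R, r)" by (cases "base_change_coeq C A B (raw j) N")
  then have r: "?r = Arr (Und N \<otimes>\<^sub>o ?B) r R" by (simp add: bcq_def)
  have qr: "raw ?q = q" "tgt ?q = Q" "raw ?r = r" "tgt ?r = R" by (simp_all add: q r)
  have rg: "raw (g \<star> idn ?B) = raw g \<otimes>\<^sub>a Idt C ?B" by (simp add: raw_struct)
  have iff: "u \<in> Hom C Q R \<and> u \<cdot> q = r \<cdot> (raw g \<otimes>\<^sub>a Idt C ?B)
      \<longleftrightarrow> ar (Arr Q u R) Q R \<and> Arr Q u R \<bullet> ?q = ?r \<bullet> (g \<star> idn ?B)" for u
    using qr rg by (simp add: eq_iff_raw cong: conj_cong)
  have hr: "Arr Q (raw h) R = h" using h qr by (intro ar_Arr_raw) simp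
  have "FAr (base_change C A B (raw j)) M N (raw g) = (THE u. u \<in> Hom C Q R \<and> u \<cdot> q = r \<cdot> (raw g \<otimes>\<^sub>a Idt C ?B))"
    by (simp add: base_change_def Qq Rr)
  also have "\<dots> = raw h"
    unfolding iff
  proof (rule the_equality)
    show "ar (Arr Q (raw h) R) Q R \<and> Arr Q (raw h) R \<bullet> ?q = ?r \<bullet> (g \<star> idn ?B)"
      using h qr unfolding hr by simp
    fix u assume u: "ar (Arr Q u R) Q R \<and> Arr Q u R \<bullet> ?q = ?r \<bullet> (g \<star> idn ?B)"
    have "Arr Q u R = h"
      by (rule tcoeq_eqI[OF bcq_coeq[OF j M]]) (use u h qr in simp_all)
    then show "u = raw h" by auto
  qed
  finally have "bcf A B j M N (raw g) = h" using hr by (simp add: bcf_def Und_bcN qr)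
  with h show "ok (bcf A B j M N (raw g))" "bcf A B j M N (raw g) \<bullet> ?q = ?r \<bullet> (g \<star> idn ?B)" by simp_all
qed

lemma bcf_st [simp]: "src (bcf A B j M N u) = tgt (bcq A B j M)" "tgt (bcf A B j M N u) = tgt (bcq A B j N)"
  by (simp_all add: bcf_def Und_bcN)

lemma bcf_mhom:
  assumes j: "chom A B j" and g: "mhom A M N g"
  shows "mhom B (bcN A B j M) (bcN A B j N) (bcf A B j M N (raw g))"
proof -
  let ?q = "bcq A B j M" and ?r = "bcq A B j N" and ?B = "MOb B" and ?h = "bcf A B j M N (raw g)"
  note A = chomD(1)[OF j] and B = chomD(2)[OF j] and M = mhomD(1)[OF g] and N = mhomD(2)[OF g]
  note [simp] = modD(1,2)[OF A M] modD(1,2)[OF A N] cmonD(1-3)[OF B] Und_bcN fmul_simps[OF B]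
    bcq_simps[OF j M] bcq_simps[OF j N] mhomD(3-5)[OF g] bcf_eq(1)[OF j g] bc_act(1)[OF j M] bc_act(1)[OF j N] bc_rs[OF j M]
  note hq = bcf_eq(2)[OF j g]
  have "?h \<bullet> act B (bcN A B j M) = act B (bcN A B j N) \<bullet> (?h \<star> idn ?B)"
  proof (rule tcoeq_eqI[OF tcoeq_tens[OF bcq_coeq[OF j M] cmonD(1)[OF B]]])
    have "(?h \<bullet> act B (bcN A B j M)) \<bullet> (?q \<star> idn ?B) = (?h \<bullet> ?q) \<bullet> fmul B (Und M)"
      by (simp only: bc_act(2)[OF j M] acomp_assoc)
    also have "\<dots> = ?r \<bullet> fmul B (Und N) \<bullet> ((g \<star> idn ?B) \<star> idn ?B)"
      using fmul_nat[OF B, of g "Und M" "Und N"] by (simp add: hq)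
    also have "\<dots> = act B (bcN A B j N) \<bullet> (?r \<star> idn ?B) \<bullet> ((g \<star> idn ?B) \<star> idn ?B)"
      by (simp only: acomp_reassoc2[OF bc_act(2)[OF j N]])
    also have "\<dots> = (act B (bcN A B j N) \<bullet> (?h \<star> idn ?B)) \<bullet> (?q \<star> idn ?B)"
      by (simp add: hq)
    finally show "(?h \<bullet> act B (bcN A B j M)) \<bullet> (?q \<star> idn ?B) = (act B (bcN A B j N) \<bullet> (?h \<star> idn ?B)) \<bullet> (?q \<star> idn ?B)" .
  qed simp_all
  then show ?thesis
    using bc_module[OF j M] bc_module[OF j N] by (simp add: mhom_def)
qed

text \<open>
  The coprojections exhibiting \<open>M \<otimes>\<^sub>A A\<^sub>t\<close> as the colimit of \<open>t\<close> acting on \<open>M\<close>; informally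
  \<open>x \<mapsto> x \<otimes> t\<^sup>-\<^sup>n\<close>.
\<close>

definition bce :: "('o, 'm) cmon \<Rightarrow> ('o, 'm) cmon \<Rightarrow> (nat \<Rightarrow> ('o, 'm) arrow) \<Rightarrow> ('o, 'm) modl \<Rightarrow> nat \<Rightarrow> ('o, 'm) arrow" where
  "bce A B e M n = bcq A B (e 0) M \<bullet> (idn (Und M) \<star> (e n \<bullet> ee A)) \<bullet> ainv (ru (Und M))"

lemma bce_simps [simp]:
  assumes "is_loc A t B e" "is_module C A M"
  shows "ok (bce A B e M n)" "src (bce A B e M n) = Und M" "tgt (bce A B e M n) = tgt (bcq A B (e 0) M)"
  using bcq_simps[OF is_locD(2)[OF assms(1)] assms(2)] modD(1,2)[OF is_locD(3)[OF assms(1)] assms(2)]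
    cmonD(1-3)[OF is_locD(3)[OF assms(1)]] telD(4-6)[OF is_locD(5)[OF assms(1)]] rendD(2)[OF is_locD(3)[OF assms(1)] is_locD(1)[OF assms(1)]]
  by (simp_all add: bce_def)

lemma loc_mult_left:
  assumes B: "is_loc A t B e" shows "mm B \<bullet> (e 0 \<star> e n) = e n \<bullet> mm A"
  using loc_mult[OF B, of 0 n] by simp

text \<open>The defining relation of the coequalizer with b = t^-n, namely (m a) \<otimes> t^-n = m
  \<otimes> a t^-n.\<close>

lemma bce_act:
  assumes B: "is_loc A t B e" and M: "is_module C A M"
  shows "bce A B e M n \<bullet> act A M = bcq A B (e 0) M \<bullet> (idn (Und M) \<star> e n)"
proof -
  let ?q = "bcq A B (e 0) M" and ?M = "Und M" and ?A = "MOb A" and ?B = "MOb B" and ?u = "UnitOb C"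
  note A = is_locD(3)[OF B] and j = is_locD(2)[OF B] and t = is_locD(1)[OF B] and Bm = is_locD(4)[OF B]
  note [simp] = bcq_simps[OF j M] modD(1,2)[OF A M] cmonD(1-3)[OF A] cmonD(1-3)[OF Bm] telD(3-6)[OF is_locD(5)[OF B]]
    rendD(1-3)[OF A t] bc_rs[OF j M]
  have qq: "?q \<bullet> (act A M \<star> idn ?B) = ?q \<bullet> (idn ?M \<star> (mm B \<bullet> (e 0 \<star> idn ?B))) \<bullet> al ?M ?A ?B"
    using tcoeqD(7)[OF bcq_coeq[OF j M]] by (simp add: bcr_def bcs_def)
  have "bce A B e M n \<bullet> act A M = ?q \<bullet> (act A M \<star> (e n \<bullet> ee A)) \<bullet> ainv (ru (?M \<otimes>\<^sub>o ?A))"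
    using ru_inv_nat[of "act A M" "?M \<otimes>\<^sub>o ?A" ?M] by (simp add: bce_def)
  also have "\<dots> = (?q \<bullet> (act A M \<star> idn ?B)) \<bullet> (idn (?M \<otimes>\<^sub>o ?A) \<star> (e n \<bullet> ee A)) \<bullet> ainv (ru (?M \<otimes>\<^sub>o ?A))"
    by simp
  also have "\<dots> = ?q \<bullet> (idn ?M \<star> (mm B \<bullet> (e 0 \<star> idn ?B))) \<bullet> (al ?M ?A ?B \<bullet> ((idn ?M \<star> idn ?A) \<star> (e n \<bullet> ee A))) \<bullet> ainv (ru (?M \<otimes>\<^sub>o ?A))"
    by (simp only: qq) simp
  also have "al ?M ?A ?B \<bullet> ((idn ?M \<star> idn ?A) \<star> (e n \<bullet> ee A)) = (idn ?M \<star> (idn ?A \<star> (e n \<bullet> ee A))) \<bullet> al ?M ?A ?u"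
    by (rule al_nat) simp_all
  also have "?q \<bullet> (idn ?M \<star> (mm B \<bullet> (e 0 \<star> idn ?B))) \<bullet> ((idn ?M \<star> (idn ?A \<star> (e n \<bullet> ee A))) \<bullet> al ?M ?A ?u) \<bullet> ainv (ru (?M \<otimes>\<^sub>o ?A))
      = ?q \<bullet> (idn ?M \<star> (mm B \<bullet> (e 0 \<star> e n) \<bullet> (idn ?A \<star> ee A) \<bullet> ainv (ru ?A)))"
    by (simp add: al_ru_inv)
  also have "mm B \<bullet> (e 0 \<star> e n) \<bullet> (idn ?A \<star> ee A) \<bullet> ainv (ru ?A) = e n \<bullet> mm A \<bullet> (idn ?A \<star> ee A) \<bullet> ainv (ru ?A)"
    by (simp only: acomp_reassoc2[OF loc_mult_left[OF B]])
  also have "\<dots> = e n \<bullet> ru ?A \<bullet> ainv (ru ?A)"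
    by (simp only: acomp_reassoc[OF cmonD(6)[OF A]])
  finally show ?thesis by simp
qed

text \<open>Acting by a on m \<otimes> t^-n and forming (m a) \<otimes> t^-n both yield the class of
  m \<otimes> a t^-n.\<close>

lemma bce_mhom:
  assumes B: "is_loc A t B e" and M: "is_module C A M"
  shows "mhom A M (rmod B (e 0) (bcN A B (e 0) M)) (bce A B e M n)"
proof -
  let ?q = "bcq A B (e 0) M" and ?M = "Und M" and ?A = "MOb A" and ?B = "MOb B" and ?u = "UnitOb C" and ?N = "bcN A B (e 0) M"
  note A = is_locD(3)[OF B] and j = is_locD(2)[OF B] and t = is_locD(1)[OF B] and Bm = is_locD(4)[OF B]
  note N = bc_module[OF j M]
  note [simp] = bcq_simps[OF j M] modD(1,2)[OF A M] cmonD(1-3)[OF A] cmonD(1-3)[OF Bm] telD(3-6)[OF is_locD(5)[OF B]]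
    rendD(1-3)[OF A t] bc_rs[OF j M] bce_simps[OF B M] Und_bcN bc_act(1)[OF j M]
  let ?x = "(idn ?M \<star> (e n \<bullet> ee A)) \<bullet> ainv (ru ?M)"
  have "act B ?N \<bullet> (idn (Und ?N) \<star> e 0) \<bullet> (bce A B e M n \<star> idn ?A) = act B ?N \<bullet> (?q \<star> idn ?B) \<bullet> (?x \<star> e 0)"
    by (simp add: bce_def)
  also have "\<dots> = ?q \<bullet> fmul B ?M \<bullet> (?x \<star> e 0)"
    by (simp only: acomp_reassoc2[OF bc_act(2)[OF j M]])
  also have "\<dots> = ?q \<bullet> (idn ?M \<star> mm B) \<bullet> (al ?M ?B ?B \<bullet> ((idn ?M \<star> (e n \<bullet> ee A)) \<star> e 0)) \<bullet> (ainv (ru ?M) \<star> idn ?A)"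
    by (simp add: fmul_def)
  also have "al ?M ?B ?B \<bullet> ((idn ?M \<star> (e n \<bullet> ee A)) \<star> e 0) = (idn ?M \<star> ((e n \<bullet> ee A) \<star> e 0)) \<bullet> al ?M ?u ?A"
    by (rule al_nat) simp_all
  also have "?q \<bullet> (idn ?M \<star> mm B) \<bullet> ((idn ?M \<star> ((e n \<bullet> ee A) \<star> e 0)) \<bullet> al ?M ?u ?A) \<bullet> (ainv (ru ?M) \<star> idn ?A)
      = ?q \<bullet> (idn ?M \<star> (mm B \<bullet> (e n \<star> e 0) \<bullet> (ee A \<star> idn ?A))) \<bullet> al ?M ?u ?A \<bullet> (ainv (ru ?M) \<star> idn ?A)"
    by simp
  also have "mm B \<bullet> (e n \<star> e 0) \<bullet> (ee A \<star> idn ?A) = e n \<bullet> lu ?A"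
    using acomp_reassoc2[OF loc_mult[OF B, of n 0], of "ee A \<star> idn ?A"] cmonD(5)[OF A] by simp
  also have "?q \<bullet> (idn ?M \<star> (e n \<bullet> lu ?A)) \<bullet> al ?M ?u ?A \<bullet> (ainv (ru ?M) \<star> idn ?A)
      = ?q \<bullet> (idn ?M \<star> e n) \<bullet> ((idn ?M \<star> lu ?A) \<bullet> al ?M ?u ?A) \<bullet> (ainv (ru ?M) \<star> idn ?A)"
    by simp
  also have "\<dots> = ?q \<bullet> (idn ?M \<star> e n)"
    by (simp only: atriangle modD(1)[OF A M] cmonD(1)[OF A]) simp
  finally show ?thesis
    using M is_module_rmod[OF j N] by (simp add: mhom_def act_rmod[OF j N] bce_act[OF B M])
qed

text \<open>M \<otimes> B is the telescope of M \<otimes> A under t, and dividing by the relations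
  replaces M \<otimes> A by M, the action being the quotient map at each stage.\<close>

lemma bce_tel:
  assumes B: "is_loc A t B e" and M: "is_module C A M"
  shows "tel (smul A M t) (Und (bcN A B (e 0) M)) (bce A B e M)"
proof -
  let ?q = "bcq A B (e 0) M" and ?M = "Und M" and ?A = "MOb A" and ?B = "MOb B" and ?T = "smul A M t"
  note A = is_locD(3)[OF B] and j = is_locD(2)[OF B] and t = is_locD(1)[OF B] and Bm = is_locD(4)[OF B]
  note L = is_locD(5)[OF B] and q = bcq_coeq[OF j M]
  note [simp] = bcq_simps[OF j M] modD(1,2)[OF A M] cmonD(1-3)[OF A] cmonD(1-3)[OF Bm] telD[OF L]
    rendD(1-3)[OF A t] bc_rs[OF j M] bce_simps[OF B M] Und_bcN smul_simps[OF A M t]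
  have [simp]: "tgt ?q \<in> Ob C" using ok_ob(2)[OF bcq_simps(1)[OF j M]] .
  note tM = tel_tens_left[OF L modD(1)[OF A M]]
  have MAo: "?M \<otimes>\<^sub>o ?A \<in> Ob C" by simp
  note tMA = tel_tens_left[OF L MAo]
  have step: "bce A B e M (Suc n) \<bullet> ?T = bce A B e M n" for n
  proof (rule act_epi[OF A M])
    have "(bce A B e M (Suc n) \<bullet> ?T) \<bullet> act A M = (bce A B e M (Suc n) \<bullet> act A M) \<bullet> (idn ?M \<star> t)"
      by (simp add: smul_act[OF A M t])
    then show "(bce A B e M (Suc n) \<bullet> ?T) \<bullet> act A M = bce A B e M n \<bullet> act A M"
      by (simp add: bce_act[OF B M])
  qed simp_all
  show ?thesis
  proof (rule telI)
    show "\<exists>h. ar h (Und (bcN A B (e 0) M)) Z \<and> (\<forall>n. h \<bullet> bce A B e M n = d n)"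
      if d: "\<And>n. ok (d n)" "\<And>n. src (d n) = src ?T" "\<And>n. tgt (d n) = Z" "\<And>n. d (Suc n) \<bullet> ?T = d n" for Z d
    proof -
      have d' [simp]: "ok (d n)" "src (d n) = ?M" "tgt (d n) = Z" for n using d by simp_all
      \<comment> \<open>Composed with the action, the cocone \<open>d\<close> lives on the telescope
        of M \<otimes> A under multiplication by t, whose colimit is M \<otimes> B.\<close>
      have "(d (Suc n) \<bullet> act A M) \<bullet> (idn ?M \<star> t) = d n \<bullet> act A M" for n
        using acomp_reassoc[OF d(4)[of n], of "act A M"] by (simp add: smul_act[OF A M t])
      then obtain k where k [simp]: "ok k" "src k = ?M \<otimes>\<^sub>o ?B" "tgt k = Z"
        and ke: "\<And>n. k \<bullet> (idn ?M \<star> e n) = d n \<bullet> act A M"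
        using tel_factor[OF tM, of "\<lambda>n. d n \<bullet> act A M" Z] by auto
      \<comment> \<open>At stage n the two arrows of the parallel pair are compared by associativity
        of the action of A on M.\<close>
      have "k \<bullet> bcr A B M = k \<bullet> bcs A B (e 0) M"
      proof (rule tel_eqI[OF tMA])
        fix n
        have "(k \<bullet> bcr A B M) \<bullet> (idn (?M \<otimes>\<^sub>o ?A) \<star> e n) = k \<bullet> (idn ?M \<star> e n) \<bullet> (act A M \<star> idn ?A)"
          by (simp add: bcr_def)
        also have "\<dots> = d n \<bullet> act A M \<bullet> (act A M \<star> idn ?A)"
          by (simp only: acomp_reassoc2[OF ke])
        also have "\<dots> = d n \<bullet> act A M \<bullet> (idn ?M \<star> mm A) \<bullet> al ?M ?A ?A"
          by (simp only: modD(3)[OF A M])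
        also have "\<dots> = k \<bullet> (idn ?M \<star> e n) \<bullet> (idn ?M \<star> mm A) \<bullet> al ?M ?A ?A"
          by (simp only: acomp_reassoc2[OF ke])
        also have "\<dots> = k \<bullet> (idn ?M \<star> mm B) \<bullet> (idn ?M \<star> (e 0 \<star> e n)) \<bullet> al ?M ?A ?A"
          by (simp add: loc_mult_left[OF B])
        also have "\<dots> = k \<bullet> (idn ?M \<star> (mm B \<bullet> (e 0 \<star> idn ?B))) \<bullet> (idn ?M \<star> (idn ?A \<star> e n)) \<bullet> al ?M ?A ?A"
          by simp
        also have "(idn ?M \<star> (idn ?A \<star> e n)) \<bullet> al ?M ?A ?A = al ?M ?A ?B \<bullet> ((idn ?M \<star> idn ?A) \<star> e n)"
          by (rule al_nat[symmetric]) simp_all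
        finally show "(k \<bullet> bcr A B M) \<bullet> (idn (?M \<otimes>\<^sub>o ?A) \<star> e n) = (k \<bullet> bcs A B (e 0) M) \<bullet> (idn (?M \<otimes>\<^sub>o ?A) \<star> e n)"
          by (simp add: bcs_def del: interchange interchange_reassoc)
      qed (use bc_rs[OF j M] in simp_all)
      then obtain h where h [simp]: "ok h" "src h = tgt ?q" "tgt h = Z" and hq: "h \<bullet> ?q = k"
        using tcoeq_factor[OF q, of k] bc_rs[OF j M] by auto
      \<comment> \<open>The equation is tested after composition with the action, which is
        epic.\<close>
      have "h \<bullet> bce A B e M n = d n" for n
      proof (rule act_epi[OF A M])
        show "(h \<bullet> bce A B e M n) \<bullet> act A M = d n \<bullet> act A M"
          using acomp_reassoc[OF hq, of "idn ?M \<star> e n"] by (simp add: bce_act[OF B M] ke)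
      qed simp_all
      then show ?thesis by (intro exI[of _ h]) simp
    qed
    show "h = h'" if h [simp]: "ok h" "ok h'" "src h = Und (bcN A B (e 0) M)" "src h' = Und (bcN A B (e 0) M)" "tgt h = tgt h'"
      and eq: "\<And>n. h \<bullet> bce A B e M n = h' \<bullet> bce A B e M n" for h h'
    proof (rule tcoeq_eqI[OF q])
      show "h \<bullet> ?q = h' \<bullet> ?q"
      proof (rule tel_eqI[OF tM])
        show "(h \<bullet> ?q) \<bullet> (idn ?M \<star> e n) = (h' \<bullet> ?q) \<bullet> (idn ?M \<star> e n)" for n
          using acomp_reassoc2[OF eq[of n], of "act A M"] by (simp add: bce_act[OF B M])
      qed simp_all
    qed (use h in simp_all)
  qed (use step in simp_all)
qed

lemma bcf_bce:
  assumes B: "is_loc A t B e" and g: "mhom A M N g"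
  shows "bcf A B (e 0) M N (raw g) \<bullet> bce A B e M n = bce A B e N n \<bullet> g"
proof -
  note A = is_locD(3)[OF B] and j = is_locD(2)[OF B] and t = is_locD(1)[OF B] and M = mhomD(1)[OF g] and N = mhomD(2)[OF g]
  note [simp] = bcq_simps[OF j M] bcq_simps[OF j N] modD(1,2)[OF A M] modD(1,2)[OF A N] cmonD(1-3)[OF A]
    telD(3-6)[OF is_locD(5)[OF B]] rendD(1-3)[OF A t] mhomD(3-5)[OF g] cmonD(1-3)[OF is_locD(4)[OF B]]
  have "bcf A B (e 0) M N (raw g) \<bullet> bce A B e M n
      = bcq A B (e 0) N \<bullet> (g \<star> idn (MOb B)) \<bullet> (idn (Und M) \<star> (e n \<bullet> ee A)) \<bullet> ainv (ru (Und M))"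
    unfolding bce_def by (simp only: acomp_reassoc2[OF bcf_eq(2)[OF j g]])
  then show ?thesis
    using ru_inv_nat[of g "Und M" "Und N"] by (simp add: bce_def)
qed

text \<open>Multiplication by a t^-n is recovered from multiplication by a through n divisions by t.
  A linear map over A commutes with t, hence with these divisions, as t is invertible on N; the
  stages exhaust B.\<close>

lemma loc_full:
  assumes B: "is_loc A t B e" and W: "is_module C B W" and N: "is_module C B N"
    and f: "mhom A (rmod B (e 0) W) (rmod B (e 0) N) f"
  shows "mhom B W N f"
proof -
  note A = is_locD(3)[OF B] and j = is_locD(2)[OF B] and t = is_locD(1)[OF B] and Bm = is_locD(4)[OF B] and L = is_locD(5)[OF B]
  note [simp] = modD(1,2)[OF Bm W] modD(1,2)[OF Bm N] cmonD(1-3)[OF A] cmonD(1-3)[OF Bm] telD(3-6)[OF L]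
    rendD(1-3)[OF A t] mhomD(3-5)[OF f, simplified]
  define S where "S V = smul A (rmod B (e 0) V) t" for V
  have S [simp]: "ok (S V)" "src (S V) = Und V" "tgt (S V) = Und V" if "is_module C B V" for V
    using smul_simps[OF A is_module_rmod[OF j that] t] by (simp_all add: S_def)
  have step: "S V \<bullet> act B V \<bullet> (idn (Und V) \<star> e (Suc n)) = act B V \<bullet> (idn (Und V) \<star> e n)" if V: "is_module C B V" for V n
  proof -
    note [simp] = modD(1,2)[OF Bm V]
    let ?T = "smul A (rmod B (e 0) (regular_module B)) t"
    note [simp] = smul_simps[OF A is_locD(7)[OF B] t, simplified]
    have "S V \<bullet> act B V = act B V \<bullet> (idn (Und V) \<star> ?T)"
      using act_scalar[OF Bm V, of "e 0 \<bullet> t \<bullet> ee A"] sc_rmod[OF j V, of "t \<bullet> ee A"]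
        sc_rmod[OF j is_module_regular[OF Bm], of "t \<bullet> ee A"] by (simp add: S_def smul_def)
    from acomp_reassoc2[OF this, of "idn (Und V) \<star> e (Suc n)"] show ?thesis
      using loc_smul_e[OF B, of n] by simp
  qed
  have Sf: "f \<bullet> S W = S N \<bullet> f"
    using smul_nat[OF A f t] by (simp add: S_def)
  have "f \<bullet> act B W \<bullet> (idn (Und W) \<star> e n) = act B N \<bullet> (idn (Und N) \<star> e n) \<bullet> (f \<star> idn (MOb A))" for n
  proof (induction n)
    case 0
    show ?case using mhomD(6)[OF f] by (simp add: act_rmod[OF j W] act_rmod[OF j N])
  next
    case (Suc n)
    have "S N \<bullet> f \<bullet> act B W \<bullet> (idn (Und W) \<star> e (Suc n)) = f \<bullet> S W \<bullet> act B W \<bullet> (idn (Und W) \<star> e (Suc n))"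
      by (simp only: acomp_reassoc2[OF Sf])
    also have "\<dots> = act B N \<bullet> (idn (Und N) \<star> e n) \<bullet> (f \<star> idn (MOb A))"
      by (simp only: step[OF W] Suc)
    also have "\<dots> = S N \<bullet> act B N \<bullet> (idn (Und N) \<star> e (Suc n)) \<bullet> (f \<star> idn (MOb A))"
      using acomp_reassoc[OF step[OF N, of n], of "f \<star> idn (MOb A)"] by simp
    finally show ?case
      by (rule aiso_cancel_left[OF loc_module_aiso[OF B N, folded S_def], rotated -1]) (use W N in simp_all)
  qed
  then have "f \<bullet> act B W = act B N \<bullet> (f \<star> idn (MOb B))"
    by - (rule tel_eqI[OF tel_tens_left[OF L modD(1)[OF Bm W]]], simp_all)
  then show ?thesis using W N by (simp add: mhom_def)
qed

text \<open>The coequalizer starts at a zero object tensored with B, so it is zero; being epic, it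
  forces the identity of its target to vanish.\<close>

lemma bc_zero:
  assumes j: "chom A B j" and M: "is_zero_ob (Modl C A) M"
  shows "is_zero_ob (Modl C B) (bcN A B j M)"
proof -
  note A = chomD(1)[OF j] and B = chomD(2)[OF j]
  have Mm: "is_module C A M" and z: "idn (Und M) = zer (Und M) (Und M)"
    using M by (simp_all add: is_zero_ob_Modl[OF A])
  let ?q = "bcq A B j M"
  note [simp] = modD(1)[OF A Mm] cmonD(1)[OF B] bcq_simps[OF j Mm] bc_rs[OF j Mm]
  have [simp]: "tgt ?q \<in> Ob C" using ok_ob(2)[OF bcq_simps(1)[OF j Mm]] .
  have "?q = ?q \<bullet> (idn (Und M) \<star> idn (MOb B))" by simp
  also have "\<dots> = zer (Und M \<otimes>\<^sub>o MOb B) (tgt ?q)"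
    unfolding z by (subst zer_tens) simp_all
  finally have "idn (tgt ?q) = zer (tgt ?q) (tgt ?q)"
    by - (rule tcoeq_eqI[OF bcq_coeq[OF j Mm]], simp_all)
  then show ?thesis
    using bc_module[OF j Mm] by (simp add: is_zero_ob_Modl[OF B] Und_bcN)
qed

end


section \<open>Flatness\<close>

lemma filtered_cat_enc:
  assumes J: "filtered_cat J" and p: "inj p" and q: "inj q"
  shows "filtered_cat (enc_cat p q J)"
proof -
  interpret J: category J using J by (simp add: filtered_cat_def)
  let ?E = "enc_cat p q J"
  have ob: "Ob ?E = p ` Ob J" and cmp: "\<And>u v. q v \<cdot>\<^bsub>?E\<^esub> q u = q (v \<cdot>\<^bsub>J\<^esub> u)"
    using q by (simp_all add: enc_cat_def)
  have hom: "q v \<in> Hom ?E (p i) (p j) \<longleftrightarrow> v \<in> Hom J i j" for v i j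
    by (auto simp: hom_enc_cat[OF p] inj_eq[OF p] inj_eq[OF q])
  show ?thesis
    unfolding filtered_cat_def
  proof (intro conjI ballI allI)
    show "category ?E" by (rule category_enc_cat[OF J.category_axioms p q])
    show "Ob ?E \<noteq> {}" using J by (simp add: ob filtered_cat_def)
  next
    fix a b assume "a \<in> Ob ?E" "b \<in> Ob ?E"
    then obtain i j where *: "a = p i" "b = p j" "i \<in> Ob J" "j \<in> Ob J" by (auto simp: ob)
    then obtain k u v where "k \<in> Ob J" "u \<in> Hom J i k" "v \<in> Hom J j k"
      using J unfolding filtered_cat_def by blast
    then have "p k \<in> Ob ?E" "q u \<in> Hom ?E a (p k)" "q v \<in> Hom ?E b (p k)"
      by (simp_all add: ob * hom)
    then show "\<exists>k\<in>Ob ?E. Hom ?E a k \<noteq> {} \<and> Hom ?E b k \<noteq> {}" by blast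
  next
    fix a b u v assume "u \<in> Hom ?E a b" "v \<in> Hom ?E a b"
    then obtain i j u' v' where *: "a = p i" "b = p j" "u = q u'" "v = q v'" "u' \<in> Hom J i j" "v' \<in> Hom J i j"
      unfolding hom_enc_cat[OF p] using injD[OF p] by metis
    then obtain k w where "w \<in> Hom J j k" "w \<cdot>\<^bsub>J\<^esub> u' = w \<cdot>\<^bsub>J\<^esub> v'"
      using J unfolding filtered_cat_def by blast
    then have "q w \<in> Hom ?E b (p k)" "q w \<cdot>\<^bsub>?E\<^esub> u = q w \<cdot>\<^bsub>?E\<^esub> v"
      by (simp_all add: * hom cmp)
    then show "\<exists>k. \<exists>w\<in>Hom ?E b k. w \<cdot>\<^bsub>?E\<^esub> u = w \<cdot>\<^bsub>?E\<^esub> v" by blast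
  qed
qed

lemma (in category) is_limit_cong:
  assumes "is_limit J C F L e" "category J" "\<And>i. i \<in> Ob J \<Longrightarrow> FOb F i = FOb G i"
    "\<And>i j u. u \<in> Hom J i j \<Longrightarrow> FAr F i j u = FAr G i j u"
  shows "is_limit J C G L e"
proof -
  have "is_cone J C F Z c \<longleftrightarrow> is_cone J C G Z c" for Z c
    unfolding is_cone_def using assms(3,4) by simp
  then show ?thesis using assms(1) by (simp add: is_limit_def)
qed

section \<open>Limits of typed arrows and of modules\<close>

context category
begin

lemma limit_factor:
  assumes L: "is_limit K C G L p" and Z: "Z \<in> Ob C" and d: "\<And>k. k \<in> Ob K \<Longrightarrow> ar (d k) Z (FOb G k)"
    and dd: "\<And>k l u. u \<in> Hom K k l \<Longrightarrow> Arr (FOb G k) (FAr G k l u) (FOb G l) \<bullet> d k = d l"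
    and K: "category K" and G: "is_ftor K C G"
  obtains h where "ok h" "src h = Z" "tgt h = L" "\<And>k. k \<in> Ob K \<Longrightarrow> Arr L (p k) (FOb G k) \<bullet> h = d k"
proof -
  interpret K: category K by fact
  have p: "p k \<in> Hom C L (FOb G k)" if "k \<in> Ob K" for k
    using L that by (simp add: is_limit_def is_cone_def)
  have GH: "FAr G k l u \<in> Hom C (FOb G k) (FOb G l)" if "u \<in> Hom K k l" for k l u
    using G that by (simp add: is_ftor_def)
  have "is_cone K C G Z (\<lambda>k. raw (d k))"
    unfolding is_cone_def
  proof (intro conjI ballI allI)
    show "raw (d k) \<in> Hom C Z (FOb G k)" if "k \<in> Ob K" for k by (rule ar_raw[OF d[OF that]])
    show "FAr G k l u \<cdot> raw (d k) = raw (d l)" if u: "u \<in> Hom K k l" for k l u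
      using arg_cong[OF dd[OF u], of raw] d[of k] K.hom_ob[OF u] GH[OF u]
        ok_acomp(4)[of "d k" "Arr (FOb G k) (FAr G k l u) (FOb G l)"] by simp
  qed fact
  then obtain h where h: "h \<in> Hom C Z L" "\<forall>k\<in>Ob K. p k \<cdot> h = raw (d k)"
    using L unfolding is_limit_def by blast
  show ?thesis
  proof (rule that[of "Arr Z h L"])
    show "Arr L (p k) (FOb G k) \<bullet> Arr Z h L = d k" if "k \<in> Ob K" for k
      using h p[OF that] that ar_Arr_raw[OF d[OF that]] by (simp add: Arr_acomp)
  qed (use h in simp_all)
qed

lemma limit_eqI:
  assumes L: "is_limit K C G L p" and K: "category K" and G: "is_ftor K C G"
    and h: "ok h" "ok h'" "src h = src h'" "tgt h = L" "tgt h' = L"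
    and eq: "\<And>k. k \<in> Ob K \<Longrightarrow> Arr L (p k) (FOb G k) \<bullet> h = Arr L (p k) (FOb G k) \<bullet> h'"
  shows "h = h'"
proof -
  have p: "p k \<in> Hom C L (FOb G k)" if "k \<in> Ob K" for k
    using L that by (simp add: is_limit_def is_cone_def)
  have GH: "FAr G k l u \<in> Hom C (FOb G k) (FOb G l)" if "u \<in> Hom K k l" for k l u
    using G that by (simp add: is_ftor_def)
  have pc: "FAr G k l u \<cdot> p k = p l" if "u \<in> Hom K k l" for k l u
    using L that by (simp add: is_limit_def is_cone_def)
  have hr: "raw h \<in> Hom C (src h') L" "raw h' \<in> Hom C (src h') L"
    using h by (auto intro: ar_raw)
  have eq': "p k \<cdot> raw h = p k \<cdot> raw h'" if "k \<in> Ob K" for k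
    using arg_cong[OF eq[OF that], of raw] p[OF that] h
      ok_acomp(4)[of h "Arr L (p k) (FOb G k)"] ok_acomp(4)[of h' "Arr L (p k) (FOb G k)"] by simp
  have "is_cone K C G (src h') (\<lambda>k. p k \<cdot> raw h')"
    unfolding is_cone_def
  proof (intro conjI ballI allI)
    show "src h' \<in> Ob C" using h(2) by simp
    show "p k \<cdot> raw h' \<in> Hom C (src h') (FOb G k)" if "k \<in> Ob K" for k by (rule cmp_hom[OF hr(2) p[OF that]])
    show "FAr G k l u \<cdot> p k \<cdot> raw h' = p l \<cdot> raw h'" if u: "u \<in> Hom K k l" for k l u
      using cmp_assoc[OF hr(2) p GH[OF u]] category.hom_ob[OF K u] pc[OF u] by simp
  qed
  then have "\<exists>!g. g \<in> Hom C (src h') L \<and> (\<forall>k\<in>Ob K. p k \<cdot> g = p k \<cdot> raw h')"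
    using L by (simp add: is_limit_def)
  then have "raw h = raw h'" using hr eq' by blast
  then show ?thesis using h by (intro arrow_eqI) simp_all
qed

end

context ag_base
begin

text \<open>Limits of modules are formed in C. The commutation hypothesis only compares with a given
  limit over A, so the limit of the base changed diagram has to be supplied.\<close>

lemma ex_limit_Modl:
  assumes A: "is_cmonoid C A" and K: "category (K :: ('i::countable, 'n::countable) cat)"
    and H: "is_ftor K (Modl C A) H"
  obtains Y b where "is_limit K (Modl C A) H Y b"
proof -
  interpret K: category K by fact
  define G where "G = \<lparr>FOb = (\<lambda>k. Und (FOb H k)), FAr = FAr H\<rparr>"
  have Gs: "FOb G k = Und (FOb H k)" "FAr G = FAr H" for k by (simp_all add: G_def)
  define h where "h k l u = Arr (Und (FOb H k)) (FAr H k l u) (Und (FOb H l))" for k l u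
  have Hm: "is_module C A (FOb H k)" if "k \<in> Ob K" for k using H that by (simp add: is_ftor_def)
  have hm: "mhom A (FOb H k) (FOb H l) (h k l u)" if "u \<in> Hom K k l" for k l u
    using H that hom_Modl[OF A] by (simp add: is_ftor_def h_def)
  have Hc: "FAr H i k (v \<cdot>\<^bsub>K\<^esub> u) = FAr H j k v \<cdot> FAr H i j u" if "u \<in> Hom K i j" "v \<in> Hom K j k" for i j k u v
    using H that by (simp add: is_ftor_def)
  have G: "is_ftor K C G"
    unfolding is_ftor_def
  proof (intro conjI ballI allI)
    show "FOb G k \<in> Ob C" if "k \<in> Ob K" for k using modD(1)[OF A Hm[OF that]] by (simp add: Gs)
    show "FAr G k l u \<in> Hom C (FOb G k) (FOb G l)" if "u \<in> Hom K k l" for k l u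
      using mhomD(3)[OF hm[OF that]] by (simp add: h_def Gs)
    show "FAr G k k (Idt K k) = Idt C (FOb G k)" if "k \<in> Ob K" for k
      using H that by (simp add: is_ftor_def Gs)
    show "FAr G i k (v \<cdot>\<^bsub>K\<^esub> u) = FAr G j k v \<cdot> FAr G i j u" if "u \<in> Hom K i j" "v \<in> Hom K j k" for i j k u v
      using Hc[OF that] by (simp add: Gs)
  qed
  obtain Y b where Y: "is_limit K C G Y b" by (rule ex_limit_countable[OF K G])
  define c where "c k = Arr Y (b k) (Und (FOb H k))" for k
  have YO [simp]: "Y \<in> Ob C" and bH: "\<And>k. k \<in> Ob K \<Longrightarrow> b k \<in> Hom C Y (Und (FOb H k))"
    and bc: "\<And>k l u. u \<in> Hom K k l \<Longrightarrow> FAr H k l u \<cdot> b k = b l"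
    using Y by (simp_all add: is_limit_def is_cone_def Gs)
  have c [simp]: "ok (c k)" "src (c k) = Y" "tgt (c k) = Und (FOb H k)" if "k \<in> Ob K" for k
    using bH[OF that] by (simp_all add: c_def)
  have hc: "h k l u \<bullet> c k = c l" if u: "u \<in> Hom K k l" for k l u
    using bc[OF u] bH[of k] K.hom_ob[OF u] mhomD(3)[OF hm[OF u]] by (simp add: h_def c_def Arr_acomp)
  note fac = limit_factor[OF Y _ _ _ K G, unfolded Gs, folded h_def c_def]
  note eqI = limit_eqI[OF Y K G, unfolded Gs, folded c_def]
  note [simp] = cmonD(1-3)[OF A] modD(1,2)[OF A Hm]
  have "h k l u \<bullet> act A (FOb H k) \<bullet> (c k \<star> idn (MOb A)) = act A (FOb H l) \<bullet> (c l \<star> idn (MOb A))"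
    if u: "u \<in> Hom K k l" for k l u
    using acomp_reassoc2[OF mhomD(6)[OF hm[OF u]], of "c k \<star> idn (MOb A)"] K.hom_ob[OF u] mhomD(3-5)[OF hm[OF u]]
    by (simp add: hc[OF u])
  \<comment> \<open>The actions on the components form a cone on Y \<otimes> A; the induced arrow is
    the action on the limit.\<close>
  then obtain a where a [simp]: "ok a" "src a = Y \<otimes>\<^sub>o MOb A" "tgt a = Y"
    and ca: "\<And>k. k \<in> Ob K \<Longrightarrow> c k \<bullet> a = act A (FOb H k) \<bullet> (c k \<star> idn (MOb A))"
    by (rule fac[of "Y \<otimes>\<^sub>o MOb A" "\<lambda>k. act A (FOb H k) \<bullet> (c k \<star> idn (MOb A))", rotated 2]) simp_all
  define N where "N = \<lparr>Und = Y, Act = raw a\<rparr>"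
  have UN [simp]: "Und N = Y" by (simp add: N_def)
  have aN [simp]: "act A N = a" using ar_Arr_raw[of a "Y \<otimes>\<^sub>o MOb A" Y] by (simp add: act_def N_def)
  have N: "is_module C A N"
    unfolding is_module_iff[OF A]
  proof (intro conjI)
    show "act A N \<bullet> (act A N \<star> idn (MOb A)) = act A N \<bullet> (idn (Und N) \<star> mm A) \<bullet> al (Und N) (MOb A) (MOb A)"
    proof (rule eqI)
      fix k assume k [simp]: "k \<in> Ob K"
      let ?H = "FOb H k" and ?A = "MOb A"
      have "c k \<bullet> a \<bullet> (a \<star> idn ?A) = act A ?H \<bullet> (act A ?H \<star> idn ?A) \<bullet> ((c k \<star> idn ?A) \<star> idn ?A)"
        using acomp_reassoc2[OF ca[OF k], of "a \<star> idn ?A"] by (simp add: ca)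
      also have "\<dots> = act A ?H \<bullet> (idn (Und ?H) \<star> mm A) \<bullet> (al (Und ?H) ?A ?A \<bullet> ((c k \<star> idn ?A) \<star> idn ?A))"
        using acomp_reassoc2[OF modD(3)[OF A Hm[OF k]], of "(c k \<star> idn ?A) \<star> idn ?A"] by simp
      also have "al (Und ?H) ?A ?A \<bullet> ((c k \<star> idn ?A) \<star> idn ?A) = (c k \<star> (idn ?A \<star> idn ?A)) \<bullet> al Y ?A ?A"
        by (rule al_nat) simp_all
      also have "act A ?H \<bullet> (idn (Und ?H) \<star> mm A) \<bullet> \<dots> = c k \<bullet> a \<bullet> (idn Y \<star> mm A) \<bullet> al Y ?A ?A"
        using acomp_reassoc2[OF ca[OF k], of "(idn Y \<star> mm A) \<bullet> al Y ?A ?A"] by simp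
      finally show "c k \<bullet> act A N \<bullet> (act A N \<star> idn ?A) = c k \<bullet> act A N \<bullet> (idn (Und N) \<star> mm A) \<bullet> al (Und N) ?A ?A"
        by simp
    qed simp_all
    show "act A N \<bullet> (idn (Und N) \<star> ee A) = ru (Und N)"
    proof (rule eqI)
      fix k assume k [simp]: "k \<in> Ob K"
      have "c k \<bullet> a \<bullet> (idn Y \<star> ee A) = (act A (FOb H k) \<bullet> (idn (Und (FOb H k)) \<star> ee A)) \<bullet> (c k \<star> idn (UnitOb C))"
        using acomp_reassoc2[OF ca[OF k], of "idn Y \<star> ee A"] by simp
      also have "\<dots> = ru (Und (FOb H k)) \<bullet> (c k \<star> idn (UnitOb C))"
        by (simp only: modD(4)[OF A Hm[OF k]])
      also have "\<dots> = c k \<bullet> ru Y" by (rule ru_nat) simp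
      finally show "c k \<bullet> act A N \<bullet> (idn (Und N) \<star> ee A) = c k \<bullet> ru (Und N)" by simp
    qed simp_all
  qed simp_all
  have cm: "mhom A N (FOb H k) (c k)" if "k \<in> Ob K" for k
    using that N Hm by (simp add: mhom_def ca)
  have rc: "raw (c k) = b k" for k by (simp add: c_def)
  have "is_limit K (Modl C A) H N b"
    unfolding is_limit_def
  proof (intro conjI allI impI)
    show "is_cone K (Modl C A) H N b"
      unfolding is_cone_def using N bc raw_hom_Modl[OF A cm] by (simp add: rc)
    fix Z d assume d: "is_cone K (Modl C A) H Z d"
    then have Z: "is_module C A Z" and dm: "\<And>k. k \<in> Ob K \<Longrightarrow> mhom A Z (FOb H k) (Arr (Und Z) (d k) (Und (FOb H k)))"
      and dd: "\<And>k l u. u \<in> Hom K k l \<Longrightarrow> FAr H k l u \<cdot> d k = d l"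
      by (simp_all add: is_cone_def hom_Modl[OF A])
    define D where "D k = Arr (Und Z) (d k) (Und (FOb H k))" for k
    note dm = dm[folded D_def]
    have hD: "h k l u \<bullet> D k = D l" if u: "u \<in> Hom K k l" for k l u
      using dd[OF u] mhomD(3)[OF dm[of k]] K.hom_ob[OF u] mhomD(3)[OF hm[OF u]] by (simp add: h_def D_def Arr_acomp)
    note [simp] = modD(1,2)[OF A Z] mhomD(3-5)[OF dm]
    obtain f where f [simp]: "ok f" "src f = Und Z" "tgt f = Y" and cf: "\<And>k. k \<in> Ob K \<Longrightarrow> c k \<bullet> f = D k"
      by (rule fac[of "Und Z" D, OF _ _ hD]) simp_all
    have fm: "mhom A Z N f"
    proof -
      have "f \<bullet> act A Z = act A N \<bullet> (f \<star> idn (MOb A))"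
      proof (rule eqI)
        fix k assume k [simp]: "k \<in> Ob K"
        show "c k \<bullet> f \<bullet> act A Z = c k \<bullet> act A N \<bullet> (f \<star> idn (MOb A))"
          using acomp_reassoc[OF cf[OF k], of "act A Z"] acomp_reassoc2[OF ca[OF k], of "f \<star> idn (MOb A)"] mhomD(6)[OF dm[OF k]]
          by (simp add: cf)
      qed simp_all
      then show ?thesis using Z N by (simp add: mhom_def)
    qed
    show "\<exists>!g. g \<in> Hom (Modl C A) Z N \<and> (\<forall>k\<in>Ob K. b k \<cdot>\<^bsub>Modl C A\<^esub> g = d k)"
    proof (rule ex1I[of _ "raw f"])
      have "b k \<cdot> raw f = d k" if "k \<in> Ob K" for k
        using arg_cong[OF cf[OF that], of raw] ok_acomp(4)[of f "c k"] that by (simp add: rc D_def)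
      then show "raw f \<in> Hom (Modl C A) Z N \<and> (\<forall>k\<in>Ob K. b k \<cdot>\<^bsub>Modl C A\<^esub> raw f = d k)"
        using raw_hom_Modl[OF A fm] by simp
    next
      fix g assume g: "g \<in> Hom (Modl C A) Z N \<and> (\<forall>k\<in>Ob K. b k \<cdot>\<^bsub>Modl C A\<^esub> g = d k)"
      then have gm: "mhom A Z N (Arr (Und Z) g (Und N))" by (simp add: hom_Modl[OF A])
      have "Arr (Und Z) g Y = f"
      proof (rule eqI)
        fix k assume k [simp]: "k \<in> Ob K"
        show "c k \<bullet> Arr (Und Z) g Y = c k \<bullet> f"
          using g mhomD(3)[OF gm] bH[OF k] by (simp add: cf) (simp add: c_def D_def Arr_acomp)
      qed (use mhomD(3)[OF gm] in simp_all)
      then show "g = raw f" by auto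
    qed
  qed
  then show ?thesis by (rule that)
qed

lemma bcf_comp:
  assumes j: "chom A B j" and f: "mhom A M N f" and g: "mhom A N P g"
  shows "bcf A B j M P (raw g \<cdot> raw f) = bcf A B j N P (raw g) \<bullet> bcf A B j M N (raw f)"
proof -
  note A = chomD(1)[OF j] and B = chomD(2)[OF j]
  note M = mhomD(1)[OF f] and N = mhomD(2)[OF f] and P = mhomD(2)[OF g]
  have gf: "mhom A M P (g \<bullet> f)" by (rule mhom_comp[OF A f g])
  note [simp] = bcf_eq(1)[OF j f] bcf_eq(1)[OF j g] bcq_simps[OF j M] bcq_simps[OF j N] bcq_simps[OF j P]
    mhomD(3-5)[OF f] mhomD(3-5)[OF g] cmonD(1)[OF B] modD(1)[OF A M] modD(1)[OF A N] modD(1)[OF A P] bc_rs[OF j M]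
  have e: "raw g \<cdot> raw f = raw (g \<bullet> f)" by simp
  show ?thesis
    unfolding e
  proof (rule tcoeq_eqI[OF bcq_coeq[OF j M]])
    show "bcf A B j M P (raw (g \<bullet> f)) \<bullet> bcq A B j M = (bcf A B j N P (raw g) \<bullet> bcf A B j M N (raw f)) \<bullet> bcq A B j M"
      using acomp_reassoc2[OF bcf_eq(2)[OF j g], of "f \<star> idn (MOb B)"]
      by (simp add: bcf_eq(2)[OF j f] bcf_eq(2)[OF j gf] del: ok_acomp(4))
  qed (use bcf_eq(1)[OF j gf] in \<open>simp_all del: ok_acomp(4)\<close>)
qed

lemma bcf_idn:
  assumes j: "chom A B j" and M: "is_module C A M"
  shows "bcf A B j M M (Idt C (Und M)) = idn (Und (bcN A B j M))"
proof -
  note A = chomD(1)[OF j] and B = chomD(2)[OF j]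
  note i = mhom_idn[OF A M]
  note [simp] = bcf_eq(1)[OF j i] bcq_simps[OF j M] cmonD(1)[OF B] modD(1)[OF A M] bc_rs[OF j M] Und_bcN
  have [simp]: "tgt (bcq A B j M) \<in> Ob C" using ok_ob(2)[OF bcq_simps(1)[OF j M]] .
  have e: "Idt C (Und M) = raw (idn (Und M))" by (simp add: raw_struct)
  show ?thesis
    unfolding e
    by (rule tcoeq_eqI[OF bcq_coeq[OF j M]]) (use bcf_eq(2)[OF j i] in simp_all)
qed

lemma apow_smul_nat:
  assumes A: "is_cmonoid C A" and f: "mhom A M N f" and t: "rend A t"
  shows "f \<bullet> apow (smul A M t) n = apow (smul A N t) n \<bullet> f"
  using smul_simps[OF A mhomD(1)[OF f] t] smul_simps[OF A mhomD(2)[OF f] t] mhomD(3-5)[OF f]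
  by (intro apow_commute smul_nat[OF A f t]) simp_all

lemma bce_is_colimit:
  assumes B: "is_loc A t B e" and M: "is_module C A M"
  shows "is_colimit nat_cat (Modl C A) (mseq M (smul A M t)) (rmod B (e 0) (bcN A B (e 0) M)) (\<lambda>n. raw (bce A B e M n))"
  using is_colimit_mseq[OF is_locD(3)[OF B] smul_mhom[OF is_locD(3)[OF B] M is_locD(1)[OF B]], of "rmod B (e 0) (bcN A B (e 0) M)" "bce A B e M"]
    bce_tel[OF B M] bce_mhom[OF B M] by simp

lemma hom_rmod_iff:
  assumes B: "is_loc A t B e" and W: "is_module C B W" and N: "is_module C B N"
  shows "u \<in> Hom (Modl C A) (rmod B (e 0) W) (rmod B (e 0) N) \<longleftrightarrow> u \<in> Hom (Modl C B) W N"
  unfolding hom_Modl[OF is_locD(3)[OF B]] hom_Modl[OF is_locD(4)[OF B]]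
  using mhom_rmod[OF is_locD(2)[OF B]] loc_full[OF B W N] by auto

lemma loc_flat:
  assumes B: "is_loc A t B e"
  shows "is_flat_morphism C A B (raw (e 0))"
  unfolding is_flat_morphism_def preserves_finite_limits_def
proof (intro allI impI, elim conjE)
  fix K :: "(nat, nat) cat" and G L p
  assume K: "finite_cat K" and G: "is_ftor K (Modl C A) G" and L: "is_limit K (Modl C A) G L p"
  note A = is_locD(3)[OF B] and t = is_locD(1)[OF B] and j = is_locD(2)[OF B] and Bm = is_locD(4)[OF B]
  interpret MA: category "Modl C A" by (rule category_Modl[OF A])
  interpret MB: category "Modl C B" by (rule category_Modl[OF Bm])
  have Kc: "category K" using K by (simp add: finite_cat_def)
  interpret K: category K by fact
  let ?F = "base_change C A B (raw (e 0))"
  define g where "g k l v = Arr (Und (FOb G k)) (FAr G k l v) (Und (FOb G l))" for k l v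
  define P where "P k = Arr (Und L) (p k) (Und (FOb G k))" for k
  define T where "T M = smul A M t" for M
  define N where "N M = bcN A B (e 0) M" for M
  define R where "R M = rmod B (e 0) (N M)" for M
  have Gm: "is_module C A (FOb G k)" if "k \<in> Ob K" for k using G that by (simp add: is_ftor_def)
  have gm: "mhom A (FOb G k) (FOb G l) (g k l v)" if "v \<in> Hom K k l" for k l v
    using G that hom_Modl[OF A] by (simp add: is_ftor_def g_def)
  have rg: "raw (g k l v) = FAr G k l v" for k l v by (simp add: g_def)
  have Gc: "FAr G i k (v \<cdot>\<^bsub>K\<^esub> u) = FAr G j k v \<cdot> FAr G i j u" if "u \<in> Hom K i j" "v \<in> Hom K j k" for i j k u v
    using G that by (simp add: is_ftor_def)
  have Gi: "FAr G k k (Idt K k) = Idt C (Und (FOb G k))" if "k \<in> Ob K" for k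
    using G that by (simp add: is_ftor_def)
  have gi: "g k k (Idt K k) = idn (Und (FOb G k))" if "k \<in> Ob K" for k
    by (simp add: g_def Gi[OF that] idn_def)
  have gc: "g i k (v \<cdot>\<^bsub>K\<^esub> u) = g j k v \<bullet> g i j u" if "u \<in> Hom K i j" "v \<in> Hom K j k" for i j k u v
    using mhomD(3)[OF gm[OF that(1)]] mhomD(3)[OF gm[OF that(2)]] by (simp add: g_def Arr_acomp Gc[OF that])
  have Lm: "is_module C A L" using L by (simp add: is_limit_def is_cone_def)
  have Pm: "mhom A L (FOb G k) (P k)" if "k \<in> Ob K" for k
    using L that hom_Modl[OF A] by (simp add: is_limit_def is_cone_def P_def)
  have rP: "raw (P k) = p k" for k by (simp add: P_def)
  have pc: "FAr G k l v \<cdot> p k = p l" if "v \<in> Hom K k l" for k l v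
    using L that by (simp add: is_limit_def is_cone_def)
  have Nm: "is_module C B (N M)" if "is_module C A M" for M
    unfolding N_def by (rule bc_module[OF j that])
  have UN: "Und (N M) = tgt (bcq A B (e 0) M)" for M by (simp add: N_def Und_bcN)
  have FAr: "FAr ?F M M' u = raw (bcf A B (e 0) M M' u)" for M M' u by (simp add: bcf_def)
  have FO: "FOb ?F = N" by (simp add: N_def fun_eq_iff)
  have Tm: "mhom A M M (T M)" if "is_module C A M" for M
    unfolding T_def by (rule smul_mhom[OF A that t])
  note Ts = mhomD(3-5)[OF Tm]
  have bm: "mhom B (N M) (N M') (bcf A B (e 0) M M' (raw f))" if "mhom A M M' f" for M M' f
    unfolding N_def by (rule bcf_mhom[OF j that])
  have bA: "mhom A (R M) (R M') (bcf A B (e 0) M M' (raw f))" if "mhom A M M' f" for M M' f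
    unfolding R_def by (rule mhom_rmod[OF j bm[OF that]])

  \<comment> \<open>The commutation hypothesis concerns small categories on \<open>'u\<close>, so
    the telescope is indexed by a copy J of the natural numbers inside \<open>'u\<close>.\<close>
  obtain \<alpha> :: "nat \<Rightarrow> 'u" where \<alpha>: "inj \<alpha>" by (rule countable_inj)
  obtain \<beta> :: "unit \<Rightarrow> 'u" where \<beta>: "inj \<beta>" by (rule countable_inj)
  define J where "J = enc_cat \<alpha> \<beta> nat_cat"
  define iv where "iv = inv_into UNIV \<alpha>"
  have iv [simp]: "iv (\<alpha> n) = n" for n using \<alpha> by (simp add: iv_def)
  have Jo: "a \<in> Ob J \<longleftrightarrow> (\<exists>n. a = \<alpha> n)" for a by (auto simp: J_def enc_cat_def)
  have Jh: "u \<in> Hom J a b \<longleftrightarrow> (\<exists>m n. a = \<alpha> m \<and> b = \<alpha> n \<and> u = \<beta> () \<and> m \<le> n)" for u a b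
    by (simp add: J_def hom_enc_cat[OF \<alpha>])
  have Ji: "Idt J a = \<beta> ()" for a by (simp add: J_def enc_cat_def)
  have J: "small_cat J" unfolding J_def
    by (rule small_cat_enc[OF category_nat_cat \<alpha> \<beta> universe_uncountable])
  have Jf: "filtered_cat J" unfolding J_def by (rule filtered_cat_enc[OF filtered_nat_cat \<alpha> \<beta>])
  have Jc: "category J" using J by (simp add: small_cat_def)
  interpret J: category J by fact

  \<comment> \<open>The value at (a, k) is \<open>FOb G k\<close> for every stage a; arrows of J act
    by powers of t, arrows of K through G.\<close>
  define D :: "('u \<times> nat, 'u \<times> nat, ('o, 'm) modl, 'm) ftor" where
    "D = \<lparr>FOb = (\<lambda>(a, k). FOb G k),
      FAr = (\<lambda>(a, k) (b, l) (u, v). raw (g k l v \<bullet> apow (T (FOb G k)) (iv b - iv a)))\<rparr>"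
  have D: "FOb D (a, k) = FOb G k" "FAr D (a, k) (b, l) (u, v) = raw (g k l v \<bullet> apow (T (FOb G k)) (iv b - iv a))"
    for a b k l u v by (simp_all add: D_def)
  \<comment> \<open>At every stage the limit over K is L, so the functor of limits is the telescope
    of L.\<close>
  define Pf where "Pf = enc_ftor \<alpha> \<beta> (mseq L (T L))"
  have Pf: "FOb Pf a = L" "FAr Pf a b u = raw (apow (T L) (iv b - iv a))" for a b u
    by (simp_all add: Pf_def enc_ftor_def mseq_def iv_def)
  \<comment> \<open>The stagewise colimits over J: the base changed diagram, regarded over
    A.\<close>
  define Q where "Q = \<lparr>FOb = (\<lambda>k. R (FOb G k)), FAr = (\<lambda>k l v. raw (bcf A B (e 0) (FOb G k) (FOb G l) (FAr G k l v)))\<rparr>"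
  have Q: "FOb Q k = R (FOb G k)" "FAr Q k l v = raw (bcf A B (e 0) (FOb G k) (FOb G l) (FAr G k l v))" for k l v
    by (simp_all add: Q_def)
  define \<iota> where "\<iota> a k = raw (bce A B e (FOb G k) (iv a))" for a k
  define x where "x a = raw (bce A B e L (iv a))" for a
  let ?f = "\<lambda>k. raw (bcf A B (e 0) L (FOb G k) (p k))"

  have Qf: "is_ftor K (Modl C A) Q"
    unfolding is_ftor_def
  proof (intro conjI ballI allI)
    show "FOb Q k \<in> Ob (Modl C A)" if "k \<in> Ob K" for k
      using is_module_rmod[OF j Nm[OF Gm[OF that]]] by (simp add: Q R_def)
    show "FAr Q k l v \<in> Hom (Modl C A) (FOb Q k) (FOb Q l)" if "v \<in> Hom K k l" for k l v
      using raw_hom_Modl[OF A bA[OF gm[OF that]]] by (simp add: Q rg)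
    show "FAr Q k k (Idt K k) = Idt (Modl C A) (FOb Q k)" if "k \<in> Ob K" for k
      using bcf_idn[OF j Gm[OF that]] by (simp add: Q Gi[OF that] raw_struct R_def N_def)
    show "FAr Q i k (v \<cdot>\<^bsub>K\<^esub> u) = FAr Q j k v \<cdot>\<^bsub>Modl C A\<^esub> FAr Q i j u" if "u \<in> Hom K i j" "v \<in> Hom K j k" for i j k u v
      using bcf_comp[OF \<open>chom A B (e 0)\<close> gm[OF that(1)] gm[OF that(2)]]
        mhomD(3-5)[OF bA[OF gm[OF that(1)]]] mhomD(3-5)[OF bA[OF gm[OF that(2)]]]
      by (simp add: Q rg Gc[OF that])
  qed
  \<comment> \<open>A limit of the base changed diagram over A. The base change of L maps to it by
    c, which the commutation hypothesis turns into an isomorphism.\<close>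
  obtain Y b where Y: "is_limit K (Modl C A) Q Y b" by (rule ex_limit_Modl[OF A Kc Qf])
  have RL: "is_module C A (R L)" unfolding R_def by (rule is_module_rmod[OF j Nm[OF Lm]])
  have fc: "FAr Q k l v \<cdot> ?f k = ?f l" if v: "v \<in> Hom K k l" for k l v
  proof -
    have k: "k \<in> Ob K" using K.hom_ob[OF v] by simp
    have "bcf A B (e 0) L (FOb G l) (raw (g k l v) \<cdot> raw (P k)) = bcf A B (e 0) (FOb G k) (FOb G l) (raw (g k l v)) \<bullet> bcf A B (e 0) L (FOb G k) (raw (P k))"
      by (rule bcf_comp[OF j Pm[OF k] gm[OF v]])
    from arg_cong[OF this, of raw] show ?thesis
      using mhomD(3-5)[OF bA[OF gm[OF v]]] mhomD(3-5)[OF bA[OF Pm[OF k]]] by (simp add: Q rg rP pc[OF v])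
  qed
  have "is_cone K (Modl C A) Q (R L) ?f"
    using RL raw_hom_Modl[OF A bA[OF Pm]] fc by (simp add: is_cone_def Q rP)
  then have "\<exists>!h. h \<in> Hom (Modl C A) (R L) Y \<and> (\<forall>k\<in>Ob K. b k \<cdot>\<^bsub>Modl C A\<^esub> h = ?f k)"
    using Y unfolding is_limit_def by blast
  then obtain c where c: "c \<in> Hom (Modl C A) (R L) Y" "\<And>k. k \<in> Ob K \<Longrightarrow> b k \<cdot> c = ?f k"
    unfolding Modl_sel(3) by blast

  have "is_iso (Modl C A) (R L) Y c"
  proof (rule filtered_colims_finite_lims[OF A, unfolded filtered_colims_commute_with_finite_lims_def, rule_format, of J K D Pf "\<lambda>_. p" Q \<iota> "R L" x Y b c],
      intro conjI ballI allI)
    show "is_ftor (prod_cat J K) (Modl C A) D"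
      unfolding is_ftor_def
    proof (intro conjI ballI allI)
      show "FOb D a \<in> Ob (Modl C A)" if "a \<in> Ob (prod_cat J K)" for a
        using that Gm by (auto simp: prod_cat_def D)
      show "FAr D a a' u \<in> Hom (Modl C A) (FOb D a) (FOb D a')" if "u \<in> Hom (prod_cat J K) a a'" for a a' u
      proof -
        obtain i k i' k' w v where *: "a = (i, k)" "a' = (i', k')" "u = (w, v)" by (metis surj_pair)
        with that have v: "v \<in> Hom K k k'" by (simp add: prod_cat_def)
        then show ?thesis
          unfolding * D using raw_hom_Modl[OF A mhom_comp[OF A mhom_apow[OF A Tm] gm[OF v]]] Gm K.hom_ob[OF v] by blast
      qed
      show "FAr D a a (Idt (prod_cat J K) a) = Idt (Modl C A) (FOb D a)" if a: "a \<in> Ob (prod_cat J K)" for a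
      proof -
        obtain i k where *: "a = (i, k)" "k \<in> Ob K" using a by (auto simp: prod_cat_def)
        then show ?thesis
          using modD(1)[OF A Gm[OF *(2)]] Ts[OF Gm[OF *(2)]] by (simp add: prod_cat_def D gi raw_struct)
      qed
      show "FAr D a a'' (v \<cdot>\<^bsub>prod_cat J K\<^esub> u) = FAr D a' a'' v \<cdot>\<^bsub>Modl C A\<^esub> FAr D a a' u"
        if "u \<in> Hom (prod_cat J K) a a'" "v \<in> Hom (prod_cat J K) a' a''" for a a' a'' u v
      proof -
        obtain i k i' k' i'' k'' u1 u2 v1 v2 where *: "a = (i, k)" "a' = (i', k')" "a'' = (i'', k'')" "u = (u1, u2)" "v = (v1, v2)"
          by (metis surj_pair)
        with that have h: "u1 \<in> Hom J i i'" "v1 \<in> Hom J i' i''" and u2: "u2 \<in> Hom K k k'" and v2: "v2 \<in> Hom K k' k''"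
          by (simp_all add: prod_cat_def)
        have k: "k \<in> Ob K" "k' \<in> Ob K" using K.hom_ob[OF u2] by auto
        from h have "iv i \<le> iv i'" "iv i' \<le> iv i''" by (auto simp: Jh inj_eq[OF \<alpha>])
        then have s: "iv i'' - iv i = (iv i'' - iv i') + (iv i' - iv i)" by simp
        note [simp] = mhomD(3-5)[OF gm[OF u2]] mhomD(3-5)[OF gm[OF v2]] Ts[OF Gm[OF k(1)]] Ts[OF Gm[OF k(2)]]
        have "g k k'' (v2 \<cdot>\<^bsub>K\<^esub> u2) \<bullet> apow (T (FOb G k)) (iv i'' - iv i)
            = g k' k'' v2 \<bullet> g k k' u2 \<bullet> apow (T (FOb G k)) (iv i'' - iv i') \<bullet> apow (T (FOb G k)) (iv i' - iv i)"
          by (simp add: s gc[OF u2 v2] apow_add)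
        also have "\<dots> = (g k' k'' v2 \<bullet> apow (T (FOb G k')) (iv i'' - iv i')) \<bullet> (g k k' u2 \<bullet> apow (T (FOb G k)) (iv i' - iv i))"
          using acomp_reassoc2[OF apow_smul_nat[OF A gm[OF u2] t, folded T_def]] by simp
        finally have eq: "g k k'' (v2 \<cdot>\<^bsub>K\<^esub> u2) \<bullet> apow (T (FOb G k)) (iv i'' - iv i)
            = (g k' k'' v2 \<bullet> apow (T (FOb G k')) (iv i'' - iv i')) \<bullet> (g k k' u2 \<bullet> apow (T (FOb G k)) (iv i' - iv i))"
          (is "_ = ?Y \<bullet> ?Z") .
        have YZ: "raw (?Y \<bullet> ?Z) = raw ?Y \<cdot> raw ?Z" by (rule ok_acomp(4)) simp_all
        have "FAr D a a'' (v \<cdot>\<^bsub>prod_cat J K\<^esub> u) = raw (g k k'' (v2 \<cdot>\<^bsub>K\<^esub> u2) \<bullet> apow (T (FOb G k)) (iv i'' - iv i))"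
          by (simp add: * D prod_cat_def del: ok_acomp(4))
        moreover have "FAr D a' a'' v = raw ?Y" "FAr D a a' u = raw ?Z" by (simp_all only: * D)
        ultimately show ?thesis by (simp only: eq YZ Modl_sel(3))
      qed
    qed
    show "is_ftor J (Modl C A) Pf"
      unfolding Pf_def J_def by (rule is_ftor_enc[OF is_ftor_mseq[OF A Tm[OF Lm]] \<alpha> \<beta>])
    show "is_limit K (Modl C A) \<lparr>FOb = \<lambda>k. FOb D (a, k), FAr = \<lambda>k l v. FAr D (a, k) (a, l) (Idt J a, v)\<rparr> (FOb Pf a) p"
      if "a \<in> Ob J" for a
      unfolding Pf
    proof (rule MA.is_limit_cong[OF L Kc])
      fix k l v assume v: "v \<in> Hom K k l"
      show "FAr G k l v = FAr \<lparr>FOb = \<lambda>k. FOb D (a, k), FAr = \<lambda>k l v. FAr D (a, k) (a, l) (Idt J a, v)\<rparr> k l v"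
        using mhomD(3-5)[OF gm[OF v]] Ts[OF Gm] K.hom_ob[OF v] by (simp add: D rg del: ok_acomp(4))
    qed (simp add: D)
    show "p k \<cdot>\<^bsub>Modl C A\<^esub> FAr Pf a a' u = FAr D (a, k) (a', k) (u, Idt K k) \<cdot>\<^bsub>Modl C A\<^esub> p k"
      if "u \<in> Hom J a a'" "k \<in> Ob K" for a a' u k
    proof -
      note [simp] = mhomD(3-5)[OF Pm[OF that(2)]] Ts[OF Lm] Ts[OF Gm[OF that(2)]]
      from arg_cong[OF apow_smul_nat[OF A Pm[OF that(2)] t, folded T_def], of raw] show ?thesis
        by (simp add: Pf D gi[OF that(2)] rP)
    qed
    show "is_colimit J (Modl C A) \<lparr>FOb = \<lambda>a. FOb D (a, k), FAr = \<lambda>a a' u. FAr D (a, k) (a', k) (u, Idt K k)\<rparr> (FOb Q k) (\<lambda>a. \<iota> a k)"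
      if k: "k \<in> Ob K" for k
    proof -
      note [simp] = Ts[OF Gm[OF k]]
      have "is_colimit J (Modl C A) (enc_ftor \<alpha> \<beta> (mseq (FOb G k) (T (FOb G k)))) (R (FOb G k)) (\<lambda>a. \<iota> a k)"
        unfolding J_def is_colimit_enc[OF \<alpha> \<beta>] \<iota>_def iv
        using bce_is_colimit[OF B Gm[OF k]] by (simp add: T_def R_def N_def)
      then show ?thesis
        unfolding Q
        by (rule MA.is_colimit_cong[OF _ Jc]) (simp_all add: D gi[OF k] enc_ftor_def mseq_def iv_def)
    qed
    show "FAr Q k l v \<cdot>\<^bsub>Modl C A\<^esub> \<iota> a k = \<iota> a l \<cdot>\<^bsub>Modl C A\<^esub> FAr D (a, k) (a, l) (Idt J a, v)"
      if v: "v \<in> Hom K k l" and "a \<in> Ob J" for k l v a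
    proof -
      have k: "k \<in> Ob K" "l \<in> Ob K" using K.hom_ob[OF v] by auto
      note [simp] = mhomD(3-5)[OF gm[OF v]] Ts[OF Gm[OF k(1)]] bce_simps[OF B Gm[OF k(1)]] bce_simps[OF B Gm[OF k(2)]] bcf_eq(1)[OF j gm[OF v]]
      from arg_cong[OF bcf_bce[OF B gm[OF v], of "iv a"], of raw] show ?thesis
        using bcf_eq(1)[OF j gm[OF v]] by (simp add: Q D \<iota>_def raw_struct rg idt_right[OF ar_raw[of "g k l v"]])
    qed
    show "is_colimit J (Modl C A) Pf (R L) x"
      unfolding J_def Pf_def is_colimit_enc[OF \<alpha> \<beta>] x_def iv
      using bce_is_colimit[OF B Lm] by (simp add: T_def R_def N_def)
    show "b k \<cdot>\<^bsub>Modl C A\<^esub> c \<cdot>\<^bsub>Modl C A\<^esub> x a = \<iota> a k \<cdot>\<^bsub>Modl C A\<^esub> p k" if "a \<in> Ob J" and k: "k \<in> Ob K" for a k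
    proof -
      have bH: "b k \<in> Hom (Modl C A) Y (FOb Q k)" using Y k by (simp add: is_limit_def is_cone_def)
      have xH: "x a \<in> Hom (Modl C A) L (R L)"
        unfolding x_def R_def N_def by (rule raw_hom_Modl[OF A bce_mhom[OF B Lm]])
      have "b k \<cdot> c \<cdot> x a = ?f k \<cdot> x a"
        using MA.cmp_assoc[OF xH c(1) bH] c(2)[OF k] by simp
      also have "\<dots> = \<iota> a k \<cdot> p k"
        using arg_cong[OF bcf_bce[OF B Pm[OF k], of "iv a"], of raw] mhomD(3-5)[OF Pm[OF k]] bcf_eq(1)[OF j Pm[OF k]]
          bce_simps[OF B Gm[OF k]] bce_simps[OF B Lm] by (simp add: x_def \<iota>_def rP)
      finally show ?thesis by simp
    qed
  qed (use J Jf K Qf Y c(1) in simp_all)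
  then obtain c' where c': "c' \<in> Hom (Modl C A) Y (R L)" "c' \<cdot> c = Idt C (Und (R L))" "c \<cdot> c' = Idt C (Und Y)"
    by (auto simp: is_iso_def)

  have fB: "?f k \<in> Hom (Modl C B) (N L) (N (FOb G k))" if "k \<in> Ob K" for k
    using raw_hom_Modl[OF Bm bm[OF Pm[OF that]]] by (simp add: rP)
  have fA: "?f k \<in> Hom (Modl C A) (R L) (R (FOb G k))" if "k \<in> Ob K" for k
    using raw_hom_Modl[OF A bA[OF Pm[OF that]]] by (simp add: rP)
  have bH: "b k \<in> Hom (Modl C A) Y (R (FOb G k))" if "k \<in> Ob K" for k
    using Y that by (simp add: is_limit_def is_cone_def Q)
  have comp: "FAr (ftor_comp ?F G) k l v = FAr Q k l v" "FOb (ftor_comp ?F G) k = N (FOb G k)" for k l v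
    by (simp_all add: ftor_comp_def FAr Q FO)
  show "is_limit K (Modl C B) (ftor_comp ?F G) (FOb ?F L) (\<lambda>k. FAr ?F L (FOb G k) (p k))"
    unfolding FAr FO is_limit_def
  proof (intro conjI allI impI)
    show "is_cone K (Modl C B) (ftor_comp ?F G) (N L) ?f"
      using fB fc Nm[OF Lm] by (simp add: is_cone_def comp)
    \<comment> \<open>A cone over the localisation is restricted to A, factored through Y, moved to
      the base change of L by the inverse of c, and read back over the localisation by full
      faithfulness of restriction.\<close>
    fix W w assume w: "is_cone K (Modl C B) (ftor_comp ?F G) W w"
    have W: "is_module C B W" using w by (simp add: is_cone_def)
    let ?W = "rmod B (e 0) W"
    have iff: "u \<in> Hom (Modl C B) W (N M) \<longleftrightarrow> u \<in> Hom (Modl C A) ?W (R M)" if "is_module C A M" for u M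
      unfolding R_def by (rule hom_rmod_iff[OF B W Nm[OF that], symmetric])
    have "is_cone K (Modl C A) Q ?W w"
      using w is_module_rmod[OF j W] iff[OF Gm] by (simp add: is_cone_def comp) (simp add: Q)
    then have "\<exists>!h. h \<in> Hom (Modl C A) ?W Y \<and> (\<forall>k\<in>Ob K. b k \<cdot>\<^bsub>Modl C A\<^esub> h = w k)"
      using Y unfolding is_limit_def by blast
    then obtain d where d: "d \<in> Hom (Modl C A) ?W Y" "\<And>k. k \<in> Ob K \<Longrightarrow> b k \<cdot> d = w k"
      and uniq: "\<And>d'. \<lbrakk>d' \<in> Hom (Modl C A) ?W Y; \<And>k. k \<in> Ob K \<Longrightarrow> b k \<cdot> d' = w k\<rbrakk> \<Longrightarrow> d' = d"
      unfolding Modl_sel(3) by blast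
    show "\<exists>!h. h \<in> Hom (Modl C B) W (N L) \<and> (\<forall>k\<in>Ob K. ?f k \<cdot>\<^bsub>Modl C B\<^esub> h = w k)"
    proof (rule ex1I[of _ "c' \<cdot> d"])
      have h: "c' \<cdot> d \<in> Hom (Modl C A) ?W (R L)" using MA.cmp_hom[OF d(1) c'(1)] by simp
      have "c \<cdot> c' \<cdot> d = d"
        using MA.cmp_assoc[OF d(1) c'(1) c(1)] c'(3) MA.idt_left[OF d(1)] by simp
      then have "?f k \<cdot> c' \<cdot> d = w k" if "k \<in> Ob K" for k
        using MA.cmp_assoc[OF h c(1) bH[OF that]] c(2)[OF that] d(2)[OF that] by simp
      then show "c' \<cdot> d \<in> Hom (Modl C B) W (N L) \<and> (\<forall>k\<in>Ob K. ?f k \<cdot>\<^bsub>Modl C B\<^esub> c' \<cdot> d = w k)"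
        using h iff[OF Lm] by simp
    next
      fix h assume "h \<in> Hom (Modl C B) W (N L) \<and> (\<forall>k\<in>Ob K. ?f k \<cdot>\<^bsub>Modl C B\<^esub> h = w k)"
      then have h: "h \<in> Hom (Modl C A) ?W (R L)" "\<And>k. k \<in> Ob K \<Longrightarrow> ?f k \<cdot> h = w k"
        using iff[OF Lm] by simp_all
      have "c \<cdot> h = d"
      proof (rule uniq)
        show "c \<cdot> h \<in> Hom (Modl C A) ?W Y" using MA.cmp_hom[OF h(1) c(1)] by simp
        show "b k \<cdot> c \<cdot> h = w k" if "k \<in> Ob K" for k
          using MA.cmp_assoc[OF h(1) c(1) bH[OF that]] c(2)[OF that] h(2)[OF that] by simp
      qed
      then show "h = c' \<cdot> d"
        using MA.cmp_assoc[OF h(1) c(1) c'(1)] c'(2) MA.idt_left[OF h(1)] by simp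
    qed
  qed
qed

end


section \<open>Partitions of unity\<close>

lemma directed_nat_cat: "directed_cat nat_cat"
  using filtered_nat_cat by (auto simp: directed_cat_def filtered_cat_def)

lemma directed_cat_enc:
  assumes J: "directed_cat J" and p: "inj p" and q: "inj q"
  shows "directed_cat (enc_cat p q J)"
proof -
  have "filtered_cat J"
    unfolding filtered_cat_def
  proof (intro conjI allI ballI)
    fix i j u v assume uv: "u \<in> Hom J i j" "v \<in> Hom J i j"
    interpret J: category J using J by (simp add: directed_cat_def)
    have "u = v" using J uv unfolding directed_cat_def by blast
    then show "\<exists>k. \<exists>w\<in>Hom J j k. w \<cdot>\<^bsub>J\<^esub> u = w \<cdot>\<^bsub>J\<^esub> v"
      using J.idt_hom J.hom_ob[OF uv(1)] by blast
  qed (use J in \<open>auto simp: directed_cat_def\<close>)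
  then have F: "filtered_cat (enc_cat p q J)" by (rule filtered_cat_enc[OF _ p q])
  have "u = v" if uv: "u \<in> Hom (enc_cat p q J) a b" "v \<in> Hom (enc_cat p q J) a b" for a b u v
  proof -
    obtain i j u' v' where *: "u = q u'" "v = q v'" "u' \<in> Hom J i j" "v' \<in> Hom J i j"
      using uv unfolding hom_enc_cat[OF p] using injD[OF p] by metis
    have "u' = v'" using J *(3,4) unfolding directed_cat_def by blast
    then show ?thesis by (simp add: *(1,2))
  qed
  with F show ?thesis unfolding directed_cat_def filtered_cat_def by blast
qed

section \<open>Annihilation by powers of scalars\<close>

context ag_base
begin

lemma zer_tens_left:
  assumes [simp]: "X \<in> Ob C" "Y \<in> Ob C" "W \<in> Ob C"
  shows "idn W \<star> zer X Y = zer (W \<otimes>\<^sub>o X) (W \<otimes>\<^sub>o Y)"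
proof -
  have "idn W \<star> zer X Y = br Y W \<bullet> (zer X Y \<star> idn W) \<bullet> br W X"
    using acomp_reassoc2[OF br_nat[of "zer X Y" X Y "idn W" W W], of "br W X"] by simp
  then show ?thesis by (simp add: zer_tens)
qed

lemma smul_zer:
  assumes A: "is_cmonoid C A" and M: "is_module C A M"
  shows "smul A M (zer (MOb A) (MOb A)) = zer (Und M) (Und M)"
proof -
  have "rend A (zer (MOb A) (MOb A))"
    using mhom_zer[OF A is_module_regular[OF A] is_module_regular[OF A]] by simp
  from smul_unique[OF A M this, of "zer (Und M) (Und M)"] show ?thesis
    using cmonD(1-3)[OF A] modD(1,2)[OF A M] by (simp add: zer_tens_left)
qed

definition kills :: "('o, 'm) arrow \<Rightarrow> ('o, 'm) arrow \<Rightarrow> bool" where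
  "kills a f \<longleftrightarrow> (\<exists>n. apow a n \<bullet> f = zer (src f) (tgt f))"

lemma apow_kill_mono:
  assumes a: "ok a" "tgt a = src a" and f: "ok f" "tgt f = src a"
    and k: "apow a n \<bullet> f = zer (src f) (tgt f)" and le: "n \<le> m"
  shows "apow a m \<bullet> f = zer (src f) (tgt f)"
proof -
  have [simp]: "src a \<in> Ob C" "src f \<in> Ob C" using a f by simp_all
  have "m = (m - n) + n" using le by simp
  then have "apow a m = apow a (m - n) \<bullet> apow a n" using apow_add[OF a] by metis
  then show ?thesis using a f by (simp add: k)
qed

text \<open>Induction on the sum of the two exponents replaces the binomial formula: one factor a +
  b splits f into a f and b f, and each of them needs one power less of a or of b,
  respectively.\<close>

lemma kills_aadd:
  assumes a [simp]: "ok a" "src a = M" "tgt a = M" and b [simp]: "ok b" "src b = M" "tgt b = M"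
    and ab: "a \<bullet> b = b \<bullet> a" and f: "ok f" "tgt f = M" "kills a f" "kills b f"
  shows "kills (aadd a b) f"
proof -
  let ?c = "aadd a b"
  have [simp]: "M \<in> Ob C" using ok_ob(1)[OF a(1)] by simp
  have "\<exists>N. apow ?c N \<bullet> f = zer (src f) M"
    if "ok f" "tgt f = M" "apow a m \<bullet> f = zer (src f) M" "apow b n \<bullet> f = zer (src f) M" "m + n = k" for m n k f
    using that
  proof (induction k arbitrary: m n f)
    case 0
    then have "apow ?c 0 \<bullet> f = zer (src f) M" by auto
    then show ?case by blast
  next
    case (Suc k)
    note f = Suc.prems
    have [simp]: "ok f" "tgt f = M" "src f \<in> Ob C" using f by simp_all
    show ?case
    proof (cases "m = 0 \<or> n = 0")
      case True
      then have "apow ?c 0 \<bullet> f = zer (src f) M" using f by auto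
      then show ?thesis by blast
    next
      case False
      then obtain m' n' where mn: "m = Suc m'" "n = Suc n'" by (meson not0_implies_Suc)
      have 1: "apow a m' \<bullet> a \<bullet> f = zer (src f) M"
        using f(3) acomp_reassoc2[OF apow_Suc2[of a m'], of f] by (simp add: mn)
      have 2: "apow b n' \<bullet> b \<bullet> f = zer (src f) M"
        using f(4) acomp_reassoc2[OF apow_Suc2[of b n'], of f] by (simp add: mn)
      have 3: "apow b n \<bullet> a \<bullet> f = zer (src f) M"
        using acomp_reassoc2[OF apow_commute[of b b a n], of f] ab f(4) by simp
      have 4: "apow a m \<bullet> b \<bullet> f = zer (src f) M"
        using acomp_reassoc2[OF apow_commute[of a a b m], of f] ab f(3) by simp
      obtain N1 where N1: "apow ?c N1 \<bullet> a \<bullet> f = zer (src f) M"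
        using Suc.IH[of "a \<bullet> f" m' n] 1 3 f(5) mn by auto
      obtain N2 where N2: "apow ?c N2 \<bullet> b \<bullet> f = zer (src f) M"
        using Suc.IH[of "b \<bullet> f" m n'] 2 4 f(5) mn by auto
      \<comment> \<open>A common exponent for a f and b f; the power is then one larger, since one
        factor has been spent on splitting f.\<close>
      let ?N = "max N1 N2"
      have "apow ?c ?N \<bullet> a \<bullet> f = zer (src f) M" "apow ?c ?N \<bullet> b \<bullet> f = zer (src f) M"
        using apow_kill_mono[of ?c "a \<bullet> f" N1 ?N] apow_kill_mono[of ?c "b \<bullet> f" N2 ?N] N1 N2 by simp_all
      then have "apow ?c (Suc ?N) \<bullet> f = zer (src f) M"
        using apow_Suc2[of ?c ?N] aadd_comp_right[of "a \<bullet> f" "b \<bullet> f" "apow ?c ?N"] aadd_comp_left[of f a b]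
        by (simp flip: apow_Suc2)
      then show ?thesis by blast
    qed
  qed
  then show ?thesis using f unfolding kills_def by metis
qed

text \<open>As s and a commute, (s a)^n = s^n a^n, and the power of a already annihilates f.\<close>

lemma kills_comp:
  assumes a [simp]: "ok a" "src a = M" "tgt a = M" and s [simp]: "ok s" "src s = M" "tgt s = M"
    and sa: "s \<bullet> a = a \<bullet> s" and f [simp]: "ok f" "tgt f = M" and k: "kills a f"
  shows "kills (s \<bullet> a) f"
proof -
  have [simp]: "M \<in> Ob C" "src f \<in> Ob C" using ok_ob(1)[OF a(1)] by simp_all
  have pow: "apow (s \<bullet> a) n = apow s n \<bullet> apow a n" for n
  proof (induction n)
    case (Suc n)
    have "a \<bullet> apow s n = apow s n \<bullet> a" using apow_commute[of s s a n] sa by simp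
    from acomp_reassoc2[OF this, of "apow a n"] show ?case by (simp add: Suc)
  qed simp
  obtain n where n: "apow a n \<bullet> f = zer (src f) M" using k by (auto simp: kills_def)
  show ?thesis unfolding kills_def by (intro exI[of _ n]) (simp add: pow n)
qed

lemma E_ring_sel [simp]:
  "carrier (E_ring C A) = Hom (Modl C A) (regular_module A) (regular_module A)"
  "x \<otimes>\<^bsub>E_ring C A\<^esub> y = x \<cdot> y" "\<one>\<^bsub>E_ring C A\<^esub> = Idt C (MOb A)"
  "\<zero>\<^bsub>E_ring C A\<^esub> = Zer C (MOb A) (MOb A)" "x \<oplus>\<^bsub>E_ring C A\<^esub> y = Add C x y"
  by (simp_all add: E_ring_def end_ring_def)

lemma E_carrier:
  assumes "is_cmonoid C A"
  shows "r \<in> carrier (E_ring C A) \<longleftrightarrow> rend A (Arr (MOb A) r (MOb A))"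
  by (simp add: hom_Modl[OF assms])

text \<open>Gives access to the finite sums that occur in \<open>partition_of_unity\<close>.\<close>

lemma abelian_monoid_E_ring:
  assumes A: "is_cmonoid C A" shows "abelian_monoid (E_ring C A)"
proof (rule abelian_monoidI)
  have H: "r \<in> Hom C (MOb A) (MOb A)" if "r \<in> carrier (E_ring C A)" for r
    using that rendD(1)[OF A, of "Arr (MOb A) r (MOb A)"] unfolding E_carrier[OF A] by simp
  show "x \<oplus>\<^bsub>E_ring C A\<^esub> y \<in> carrier (E_ring C A)" if "x \<in> carrier (E_ring C A)" "y \<in> carrier (E_ring C A)" for x y
    using that mhom_aadd[OF A, of _ _ "Arr (MOb A) x (MOb A)" "Arr (MOb A) y (MOb A)"]
    unfolding E_carrier[OF A] by (simp add: aadd_def)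
  show "\<zero>\<^bsub>E_ring C A\<^esub> \<in> carrier (E_ring C A)"
    using mhom_zer[OF A is_module_regular[OF A] is_module_regular[OF A]]
    unfolding E_carrier[OF A] by (simp add: zer_def)
  show "(x \<oplus>\<^bsub>E_ring C A\<^esub> y) \<oplus>\<^bsub>E_ring C A\<^esub> z = x \<oplus>\<^bsub>E_ring C A\<^esub> (y \<oplus>\<^bsub>E_ring C A\<^esub> z)"
    if "x \<in> carrier (E_ring C A)" "y \<in> carrier (E_ring C A)" "z \<in> carrier (E_ring C A)" for x y z
    using Add_assoc[OF that[THEN H]] by simp
  show "x \<oplus>\<^bsub>E_ring C A\<^esub> y = y \<oplus>\<^bsub>E_ring C A\<^esub> x" if "x \<in> carrier (E_ring C A)" "y \<in> carrier (E_ring C A)" for x y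
    using Add_commute[OF that[THEN H]] by simp
  show "\<zero>\<^bsub>E_ring C A\<^esub> \<oplus>\<^bsub>E_ring C A\<^esub> x = x" if "x \<in> carrier (E_ring C A)" for x
    using Add_Zer[OF H[OF that]] Add_commute[OF Zer_hom[of "MOb A" "MOb A"] H[OF that]] cmonD(1)[OF A] by simp
qed

text \<open>The composite of f with stage 0 of the telescope of M is zero. Since P is finitely
  presented, f and 0 already agree at a finite stage, which means after a power of t.\<close>

lemma fp_kills:
  assumes B: "is_loc A t B e" and P: "is_finitely_presented_module U C A P" and f: "mhom A P M f"
    and z: "bce A B e M 0 \<bullet> f = zer (Und P) (Und (bcN A B (e 0) M))"
  shows "kills (smul A M t) f"
proof -
  note A = is_locD(3)[OF B] and t = is_locD(1)[OF B] and M = mhomD(2)[OF f] and Pm = mhomD(1)[OF f]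
  interpret MA: category "Modl C A" by (rule category_Modl[OF A])
  let ?T = "smul A M t" and ?Q = "rmod B (e 0) (bcN A B (e 0) M)"
  note Tm = smul_mhom[OF A M t]
  obtain \<alpha> :: "nat \<Rightarrow> 'u" where \<alpha>: "inj \<alpha>" by (rule countable_inj)
  obtain \<beta> :: "unit \<Rightarrow> 'u" where \<beta>: "inj \<beta>" by (rule countable_inj)
  let ?J = "enc_cat \<alpha> \<beta> nat_cat" and ?G = "enc_ftor \<alpha> \<beta> (mseq M ?T)"
  have dir: "directed_cat ?J" by (rule directed_cat_enc[OF directed_nat_cat \<alpha> \<beta>])
  have fil: "filtered_cat ?J" by (rule filtered_cat_enc[OF filtered_nat_cat \<alpha> \<beta>])
  have sm: "small_cat ?J" by (rule small_cat_enc[OF category_nat_cat \<alpha> \<beta> universe_uncountable])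
  have G: "is_ftor ?J (Modl C A) ?G" by (rule is_ftor_enc[OF is_ftor_mseq[OF A Tm] \<alpha> \<beta>])
  let ?d = "\<lambda>a. raw (bce A B e M (inv_into UNIV \<alpha> a))"
  have co: "is_colimit ?J (Modl C A) ?G ?Q ?d"
    unfolding is_colimit_enc[OF \<alpha> \<beta>] using bce_is_colimit[OF B M] \<alpha> by simp
  then have cc: "is_cocone ?J (Modl C A) ?G ?Q ?d" by (simp add: is_colimit_def)
  have "hom_commutes_with_colim (Modl C A) P ?J ?G ?Q ?d"
    using P sm dir G co unfolding is_finitely_presented_module_def hom_preserves_directed_colims_def by blast
  \<comment> \<open>Of the criterion the injectivity half is kept, to be applied to f and the zero
    arrow.\<close>
  then have uni: "\<forall>i\<in>Ob ?J. \<forall>x\<in>Hom (Modl C A) P (FOb ?G i). \<forall>y\<in>Hom (Modl C A) P (FOb ?G i). ?d i \<cdot> x = ?d i \<cdot> y \<longrightarrow>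
       (\<exists>k. \<exists>u\<in>Hom ?J i k. FAr ?G i k u \<cdot> x = FAr ?G i k u \<cdot> y)"
    using MA.hom_commutes_filtered_iff[OF fil G cc] by simp
  have Go: "FOb ?G i = M" for i by (simp add: enc_ftor_def mseq_def)
  have zm: "mhom A P M (zer (Und P) (Und M))" by (rule mhom_zer[OF A Pm M])
  note [simp] = mhomD(3-5)[OF f] modD(1)[OF A Pm] modD(1)[OF A M] bce_simps[OF B M] smul_simps[OF A M t]
  have tg: "tgt (bce A B e M 0) = Und (bcN A B (e 0) M)" by (simp add: Und_bcN)
  have "raw (bce A B e M 0 \<bullet> f) = raw (bce A B e M 0 \<bullet> zer (Und P) (Und M))"
    using z tg by (simp del: ok_acomp(4))
  then have "?d (\<alpha> 0) \<cdot> raw f = ?d (\<alpha> 0) \<cdot> raw (zer (Und P) (Und M))"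
    using \<alpha> ok_acomp(4)[of f "bce A B e M 0"] ok_acomp(4)[of "zer (Und P) (Und M)" "bce A B e M 0"] by simp
  moreover have "\<alpha> 0 \<in> Ob ?J" by (simp add: enc_cat_def)
  moreover have "raw f \<in> Hom (Modl C A) P (FOb ?G (\<alpha> 0))" "raw (zer (Und P) (Und M)) \<in> Hom (Modl C A) P (FOb ?G (\<alpha> 0))"
    using raw_hom_Modl[OF A f] raw_hom_Modl[OF A zm] by (simp_all add: Go)
  ultimately obtain k u where "FAr ?G (\<alpha> 0) k u \<cdot> raw f = FAr ?G (\<alpha> 0) k u \<cdot> raw (zer (Und P) (Und M))"
    using uni by blast
  then obtain n where n: "raw (apow ?T n) \<cdot> raw f = raw (apow ?T n) \<cdot> raw (zer (Und P) (Und M))"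
    by (auto simp: enc_ftor_def mseq_def)
  have "raw (apow ?T n \<bullet> g) = raw (apow ?T n) \<cdot> raw g" if "ok g" "tgt g = Und M" for g
    using that by (intro ok_acomp(4)) simp_all
  from this[of f] this[of "zer (Und P) (Und M)"] n
  have "raw (apow ?T n \<bullet> f) = raw (apow ?T n \<bullet> zer (Und P) (Und M))" by (simp del: zer_right)
  then have "apow ?T n \<bullet> f = apow ?T n \<bullet> zer (Und P) (Und M)"
    by (intro arrow_eqI) simp_all
  then show ?thesis unfolding kills_def by (intro exI[of _ n]) simp
qed

text \<open>The elements of \<open>\<E>(A)\<close> that have a power annihilating \<open>f\<close> form an ideal.\<close>

lemma partition_kills:
  assumes A: "is_cmonoid C A" and pu: "partition_of_unity C A I t" and f: "mhom A P M f"
    and k: "\<And>i. i \<in> I \<Longrightarrow> kills (smul A M (Arr (MOb A) (t i) (MOb A))) f"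
  shows "f = zer (Und P) (Und M)"
proof -
  let ?E = "E_ring C A" and ?a = "\<lambda>r. Arr (MOb A) r (MOb A)"
  interpret E: abelian_monoid ?E by (rule abelian_monoid_E_ring[OF A])
  note M = mhomD(2)[OF f] and Pm = mhomD(1)[OF f]
  note [simp] = mhomD(3-5)[OF f] modD(1)[OF A M] modD(1)[OF A Pm]
  from pu obtain s where fin: "finite I" and t: "\<And>i. i \<in> I \<Longrightarrow> t i \<in> carrier ?E"
    and s: "\<And>i. i \<in> I \<Longrightarrow> s i \<in> carrier ?E"
    and one: "finsum ?E (\<lambda>i. s i \<otimes>\<^bsub>?E\<^esub> t i) I = \<one>\<^bsub>?E\<^esub>"
    unfolding partition_of_unity_def by blast
  note R = E_carrier[OF A, THEN iffD1]
  have mult: "?a (s i \<otimes>\<^bsub>?E\<^esub> t i) = ?a (s i) \<bullet> ?a (t i)" if "i \<in> I" for i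
    using rendD(1)[OF A R[OF s[OF that]]] rendD(1)[OF A R[OF t[OF that]]] by (simp add: Arr_acomp)
  have st: "s i \<otimes>\<^bsub>?E\<^esub> t i \<in> carrier ?E" if "i \<in> I" for i
    using mhom_comp[OF A R[OF t[OF that]] R[OF s[OF that]]] unfolding E_carrier[OF A] mult[OF that] .
  have comm: "smul A M r \<bullet> smul A M r' = smul A M r' \<bullet> smul A M r" if "rend A r" "rend A r'" for r r'
    by (rule smul_nat[OF A smul_mhom[OF A M that(1)] that(2)])
  \<comment> \<open>Induction over partial sums; the carrier clause is carried along because the
    next partial sum has to act on M as well.\<close>
  have "kills (smul A M (?a (finsum ?E (\<lambda>i. s i \<otimes>\<^bsub>?E\<^esub> t i) I'))) f \<and> finsum ?E (\<lambda>i. s i \<otimes>\<^bsub>?E\<^esub> t i) I' \<in> carrier ?E"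
    if "finite I'" "I' \<subseteq> I" for I'
    using that
  proof (induction I' rule: finite_induct)
    case empty
    \<comment> \<open>Exponent 1, not 0: the zeroth power is the identity even for the zero
      endomorphism.\<close>
    have "apow (zer (Und M) (Und M)) (Suc 0) \<bullet> f = zer (Und P) (Und M)" by simp
    then have "kills (zer (Und M) (Und M)) f" unfolding kills_def by (metis mhomD(4,5) f)
    moreover have "?a \<zero>\<^bsub>?E\<^esub> = zer (MOb A) (MOb A)" by (simp add: zer_def)
    ultimately show ?case
      using E.finsum_empty E.zero_closed smul_zer[OF A M] by (simp del: E_ring_sel)
  next
    case (insert i I')
    let ?r = "finsum ?E (\<lambda>i. s i \<otimes>\<^bsub>?E\<^esub> t i) I'"
    have i: "i \<in> I" and I': "I' \<subseteq> I" using insert.prems by auto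
    have IH: "kills (smul A M (?a ?r)) f" "?r \<in> carrier ?E" using insert.IH[OF I'] by auto
    have sum: "finsum ?E (\<lambda>i. s i \<otimes>\<^bsub>?E\<^esub> t i) (insert i I') = (s i \<otimes>\<^bsub>?E\<^esub> t i) \<oplus>\<^bsub>?E\<^esub> ?r"
      by (rule E.finsum_insert[OF insert.hyps]) (use st i I' in blast)+
    note ri = R[OF s[OF i]] R[OF t[OF i]] and rst = R[OF st[OF i]] and rr = R[OF IH(2)]
    have "?a ((s i \<otimes>\<^bsub>?E\<^esub> t i) \<oplus>\<^bsub>?E\<^esub> ?r) = aadd (?a (s i \<otimes>\<^bsub>?E\<^esub> t i)) (?a ?r)"
      by (simp add: aadd_def)
    moreover have "kills (smul A M (?a (s i \<otimes>\<^bsub>?E\<^esub> t i))) f"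
      unfolding mult[OF i] smul_comp[OF A M ri]
      by (rule kills_comp[OF _ _ _ _ _ _ comm[OF ri]]) (use k[OF i] smul_simps[OF A M ri(1)] smul_simps[OF A M ri(2)] in simp_all)
    then have "kills (aadd (smul A M (?a (s i \<otimes>\<^bsub>?E\<^esub> t i))) (smul A M (?a ?r))) f"
      by (intro kills_aadd[OF _ _ _ _ _ _ comm[OF rst rr]])
        (use IH(1) smul_simps[OF A M rst] smul_simps[OF A M rr] in simp_all)
    ultimately have "kills (smul A M (?a ((s i \<otimes>\<^bsub>?E\<^esub> t i) \<oplus>\<^bsub>?E\<^esub> ?r))) f"
      by (simp only: smul_aadd[OF A M rst rr])
    moreover have "(s i \<otimes>\<^bsub>?E\<^esub> t i) \<oplus>\<^bsub>?E\<^esub> ?r \<in> carrier ?E"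
      by (rule E.a_closed[OF st[OF i] IH(2)])
    ultimately show ?case by (simp only: sum)
  qed
  from this[OF fin subset_refl] have "kills (smul A M (?a (Idt C (MOb A)))) f"
    unfolding one by simp
  then have "kills (idn (Und M)) f"
    using smul_idn[OF A M] by (simp add: idn_def)
  \<comment> \<open>The full sum is 1, and a power of the identity annihilates f only if f is
    zero.\<close>
  then obtain n where n: "apow (idn (Und M)) n \<bullet> f = zer (Und P) (Und M)" by (auto simp: kills_def)
  then show ?thesis by (simp add: apow_idn)
qed

lemma partition_conservative:
  assumes A: "is_cmonoid C A" and pu: "partition_of_unity C A I t" and M: "is_module C A M"
    and B: "\<And>i. i \<in> I \<Longrightarrow> is_loc A (Arr (MOb A) (t i) (MOb A)) (B i) (e i)"
    and Z: "\<And>i. i \<in> I \<Longrightarrow> is_zero_ob (Modl C (B i)) (bcN A (B i) (e i 0) M)"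
  shows "is_zero_ob (Modl C A) M"
proof -
  interpret MA: category "Modl C A" by (rule category_Modl[OF A])
  obtain J :: "('u, 'u) cat" and G d where fp: "\<And>j. j \<in> Ob J \<Longrightarrow> is_finitely_presented_module U C A (FOb G j)"
    and co: "is_colimit J (Modl C A) G M d"
    using C2[OF A, of M] M by auto
  have cc: "is_cocone J (Modl C A) G M d" using co by (simp add: is_colimit_def)
  have d: "mhom A (FOb G j) M (Arr (Und (FOb G j)) (d j) (Und M))" if "j \<in> Ob J" for j
    using cc that hom_Modl[OF A] by (simp add: is_cocone_def)
  \<comment> \<open>Each coprojection starts at a finitely presented module and dies in every
    localisation of M, since these are zero; the partition then makes it vanish.\<close>
  have dz: "d j = Zer C (Und (FOb G j)) (Und M)" if j: "j \<in> Ob J" for j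
  proof -
    let ?d = "Arr (Und (FOb G j)) (d j) (Und M)"
    have "kills (smul A M (Arr (MOb A) (t i) (MOb A))) ?d" if i: "i \<in> I" for i
    proof (rule fp_kills[OF B[OF i] fp[OF j] d[OF j]])
      let ?N = "Und (bcN A (B i) (e i 0) M)"
      have idz: "idn ?N = zer ?N ?N" and N: "?N \<in> Ob C"
        using Z[OF i] modD(1)[OF is_locD(4)[OF B[OF i]]] by (auto simp: is_zero_ob_Modl[OF is_locD(4)[OF B[OF i]]])
      note [simp] = bce_simps[OF B[OF i] M] mhomD(3-5)[OF d[OF j]] modD(1)[OF A M]
      have tg: "tgt (bce A (B i) (e i) M 0) = ?N" by (simp add: Und_bcN)
      have "bce A (B i) (e i) M 0 = idn ?N \<bullet> bce A (B i) (e i) M 0" using tg by simp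
      also have "\<dots> = zer (Und M) ?N" unfolding idz using tg N by simp
      finally show "bce A (B i) (e i) M 0 \<bullet> ?d = zer (Und (FOb G j)) ?N"
        using N mhomD(3)[OF d[OF j]] by simp
    qed
    from partition_kills[OF A pu d[OF j] this] show ?thesis by (simp add: zer_def)
  qed
  \<comment> \<open>As all coprojections vanish, the identity and the zero endomorphism of M both
    factor the cocone \<open>d\<close> through itself; uniqueness identifies them.\<close>
  have "\<exists>!h. h \<in> Hom (Modl C A) M M \<and> (\<forall>j\<in>Ob J. h \<cdot> d j = d j)"
    using co cc unfolding is_colimit_def Modl_sel(3) by blast
  moreover have "Idt C (Und M) \<cdot> d j = d j" if "j \<in> Ob J" for j
    using mhomD(3)[OF d[OF that]] idt_left[of "d j" "Und (FOb G j)"] by simp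
  then have "raw (idn (Und M)) \<in> Hom (Modl C A) M M \<and> (\<forall>j\<in>Ob J. raw (idn (Und M)) \<cdot> d j = d j)"
    using raw_hom_Modl[OF A mhom_idn[OF A M]] by (simp add: raw_struct)
  moreover have "raw (zer (Und M) (Und M)) \<cdot> d j = d j" if j: "j \<in> Ob J" for j
  proof -
    let ?d = "Arr (Und (FOb G j)) (d j) (Und M)"
    note [simp] = mhomD(3)[OF d[OF j], simplified] modD(1)[OF A M]
    have "zer (Und M) (Und M) \<bullet> ?d = zer (Und (FOb G j)) (Und M)" by simp
    from arg_cong[OF this, of raw] show ?thesis
      using ok_acomp(4)[of ?d "zer (Und M) (Und M)"] dz[OF j] Zer_hom[of "Und M" "Und M"]
        Zer_hom[OF modD(1)[OF A mhomD(1)[OF d[OF j]]] modD(1)[OF A M]] by (simp add: zer_def)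
  qed
  then have "raw (zer (Und M) (Und M)) \<in> Hom (Modl C A) M M \<and> (\<forall>j\<in>Ob J. raw (zer (Und M) (Und M)) \<cdot> d j = d j)"
    using raw_hom_Modl[OF A mhom_zer[OF A M M]] by simp
  ultimately have "raw (idn (Und M)) = raw (zer (Und M) (Und M))" by blast
  then have "idn (Und M) = zer (Und M) (Und M)"
    using modD(1)[OF A M] by (intro arrow_eqI) simp_all
  then show ?thesis using M by (simp add: is_zero_ob_Modl[OF A])
qed

lemma loc_is_epi:
  assumes B: "is_loc A t B e"
  shows "is_epi (Comm C) A B (raw (e 0))"
proof -
  note j = is_locD(2)[OF B]
  have jr: "Arr (MOb A) (raw (e 0)) (MOb B) = e 0" using chomD(3-5)[OF j] by (intro ar_Arr_raw) simp
  have "g = h" if g: "chom B Z (Arr (MOb B) g (MOb Z))" and h: "chom B Z (Arr (MOb B) h (MOb Z))"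
    and eq: "g \<cdot> raw (e 0) = h \<cdot> raw (e 0)" for Z g h
  proof -
    have "Arr (MOb B) g (MOb Z) \<bullet> e 0 = Arr (MOb B) h (MOb Z) \<bullet> e 0"
      using chomD(3)[OF g] chomD(3)[OF h] chomD(3-5)[OF j] eq by (intro arrow_eqI) simp_all
    from loc_epi[OF B g h this] show ?thesis by simp
  qed
  then show ?thesis
    using raw_hom_Comm[OF j] by (auto simp: is_epi_def hom_Comm)
qed

end

theorem proposition2p9:
  fixes C :: "('o, 'm) smon_cat" and U :: "'u itself"
    and A :: "('o, 'm) cmon" and I :: "'i set" and t :: "'i \<Rightarrow> 'm"
  assumes "ag_base C U"
    and "A \<in> Ob (Comm C)"
    and "partition_of_unity C A I t"
  shows "zariski_open_cover U C I (\<lambda>i. loc_monoid C A (t i)) (\<lambda>i. loc_map C A (t i)) A"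
proof -
  interpret ag_base C U by fact
  have A: "is_cmonoid C A" using assms(2) by simp
  have t: "rend A (Arr (MOb A) (t i) (MOb A))" if "i \<in> I" for i
    using assms(3) that E_carrier[OF A] unfolding partition_of_unity_def by blast
  \<comment> \<open>The chosen localisations are equipped with telescopes once and for all; from
    here on they are handled through \<open>is_loc\<close>.\<close>
  have "\<exists>e. is_loc A (Arr (MOb A) (t i) (MOb A)) (loc_monoid C A (t i)) e \<and> raw (e 0) = loc_map C A (t i)"
    if "i \<in> I" for i
    using loc_monoid_is_loc[OF A t[OF that]] by (metis arrow.sel(2))
  then obtain e where B: "\<And>i. i \<in> I \<Longrightarrow> is_loc A (Arr (MOb A) (t i) (MOb A)) (loc_monoid C A (t i)) (e i)"
    and e: "\<And>i. i \<in> I \<Longrightarrow> raw (e i 0) = loc_map C A (t i)"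
    by metis
  have "zariski_open_immersion U C (loc_monoid C A (t i)) A (loc_map C A (t i))" if "i \<in> I" for i
    unfolding zariski_open_immersion_def e[OF that, symmetric]
    using raw_hom_Comm[OF is_locD(2)[OF B[OF that]]] loc_flat[OF B[OF that]] loc_is_epi[OF B[OF that]]
      loc_finitely_presented[OF B[OF that]] by (simp add: Aff_def opcat_def)
  moreover have "is_zero_ob (Modl C A) M \<longleftrightarrow>
      (\<forall>i\<in>I. is_zero_ob (Modl C (loc_monoid C A (t i))) (FOb (base_change C A (loc_monoid C A (t i)) (loc_map C A (t i))) M))"
    if M: "M \<in> Ob (Modl C A)" for M
  proof
    assume "is_zero_ob (Modl C A) M"
    then show "\<forall>i\<in>I. is_zero_ob (Modl C (loc_monoid C A (t i))) (FOb (base_change C A (loc_monoid C A (t i)) (loc_map C A (t i))) M)"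
      using bc_zero[OF is_locD(2)[OF B]] e by metis
  next
    assume Z: "\<forall>i\<in>I. is_zero_ob (Modl C (loc_monoid C A (t i))) (FOb (base_change C A (loc_monoid C A (t i)) (loc_map C A (t i))) M)"
    show "is_zero_ob (Modl C A) M"
      by (rule partition_conservative[OF A assms(3) _ B]) (use M Z e in auto)
  qed
  \<comment> \<open>The index set of a partition of unity is finite, so it serves as its own finite
    subfamily.\<close>
  moreover have "finite I" using assms(3) by (simp add: partition_of_unity_def)
  ultimately show ?thesis
    unfolding zariski_open_cover_def by blast
qed

end
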